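(* Let $\mathbb F_q$ have characteristic $p$, let $f,g\in \mathbb F_q[x]$, and let $A,B,C\subset\mathbb F_q$. (1) If $1\leq \deg(f)<\deg(g)< p$, then $|f(A)+B|\,|g(A)+C|\gtrsim \min(|A|q,\ |A|^2|B||C|q^{-1})$. In particular, $|f(A)+g(A)|\gtrsim\min(|A|^{1/2}q^{1/2},\ |A|^2q^{-1/2})$. (2) If $\gcd(\deg(g),q-1)=1$, $\deg(f)\geq1$ and $\deg(f)+\deg(g)< p$, then $|f(A)+B|\,|g(A)C|\gtrsim \min(|A|q,\ |A|^2|B||C|q^{-1})$. (3) Suppose $f$ has irreducible factors that are not factors of $g$ such that the greatest common divisor of the exponents of these factors in the canonical factorization of $f$ is $1$, and likewise $g$ has irreducible factors that are not factors of $f$ such that the greatest common divisor of the exponents of these factors in the canonical factorization of $g$ is $1$. Suppose $\deg(f)+\deg(g)< p$. Then $|f(A)B|\,|g(A)C|\gtrsim \min(|A|q,\ |A|^2|B||C|q^{-1})$. In particular, $|f(A)g(A)|\gtrsim\min(|A|^{1/2}q^{1/2},\ |A|^2q^{-1/2})$.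
   Context: For a polynomial $h$ and set $A$, $h(A)=\{h(a):a\in A\}$. For sets $S,T\subset\mathbb F_q$, $S+T=\{s+t:s\in S,t\in T\}$ and $ST=\{st:s\in S,t\in T\}$. $X\gtrsim Y$ means $X\ge cY$ for a constant $c>0$ that may depend only on the degrees of the polynomials involved (not on $q$ or the sets).
   Formalization: Fields are taken up to isomorphism. As literally stated, (2) fails for C={0} and the first bound of (3) fails for B={0}, C={0}, or nonempty A inside the common zeros of f and g; exactly these cases are excluded. (1) and both "in particular" bounds are unrestricted. *)

theory Defs
  imports Complex_Main "HOL-Algebra.Algebra"
begin

text \<open>
  The implied constant of the theorem must be uniform over all finite fields. Types cannot be
  quantified inside a formula, so finite fields are ring records with carrier in \<open>nat\<close>.
  The next lemma shows that this loses no finite field.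
\<close>

lemma finite_field_iso_nat_field:
  fixes R :: "('a, 'b) ring_scheme"
  assumes "field R" and "finite (carrier R)"
  shows "\<exists>F :: nat ring. field F \<and> finite (carrier F) \<and> R \<simeq> F"
proof -
  obtain h :: "'a \<Rightarrow> nat" where "inj_on h (carrier R)"
    using finite_imp_inj_to_nat_seg[OF assms(2)] by blast
  then have "field (image_ring h R)" "h \<in> ring_iso R (image_ring h R)"
    by (simp_all add: field.inj_imp_image_ring_is_field[OF assms(1)] inj_imp_image_ring_iso)
  moreover have "finite (carrier (image_ring h R))"
    using assms(2) by (simp add: image_ring_carrier)
  ultimately show ?thesis
    by (auto simp: is_ring_iso_def)
qed

definition ring_char :: "('a, 'b) ring_scheme \<Rightarrow> nat" where
  "ring_char R = group.ord (add_monoid R) \<one>\<^bsub>R\<^esub>"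

text \<open>
  Polynomials are coefficient lists, leading coefficient first, so
  \<open>lead_coeff P = \<one>\<close> makes \<open>P\<close> monic; the factorization is
  \<open>f = u \<cdot> \<Prod>P\<in>S. P ^ e P\<close>, which forces \<open>f\<close> to be nonzero.
\<close>

definition canonical_factorization ::
  "('a, 'b) ring_scheme \<Rightarrow> 'a list \<Rightarrow> 'a \<Rightarrow> 'a list set \<Rightarrow> ('a list \<Rightarrow> nat) \<Rightarrow> bool" where
  "canonical_factorization R f u S e \<longleftrightarrow>
     u \<in> carrier R - {\<zero>\<^bsub>R\<^esub>} \<and> finite S \<and>
     (\<forall>P\<in>S. P \<in> carrier (poly_ring R) \<and> pirreducible\<^bsub>R\<^esub> (carrier R) P \<and>
             lead_coeff P = \<one>\<^bsub>R\<^esub> \<and> e P \<ge> 1) \<and>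
     f = ring.poly_of_const R u \<otimes>\<^bsub>poly_ring R\<^esub>
           (\<Otimes>\<^bsub>poly_ring R\<^esub>P\<in>S. P [^]\<^bsub>poly_ring R\<^esub> e P)"

text \<open>Since \<open>Gcd {} = 0\<close>, the set \<open>T\<close> below is nonempty.\<close>

definition coprime_exponents_outside ::
  "('a, 'b) ring_scheme \<Rightarrow> 'a list \<Rightarrow> 'a list \<Rightarrow> bool" where
  "coprime_exponents_outside R f g \<longleftrightarrow>
     (\<exists>u S e. canonical_factorization R f u S e \<and>
       (\<exists>T\<subseteq>S. (\<forall>P\<in>T. \<not> P pdivides\<^bsub>R\<^esub> g) \<and> Gcd (e ` T) = 1))"

end

theory Submission
  imports Defs "HOL-Algebra.Algebraic_Closure_Type"
begin

text \<open>
  Expanding the equations \<open>y = f(a) + b\<close>, \<open>z = g(a) + c\<close> (or their multiplicative versions) in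
  characters of \<open>F\<close> reduces each part to square-root cancellation in the sums
  \<open>\<Sum>x. \<psi>(u(x)) \<chi>(G(x))\<close>: it bounds the number of incidences between \<open>(f(A) + B) \<times> (g(A) + C)\<close> and
  \<open>A \<times> B \<times> C\<close> by the expected number plus \<open>O(sqrt q)\<close> times the \<open>L\<^sup>2\<close>-norms, and each
  \<open>(a, b, c)\<close> is itself an incidence. The hypotheses on \<open>f\<close> and \<open>g\<close> say that no nontrivial pair
  of characters makes the sum degenerate.

  Square-root cancellation is proved from scratch. The \<open>L\<close>-function of the sum, a weighted count of the
  Frobenius-invariant multisets in the algebraic closure (that is, of the monic polynomials over \<open>F\<close>), is a
  polynomial of degree less than the required constant; so the sums over the extensions of degree \<open>s\<close> are
  power sums \<open>-\<Sum>i. \<omega>\<^sub>i^s\<close>, and it is enough to bound these by \<open>O(q^(s/2))\<close> for even \<open>s\<close>.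
  This is done by Stepanov's method: a nonzero polynomial of controlled degree, built from the monomials
  \<open>x^(k + j Q) (Tr u)^i G^(l (Q - 1)/d)\<close> with \<open>Q = q^s\<close>, vanishes to high order at all points with prescribed
  character values. That it is nonzero follows by comparing degrees, or from Kummer theory when \<open>u = 0\<close>.
\<close>

text \<open>The need for a constant independent of q shapes the argument. The Stepanov estimates
  hold for large s only and carry constants that depend on q, but only their rate q^(s/2) is used:
  it forces every root to have modulus at most sqrt q, and the sum over F then costs just the number
  of roots. That number must not grow with the exponents a, b <= q - 1 in f^a g^b; hence the
  vanishing lemmas measure degrees by a polynomial \<open>\<rho>\<close> that vanishes at the zeros
  of G, not by G itself. Stepanov's method gives only upper bounds for the number of points with
  prescribed character values. They suffice because these numbers add up to Q apart from a bounded
  error while the character values sum to zero. Even s is taken so that Q = R^2. Modulo (x - x0)^R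
  every R-th power is a constant, so Tr u and G^((Q-1)/d) reduce to polynomials of degree about R,
  low enough for linear algebra to impose R-fold zeros. Multiplicative characters see neither the
  zeros of f and g nor the element 0 of B and C. These are discarded first, at the cost of a factor
  16, and small A is treated directly.\<close>

hide_const (open) Polynomials.degree Polynomials.lead_coeff UnivPoly.coeff UnivPoly.monom Module.smult
  Divisibility.prime Coset.order

section \<open>Power sums and recurrences\<close>

text \<open>Gaussian elimination: an unknown \<open>u0\<close> with nonzero coefficient in the
  equation \<open>v\<close> is solved for and substituted into the others. The solution supplies the
  coefficients of the auxiliary polynomial.\<close>

lemma underdetermined_system:
  fixes M :: "'e \<Rightarrow> 'u \<Rightarrow> 'k::field"
  assumes "finite V" "finite U" "card V < card U"
  shows "\<exists>c. (\<exists>u\<in>U. c u \<noteq> 0) \<and> (\<forall>v\<in>V. (\<Sum>u\<in>U. M v u * c u) = 0)"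
  using assms
proof (induction V arbitrary: U M rule: finite_induct)
  case empty
  then have "U \<noteq> {}" by auto
  then show ?case by (intro exI[of _ "\<lambda>_. 1"]) auto
next
  case (insert v V)
  show ?case
  proof (cases "\<forall>u\<in>U. M v u = 0")
    case True
    have "card V < card U" using insert by auto
    from insert.IH[OF insert.prems(1) this, of M] obtain c where
      "\<exists>u\<in>U. c u \<noteq> 0" "\<forall>w\<in>V. (\<Sum>u\<in>U. M w u * c u) = 0" by blast
    with True show ?thesis by (intro exI[of _ c]) auto
  next
    case False
    then obtain u0 where u0: "u0 \<in> U" "M v u0 \<noteq> 0" by auto
    define U' where "U' = U - {u0}"
    define M' where "M' w u = M w u - M w u0 * M v u / M v u0" for w u
    have fU': "finite U'" "card V < card U'"
      using insert u0 by (auto simp: U'_def)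
    from insert.IH[OF fU', of M'] obtain c where
      c: "\<exists>u\<in>U'. c u \<noteq> 0" "\<forall>w\<in>V. (\<Sum>u\<in>U'. M' w u * c u) = 0" by blast
    define c' where "c' u = (if u = u0 then - (\<Sum>u\<in>U'. M v u * c u) / M v u0 else c u)" for u
    have *: "(\<Sum>u\<in>U. M w u * c' u) = (\<Sum>u\<in>U'. M' w u * c u)" for w
    proof -
      have "(\<Sum>u\<in>U. M w u * c' u) = M w u0 * c' u0 + (\<Sum>u\<in>U'. M w u * c' u)"
        unfolding U'_def using insert u0 by (subst sum.remove[of U u0]) auto
      also have "(\<Sum>u\<in>U'. M w u * c' u) = (\<Sum>u\<in>U'. M w u * c u)"
        by (intro sum.cong) (auto simp: c'_def U'_def)
      finally have "(\<Sum>u\<in>U. M w u * c' u) =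
          (\<Sum>u\<in>U'. M w u * c u) - (M w u0 / M v u0) * (\<Sum>u\<in>U'. M v u * c u)"
        by (simp add: c'_def)
      also have "\<dots> = (\<Sum>u\<in>U'. M' w u * c u)"
        by (simp add: M'_def sum_distrib_left sum_subtractf[symmetric] algebra_simps)
      finally show ?thesis .
    qed
    have "(\<Sum>u\<in>U'. M' v u * c u) = 0"
      using u0 by (intro sum.neutral) (auto simp: M'_def)
    with * c have "\<forall>w\<in>insert v V. (\<Sum>u\<in>U. M w u * c' u) = 0" by auto
    moreover have "\<exists>u\<in>U. c' u \<noteq> 0" using c(1) by (auto simp: c'_def U'_def)
    ultimately show ?thesis by blast
  qed
qed

text \<open>A polynomial \<open>P\<close> that vanishes at all other elements of \<open>Z\<close>
  combines consecutive power sums into \<open>count Z z * z ^ h * poly P z\<close>. So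
  \<open>norm z ^ h\<close> is O(B^h), which excludes \<open>norm z > B\<close>. Only the rate B^h
  survives, so the estimates that feed this lemma may lose any factor independent of h.\<close>

lemma norm_le_if_power_sums_bounded:
  fixes Z :: "complex multiset" and B C :: real
  assumes B: "B > 0" and bound: "\<And>h. h \<ge> H \<Longrightarrow> norm (\<Sum>z\<in>#Z. z ^ h) \<le> C * B ^ h"
    and z: "z \<in># Z"
  shows "norm z \<le> B"
proof (rule ccontr)
  assume "\<not> norm z \<le> B"
  then have zB: "norm z / B > 1" using B by auto
  define P where "P = (\<Prod>w\<in>set_mset Z - {z}. [:-w, 1:])"
  have Pz: "poly P z \<noteq> 0"
    by (auto simp: P_def poly_prod)
  have P0: "poly P w = 0" if "w \<in># Z" "w \<noteq> z" for w
    using that by (auto simp: P_def poly_prod)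
  define n where "n = degree P"
  define C' where "C' = (\<Sum>k\<le>n. norm (coeff P k) * (C * B ^ k))"
  have key: "norm z ^ h * norm (poly P z) \<le> C' * B ^ h" if h: "h \<ge> H" for h
  proof -
    have "(\<Sum>k\<le>n. coeff P k * (\<Sum>w\<in>#Z. w ^ (h + k))) =
          (\<Sum>k\<le>n. \<Sum>w\<in>#Z. w ^ h * (coeff P k * w ^ k))"
      by (simp add: sum_mset_distrib_left power_add algebra_simps)
    also have "\<dots> = (\<Sum>w\<in>#Z. \<Sum>k\<le>n. w ^ h * (coeff P k * w ^ k))"
      by (induction Z) (simp_all add: sum.distrib)
    also have "\<dots> = (\<Sum>w\<in>#Z. w ^ h * poly P w)"
      by (simp add: poly_altdef n_def sum_distrib_left)
    also have "\<dots> = (\<Sum>w\<in>#Z. if w = z then z ^ h * poly P z else 0)"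
      by (intro arg_cong[of _ _ sum_mset] image_mset_cong) (auto simp: P0)
    also have "\<dots> = of_nat (count Z z) * (z ^ h * poly P z)"
      by (induction Z) (auto simp: algebra_simps)
    finally have eq: "(\<Sum>k\<le>n. coeff P k * (\<Sum>w\<in>#Z. w ^ (h + k))) =
        of_nat (count Z z) * (z ^ h * poly P z)" .
    have "1 * (norm z ^ h * norm (poly P z)) \<le> real (count Z z) * (norm z ^ h * norm (poly P z))"
      using z by (intro mult_right_mono) (auto simp: Suc_le_eq)
    also have "\<dots> = norm (\<Sum>k\<le>n. coeff P k * (\<Sum>w\<in>#Z. w ^ (h + k)))"
      by (simp add: eq norm_mult norm_power)
    also have "\<dots> \<le> (\<Sum>k\<le>n. norm (coeff P k) * (C * B ^ (h + k)))"
      by (intro sum_norm_le) (auto simp: norm_mult intro!: mult_left_mono bound h trans_le_add1)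
    also have "\<dots> = C' * B ^ h"
      by (simp add: C'_def sum_distrib_left power_add algebra_simps)
    finally show ?thesis by simp
  qed
  have "(norm z / B) ^ h \<le> C' / norm (poly P z)" if "h \<ge> H" for h
    using key[OF that] B Pz by (simp add: field_simps)
  moreover obtain k where k: "C' / norm (poly P z) < (norm z / B) ^ k"
    using real_arch_pow[OF zB] by blast
  moreover have "(norm z / B) ^ k \<le> (norm z / B) ^ (max k H)"
    using zB by (intro power_increasing) auto
  ultimately show False
    by (meson linorder_not_less max.cobounded2 order_trans)
qed

section \<open>Euler products and Newton's identities\<close>

definition euler_fps :: "'a::comm_ring_1 multiset \<Rightarrow> 'a fps" where
  "euler_fps M = (\<Prod>z\<in>#M. 1 - fps_const z * fps_X)"

definition power_sum_fps :: "'a::comm_ring_1 multiset \<Rightarrow> 'a fps" where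
  "power_sum_fps M = Abs_fps (\<lambda>k. if k = 0 then 0 else (\<Sum>z\<in>#M. z ^ k))"

text \<open>The logarithmic derivative turns the product into a sum. The factor 1 - z X contributes
  - z X / (1 - z X), the negative of the generating function \<open>T\<close> of the powers of
  z.\<close>

lemma euler_fps_logderiv:
  fixes M :: "'a::comm_ring_1 multiset"
  shows "fps_X * fps_deriv (euler_fps M) = - (euler_fps M * power_sum_fps M)"
proof (induction M)
  case empty
  show ?case by (simp add: euler_fps_def power_sum_fps_def fps_eq_iff)
next
  case (add z M)
  define L where "L = 1 - fps_const z * fps_X"
  define T where "T = Abs_fps (\<lambda>k. if k = 0 then 0 else z ^ k)"
  have LT: "L * T = fps_const z * fps_X"
  proof (rule fps_ext)
    fix k
    have "(L * T) $ k = T $ k - z * (if k = 0 then 0 else T $ (k - 1))"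
      by (simp add: L_def ring_distribs fps_mult_fps_X_commute mult.assoc)
    also have "\<dots> = (fps_const z * fps_X) $ k"
      by (cases k; cases "k - 1") (auto simp: T_def)
    finally show "(L * T) $ k = (fps_const z * fps_X) $ k" .
  qed
  have ps: "power_sum_fps (add_mset z M) = T + power_sum_fps M"
    by (simp add: power_sum_fps_def T_def fps_eq_iff)
  have eu: "euler_fps (add_mset z M) = L * euler_fps M"
    by (simp add: euler_fps_def L_def)
  have dL: "fps_deriv L = - fps_const z" by (simp add: L_def)
  have "fps_X * fps_deriv (L * euler_fps M) =
        L * (fps_X * fps_deriv (euler_fps M)) - fps_const z * fps_X * euler_fps M"
    by (simp add: dL algebra_simps del: fps_const_neg)
  also have "\<dots> = - (L * euler_fps M * power_sum_fps M) - L * T * euler_fps M"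
    by (simp only: add.IH LT) (simp add: algebra_simps)
  finally show ?case by (simp only: ps eu) (simp add: algebra_simps)
qed

lemma euler_fps_nonzero: "euler_fps M \<noteq> (0 :: 'a::idom fps)"
proof -
  have "(1 :: 'a fps) - fps_const z * fps_X \<noteq> 0" for z
    by (auto simp: fps_eq_iff intro!: exI[of _ 0])
  then show ?thesis by (auto simp: euler_fps_def)
qed

lemma euler_fps_nth_0 [simp]: "euler_fps M $ 0 = 1"
  by (induction M) (auto simp: euler_fps_def)

lemma newton_identity:
  "of_nat k * euler_fps M $ k = - (\<Sum>i<k. euler_fps M $ i * (\<Sum>z\<in>#M. z ^ (k - i)))"
    for M :: "'a::comm_ring_1 multiset"
proof -
  have "of_nat k * euler_fps M $ k = (fps_X * fps_deriv (euler_fps M)) $ k"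
    by (cases k) auto
  also have "\<dots> = - (\<Sum>i\<le>k. euler_fps M $ i * power_sum_fps M $ (k - i))"
    by (simp add: euler_fps_logderiv fps_mult_nth atLeast0AtMost)
  also have "(\<Sum>i\<le>k. euler_fps M $ i * power_sum_fps M $ (k - i)) =
      (\<Sum>i<k. euler_fps M $ i * (\<Sum>z\<in>#M. z ^ (k - i)))"
    by (simp add: lessThan_Suc_atMost[symmetric] power_sum_fps_def)
  finally show ?thesis .
qed

text \<open>Solved for the power sum, whose own coefficient is 1. This avoids the division by k and
  is therefore usable in characteristic p.\<close>

lemma power_sum_newton:
  fixes M :: "'a::comm_ring_1 multiset"
  assumes "k > 0"
  shows "(\<Sum>z\<in>#M. z ^ k) = - (of_nat k * euler_fps M $ k)
           - (\<Sum>i\<in>{0<..<k}. euler_fps M $ i * (\<Sum>z\<in>#M. z ^ (k - i)))"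
proof -
  have "{..<k} = insert 0 {0<..<k}" using assms by auto
  then show ?thesis using newton_identity[of k M] by (simp add: algebra_simps eq_neg_iff_add_eq_0)
qed

lemma power_sums_eq_if_euler_eq:
  fixes M M' :: "'a::comm_ring_1 multiset"
  assumes "\<And>i. i < m \<Longrightarrow> euler_fps M $ i = euler_fps M' $ i" "0 < k" "k < m"
  shows "(\<Sum>z\<in>#M. z ^ k) = (\<Sum>z\<in>#M'. z ^ k)"
  using assms(2,3)
proof (induction k rule: less_induct)
  case (less k)
  have "(\<Sum>i\<in>{0<..<k}. euler_fps M $ i * (\<Sum>z\<in>#M. z ^ (k - i))) =
        (\<Sum>i\<in>{0<..<k}. euler_fps M' $ i * (\<Sum>z\<in>#M'. z ^ (k - i)))"
    using less assms(1) by (intro sum.cong refl arg_cong2[of _ _ _ _ times] less.IH) auto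
  then show ?case
    using less.prems assms(1)[of k] by (simp add: power_sum_newton[of k])
qed

text \<open>The first coefficient in which the two products differ enters the power sum of the same
  index linearly, with factor \<open>- of_nat m\<close>. Keeping this factor nonzero is what degrees
  below the characteristic are for.\<close>

lemma power_sum_diff_if_euler_diff:
  fixes M M' :: "'a::comm_ring_1 multiset"
  assumes "\<And>i. i < m \<Longrightarrow> euler_fps M $ i = euler_fps M' $ i" "0 < m"
    and "euler_fps M' $ m = euler_fps M $ m + e"
  shows "(\<Sum>z\<in>#M'. z ^ m) = (\<Sum>z\<in>#M. z ^ m) - of_nat m * e"
proof -
  have "(\<Sum>i\<in>{0<..<m}. euler_fps M $ i * (\<Sum>z\<in>#M. z ^ (m - i))) =
        (\<Sum>i\<in>{0<..<m}. euler_fps M' $ i * (\<Sum>z\<in>#M'. z ^ (m - i)))"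
    using assms(1) by (intro sum.cong refl arg_cong2[of _ _ _ _ times]
      power_sums_eq_if_euler_eq[of m]) auto
  then show ?thesis
    using assms(2,3) by (simp add: power_sum_newton[of m] algebra_simps)
qed

section \<open>Monic polynomials as multisets of roots\<close>

lemma proots_prod_linear [simp]: "proots (\<Prod>x\<in>#B. [:-x, 1:]) = (B :: 'a::idom multiset)"
proof (induction B)
  case (add x B)
  have "proots ([:-x, 1:] * (\<Prod>x\<in>#B. [:-x, 1:])) = add_mset x B"
    using add by (subst proots_mult) auto
  then show ?case by simp
qed auto

lemma prod_mset_linear:
  fixes p :: "'a::alg_closed_field poly"
  assumes "lead_coeff p = 1"
  shows "(\<Prod>x\<in>#proots p. [:-x, 1:]) = p" "size (proots p) = degree p"
proof -
  have "p \<noteq> 0" using assms by auto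
  from alg_closed_imp_factorization[OF this] assms
  obtain A where A: "size A = degree p" "p = (\<Prod>x\<in>#A. [:-x, 1:])" by auto
  then have "proots p = A" by simp
  with A show "(\<Prod>x\<in>#proots p. [:-x, 1:]) = p" "size (proots p) = degree p" by auto
qed

lemma lead_coeff_prod_linear [simp]:
  "lead_coeff (\<Prod>x\<in>#B. [:-x, 1:]) = (1 :: 'a::idom)"
proof (induction B)
  case (add x B)
  then show ?case by (simp only: image_mset_add_mset prod_mset.add_mset lead_coeff_mult) simp
qed auto

lemma degree_prod_linear [simp]:
  "degree (\<Prod>x\<in>#B. [:-x, 1:] :: 'a::idom poly) = size B"
proof (induction B)
  case (add x B)
  have "(\<Prod>x\<in>#B. [:-x, 1:] :: 'a poly) \<noteq> 0" by auto
  then have "degree ([:-x, 1:] * (\<Prod>x\<in>#B. [:-x, 1:] :: 'a poly)) = Suc (size B)"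
    using add by (subst degree_mult_eq) auto
  then show ?case by simp
qed auto

text \<open>Reflecting the product of the X - z gives the product of the 1 - z X, so the Euler
  product lists the coefficients from the leading one downwards.\<close>

lemma euler_fps_proots_nth:
  fixes p :: "'a::alg_closed_field poly"
  assumes "lead_coeff p = 1" "i \<le> degree p"
  shows "euler_fps (proots p) $ i = coeff p (degree p - i)"
proof -
  have "fps_of_poly (reflect_poly (\<Prod>x\<in>#B. [:-x, 1:])) = euler_fps B" for B :: "'a multiset"
  proof (induction B)
    case empty
    then show ?case by (simp add: euler_fps_def)
  next
    case (add z B)
    have "fps_of_poly (reflect_poly [:-z, 1:]) = 1 - fps_const z * fps_X"
      by (simp add: reflect_poly_def fps_of_poly_pCons cCons_def fps_const_neg[symmetric]
            del: fps_const_neg)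
    then have "fps_of_poly (reflect_poly ([:-z, 1:] * (\<Prod>x\<in>#B. [:-x, 1:]))) =
        (1 - fps_const z * fps_X) * euler_fps B"
      by (simp only: reflect_poly_mult fps_of_poly_mult add.IH)
    then have "fps_of_poly (reflect_poly ([:-z, 1:] * (\<Prod>x\<in>#B. [:-x, 1:]))) =
        euler_fps (add_mset z B)"
      by (simp only: euler_fps_def image_mset_add_mset prod_mset.add_mset)
    then show ?case by (simp only: image_mset_add_mset prod_mset.add_mset)
  qed
  from this[of "proots p"] have e: "fps_of_poly (reflect_poly p) = euler_fps (proots p)"
    by (simp only: prod_mset_linear(1)[OF assms(1)])
  show ?thesis
    unfolding e[symmetric] fps_of_poly_nth coeff_reflect_poly using assms(2) by simp
qed

text \<open>With L = sum c_n X^n the recurrence reads X L' = L * (sum S_s X^s). Since L is a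
  polynomial with constant term 1, it is a product of factors 1 - z X, and its logarithmic
  derivative exhibits the S_s as negated power sums.\<close>

lemma recurrence_power_sums:
  fixes c S :: "nat \<Rightarrow> complex"
  assumes c0: "c 0 = 1" and cN: "\<And>n. n \<ge> N \<Longrightarrow> c n = 0"
    and rec: "\<And>n. of_nat n * c n = (\<Sum>s=1..n. S s * c (n - s))"
  obtains Z where "size Z < N" "\<forall>s>0. S s = - (\<Sum>z\<in>#Z. z ^ s)"
proof -
  have N: "N > 0" using c0 cN[of 0] by (cases N) auto
  \<comment> \<open>The reversal of L, padded to degree exactly N - 1. If
    \<open>c (N - 1) = 0\<close> this introduces roots 0, which do not affect power sums with
    positive exponent.\<close>
  define p where "p = (\<Sum>n<N. monom (c n) (N - 1 - n))"
  have cf: "coeff p (N - 1 - i) = c i" if "i < N" for i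
  proof -
    have "coeff p (N - 1 - i) = (\<Sum>n<N. if n = i then c n else 0)"
      unfolding p_def coeff_sum using that by (intro sum.cong) auto
    then show ?thesis using that by simp
  qed
  have "degree p \<le> N - 1"
    unfolding p_def by (intro degree_sum_le) (auto intro!: order_trans[OF degree_monom_le])
  moreover have "coeff p (N - 1) = 1" using cf[of 0] N c0 by simp
  ultimately have deg: "degree p = N - 1"
    by (simp add: le_antisym le_degree)
  have lc: "lead_coeff p = 1" using cf[of 0] N c0 deg by simp
  define Z where "Z = proots p"
  have e: "euler_fps Z = Abs_fps c"
  proof (rule fps_ext)
    fix i
    show "euler_fps Z $ i = Abs_fps c $ i"
    proof (cases "i < N")
      case True
      then show ?thesis using euler_fps_proots_nth[OF lc, of i] cf[OF True] deg
        by (simp add: Z_def)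
    next
      case False
      have z: "euler_fps M $ i = 0" if "size M < i" for M :: "complex multiset" and i
        using that
      proof (induction M arbitrary: i)
        case empty then show ?case by (simp add: euler_fps_def)
      next
        case (add z M)
        have "euler_fps (add_mset z M) $ i = euler_fps M $ i - z * euler_fps M $ (i - 1)"
          using add.prems by (simp add: euler_fps_def ring_distribs mult.assoc)
        then show ?case using add.IH[of i] add.IH[of "i - 1"] add.prems by simp
      qed
      show ?thesis
        using False N cN[of i] prod_mset_linear(2)[OF lc] deg by (subst z) (auto simp: Z_def)
    qed
  qed
  define T where "T = Abs_fps (\<lambda>s. if s = 0 then 0 else S s)"
  have "fps_X * fps_deriv (euler_fps Z) = euler_fps Z * T"
  proof (rule fps_ext)
    fix n
    have "(fps_X * fps_deriv (euler_fps Z)) $ n = of_nat n * c n"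
      by (cases n) (auto simp: e)
    also have "\<dots> = (\<Sum>s=1..n. S s * c (n - s))" by (rule rec)
    also have "\<dots> = (\<Sum>s=0..n. T $ s * c (n - s))"
      by (simp add: sum.atLeast_Suc_atMost[of 0 n] T_def)
    also have "\<dots> = (T * euler_fps Z) $ n"
      by (simp add: fps_mult_nth e)
    finally show "(fps_X * fps_deriv (euler_fps Z)) $ n = (euler_fps Z * T) $ n"
      by (simp add: mult.commute)
  qed
  then have "euler_fps Z * T = euler_fps Z * (- power_sum_fps Z)"
    by (simp add: euler_fps_logderiv)
  then have T: "T = - power_sum_fps Z" using euler_fps_nonzero[of Z] by (metis mult_left_cancel)
  show ?thesis
  proof
    show "size Z < N" using prod_mset_linear(2)[OF lc] deg N by (simp add: Z_def)
    show "\<forall>s>0. S s = - (\<Sum>z\<in>#Z. z ^ s)"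
    proof (intro allI impI)
      fix s :: nat assume "s > 0"
      have "T $ s = (- power_sum_fps Z) $ s" using T by simp
      then show "S s = - (\<Sum>z\<in>#Z. z ^ s)"
        using \<open>s > 0\<close> by (simp add: T_def power_sum_fps_def)
    qed
  qed
qed

text \<open>
  The Riemann hypothesis for an abstract \<open>L\<close>-function: square-root cancellation of the
  sums \<open>S s\<close> along even \<open>s\<close> forces it already at \<open>s = 1\<close>.
\<close>

lemma square_root_bound_of_recurrence:
  fixes c S :: "nat \<Rightarrow> complex" and B :: real and N :: nat
  assumes c0: "c 0 = 1" and cN: "\<And>n. n \<ge> N \<Longrightarrow> c n = 0"
    and rec: "\<And>n. of_nat n * c n = (\<Sum>s=1..n. S s * c (n - s))"
    and B: "B > 0" and bound: "\<And>h. h \<ge> H \<Longrightarrow> norm (S (2 * h)) \<le> C * B ^ h"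
  shows "norm (S 1) \<le> N * sqrt B"
proof -
  obtain Z where Z: "size Z < N" and "\<forall>s>0. S s = - (\<Sum>z\<in>#Z. z ^ s)"
    by (rule recurrence_power_sums[OF c0 cN rec])
  then have Z2: "S s = - (\<Sum>z\<in>#Z. z ^ s)" if "s > 0" for s using that by blast
  have nz: "norm z \<le> sqrt B" if "z \<in># Z" for z
  proof -
    \<comment> \<open>Growth is known along even indices only. \<open>S (2 * h)\<close> is minus the
      h-th power sum of the squares of the roots, so it is the squares that are bounded by
      B.\<close>
    have bd: "norm (\<Sum>z\<in>#image_mset (\<lambda>z. z\<^sup>2) Z. z ^ h) \<le> C * B ^ h" if "h \<ge> max 1 H" for h
    proof -
      have "(\<Sum>z\<in>#image_mset (\<lambda>z. z\<^sup>2) Z. z ^ h) = - S (2 * h)"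
        using that Z2[of "2 * h"] by (simp add: image_mset.compositionality o_def power_mult)
      then show ?thesis using bound[of h] that by simp
    qed
    have "z\<^sup>2 \<in># image_mset (\<lambda>z. z\<^sup>2) Z" using that by auto
    with B bd have "norm (z\<^sup>2) \<le> B" by (rule norm_le_if_power_sums_bounded)
    then have "norm z ^ 2 \<le> B" by (simp add: norm_power)
    then show ?thesis by (rule real_le_rsqrt)
  qed
  have "norm (\<Sum>z\<in>#Y. z) \<le> size Y * sqrt B" if "\<And>z. z \<in># Y \<Longrightarrow> norm z \<le> sqrt B" for Y :: "complex multiset"
    using that
  proof (induction Y)
    case (add z Y)
    have "norm (z + (\<Sum>z\<in>#Y. z)) \<le> norm z + norm (\<Sum>z\<in>#Y. z)" by (rule norm_triangle_ineq)
    also have "norm z \<le> sqrt B" by (rule add.prems) simp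
    also have "norm (\<Sum>z\<in>#Y. z) \<le> size Y * sqrt B" by (rule add.IH) (use add.prems in simp)
    finally show ?case by (simp add: algebra_simps)
  qed simp
  from this[of Z] nz have "norm (S 1) \<le> size Z * sqrt B" using Z2[of 1] by simp
  also have "\<dots> \<le> N * sqrt B" using Z B by (intro mult_right_mono) auto
  finally show ?thesis .
qed

section \<open>Frobenius and its invariant multisets\<close>

text \<open>
  The field with \<open>q\<close> elements is the fixed set \<open>fixed 1\<close> of \<open>x \<mapsto> x ^ q\<close> in the algebraically closed
  type \<open>'k\<close>; \<open>type_dummy\<close> only makes \<open>'k\<close> a parameter of the locale.
\<close>

locale frob =
  fixes q r :: nat and type_dummy :: "'k::alg_closed_field itself"
  assumes char_prime: "prime CHAR('k)" and q_eq: "q = CHAR('k) ^ r" and r_pos: "r > 0"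
begin

lemma q_gt_1: "q > 1"
  unfolding q_eq using prime_gt_1_nat[OF char_prime] r_pos by (rule one_less_power)

lemma q_power_eq: "q ^ s = CHAR('k) ^ (r * s)"
  by (simp add: q_eq power_mult)

lemma frob_add: "(x + y :: 'k) ^ (q ^ s) = x ^ (q ^ s) + y ^ (q ^ s)"
  by (rule freshmans_dream'[OF char_prime q_power_eq])

lemma frob_sum: "(\<Sum>i\<in>A. f i :: 'k) ^ (q ^ s) = (\<Sum>i\<in>A. f i ^ (q ^ s))"
  by (rule freshmans_dream_sum'[OF char_prime q_power_eq])

lemma frob_add_poly: "(x + y :: 'k poly) ^ (q ^ s) = x ^ (q ^ s) + y ^ (q ^ s)"
  by (rule freshmans_dream'[where n = "r * s"]) (use char_prime q_power_eq in auto)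

lemma frob_sum_poly: "(\<Sum>i\<in>A. f i :: 'k poly) ^ (q ^ s) = (\<Sum>i\<in>A. f i ^ (q ^ s))"
  by (rule freshmans_dream_sum'[where n = "r * s"]) (use char_prime q_power_eq in auto)

lemma frob_minus: "(- x :: 'k) ^ (q ^ s) = - (x ^ (q ^ s))"
  using frob_add[of x "- x" s] q_gt_1 by (simp add: eq_neg_iff_add_eq_0 add.commute power_0_left)

lemma frob_diff: "(x - y :: 'k) ^ (q ^ s) = x ^ (q ^ s) - y ^ (q ^ s)"
  using frob_add[of x "- y" s] by (simp add: frob_minus)

lemma frob_diff_poly: "(x - y :: 'k poly) ^ (q ^ s) = x ^ (q ^ s) - y ^ (q ^ s)"
  using frob_add_poly[of "x - y" y s] by (simp add: algebra_simps)

lemma frob_inj: "(x :: 'k) ^ (q ^ s) = y ^ (q ^ s) \<Longrightarrow> x = y"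
  using frob_diff[of x y s] by simp

lemma frob_comp: "((x :: 'k) ^ (q ^ s)) ^ (q ^ t) = x ^ (q ^ (s + t))"
  by (simp add: power_add power_mult)

definition fixed :: "nat \<Rightarrow> 'k set" where "fixed s = {x. x ^ (q ^ s) = x}"

lemma fixed_1: "x \<in> fixed 1 \<longleftrightarrow> x ^ q = x"
  by (simp add: fixed_def)

lemma fixed_mult: "x \<in> fixed s \<Longrightarrow> y \<in> fixed s \<Longrightarrow> x * y \<in> fixed s"
  by (simp add: fixed_def power_mult_distrib)

lemma fixed_add: "x \<in> fixed s \<Longrightarrow> y \<in> fixed s \<Longrightarrow> x + y \<in> fixed s"
  by (simp add: fixed_def frob_add)

lemma fixed_diff: "x \<in> fixed s \<Longrightarrow> y \<in> fixed s \<Longrightarrow> x - y \<in> fixed s"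
  by (simp add: fixed_def frob_diff)

lemma fixed_minus: "x \<in> fixed s \<Longrightarrow> - x \<in> fixed s"
  by (simp add: fixed_def frob_minus)

lemma fixed_divide: "x \<in> fixed s \<Longrightarrow> y \<in> fixed s \<Longrightarrow> x / y \<in> fixed s"
  by (simp add: fixed_def power_divide)

lemma fixed_power: "x \<in> fixed s \<Longrightarrow> x ^ n \<in> fixed s"
proof -
  have "(x ^ n) ^ (q ^ s) = (x ^ (q ^ s)) ^ n"
    by (simp only: power_mult[symmetric] mult.commute)
  then show "x \<in> fixed s \<Longrightarrow> x ^ n \<in> fixed s" by (simp add: fixed_def)
qed

lemma fixed_0 [simp]: "0 \<in> fixed s" and fixed_one [simp]: "1 \<in> fixed s"
  using q_gt_1 by (auto simp: fixed_def)

lemma fixed_sum: "(\<And>i. i \<in> A \<Longrightarrow> f i \<in> fixed s) \<Longrightarrow> (\<Sum>i\<in>A. f i) \<in> fixed s"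
  by (induction A rule: infinite_finite_induct) (auto intro: fixed_add)

lemma fixed_of_nat [simp]: "of_nat n \<in> fixed s"
  by (induction n) (auto intro: fixed_add)

lemma fixed_mono: "x \<in> fixed s \<Longrightarrow> x \<in> fixed (s * k)"
proof (induction k)
  case (Suc k)
  have "x ^ (q ^ (s * k + s)) = (x ^ (q ^ (s * k))) ^ (q ^ s)" by (simp add: frob_comp)
  also have "\<dots> = x" using Suc by (simp add: fixed_def)
  finally show ?case by (simp add: fixed_def add.commute)
qed (auto simp: fixed_def)

lemma fixed_1_imp: "x \<in> fixed 1 \<Longrightarrow> x \<in> fixed s"
  using fixed_mono[of x 1 s] by simp

text \<open>The number of roots of X^Q - X equals its degree because all roots are simple: around a
  root b it equals (X - b)^Q - (X - b), which contains X - b exactly once.\<close>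

lemma card_fixed:
  assumes "s > 0"
  shows "finite (fixed s)" "card (fixed s) = q ^ s"
proof -
  define Q where "Q = q ^ s"
  have Q: "Q > 1" unfolding Q_def using q_gt_1 assms by (rule one_less_power)
  define p :: "'k poly" where "p = monom 1 Q - [:0, 1:]"
  have deg: "degree p = Q"
  proof (rule antisym)
    show "degree p \<le> Q"
      unfolding p_def using Q by (intro degree_diff_le) (auto simp: degree_monom_le)
    show "Q \<le> degree p"
      by (rule le_degree) (use Q in \<open>auto simp: p_def coeff_pCons split: nat.splits\<close>)
  qed
  have lc: "lead_coeff p = 1"
    unfolding deg using Q by (auto simp: p_def coeff_pCons split: nat.splits)
  have p0: "p \<noteq> 0" using lc by auto
  have fx: "fixed s = {x. poly p x = 0}"
    by (auto simp: fixed_def p_def poly_monom Q_def)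
  then show fin: "finite (fixed s)" using poly_roots_finite[OF p0] by simp
  have "order b p = 1" if b: "poly p b = 0" for b
  proof -
    have bQ: "b ^ Q = b" using b by (simp add: p_def poly_monom)
    have "[:-b, 1:] ^ Q = ([:0, 1:] - [:b:]) ^ Q" by simp
    also have "\<dots> = [:0, 1:] ^ Q - [:b:] ^ Q" unfolding Q_def by (rule frob_diff_poly)
    also have "[:b:] ^ Q = [:b:]" by (simp add: poly_const_pow bQ)
    finally have "p = [:-b, 1:] ^ Q - [:-b, 1:]"
      by (simp add: p_def monom_altdef)
    also have "\<dots> = [:-b, 1:] * ([:-b, 1:] ^ (Q - 1) - 1)"
      using Q by (subst (1) power_eq_if) (auto simp: algebra_simps simp del: mult_pCons_left)
    finally have p: "p = [:-b, 1:] * ([:-b, 1:] ^ (Q - 1) - 1)" .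
    have "poly ([:-b, 1:] ^ (Q - 1) - 1) b \<noteq> 0" using Q by (simp add: power_0_left)
    then have "order b ([:-b, 1:] ^ (Q - 1) - 1) = 0" by (rule order_0I)
    moreover have "order b p = order b [:-b, 1:] + order b ([:-b, 1:] ^ (Q - 1) - 1)"
      using p p0 by (metis order_mult)
    moreover have "order b [:-b, 1:] = 1" using order_power_n_n[of b 1] by simp
    ultimately show ?thesis by simp
  qed
  then have "proots p = mset_set (fixed s)"
    using p0 fin by (intro multiset_eqI) (auto simp: fx count_mset_set' order_0I)
  then show "card (fixed s) = q ^ s"
    using prod_mset_linear(2)[OF lc] deg by (simp add: Q_def)
qed

section \<open>Polynomials over the fixed field\<close>

definition fpoly :: "'k poly \<Rightarrow> bool" where
  "fpoly f \<longleftrightarrow> (\<forall>i. coeff f i \<in> fixed 1)"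

lemma fpoly_frob: "fpoly f \<Longrightarrow> poly f x ^ (q ^ s) = poly f (x ^ (q ^ s))"
proof -
  assume f: "fpoly f"
  have "poly f x ^ (q ^ s) = (\<Sum>i\<le>degree f. (coeff f i * x ^ i) ^ (q ^ s))"
    by (simp add: poly_altdef frob_sum)
  also have "\<dots> = (\<Sum>i\<le>degree f. coeff f i * (x ^ (q ^ s)) ^ i)"
  proof (intro sum.cong refl)
    fix i
    have "coeff f i ^ (q ^ s) = coeff f i"
      using f fixed_1_imp[of "coeff f i" s] by (auto simp: fpoly_def fixed_def)
    then show "(coeff f i * x ^ i) ^ (q ^ s) = coeff f i * (x ^ (q ^ s)) ^ i"
      by (simp add: power_mult_distrib flip: power_mult) (simp add: mult.commute)
  qed
  finally show ?thesis by (simp add: poly_altdef)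
qed

lemma fpoly_fixed: "fpoly f \<Longrightarrow> x \<in> fixed s \<Longrightarrow> poly f x \<in> fixed s"
  by (simp add: fixed_def fpoly_frob)

lemma fpoly_add: "fpoly f \<Longrightarrow> fpoly g \<Longrightarrow> fpoly (f + g)"
  and fpoly_diff: "fpoly f \<Longrightarrow> fpoly g \<Longrightarrow> fpoly (f - g)"
  and fpoly_smult: "c \<in> fixed 1 \<Longrightarrow> fpoly f \<Longrightarrow> fpoly (smult c f)"
  by (auto simp: fpoly_def intro: fixed_add fixed_diff fixed_mult)

lemma fpoly_mult: "fpoly f \<Longrightarrow> fpoly g \<Longrightarrow> fpoly (f * g)"
  by (auto simp: fpoly_def coeff_mult intro!: fixed_sum fixed_mult)

lemma fpoly_one [simp]: "fpoly 1" by (auto simp: fpoly_def)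

lemma fpoly_0 [simp]: "fpoly 0" by (auto simp: fpoly_def)

lemma fpoly_power: "fpoly f \<Longrightarrow> fpoly (f ^ n)"
  by (induction n) (auto intro: fpoly_mult)

lemma fpoly_monom: "c \<in> fixed 1 \<Longrightarrow> fpoly (monom c n)"
  by (auto simp: fpoly_def)

lemma fpoly_sum: "(\<And>i. i \<in> A \<Longrightarrow> fpoly (f i)) \<Longrightarrow> fpoly (\<Sum>i\<in>A. f i)"
  by (induction A rule: infinite_finite_induct) (auto intro: fpoly_add)

section \<open>Frobenius-invariant multisets and orbits\<close>

definition frobinv :: "'k multiset \<Rightarrow> bool" where
  "frobinv M \<longleftrightarrow> image_mset (\<lambda>x. x ^ q) M = M"

text \<open>For x in \<open>fixed s\<close> this is the Frobenius orbit of x, repeated s /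
  \<open>period x\<close> times. Sums and products over it are then traces and norms from
  \<open>fixed s\<close> to \<open>fixed 1\<close>, and it is the multiset that the logarithmic
  derivative of the L-function removes.\<close>

definition cyc :: "'k \<Rightarrow> nat \<Rightarrow> 'k multiset" where
  "cyc x s = image_mset (\<lambda>i. x ^ (q ^ i)) (mset_set {..<s})"

definition invmsets :: "nat \<Rightarrow> 'k multiset set" where
  "invmsets n = {M. frobinv M \<and> size M = n}"

lemma frobinv_empty [simp]: "frobinv {#}" by (simp add: frobinv_def)

lemma frobinv_plus: "frobinv M \<Longrightarrow> frobinv N \<Longrightarrow> frobinv (M + N)"
  by (simp add: frobinv_def)

lemma frobinv_diff: "frobinv (M + N) \<Longrightarrow> frobinv M \<Longrightarrow> frobinv N"
  by (simp add: frobinv_def)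

lemma frobinv_count: "frobinv M \<Longrightarrow> count M (x ^ (q ^ i)) = count M x"
proof (induction i)
  case (Suc i)
  have inj: "inj (\<lambda>x :: 'k. x ^ q)" using frob_inj[of _ 1] by (auto simp: inj_def)
  have "count M (x ^ (q ^ Suc i)) = count (image_mset (\<lambda>x. x ^ q) M) ((x ^ (q ^ i)) ^ q)"
    using Suc.prems by (simp add: frobinv_def flip: power_mult) (simp add: mult.commute)
  also have "\<dots> = count M (x ^ (q ^ i))"
    using inj by (induction M) (auto simp: inj_def)
  finally show ?case using Suc by simp
qed auto

lemma size_cyc [simp]: "size (cyc x s) = s" by (simp add: cyc_def)

lemma cyc_Suc: "cyc x (Suc s) = add_mset (x ^ (q ^ s)) (cyc x s)"
  by (simp add: cyc_def lessThan_Suc)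

lemma cyc_Suc': "cyc x (Suc s) = add_mset x (cyc (x ^ q) s)"
proof -
  have "mset_set {..<Suc s} = add_mset 0 (image_mset Suc (mset_set {..<s}))"
    by (subst lessThan_Suc_eq_insert_0) (simp add: image_mset_mset_set)
  then show ?thesis
    by (simp add: cyc_def image_mset.compositionality o_def power_mult)
qed

lemma image_frob_cyc: "image_mset (\<lambda>x. x ^ q) (cyc x s) = cyc (x ^ q) s"
  by (simp add: cyc_def image_mset.compositionality o_def flip: power_mult) (simp add: mult.commute)

lemma frobinv_cyc: "x \<in> fixed s \<Longrightarrow> frobinv (cyc x s)"
  unfolding frobinv_def image_frob_cyc
  using cyc_Suc[of x s] cyc_Suc'[of x s] by (simp add: fixed_def)

lemma cyc_add: "cyc x (s + t) = cyc x s + cyc (x ^ (q ^ s)) t"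
  by (induction t) (simp_all add: cyc_Suc frob_comp, simp add: cyc_def)

lemma cyc_mult: "x \<in> fixed s \<Longrightarrow> cyc x (k * s) = repeat_mset k (cyc x s)"
proof (induction k)
  case (Suc k)
  then show ?case using cyc_add[of x s "k * s"] by (simp add: fixed_def)
qed (simp add: cyc_def)

definition period :: "'k \<Rightarrow> nat" where
  "period x = (LEAST s. s > 0 \<and> x \<in> fixed s)"

lemma period:
  assumes "x \<in> fixed s" "s > 0"
  shows "period x > 0" "x \<in> fixed (period x)" "period x \<le> s"
    using LeastI[of "\<lambda>s. s > 0 \<and> x \<in> fixed s" s] Least_le[of "\<lambda>s. s > 0 \<and> x \<in> fixed s" s] assms
  by (auto simp: period_def)

lemma fixed_diff_exp: "x \<in> fixed s \<Longrightarrow> x \<in> fixed (s + t) \<Longrightarrow> x \<in> fixed t"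
  by (simp add: fixed_def flip: frob_comp)

lemma frob_eq_imp_fixed: "x ^ (q ^ i) = x ^ (q ^ j) \<Longrightarrow> i \<le> j \<Longrightarrow> x \<in> fixed (j - i)"
  using frob_inj[of x i "x ^ (q ^ (j - i))"] by (simp add: frob_comp fixed_def)

lemma period_dvd:
  assumes "x \<in> fixed s"  "s > 0"
  shows "period x dvd s"
proof -
  have "s mod period x = 0"
  proof (rule ccontr)
    assume n: "s mod period x \<noteq> 0"
    have "x \<in> fixed (period x * (s div period x) + s mod period x)"
      using assms by simp
    then have "x \<in> fixed (s mod period x)"
      using fixed_diff_exp fixed_mono period(2)[OF assms] by blast
    then have "period x \<le> s mod period x"
      using n by (intro period(3)) auto
    moreover have "s mod period x < period x" using period(1)[OF assms] by simp
    ultimately show False by simp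
  qed
  then show ?thesis by auto
qed

lemma inj_on_period:
  assumes "x \<in> fixed s" "s > 0"
  shows "inj_on (\<lambda>i. x ^ (q ^ i)) {..<period x}"
proof (rule linorder_inj_onI)
  fix i j assume ij: "i < j" "i \<in> {..<period x}" "j \<in> {..<period x}"
  show "x ^ (q ^ i) \<noteq> x ^ (q ^ j)"
  proof
    assume "x ^ (q ^ i) = x ^ (q ^ j)"
    then have "x \<in> fixed (j - i)" using frob_eq_imp_fixed ij by simp
    then have "period x \<le> j - i" using ij by (intro period(3)) auto
    then show False using ij by auto
  qed
qed auto

lemma cyc_period:
  assumes "x \<in> fixed s" "s > 0"
  shows "cyc x (period x) = mset_set ((\<lambda>i. x ^ (q ^ i)) ` {..<period x})"
  unfolding cyc_def by (rule image_mset_mset_set[OF inj_on_period[OF assms]])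

text \<open>All x^(q^i) lie in M, so two of the first \<open>size M + 1\<close> of them coincide,
  and injectivity of Frobenius cancels the common part of the exponents.\<close>

lemma frobinv_fixed:
  assumes M: "frobinv M" and x: "x \<in># M"
  obtains s where "0 < s" "s \<le> size M" "x \<in> fixed s"
proof -
  have "(\<lambda>i. x ^ (q ^ i)) ` {..size M} \<subseteq> set_mset M"
    using frobinv_count[OF M, of x] x by (force simp flip: count_greater_zero_iff)
  then have "card ((\<lambda>i. x ^ (q ^ i)) ` {..size M}) \<le> card (set_mset M)"
    by (intro card_mono) auto
  also have "\<dots> \<le> size M"
    by (simp add: size_multiset_overloaded_eq) (rule order_trans[OF _ sum_mono[of _ "\<lambda>_. 1"]], auto simp: Suc_le_eq)
  finally have "\<not> inj_on (\<lambda>i. x ^ (q ^ i)) {..size M}"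
    by (auto dest!: card_image)
  then obtain i j where "i \<le> size M" "j \<le> size M" "x ^ (q ^ i) = x ^ (q ^ j)" "i < j"
    unfolding inj_on_def by (metis atMost_iff linorder_neqE_nat)
  then show ?thesis using frob_eq_imp_fixed[of x i j] by (intro that[of "j - i"]) auto
qed

lemma finite_invmsets: "finite (invmsets n)"
proof -
  define A where "A = (\<Union>s\<in>{1..n}. fixed s)"
  have A: "finite A" using card_fixed by (auto simp: A_def)
  have "invmsets n \<subseteq> mset ` {xs. set xs \<subseteq> A \<and> length xs = n}"
  proof
    fix M assume M: "M \<in> invmsets n"
    obtain xs where xs: "M = mset xs" using ex_mset[of M] by metis
    have "set_mset M \<subseteq> A"
    proof
      fix x assume "x \<in># M"
      moreover have "frobinv M" "size M = n" using M by (auto simp: invmsets_def)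
      ultimately obtain s where "0 < s" "s \<le> n" "x \<in> fixed s"
        using frobinv_fixed by metis
      then show "x \<in> A" by (auto simp: A_def)
    qed
    then show "M \<in> mset ` {xs. set xs \<subseteq> A \<and> length xs = n}"
      using M xs by (auto simp: invmsets_def)
  qed
  then show ?thesis by (rule finite_subset) (intro finite_imageI finite_lists_length_eq A)
qed

text \<open>The admissible s are the multiples k l of the period l, and \<open>cyc x (k * l)\<close>
  consists of k copies of the orbit. Since all conjugates of x have the same multiplicity in M, it
  is contained in M iff k is at most that multiplicity.\<close>

lemma card_cyc_subsets_at:
  assumes M: "frobinv M" and x: "x \<in># M"
  shows "card {s. 0 < s \<and> x \<in> fixed s \<and> cyc x s \<subseteq># M} = count M x"
proof -
  obtain s0 where s0: "x \<in> fixed s0" "s0 > 0" using frobinv_fixed[OF M x] by blast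
  define l where "l = period x"
  note per = period[OF s0, folded l_def]
  have cl: "count (cyc x l) y \<le> 1" "count (cyc x l) x = 1" for y
  proof -
    show "count (cyc x l) y \<le> 1" unfolding l_def cyc_period[OF s0] by (simp add: count_mset_set')
    have "x \<in> (\<lambda>i. x ^ (q ^ i)) ` {..<period x}"
      using period(1)[OF s0] by (intro image_eqI[of _ _ 0]) auto
    then show "count (cyc x l) x = 1"
      unfolding l_def cyc_period[OF s0] by (simp add: count_mset_set')
  qed
  have "{s. 0 < s \<and> x \<in> fixed s \<and> cyc x s \<subseteq># M} = (\<lambda>k. k * l) ` {1..count M x}" (is "?L = ?R")
  proof
    show "?L \<subseteq> ?R"
    proof
      fix s assume "s \<in> ?L"
      then have s: "0 < s" "x \<in> fixed s" "cyc x s \<subseteq># M" by auto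
      then obtain k where k: "s = k * l" using period_dvd[of x s] by (auto simp: l_def mult.commute)
      have "count (cyc x s) x = k" using cl(2) by (simp add: k cyc_mult[OF per(2)])
      then have "k \<le> count M x" using s(3) by (metis mset_subset_eq_count)
      then show "s \<in> ?R" using k s(1) by (auto intro!: image_eqI[of _ _ k])
    qed
    show "?R \<subseteq> ?L"
    proof
      fix s assume "s \<in> ?R"
      then obtain k where k: "k \<in> {1..count M x}" "s = k * l" by auto
      have "cyc x s \<subseteq># M"
      proof (rule mset_subset_eqI)
        fix y
        show "count (cyc x s) y \<le> count M y"
        proof (cases "y \<in># cyc x l")
          case True
          then obtain i where "y = x ^ (q ^ i)" by (auto simp: cyc_def)
          then have "count M y = count M x" by (simp add: frobinv_count[OF M])
          moreover have "count (cyc x s) y \<le> k * 1"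
            unfolding k cyc_mult[OF per(2)] using cl(1)[of y] by (simp only: count_repeat_mset) (intro mult_le_mono2)
          ultimately show ?thesis using k by auto
        next
          case False
          then show ?thesis by (simp add: k cyc_mult[OF per(2)] not_in_iff)
        qed
      qed
      moreover have "x \<in> fixed s" using fixed_mono[OF per(2), of k] by (simp add: k mult.commute)
      ultimately show "s \<in> ?L" using k per by auto
    qed
  qed
  moreover have "inj_on (\<lambda>k. k * l) {1..count M x}" using per by (auto simp: inj_on_def)
  ultimately show ?thesis by (simp add: card_image)
qed

text \<open>The multiplicities of the elements of M add up to its size. This writes the factor n of
  the logarithmic derivative as a count of pairs (x, s).\<close>

lemma card_cyc_subsets:
  assumes M: "M \<in> invmsets n"
  shows "card {(x, s). s \<in> {1..n} \<and> x \<in> fixed s \<and> cyc x s \<subseteq># M} = n"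
proof -
  have Mi: "frobinv M" "size M = n" using M by (auto simp: invmsets_def)
  define T where "T x = {s. 0 < s \<and> x \<in> fixed s \<and> cyc x s \<subseteq># M}" for x
  have sn: "s \<le> n" if "cyc x s \<subseteq># M" for x s
    using size_mset_mono[OF that] Mi by simp
  have "{(x, s). s \<in> {1..n} \<and> x \<in> fixed s \<and> cyc x s \<subseteq># M} = Sigma (set_mset M) T"
  proof -
    have "x \<in># M" if "cyc x s \<subseteq># M" "s > 0" for x s
    proof -
      obtain s' where "s = Suc s'" using \<open>s > 0\<close> by (cases s) auto
      then show ?thesis using that cyc_Suc'[of x s'] by (auto dest: mset_subset_eqD)
    qed
    then show ?thesis using sn by (auto simp: T_def)
  qed
  also have "card \<dots> = (\<Sum>x\<in>set_mset M. card (T x))"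
  proof (rule card_SigmaI)
    show "\<forall>x\<in>set_mset M. finite (T x)"
      using sn by (auto simp: T_def intro!: finite_subset[of _ "{..n}"])
  qed auto
  also have "\<dots> = (\<Sum>x\<in>set_mset M. count M x)"
    by (intro sum.cong) (auto simp: T_def card_cyc_subsets_at[OF Mi(1)])
  finally show ?thesis using Mi by (simp add: size_multiset_overloaded_eq)
qed

text \<open>The factor n counts the pairs (x, s) with \<open>cyc x s\<close> contained in M.
  Splitting off \<open>cyc x s\<close> leaves an arbitrary invariant multiset of size n - s. This is
  the logarithmic derivative of the Euler product of the L-function, obtained without factoring into
  irreducible polynomials.\<close>

lemma invmset_recurrence:
  fixes \<Lambda> :: "'k multiset \<Rightarrow> complex"
  assumes mult: "\<And>M N. frobinv M \<Longrightarrow> frobinv N \<Longrightarrow> \<Lambda> (M + N) = \<Lambda> M * \<Lambda> N"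
  shows "of_nat n * (\<Sum>M\<in>invmsets n. \<Lambda> M) =
    (\<Sum>s=1..n. (\<Sum>x\<in>fixed s. \<Lambda> (cyc x s)) * (\<Sum>M\<in>invmsets (n - s). \<Lambda> M))"
proof -
  define T where "T = {(x :: 'k, s). s \<in> {1..n} \<and> x \<in> fixed s}"
  have T: "T = prod.swap ` Sigma {1..n} fixed" by (auto simp: T_def image_iff)
  have fT: "finite T" unfolding T using card_fixed by (intro finite_imageI finite_SigmaI) auto
  have "of_nat n * (\<Sum>M\<in>invmsets n. \<Lambda> M) =
      (\<Sum>M\<in>invmsets n. \<Sum>t\<in>{(x, s). s \<in> {1..n} \<and> x \<in> fixed s \<and> cyc x s \<subseteq># M}. \<Lambda> M)"
    by (simp only: sum_distrib_left sum_constant card_cyc_subsets cong: sum.cong)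
  also have "\<dots> = (\<Sum>M\<in>invmsets n. \<Sum>t\<in>T. if cyc (fst t) (snd t) \<subseteq># M then \<Lambda> M else 0)"
    using fT by (intro sum.cong sum.mono_neutral_cong_left refl) (auto simp: T_def)
  also have "\<dots> = (\<Sum>t\<in>T. \<Sum>M\<in>invmsets n. if cyc (fst t) (snd t) \<subseteq># M then \<Lambda> M else 0)"
    by (rule sum.swap)
  also have "\<dots> = (\<Sum>t\<in>T. \<Lambda> (cyc (fst t) (snd t)) * (\<Sum>M\<in>invmsets (n - snd t). \<Lambda> M))"
  proof (intro sum.cong refl)
    fix t assume t: "t \<in> T"
    define N where "N = cyc (fst t) (snd t)"
    have N: "frobinv N" "size N = snd t" "snd t \<le> n"
      using t by (auto simp: T_def N_def intro!: frobinv_cyc)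
    have "(\<Sum>M\<in>invmsets n. if N \<subseteq># M then \<Lambda> M else 0) = (\<Sum>M\<in>{M \<in> invmsets n. N \<subseteq># M}. \<Lambda> M)"
      using finite_invmsets by (simp add: sum.inter_filter)
    also have "\<dots> = (\<Sum>M\<in>invmsets (n - snd t). \<Lambda> (N + M))"
      by (rule sum.reindex_bij_witness[of _ "\<lambda>M. N + M" "\<lambda>M. M - N"])
        (use N in \<open>auto simp: invmsets_def size_Diff_submset intro: frobinv_plus frobinv_diff[of N]\<close>)
    also have "\<dots> = \<Lambda> N * (\<Sum>M\<in>invmsets (n - snd t). \<Lambda> M)"
      unfolding sum_distrib_left using N by (intro sum.cong refl mult) (auto simp: invmsets_def)
    finally show "(\<Sum>M\<in>invmsets n. if cyc (fst t) (snd t) \<subseteq># M then \<Lambda> M else 0) =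
        \<Lambda> (cyc (fst t) (snd t)) * (\<Sum>M\<in>invmsets (n - snd t). \<Lambda> M)" by (simp add: N_def)
  qed
  also have "\<dots> = (\<Sum>(s, x)\<in>Sigma {1..n} fixed. \<Lambda> (cyc x s) * (\<Sum>M\<in>invmsets (n - s). \<Lambda> M))"
    unfolding T by (subst sum.reindex) (auto simp: case_prod_beta)
  also have "\<dots> = (\<Sum>s=1..n. \<Sum>x\<in>fixed s. \<Lambda> (cyc x s) * (\<Sum>M\<in>invmsets (n - s). \<Lambda> M))"
    using card_fixed by (subst sum.Sigma) auto
  finally show ?thesis by (simp add: sum_distrib_right)
qed

lemma invmsets_0: "invmsets 0 = {{#}}"
  by (auto simp: invmsets_def)

section \<open>Invariant multisets as monic polynomials over the fixed field\<close>

definition mpolys :: "nat \<Rightarrow> 'k poly set" where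
  "mpolys n = {h. degree h = n \<and> lead_coeff h = 1 \<and> fpoly h}"

lemma map_poly_frob_mult:
  "map_poly (\<lambda>c. c ^ q) (f * g) = map_poly (\<lambda>c. c ^ q) f * map_poly (\<lambda>c. c ^ q) (g :: 'k poly)"
proof -
  have q0: "(0 :: 'k) ^ q = 0" using q_gt_1 by simp
  then show ?thesis
    by (intro poly_eqI)
      (simp add: coeff_map_poly coeff_mult power_mult_distrib frob_sum[of _ _ 1, simplified])
qed

lemma map_poly_frob_prod_linear:
  "map_poly (\<lambda>c. c ^ q) (\<Prod>x\<in>#M. [:-x, 1:] :: 'k poly) = (\<Prod>x\<in>#image_mset (\<lambda>x. x ^ q) M. [:-x, 1:])"
proof (induction M)
  case empty
  then show ?case by simp
next
  case (add z M)
  have q0: "(0 :: 'k) ^ q = 0" using q_gt_1 by simp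
  have "map_poly (\<lambda>c. c ^ q) [:-z, 1:] = [:-(z ^ q), 1:]"
    using q0 frob_minus[of z 1] by (simp add: map_poly_pCons)
  then show ?case using add map_poly_frob_mult[of "[:-z, 1:]"] by simp
qed

lemma fpoly_iff: "fpoly h \<longleftrightarrow> map_poly (\<lambda>c. c ^ q) h = h"
  using q_gt_1 by (auto simp: fpoly_def fixed_def poly_eq_iff coeff_map_poly)

lemma mpolys_proots: "h \<in> mpolys n \<Longrightarrow> proots h \<in> invmsets n"
proof -
  assume h: "h \<in> mpolys n"
  then have lc: "lead_coeff h = 1" by (auto simp: mpolys_def)
  have "(\<Prod>x\<in>#image_mset (\<lambda>x. x ^ q) (proots h). [:-x, 1:]) = h"
    using map_poly_frob_prod_linear[of "proots h"] h
    by (simp add: prod_mset_linear[OF lc] mpolys_def fpoly_iff)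
  then have "image_mset (\<lambda>x. x ^ q) (proots h) = proots h"
    using proots_prod_linear[of "image_mset (\<lambda>x. x ^ q) (proots h)"] by simp
  then show ?thesis using h prod_mset_linear(2)[OF lc] by (simp add: invmsets_def frobinv_def mpolys_def)
qed

lemma invmsets_prod: "M \<in> invmsets n \<Longrightarrow> (\<Prod>x\<in>#M. [:-x, 1:]) \<in> mpolys n"
  using lead_coeff_prod_linear[of M]
  by (auto simp: mpolys_def invmsets_def fpoly_iff map_poly_frob_prod_linear frobinv_def
      simp del: lead_coeff_prod_linear)

lemma sum_invmsets_eq: "(\<Sum>M\<in>invmsets n. \<Lambda> M) = (\<Sum>h\<in>mpolys n. \<Lambda> (proots h))"
  by (rule sum.reindex_bij_witness[of _ proots "\<lambda>M. \<Prod>x\<in>#M. [:-x, 1:]"])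
    (use mpolys_proots invmsets_prod in \<open>auto simp: mpolys_def prod_mset_linear\<close>)

end

section \<open>Vanishing of L-function coefficients\<close>

text \<open>Both sides are the resultant of h and G, evaluated over the roots of either polynomial.
  It shows that the product of G over the roots of h depends only on the values of h at the roots of
  G.\<close>

lemma prod_mset_poly_proots:
  fixes h G :: "'a::alg_closed_field poly"
  assumes h: "lead_coeff h = 1" and G: "G \<noteq> 0"
  shows "(\<Prod>\<theta>\<in>#proots h. poly G \<theta>) = lead_coeff G ^ degree h *
    (\<Prod>\<beta>\<in>#proots G. (-1) ^ degree h * poly h \<beta>)"
proof -
  define l where "l = lead_coeff G"
  have l: "l \<noteq> 0" using G by (simp add: l_def)
  have "lead_coeff (smult (1 / l) G) = 1" using l by (simp add: l_def)
  from prod_mset_linear(1)[OF this] have "(\<Prod>x\<in>#proots G. [:-x, 1:]) = smult (1 / l) G"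
    using l by simp
  then have Gl: "G = smult l (\<Prod>x\<in>#proots G. [:-x, 1:])" using l by simp
  have pG: "poly G \<theta> = l * (\<Prod>x\<in>#proots G. \<theta> - x)" for \<theta>
    by (subst Gl) (simp add: poly_prod_mset image_mset.compositionality o_def)
  have ph: "poly h \<beta> = (\<Prod>x\<in>#proots h. \<beta> - x)" for \<beta>
    by (subst prod_mset_linear(1)[OF h, symmetric]) (simp add: poly_prod_mset image_mset.compositionality o_def)
  have sg: "(\<Prod>x\<in>#M. x - \<beta>) = (-1) ^ size M * (\<Prod>x\<in>#M. \<beta> - x)" for M and \<beta> :: 'a
    by (induction M) (auto simp: algebra_simps)
  have sw: "(\<Prod>\<theta>\<in>#M. l * (\<Prod>x\<in>#N. \<theta> - x)) = l ^ size M * (\<Prod>x\<in>#N. (\<Prod>\<theta>\<in>#M. \<theta> - x))" for M N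
    by (induction M) (auto simp: prod_mset.distrib mult_ac)
  show ?thesis
    using prod_mset_linear(2)[OF h] by (simp add: pG sw sg ph flip: l_def)
qed

text \<open>One pair of characters is enough. As \<psi> is nontrivial, the additive characters are y
  -> \<psi>(s y); as \<chi> is faithful, it generates the multiplicative ones, which are y ->
  \<chi>(y^a). Setting \<chi>(0) = 0 makes the sums skip the zeros of G.\<close>

locale frob_chars = frob q r type_dummy
  for q r and type_dummy :: "'k::alg_closed_field itself" +
  fixes \<psi> \<chi> :: "'k \<Rightarrow> complex"
  assumes psi_add: "x \<in> fixed 1 \<Longrightarrow> y \<in> fixed 1 \<Longrightarrow> \<psi> (x + y) = \<psi> x * \<psi> y"
    and psi_norm: "x \<in> fixed 1 \<Longrightarrow> norm (\<psi> x) = 1"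
    and psi_nontrivial: "\<exists>x\<in>fixed 1. \<psi> x \<noteq> 1"
    and chi_0: "\<chi> 0 = 0"
    and chi_mult: "x \<in> fixed 1 \<Longrightarrow> y \<in> fixed 1 \<Longrightarrow> \<chi> (x * y) = \<chi> x * \<chi> y"
    and chi_norm: "x \<in> fixed 1 \<Longrightarrow> x \<noteq> 0 \<Longrightarrow> norm (\<chi> x) = 1"
    and chi_faithful: "x \<in> fixed 1 \<Longrightarrow> x \<noteq> 0 \<Longrightarrow> \<chi> x = 1 \<Longrightarrow> x = 1"
begin

lemma psi_0: "\<psi> 0 = 1"
proof -
  have "\<psi> 0 * \<psi> 0 = \<psi> 0" using psi_add[of 0 0] by simp
  moreover have "\<psi> 0 \<noteq> 0" using psi_norm[of 0] by auto
  ultimately show ?thesis by simp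
qed

lemma chi_1: "\<chi> 1 = 1"
proof -
  have "\<chi> 1 * \<chi> 1 = \<chi> 1" using chi_mult[of 1 1] by simp
  moreover have "\<chi> 1 \<noteq> 0" using chi_norm[of 1] by auto
  ultimately show ?thesis by simp
qed

lemma psi_sum:
  assumes "c \<in> fixed 1" "c \<noteq> 0"
  shows "(\<Sum>x\<in>fixed 1. \<psi> (c * x)) = 0"
proof -
  obtain z where z: "z \<in> fixed 1" "\<psi> z \<noteq> 1" using psi_nontrivial by blast
  have "(\<Sum>x\<in>fixed 1. \<psi> x) = (\<Sum>x\<in>fixed 1. \<psi> (x + z))"
    by (rule sum.reindex_bij_witness[of _ "\<lambda>x. x + z" "\<lambda>x. x - z"])
      (use z in \<open>auto intro: fixed_add fixed_diff\<close>)
  also have "\<dots> = \<psi> z * (\<Sum>x\<in>fixed 1. \<psi> x)"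
    unfolding sum_distrib_left using z by (intro sum.cong refl) (simp add: psi_add mult.commute)
  finally have "(\<Sum>x\<in>fixed 1. \<psi> x) = 0" using z by simp
  moreover have "(\<Sum>x\<in>fixed 1. \<psi> (c * x)) = (\<Sum>x\<in>fixed 1. \<psi> x)"
    by (rule sum.reindex_bij_witness[of _ "\<lambda>x. x / c" "\<lambda>x. c * x"])
      (use assms in \<open>auto intro: fixed_mult fixed_divide\<close>)
  ultimately show ?thesis by simp
qed

text \<open>The completely multiplicative weight whose generating series is the L-function. On
  \<open>cyc x s\<close> with x in \<open>fixed s\<close> it is \<psi> of the trace of u(x) times
  \<chi> of the norm of G(x).\<close>

definition wt :: "'k poly \<Rightarrow> 'k poly \<Rightarrow> 'k multiset \<Rightarrow> complex" where
  "wt u G M = \<psi> (\<Sum>\<theta>\<in>#M. poly u \<theta>) * \<chi> (\<Prod>\<theta>\<in>#M. poly G \<theta>)"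

lemma frobinv_sum_fixed:
  assumes "frobinv M" "fpoly u"
  shows "(\<Sum>\<theta>\<in>#M. poly u \<theta>) \<in> fixed 1"
proof -
  have "(\<Sum>\<theta>\<in>#N. poly u \<theta>) ^ q = (\<Sum>\<theta>\<in>#image_mset (\<lambda>x. x ^ q) N. poly u \<theta>)" for N
  proof (induction N)
    case (add x N)
    then show ?case using frob_add[of "poly u x" _ 1] fpoly_frob[OF assms(2), of x 1] by simp
  qed (use q_gt_1 in auto)
  from this[of M] show ?thesis using assms(1) unfolding fixed_1 frobinv_def by simp
qed

lemma frobinv_prod_fixed:
  assumes "frobinv M" "fpoly u"
  shows "(\<Prod>\<theta>\<in>#M. poly u \<theta>) \<in> fixed 1"
proof -
  have "(\<Prod>\<theta>\<in>#N. poly u \<theta>) ^ q = (\<Prod>\<theta>\<in>#image_mset (\<lambda>x. x ^ q) N. poly u \<theta>)" for N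
  proof (induction N)
    case (add x N)
    then show ?case using fpoly_frob[OF assms(2), of x 1] by (simp add: power_mult_distrib)
  qed (use q_gt_1 in auto)
  from this[of M] show ?thesis using assms(1) unfolding fixed_1 frobinv_def by simp
qed

lemma wt_plus:
  assumes "fpoly u" "fpoly G" "frobinv M" "frobinv N"
  shows "wt u G (M + N) = wt u G M * wt u G N"
  using frobinv_sum_fixed[OF assms(3,1)] frobinv_sum_fixed[OF assms(4,1)]
    frobinv_prod_fixed[OF assms(3,2)] frobinv_prod_fixed[OF assms(4,2)]
  by (simp add: wt_def psi_add chi_mult)

lemma mpolys_shift:
  assumes h: "h \<in> mpolys n" and v: "fpoly v" "v = 0 \<or> degree v < n"
  shows "h + v \<in> mpolys n"
proof -
  have "degree h = n" "lead_coeff h = 1" "fpoly h" using h by (auto simp: mpolys_def)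
  moreover have "degree (h + v) = n"
    using v(2) calculation(1) by (auto intro: degree_add_eq_left)
  moreover have "coeff v n = 0" using v(2) by (auto intro: coeff_eq_0)
  ultimately show ?thesis using v(1) by (auto simp: mpolys_def fpoly_add)
qed

lemma sum_mpolys_shift:
  assumes v: "fpoly v" "v = 0 \<or> degree v < n"
  shows "(\<Sum>h\<in>mpolys n. f (h + v)) = (\<Sum>h\<in>mpolys n. f h)"
proof -
  have v': "fpoly (- v)" using fpoly_diff[of 0 v] v by simp
  show ?thesis
    by (rule sum.reindex_bij_witness[of _ "\<lambda>h. h - v" "\<lambda>h. h + v"])
      (use mpolys_shift[OF _ v] mpolys_shift[of _ n "- v"] v v' in auto)
qed

lemma sum_proots_poly:
  "(\<Sum>\<theta>\<in>#M. poly u \<theta>) = (\<Sum>k\<le>degree u. coeff u k * (\<Sum>\<theta>\<in>#M. \<theta> ^ k))"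
    for M :: "'k multiset"
  by (induction M) (simp_all add: poly_altdef sum.distrib distrib_left)

text \<open>The monic polynomials h are averaged over the shifts h + c v. As v vanishes at the zeros
  of G, the resultant and with it the \<chi>-part is unchanged. The power sums of the roots below
  index m are unchanged too, and the m-th one changes by a nonzero multiple of c. So the average
  runs \<psi> through all of the field and is 0.\<close>

lemma additive_coefficient_vanishes:
  assumes u: "fpoly u" "degree u = m" "0 < m" "m < CHAR('k)"
    and G: "fpoly G" "G \<noteq> 0" and \<rho>: "fpoly \<rho>" "\<rho> \<noteq> 0"
    and roots: "\<And>x. poly G x = 0 \<Longrightarrow> poly \<rho> x = 0"
    and n: "n \<ge> m + degree \<rho>"
  shows "(\<Sum>M\<in>invmsets n. wt u G M) = 0"
proof -
  define l where "l = lead_coeff \<rho>"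
  have l: "l \<noteq> 0" "l \<in> fixed 1" using \<rho> by (auto simp: l_def fpoly_def)
  \<comment> \<open>The factor \<rho> makes v vanish at the zeros of G, and the monomial raises the
    degree to n - m, so that the coefficient of index m counted from the top is the first to
    change.\<close>
  define v where "v = monom 1 (n - m - degree \<rho>) * \<rho>"
  have dv: "degree v = n - m"
    unfolding v_def using \<rho> n by (subst degree_mult_eq) (auto simp: degree_monom_eq)
  have lv: "coeff v (n - m) = l"
  proof -
    have "lead_coeff v = l"
      unfolding v_def lead_coeff_mult by (simp add: l_def degree_monom_eq)
    then show ?thesis using dv by simp
  qed
  have fv: "fpoly v" unfolding v_def by (intro fpoly_mult fpoly_monom \<rho>) auto
  define um where "um = coeff u m"
  have um: "um \<noteq> 0" "um \<in> fixed 1" using u by (auto simp: um_def fpoly_def)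
  \<comment> \<open>The change of the sum of u over the roots is \<kappa> c: Newton's identity
    contributes - m l, and the leading coefficient of u the factor \<open>um\<close>.\<close>
  define \<kappa> where "\<kappa> = - (of_nat m * l * um)"
  have m0: "of_nat m \<noteq> (0 :: 'k)" using u by (auto simp: of_nat_eq_0_iff_char_dvd dest: dvd_imp_le)
  have \<kappa>: "\<kappa> \<noteq> 0" "\<kappa> \<in> fixed 1" using m0 l um
    by (auto simp: \<kappa>_def intro!: fixed_minus fixed_mult)
  have shift: "wt u G (proots (h + smult c v)) = wt u G (proots h) * \<psi> (\<kappa> * c)"
    if h: "h \<in> mpolys n" and c: "c \<in> fixed 1" for h c
  proof -
    define h' where "h' = h + smult c v"
    have h': "h' \<in> mpolys n" unfolding h'_def
      by (rule mpolys_shift[OF h fpoly_smult[OF c fv]]) (use dv u n in auto)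
    have lc: "lead_coeff h = 1" "lead_coeff h' = 1" "degree h = n" "degree h' = n"
      using h h' by (auto simp: mpolys_def)
    have "poly h' \<beta> = poly h \<beta>" if "\<beta> \<in># proots G" for \<beta>
      using that roots[of \<beta>] G by (simp add: h'_def v_def)
    then have "(\<Prod>\<beta>\<in>#proots G. (-1) ^ n * poly h' \<beta>) = (\<Prod>\<beta>\<in>#proots G. (-1) ^ n * poly h \<beta>)"
      by (intro arg_cong[of _ _ prod_mset] image_mset_cong) simp
    then have pr: "(\<Prod>\<theta>\<in>#proots h'. poly G \<theta>) = (\<Prod>\<theta>\<in>#proots h. poly G \<theta>)"
      by (simp add: prod_mset_poly_proots[OF lc(1) G(2)] prod_mset_poly_proots[OF lc(2) G(2)] lc(3,4))
    have e1: "euler_fps (proots h) $ i = euler_fps (proots h') $ i" if "i < m" for i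
    proof -
      have "coeff v (n - i) = 0" using that dv n by (intro coeff_eq_0) auto
      then show ?thesis
        using euler_fps_proots_nth[OF lc(1), of i] euler_fps_proots_nth[OF lc(2), of i] lc that n
        by (simp add: h'_def)
    qed
    have e2: "euler_fps (proots h') $ m = euler_fps (proots h) $ m + c * l"
      using euler_fps_proots_nth[OF lc(1), of m] euler_fps_proots_nth[OF lc(2), of m] lc n lv
      by (simp add: h'_def)
    have pw: "(\<Sum>\<theta>\<in>#proots h'. \<theta> ^ k) = (\<Sum>\<theta>\<in>#proots h. \<theta> ^ k)" if "k < m" for k
    proof (cases "k = 0")
      case True
      have "size (proots h') = size (proots h)"
        using prod_mset_linear(2)[OF lc(1)] prod_mset_linear(2)[OF lc(2)] lc by simp
      then show ?thesis using True by simp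
    next
      case False
      then show ?thesis using power_sums_eq_if_euler_eq[of m "proots h" "proots h'" k] e1 that by simp
    qed
    have pm: "(\<Sum>\<theta>\<in>#proots h'. \<theta> ^ m) = (\<Sum>\<theta>\<in>#proots h. \<theta> ^ m) - of_nat m * (c * l)"
      by (rule power_sum_diff_if_euler_diff[OF e1 u(3) e2])
    have "(\<Sum>\<theta>\<in>#proots h'. poly u \<theta>) = (\<Sum>k\<le>m. coeff u k * (\<Sum>\<theta>\<in>#proots h'. \<theta> ^ k))"
      by (simp add: sum_proots_poly u(2))
    also have "{..m} = insert m {..<m}" by auto
    also have "(\<Sum>k\<in>insert m {..<m}. coeff u k * (\<Sum>\<theta>\<in>#proots h'. \<theta> ^ k)) =
        (\<Sum>k\<in>insert m {..<m}. coeff u k * (\<Sum>\<theta>\<in>#proots h. \<theta> ^ k)) + \<kappa> * c"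
      by (simp add: pw pm \<kappa>_def um_def algebra_simps)
    also have "insert m {..<m} = {..m}" by auto
    also have "(\<Sum>k\<le>m. coeff u k * (\<Sum>\<theta>\<in>#proots h. \<theta> ^ k)) = (\<Sum>\<theta>\<in>#proots h. poly u \<theta>)"
      by (simp add: sum_proots_poly u(2))
    finally have "(\<Sum>\<theta>\<in>#proots h'. poly u \<theta>) = (\<Sum>\<theta>\<in>#proots h. poly u \<theta>) + \<kappa> * c" .
    moreover have "(\<Sum>\<theta>\<in>#proots h. poly u \<theta>) \<in> fixed 1"
      using mpolys_proots[OF h] u(1) by (intro frobinv_sum_fixed) (auto simp: invmsets_def)
    moreover have "\<kappa> * c \<in> fixed 1" using \<kappa> c by (intro fixed_mult)
    ultimately show ?thesis
      by (simp add: wt_def pr psi_add flip: h'_def)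
  qed
  have "of_nat (card (fixed 1)) * (\<Sum>h\<in>mpolys n. wt u G (proots h)) =
      (\<Sum>c\<in>fixed 1. \<Sum>h\<in>mpolys n. wt u G (proots (h + smult c v)))"
  proof -
    have "(\<Sum>h\<in>mpolys n. wt u G (proots (h + smult c v))) = (\<Sum>h\<in>mpolys n. wt u G (proots h))"
      if "c \<in> fixed 1" for c
      by (rule sum_mpolys_shift[OF fpoly_smult[OF that fv], where f = "\<lambda>h. wt u G (proots h)"])
        (use dv u n in auto)
    then show ?thesis by simp
  qed
  also have "\<dots> = (\<Sum>c\<in>fixed 1. \<Sum>h\<in>mpolys n. wt u G (proots h) * \<psi> (\<kappa> * c))"
    by (intro sum.cong refl shift)
  also have "\<dots> = (\<Sum>h\<in>mpolys n. wt u G (proots h)) * (\<Sum>c\<in>fixed 1. \<psi> (\<kappa> * c))"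
    by (simp add: sum_product sum.swap[of _ "mpolys n"])
  also have "\<dots> = 0" using psi_sum[OF \<kappa>(2,1)] by simp
  finally show ?thesis
    using card_fixed(2)[of 1] q_gt_1 by (simp add: sum_invmsets_eq)
qed

lemma frobinv_proots:
  assumes "fpoly G" "G \<noteq> 0"
  shows "frobinv (proots G)"
proof -
  define l where "l = lead_coeff G"
  have l: "l \<noteq> 0" "l \<in> fixed 1" using assms by (auto simp: l_def fpoly_def)
  have "fpoly (smult (1 / l) G)" using assms l by (intro fpoly_smult fixed_divide) auto
  then have "smult (1 / l) G \<in> mpolys (degree G)"
    using l by (auto simp: mpolys_def l_def)
  from mpolys_proots[OF this] show ?thesis using l by (simp add: invmsets_def)
qed

text \<open>The norm is y -> y^T with T = (q^t - 1) / (q - 1). If y -> \<chi>(y^(T e)) were trivial,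
  faithfulness would give z^(e0 T) = 1 for all (q - 1) T units z, where e0 = e mod (q - 1) is
  positive and less than q - 1: too many roots. A nontrivial character sums to 0.\<close>

lemma chi_norm_sum:
  assumes t: "t > 0" and e: "\<not> (q - 1) dvd e"
  shows "(\<Sum>y\<in>fixed t. \<chi> ((\<Prod>i<t. y ^ (q ^ i)) ^ e)) = 0"
proof -
  define T where "T = (\<Sum>i<t. q ^ i)"
  have N: "(\<Prod>i<t. y ^ (q ^ i)) = y ^ T" for y :: 'k by (simp add: T_def power_sum)
  have T: "(q - 1) * T = q ^ t - 1"
  proof -
    have "q ^ t = (q - 1) * T + 1"
      unfolding T_def
    proof (induction t)
      case (Suc t)
      obtain q' where "q = Suc q'" using q_gt_1 by (cases q) auto
      then show ?case using Suc by (simp add: algebra_simps)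
    qed auto
    then show ?thesis by simp
  qed
  have Tpos: "T > 0" using t q_gt_1 by (auto simp: T_def intro!: sum_pos2[of _ 0])
  have NF: "y ^ T \<in> fixed 1" if "y \<in> fixed t" for y
  proof (cases "y = 0")
    case False
    have "y ^ (q ^ t) = y" using that by (simp add: fixed_def)
    moreover have "q ^ t = Suc (q ^ t - 1)" using q_gt_1 by simp
    ultimately have "y * y ^ (q ^ t - 1) = y * 1" by (metis mult.right_neutral power_Suc)
    then have "y ^ (q ^ t - 1) = 1" using False by simp
    then have "(y ^ T) ^ (q - 1) = 1" by (simp only: power_mult[symmetric] mult.commute[of T] T)
    then have "(y ^ T) ^ q = y ^ T" using q_gt_1 by (metis Suc_diff_1 less_trans zero_less_one mult.right_neutral power_Suc)
    then show ?thesis unfolding fixed_1 .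
  qed (use Tpos in \<open>auto simp: power_0_left\<close>)
  define e0 where "e0 = e mod (q - 1)"
  have e0: "e0 > 0" "e0 < q - 1" using e q_gt_1 by (auto simp: e0_def mod_greater_zero_iff_not_dvd)
  obtain z where z: "z \<in> fixed t" "z \<noteq> 0" "\<chi> ((z ^ T) ^ e) \<noteq> 1"
  proof (rule ccontr)
    assume "\<not> thesis"
    then have A: "\<chi> ((z ^ T) ^ e) = 1" if "z \<in> fixed t" "z \<noteq> 0" for z using that \<open>\<And>z. z \<in> fixed t \<Longrightarrow> z \<noteq> 0 \<Longrightarrow> \<chi> ((z ^ T) ^ e) \<noteq> 1 \<Longrightarrow> thesis\<close> by blast
    have one: "z ^ (e0 * T) = 1" if z: "z \<in> fixed t" "z \<noteq> 0" for z
    proof -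
      have f: "(z ^ T) ^ e \<in> fixed 1" by (rule fixed_power, rule NF[OF z(1)])
      have "(z ^ T) ^ e = 1" by (rule chi_faithful[OF f]) (use z A in auto)
      moreover have "(z ^ T) ^ q = z ^ T" using NF[OF z(1)] unfolding fixed_1 .
      then have "z ^ T * (z ^ T) ^ (q - 1) = z ^ T * 1" using q_gt_1 by (metis Suc_diff_1 less_trans zero_less_one mult.right_neutral power_Suc)
      then have "(z ^ T) ^ (q - 1) = 1" using z by simp
      then have "(z ^ T) ^ ((q - 1) * (e div (q - 1)) + e mod (q - 1)) = (z ^ T) ^ e0"
        by (simp only: power_add power_mult e0_def power_one mult_1)
      then have "(z ^ T) ^ e = (z ^ T) ^ e0" by simp
      ultimately show ?thesis by (simp add: mult.commute power_mult)
    qed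
    define p :: "'k poly" where "p = monom 1 (e0 * T) - 1"
    have "coeff p (e0 * T) = 1" using e0 Tpos by (simp add: p_def)
    then have p0: "p \<noteq> 0" by auto
    have "q ^ t - 1 = card (fixed t - {0 :: 'k})"
      using card_fixed[OF t] by simp
    also have "\<dots> \<le> card {x. poly p x = 0}"
      using one poly_roots_finite[OF p0] by (intro card_mono) (auto simp: p_def poly_monom)
    also have "\<dots> \<le> degree p" by (rule card_poly_roots_bound[OF p0])
    also have "\<dots> \<le> e0 * T" unfolding p_def by (intro degree_diff_le) (auto simp: degree_monom_le)
    also have "\<dots> < (q - 1) * T" using e0 Tpos by simp
    finally show False using T by simp
  qed
  have "(\<Sum>y\<in>fixed t. \<chi> ((y ^ T) ^ e)) = (\<Sum>y\<in>fixed t. \<chi> (((z * y) ^ T) ^ e))"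
    by (rule sum.reindex_bij_witness[of _ "\<lambda>y. z * y" "\<lambda>y. y / z"])
      (use z in \<open>auto intro: fixed_mult fixed_divide\<close>)
  also have "\<dots> = (\<Sum>y\<in>fixed t. \<chi> ((z ^ T) ^ e) * \<chi> ((y ^ T) ^ e))"
    using z NF by (intro sum.cong refl) (simp add: power_mult_distrib chi_mult fixed_power)
  finally have "(\<Sum>y\<in>fixed t. \<chi> ((y ^ T) ^ e)) = \<chi> ((z ^ T) ^ e) * (\<Sum>y\<in>fixed t. \<chi> ((y ^ T) ^ e))"
    unfolding sum_distrib_left .
  then show ?thesis using z(3) by (simp add: N)
qed

lemma card_fpolys_less:
  "card {k. fpoly k \<and> (\<forall>i\<ge>t. coeff k i = 0)} = q ^ t" (is "card ?K = _")
proof -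
  have "bij_betw (\<lambda>k. restrict (coeff k) {..<t}) ?K (PiE {..<t} (\<lambda>_. fixed 1))"
  proof (rule bij_betwI[where g = "\<lambda>c. \<Sum>i<t. monom (c i) i"])
    show "(\<lambda>k. restrict (coeff k) {..<t}) \<in> ?K \<rightarrow> (PiE {..<t} (\<lambda>_. fixed 1))"
      by (auto simp: fpoly_def)
    show "(\<lambda>c. \<Sum>i<t. monom (c i) i) \<in> (PiE {..<t} (\<lambda>_. fixed 1)) \<rightarrow> ?K"
    proof
      fix c :: "nat \<Rightarrow> 'k" assume c: "c \<in> PiE {..<t} (\<lambda>_. fixed 1)"
      have "fpoly (\<Sum>i<t. monom (c i) i)"
        by (rule fpoly_sum, rule fpoly_monom) (use c in \<open>auto dest: PiE_mem\<close>)
      moreover have "coeff (\<Sum>i<t. monom (c i) i) j = 0" if "j \<ge> t" for j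
        unfolding coeff_sum using that by (intro sum.neutral) auto
      ultimately show "(\<Sum>i<t. monom (c i) i) \<in> ?K" by simp
    qed
    show "(\<Sum>i<t. monom (restrict (coeff k) {..<t} i) i) = k" if "k \<in> ?K" for k
      using that by (auto simp: poly_eq_iff coeff_sum if_distrib cong: if_cong)
    show "restrict (coeff (\<Sum>i<t. monom (c i) i)) {..<t} = c"
      if "c \<in> PiE {..<t} (\<lambda>_. fixed 1)" for c
    proof
      fix j
      show "restrict (coeff (\<Sum>i<t. monom (c i) i)) {..<t} j = c j"
        using that by (cases "j < t") (simp_all add: coeff_sum PiE_arb[of c])
    qed
  qed
  then have "card ?K = card (PiE {..<t} (\<lambda>_. fixed 1))" by (rule bij_betw_same_card)
  then show ?thesis using card_fixed(2)[of 1] by (simp add: card_PiE)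
qed

text \<open>Here the shifts are h + w k with deg k < t, where t is the size of the orbit of \<beta>
  and w vanishes at the zeros of \<rho> outside that orbit. They fix the values of h at all other
  zeros of G, while the value y at \<beta> runs once through \<open>fixed t\<close>. The weight
  becomes a constant times \<chi>(N(y)^e), e being the order of G at \<beta>, and the average is
  0.\<close>

lemma multiplicative_coefficient_vanishes:
  assumes G: "fpoly G" "G \<noteq> 0" and \<rho>: "fpoly \<rho>" "\<rho> \<noteq> 0"
    and roots: "\<And>x. poly G x = 0 \<Longrightarrow> poly \<rho> x = 0"
    and n: "n \<ge> degree \<rho>"
    and \<beta>: "\<not> (q - 1) dvd order \<beta> G"
  shows "(\<Sum>M\<in>invmsets n. wt 0 G M) = 0"
proof -
  define e where "e = order \<beta> G"
  have G\<beta>: "poly G \<beta> = 0" using \<beta> G(2) by (metis dvd_0_right order_root)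
  have invG: "frobinv (proots G)" and inv\<rho>: "frobinv (proots \<rho>)"
    using frobinv_proots G \<rho> by auto
  obtain s where s: "0 < s" "\<beta> \<in> fixed s"
    using frobinv_fixed[OF invG, of \<beta>] G\<beta> G(2) by auto
  define t where "t = period \<beta>"
  have t: "t > 0" "\<beta> \<in> fixed t" using period[OF s(2,1)] by (auto simp: t_def)
  define O' where "O' = (\<lambda>i. \<beta> ^ (q ^ i)) ` {..<t}"
  have injO: "inj_on (\<lambda>i. \<beta> ^ (q ^ i)) {..<t}"
    unfolding t_def by (rule inj_on_period[OF s(2,1)])
  have cycO: "cyc \<beta> t = mset_set O'" unfolding t_def O'_def by (rule cyc_period[OF s(2,1)])
  have finO: "finite O'" and cardO: "card O' = t" using injO by (auto simp: O'_def card_image)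
  have \<beta>O: "\<beta> \<in> O'" using t by (auto simp: O'_def intro!: image_eqI[of _ _ 0])
  have frobO: "x ^ q \<in> O' \<longleftrightarrow> x \<in> O'" for x
  proof -
    have "frobinv (cyc \<beta> t)" using t by (intro frobinv_cyc)
    from frobinv_count[OF this, of x 1] have "count (mset_set O') (x ^ q) = count (mset_set O') x"
      unfolding cycO by simp
    then show ?thesis using finO by (cases "x \<in> O'"; cases "x ^ q \<in> O'") simp_all
  qed
  have filter_inv: "frobinv (filter_mset (\<lambda>x. x \<notin> O') M)" if "frobinv M" for M
  proof -
    have "image_mset (\<lambda>x. x ^ q) (filter_mset (\<lambda>x. x \<notin> O') M) =
        filter_mset (\<lambda>x. x \<notin> O') (image_mset (\<lambda>x. x ^ q) M)"
      by (induction M) (auto simp: frobO)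
    then show ?thesis using that by (simp add: frobinv_def)
  qed
  have O\<rho>: "poly \<rho> x = 0" if "x \<in> O'" for x
  proof -
    obtain i where "x = \<beta> ^ (q ^ i)" using \<open>x \<in> O'\<close> by (auto simp: O'_def)
    then have "poly G x = 0" using fpoly_frob[OF G(1), of \<beta> i] G\<beta> q_gt_1 by (simp add: power_0_left)
    then show ?thesis by (rule roots)
  qed
  define M2 where "M2 = filter_mset (\<lambda>x. x \<notin> O') (proots \<rho>)"
  have "mset_set O' + M2 \<subseteq># proots \<rho>"
  proof (rule mset_subset_eqI)
    fix x
    show "count (mset_set O' + M2) x \<le> count (proots \<rho>) x"
      using finO O\<rho>[of x] \<rho>(2) by (auto simp: M2_def count_mset_set' Suc_le_eq order_gt_0_iff)
  qed
  from size_mset_mono[OF this] have szM2: "size M2 + t \<le> n"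
    using size_proots_le[of \<rho>] n cardO by simp
  define w where "w = (\<Prod>x\<in>#M2. [:-x, 1:])"
  have w: "w \<in> mpolys (size M2)"
    unfolding w_def by (rule invmsets_prod) (simp add: invmsets_def M2_def filter_inv inv\<rho>)
  have dw: "degree w = size M2" "fpoly w" "w \<noteq> 0" using w by (auto simp: mpolys_def w_def)
  have w0: "poly w x = 0 \<longleftrightarrow> x \<in># M2" for x
    by (auto simp: w_def poly_prod_mset)
  define K where "K = {k. fpoly k \<and> (\<forall>i\<ge>t. coeff k i = 0)}"
  have cK: "card K = q ^ t" unfolding K_def by (rule card_fpolys_less)
  have fK: "finite K" using cK q_gt_1 by (intro card_ge_0_finite) auto
  have Kdeg: "degree k < t" if "k \<in> K" for k
  proof (cases "k = 0")
    case False
    then have "coeff k (degree k) \<noteq> 0" by simp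
    then show ?thesis using that by (auto simp: K_def simp flip: not_le)
  qed (use t(1) in simp)
  have wk: "fpoly (w * k)" "w * k = 0 \<or> degree (w * k) < n" if "k \<in> K" for k
  proof -
    show "fpoly (w * k)" using that dw by (auto simp: K_def intro: fpoly_mult)
    have "degree (w * k) \<le> degree w + degree k" by (rule degree_mult_le)
    then show "w * k = 0 \<or> degree (w * k) < n" using Kdeg[OF that] dw szM2 by auto
  qed
  have w\<beta>: "poly w \<beta> \<noteq> 0" using \<beta>O by (auto simp: w0 M2_def)
  have inner: "(\<Sum>k\<in>K. wt 0 G (proots (h + w * k))) = 0" if h: "h \<in> mpolys n" for h
  proof -
    define y where "y k = poly (h + w * k) \<beta>" for k
    define N where "N z = (\<Prod>i<t. z ^ (q ^ i))" for z :: 'k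
    define c1 where "c1 = lead_coeff G ^ n *
      (\<Prod>\<beta>\<in>#filter_mset (\<lambda>x. x \<notin> O') (proots G). (-1) ^ n * poly h \<beta>) * ((-1) ^ n) ^ (t * e)"
    have val: "(\<Prod>\<theta>\<in>#proots (h + w * k). poly G \<theta>) = c1 * N (y k) ^ e" if k: "k \<in> K" for k
    proof -
      have hk: "h + w * k \<in> mpolys n" by (rule mpolys_shift[OF h wk[OF k]])
      then have lc: "lead_coeff (h + w * k) = 1" "degree (h + w * k) = n" "fpoly (h + w * k)"
        by (auto simp: mpolys_def)
      have split: "proots G = filter_mset (\<lambda>x. x \<notin> O') (proots G) + repeat_mset e (mset_set O')"
      proof (rule multiset_eqI)
        fix x
        have "order x G = e" if "x \<in> O'"
        proof -
          obtain i where "x = \<beta> ^ (q ^ i)" using \<open>x \<in> O'\<close> by (auto simp: O'_def)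
          then show ?thesis using frobinv_count[OF invG, of \<beta> i] G(2) by (simp add: e_def)
        qed
        then show "count (proots G) x = count (filter_mset (\<lambda>x. x \<notin> O') (proots G) + repeat_mset e (mset_set O')) x"
          using finO G(2) by (auto simp: count_mset_set')
      qed
      have rep: "(\<Prod>x\<in>#repeat_mset e M. f x) = (\<Prod>x\<in>#M. f x) ^ e" for M and f :: "'k \<Rightarrow> 'k"
        by (induction e) auto
      have p1: "(\<Prod>\<beta>\<in>#filter_mset (\<lambda>x. x \<notin> O') (proots G). (-1) ^ n * poly (h + w * k) \<beta>) =
          (\<Prod>\<beta>\<in>#filter_mset (\<lambda>x. x \<notin> O') (proots G). (-1) ^ n * poly h \<beta>)"
      proof (intro arg_cong[of _ _ prod_mset] image_mset_cong)
        fix x assume "x \<in># filter_mset (\<lambda>x. x \<notin> O') (proots G)"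
        then have "x \<in># M2" using roots G(2) \<rho>(2) by (auto simp: M2_def)
        then show "(-1) ^ n * poly (h + w * k) x = (-1) ^ n * poly h x" by (simp add: w0)
      qed
      have p2: "(\<Prod>x\<in>#mset_set O'. (-1) ^ n * poly (h + w * k) x) = ((-1) ^ n) ^ t * N (y k)"
      proof -
        have "(\<Prod>x\<in>#mset_set O'. (-1) ^ n * poly (h + w * k) x) = (\<Prod>x\<in>O'. (-1) ^ n * poly (h + w * k) x)"
          by (simp add: prod_unfold_prod_mset)
        also have "\<dots> = (\<Prod>i<t. (-1) ^ n * poly (h + w * k) (\<beta> ^ (q ^ i)))"
          unfolding O'_def using injO by (subst prod.reindex) auto
        also have "\<dots> = (\<Prod>i<t. (-1) ^ n * y k ^ (q ^ i))"
          unfolding y_def fpoly_frob[OF lc(3)] ..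
        also have "\<dots> = ((-1) ^ n) ^ t * N (y k)"
          unfolding N_def prod.distrib by simp
        finally show ?thesis .
      qed
      have "(\<Prod>\<theta>\<in>#proots (h + w * k). poly G \<theta>) = lead_coeff G ^ n *
          (\<Prod>\<beta>\<in>#proots G. (-1) ^ n * poly (h + w * k) \<beta>)"
        unfolding prod_mset_poly_proots[OF lc(1) G(2)] lc(2) ..
      also have "\<dots> = lead_coeff G ^ n *
          ((\<Prod>\<beta>\<in>#filter_mset (\<lambda>x. x \<notin> O') (proots G). (-1) ^ n * poly h \<beta>) * (((-1) ^ n) ^ t * N (y k)) ^ e)"
        by (subst split, simp only: image_mset_union prod_mset_Un rep p1 p2)
      also have "\<dots> = c1 * N (y k) ^ e"
        unfolding c1_def power_mult power_mult_distrib by (simp only: mult.assoc)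
      finally show ?thesis .
    qed
    \<comment> \<open>Interpolation on the orbit: a polynomial over the base field of degree below t
      that vanishes at \<beta> vanishes at all t conjugates and is 0. Both sets have q^t
      elements.\<close>
    have bij: "bij_betw y K (fixed t)"
    proof -
      have "inj_on y K"
      proof (rule inj_onI)
        fix k k' assume k: "k \<in> K" "k' \<in> K" "y k = y k'"
        then have z: "poly (k - k') \<beta> = 0" using w\<beta> by (simp add: y_def)
        have f: "fpoly (k - k')" using k by (auto simp: K_def intro: fpoly_diff)
        show "k = k'"
        proof (rule ccontr)
          assume "k \<noteq> k'"
          then have nz: "k - k' \<noteq> 0" by simp
          have "O' \<subseteq> {x. poly (k - k') x = 0}"
            using fpoly_frob[OF f, of \<beta>] z q_gt_1 by (force simp: O'_def power_0_left)
          then have "card O' \<le> card {x. poly (k - k') x = 0}"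
            using poly_roots_finite[OF nz] by (intro card_mono)
          also have "\<dots> \<le> degree (k - k')" by (rule card_poly_roots_bound[OF nz])
          also have "\<dots> < t" using Kdeg[OF k(1)] Kdeg[OF k(2)] by (intro degree_diff_less)
          finally show False using cardO by simp
        qed
      qed
      moreover have "y ` K \<subseteq> fixed t"
        using mpolys_shift[OF h wk] t(2) fpoly_fixed by (auto simp: y_def mpolys_def simp del: poly_add poly_mult)
      moreover have "card (y ` K) = card (fixed t)"
        using calculation(1) cK card_fixed(2)[OF t(1)] by (simp add: card_image)
      ultimately show ?thesis
        using card_subset_eq[OF card_fixed(1)[OF t(1)]] by (auto simp: bij_betw_def)
    qed
    have NF: "N z ^ e \<in> fixed 1" if "z \<in> fixed t" for z
    proof -
      have "N z ^ q = N z"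
      proof -
        have "N z ^ q = (\<Prod>i<t. z ^ (q ^ Suc i))"
          unfolding N_def prod_power_distrib by (simp flip: power_mult add: mult.commute)
        also have "\<dots> * z = (\<Prod>i<Suc t. z ^ (q ^ i))"
          by (subst prod.lessThan_Suc_shift) (simp add: mult.commute)
        also have "\<dots> = N z * z" using that by (simp add: N_def fixed_def)
        finally show ?thesis by (cases "z = 0") (use t(1) q_gt_1 in \<open>auto simp: N_def power_0_left\<close>)
      qed
      then show ?thesis by (intro fixed_power) (simp only: fixed_1)
    qed
    \<comment> \<open>That \<open>c1\<close> lies in the base field is not visible from its
      definition. It is the whole product for the k with y(k) = 1, and that product is
      Frobenius-invariant.\<close>
    have c1F: "c1 \<in> fixed 1"
    proof -
      have "1 \<in> y ` K" using bij by (auto simp: bij_betw_def)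
      then obtain k where k: "k \<in> K" "y k = 1" by auto
      have hk: "h + w * k \<in> mpolys n" by (rule mpolys_shift[OF h wk[OF k(1)]])
      have "(\<Prod>\<theta>\<in>#proots (h + w * k). poly G \<theta>) \<in> fixed 1"
        using mpolys_proots[OF hk] by (intro frobinv_prod_fixed G) (simp add: invmsets_def)
      then show ?thesis using val[OF k(1)] k(2) by (simp add: N_def)
    qed
    have "(\<Sum>k\<in>K. wt 0 G (proots (h + w * k))) = (\<Sum>k\<in>K. \<chi> c1 * \<chi> (N (y k) ^ e))"
    proof (intro sum.cong refl)
      fix k assume k: "k \<in> K"
      then have "y k \<in> fixed t" using bij by (auto simp: bij_betw_def)
      then show "wt 0 G (proots (h + w * k)) = \<chi> c1 * \<chi> (N (y k) ^ e)"
        using val[OF k] c1F NF by (simp add: wt_def psi_0 chi_mult)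
    qed
    also have "\<dots> = \<chi> c1 * (\<Sum>z\<in>fixed t. \<chi> (N z ^ e))"
      using sum.reindex_bij_betw[OF bij, of "\<lambda>z. \<chi> (N z ^ e)"] by (simp flip: sum_distrib_left)
    also have "\<dots> = 0" using chi_norm_sum[OF t(1), of e] \<beta> by (simp add: N_def e_def)
    finally show ?thesis .
  qed
  have "of_nat (card K) * (\<Sum>h\<in>mpolys n. wt 0 G (proots h)) =
      (\<Sum>k\<in>K. \<Sum>h\<in>mpolys n. wt 0 G (proots (h + w * k)))"
    using sum_mpolys_shift[OF wk, where f = "\<lambda>h. wt 0 G (proots h)"] by simp
  also have "\<dots> = (\<Sum>h\<in>mpolys n. \<Sum>k\<in>K. wt 0 G (proots (h + w * k)))" by (rule sum.swap)
  also have "\<dots> = 0" by (intro sum.neutral ballI inner)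
  finally show ?thesis using cK q_gt_1 by (simp add: sum_invmsets_eq)
qed

end

section \<open>The Stepanov auxiliary polynomial\<close>

lemma map_poly_mult_hom:
  fixes f :: "'a::comm_ring_1 \<Rightarrow> 'b::comm_ring_1"
  assumes "f 0 = 0" "\<And>x y. f (x + y) = f x + f y" "\<And>x y. f (x * y) = f x * f y"
  shows "map_poly f (p * q) = map_poly f p * map_poly f q"
proof -
  have "f (\<Sum>i\<in>A. g i) = (\<Sum>i\<in>A. f (g i))" for g :: "nat \<Rightarrow> 'a" and A
    using assms by (induction A rule: infinite_finite_induct) auto
  then show ?thesis
    using assms by (intro poly_eqI) (simp add: coeff_map_poly coeff_mult)
qed

lemma map_poly_add_hom:
  fixes f :: "'a::comm_ring_1 \<Rightarrow> 'b::comm_ring_1"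
  assumes "f 0 = 0" "\<And>x y. f (x + y) = f x + f y"
  shows "map_poly f (p + q) = map_poly f p + map_poly f q"
  using assms by (intro poly_eqI) (simp add: coeff_map_poly)

text \<open>
  Elements of \<open>'a poly poly\<close> are polynomials in \<open>y\<close> over \<open>K[X]\<close>; \<open>shift p\<close> is \<open>p(X + y)\<close>, and
  \<open>recenter x0\<close> substitutes \<open>X = x0\<close>, \<open>y = x - x0\<close>.
\<close>

definition shift :: "'a::field poly \<Rightarrow> 'a poly poly" where
  "shift p = poly (map_poly (\<lambda>c. [:[:c:]:]) p) [:[:0, 1:], 1:]"

definition recenter :: "'a::field \<Rightarrow> 'a poly poly \<Rightarrow> 'a poly" where
  "recenter x0 P = poly (map_poly (\<lambda>c. [:poly c x0:]) P) [:-x0, 1:]"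

lemma recenter_add: "recenter x0 (P + P') = recenter x0 P + recenter x0 P'"
  unfolding recenter_def by (subst map_poly_add_hom) auto

lemma recenter_mult: "recenter x0 (P * P') = recenter x0 P * recenter x0 P'"
  unfolding recenter_def by (subst map_poly_mult_hom) auto

lemma recenter_const: "recenter x0 [:p:] = [:poly p x0:]"
  by (simp add: recenter_def map_poly_pCons)

lemma recenter_0 [simp]: "recenter x0 0 = 0"
  by (simp add: recenter_def)

lemma recenter_1 [simp]: "recenter x0 1 = 1"
  by (metis one_pCons poly_1 recenter_const)

lemma recenter_diff: "recenter x0 (P - P') = recenter x0 P - recenter x0 P'"
  using recenter_add[of x0 "P - P'" P'] by simp

lemma recenter_power: "recenter x0 (P ^ n) = recenter x0 P ^ n"
  by (induction n) (simp_all add: recenter_mult)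

lemma recenter_sum: "recenter x0 (\<Sum>i\<in>A. f i) = (\<Sum>i\<in>A. recenter x0 (f i))"
  by (induction A rule: infinite_finite_induct) (simp_all add: recenter_add)

lemma shift_pCons: "shift (pCons a p) = [:[:a:]:] + [:[:0, 1:], 1:] * shift p"
  by (simp add: shift_def map_poly_pCons)

lemma recenter_var: "recenter x0 [:[:0, 1:], 1:] = [:0, 1:]"
  by (simp add: recenter_def map_poly_pCons)

lemma shift_0 [simp]: "shift 0 = 0" by (simp add: shift_def)

lemma recenter_shift: "recenter x0 (shift p) = p"
proof (induction p)
  case (pCons a p)
  have "recenter x0 (shift (pCons a p)) = [:a:] + [:0, 1:] * p"
    unfolding shift_pCons recenter_add recenter_mult recenter_const recenter_var pCons.IH by simp
  then show ?case by simp
qed auto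

text \<open>The degree in X, uniformly over the powers of y. Together with the truncation at y^R it
  counts the linear conditions on the auxiliary polynomial.\<close>

definition inner_degree_le :: "'a::comm_ring_1 poly poly \<Rightarrow> nat \<Rightarrow> bool" where
  "inner_degree_le P n \<longleftrightarrow> (\<forall>k. degree (coeff P k) \<le> n)"

lemma inner_degree_le_mono: "inner_degree_le P n \<Longrightarrow> n \<le> n' \<Longrightarrow> inner_degree_le P n'"
  by (auto simp: inner_degree_le_def intro: order_trans)

lemma inner_degree_le_add: "inner_degree_le P n \<Longrightarrow> inner_degree_le P' n \<Longrightarrow> inner_degree_le (P + P') n"
  and inner_degree_le_diff: "inner_degree_le P n \<Longrightarrow> inner_degree_le P' n \<Longrightarrow> inner_degree_le (P - P') n"
  by (auto simp: inner_degree_le_def intro: degree_add_le degree_diff_le)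

lemma inner_degree_le_mult:
  "inner_degree_le P n \<Longrightarrow> inner_degree_le P' n' \<Longrightarrow> inner_degree_le (P * P') (n + n')"
  unfolding inner_degree_le_def coeff_mult
  by (intro allI degree_sum_le) (auto intro!: order_trans[OF degree_mult_le] add_mono)

lemma inner_degree_le_const: "degree p \<le> n \<Longrightarrow> inner_degree_le [:p:] n"
  by (auto simp: inner_degree_le_def coeff_pCons split: nat.splits)

lemma inner_degree_le_1 [simp]: "inner_degree_le 1 n"
  by (metis degree_1 le0 inner_degree_le_const one_pCons)

lemma inner_degree_le_0 [simp]: "inner_degree_le 0 n"
  by (simp add: inner_degree_le_def)

lemma inner_degree_le_power: "inner_degree_le P n \<Longrightarrow> inner_degree_le (P ^ k) (k * n)"
  by (induction k) (auto intro: inner_degree_le_mult)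

lemma inner_degree_le_sum:
  "(\<And>i. i \<in> A \<Longrightarrow> inner_degree_le (f i) n) \<Longrightarrow> inner_degree_le (\<Sum>i\<in>A. f i) n"
  by (induction A rule: infinite_finite_induct) (auto intro: inner_degree_le_add)

lemma inner_degree_le_var: "inner_degree_le [:[:0, 1:], 1:] 1"
  by (auto simp: inner_degree_le_def coeff_pCons split: nat.splits)

lemma inner_degree_le_shift: "inner_degree_le (shift p) (degree p)"
proof (induction p)
  case (pCons a p)
  show ?case
  proof (cases "p = 0")
    case False
    have "inner_degree_le ([:[:0, 1:], 1:] * shift p) (1 + degree p)"
      by (rule inner_degree_le_mult[OF inner_degree_le_var pCons.IH])
    then show ?thesis using False unfolding shift_pCons
      by (intro inner_degree_le_add inner_degree_le_const) (auto simp: inner_degree_le_def)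
  qed (auto simp: shift_pCons inner_degree_le_const)
qed auto

lemma dvd_diff_mult:
  fixes z :: "'a::comm_ring_1"
  assumes "z dvd a - a'" "z dvd b - b'"
  shows "z dvd a * b - a' * b'"
proof -
  have "a * b - a' * b' = (a - a') * b + a' * (b - b')" by (simp add: algebra_simps)
  then show ?thesis using assms by (metis dvd_add dvd_mult dvd_mult2)
qed

lemma dvd_of_dvd_diff: "z dvd a - b \<Longrightarrow> b = c \<Longrightarrow> z dvd c \<Longrightarrow> z dvd a" for z :: "'a::comm_ring_1"
  by (metis diff_add_cancel dvd_add)

lemma dvd_diff_power: "z dvd a - a' \<Longrightarrow> z dvd a ^ n - a' ^ n" for z :: "'a::comm_ring_1"
  by (induction n) (auto intro: dvd_diff_mult)

lemma dvd_diff_sum: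
  "(\<And>i. i \<in> A \<Longrightarrow> z dvd f i - g i) \<Longrightarrow> z dvd (\<Sum>i\<in>A. f i) - (\<Sum>i\<in>A. g i)" for z :: "'a::comm_ring_1"
  unfolding sum_subtractf[symmetric] by (rule dvd_sum)

lemma dvd_diff_eval: "[:-x0, 1:] dvd p - [:poly p x0:]" for p :: "'a::field poly"
  by (simp flip: poly_eq_0_iff_dvd)

text \<open>The coefficients of y^k for k < R vanish as polynomials in X, hence at X = x0 for every
  x0. One system of linear equations thus produces R-fold zeros at all points simultaneously. This
  takes the place of Hasse derivatives.\<close>

lemma power_dvd_recenter:
  assumes "\<And>k. k < R \<Longrightarrow> coeff P k = 0"
  shows "[:-x0, 1:] ^ R dvd recenter x0 P"
proof -
  have "recenter x0 P = (\<Sum>k\<le>degree (map_poly (\<lambda>c. [:poly c x0:]) P).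
      [:poly (coeff P k) x0:] * [:-x0, 1:] ^ k)"
    by (simp add: recenter_def poly_altdef coeff_map_poly)
  also have "[:-x0, 1:] ^ R dvd \<dots>"
  proof (rule dvd_sum)
    fix k
    show "[:-x0, 1:] ^ R dvd [:poly (coeff P k) x0:] * [:-x0, 1:] ^ k"
    proof (cases "k < R")
      case True
      then show ?thesis using assms by simp
    next
      case False
      then show ?thesis by (intro dvd_mult le_imp_power_dvd) auto
    qed
  qed
  finally show ?thesis .
qed

lemma card_mult_le_degree:
  fixes p :: "'a::field poly"
  assumes "p \<noteq> 0" "finite A" "\<And>x. x \<in> A \<Longrightarrow> [:-x, 1:] ^ R dvd p"
  shows "R * card A \<le> degree p"
proof -
  have "repeat_mset R (mset_set A) \<subseteq># proots p"
  proof (rule mset_subset_eqI)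
    fix x
    show "count (repeat_mset R (mset_set A)) x \<le> count (proots p) x"
      using assms by (auto simp: count_mset_set' order_divides)
  qed
  from size_mset_mono[OF this] show ?thesis using size_proots_le[of p] by simp
qed

lemma pred_dvd_power_pred: "n - 1 dvd n ^ h - 1" if n: "n > 0" for n :: nat
proof (induction h)
  case (Suc h)
  obtain k where k: "n ^ h = Suc k" using n by (cases "n ^ h") auto
  then have "n ^ Suc h - 1 = n * (n ^ h - 1) + (n - 1)" using n by simp
  then show ?case using Suc by (metis dvd_add dvd_mult dvd_refl)
qed simp

section \<open>The auxiliary polynomial and its zeros\<close>

context frob
begin

definition trace_poly :: "'k poly \<Rightarrow> nat \<Rightarrow> 'k poly" where
  "trace_poly u s = (\<Sum>i<s. u ^ (q ^ i))"

text \<open>For even s the trace is a polynomial of degree about R plus the R-th power of the same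
  polynomial, and that R-th power is constant modulo (x - x0)^R.\<close>

lemma trace_poly_double: "trace_poly u (2 * h) = trace_poly u h + trace_poly u h ^ (q ^ h)"
proof -
  have split: "(\<Sum>i<m + n. f i) = (\<Sum>i<m. f i) + (\<Sum>i<n. f (m + i))" for m n and f :: "nat \<Rightarrow> 'k poly"
    by (induction n) (simp_all add: add.assoc)
  have "trace_poly u (2 * h) = (\<Sum>i<h + h. u ^ (q ^ i))" by (simp add: trace_poly_def mult_2)
  also have "\<dots> = (\<Sum>i<h. u ^ (q ^ i)) + (\<Sum>i<h. u ^ (q ^ (h + i)))"
    by (rule split)
  also have "(\<Sum>i<h. u ^ (q ^ (h + i))) = (\<Sum>i<h. (u ^ (q ^ i)) ^ (q ^ h))"
    by (intro sum.cong refl) (simp only: power_mult[symmetric] power_add mult.commute)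
  finally show ?thesis by (simp add: trace_poly_def frob_sum_poly)
qed

lemma degree_trace_poly: "s > 0 \<Longrightarrow> degree (trace_poly u s) \<le> degree u * q ^ (s - 1)"
  unfolding trace_poly_def using q_gt_1
  by (intro degree_sum_le) (auto intro!: order_trans[OF degree_power_le] mult_le_mono2 power_increasing)

text \<open>Modulo (x - x0)^R one has p^R = p(x0)^R for every p. Hence x^Q becomes x0, the trace a =
  a0 + a0^R becomes a0 + t - a0(x0), and b = b0 b0^R becomes b0 w / b0(x0). The right-hand side
  writes this as a polynomial in X and y in which X stands for x0, so that quantities depending on
  x0 become coefficients of low degree.\<close>

lemma stepanov_monomial_congruence:
  fixes u G :: "'k poly" and h d :: nat
  defines "R \<equiv> q ^ h" and "Q \<equiv> q ^ (2 * h)"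
  defines "a \<equiv> trace_poly u (2 * h)" and "b \<equiv> G ^ ((Q - 1) div d)"
    and "a0 \<equiv> trace_poly u h" and "b0 \<equiv> G ^ ((R - 1) div d)"
  assumes d: "d dvd q - 1" and l: "l < d"
    and x0: "x0 \<in> fixed (2 * h)" "poly a x0 = t" "poly b x0 = w" "w \<noteq> 0"
  shows "[:-x0, 1:] ^ R dvd [:poly b0 x0 ^ (d - 1):] * ([:0, 1:] ^ (k + j * Q) * a ^ i * b ^ l)
    - recenter x0 ([:[:0, 1:], 1:] ^ k * [:[:0, 1:] ^ j:] * ([:[:t:]:] + shift a0 - [:a0:]) ^ i *
        ([:[:w ^ l:]:] * shift b0 ^ l * [:b0 ^ (d - 1 - l):]))"
proof -
  define z where "z = [:-x0, 1:] ^ R"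
  define \<alpha> \<beta> where "\<alpha> = poly a0 x0" and "\<beta> = poly b0 x0"
  have QR: "Q = R * R" unfolding Q_def R_def mult_2 power_add ..
  have dR: "d dvd R - 1"
  proof -
    have "q - 1 dvd q ^ h - 1"
      using q_gt_1 by (intro pred_dvd_power_pred) simp
    then show ?thesis using d dvd_trans by (auto simp: R_def)
  qed
  have bb: "b = b0 * b0 ^ R"
  proof -
    obtain e where e: "R - 1 = d * e" using dR by auto
    have d0: "d > 0" using l by simp
    have R1: "R \<ge> 1" using q_gt_1 by (simp add: R_def)
    have "Q - 1 = (R - 1) * (R + 1)" using R1 by (simp add: QR algebra_simps)
    then have "(Q - 1) div d = e * (R + 1)" using e d0 by simp
    moreover have "(R - 1) div d = e" using e d0 by simp
    ultimately show ?thesis unfolding b_def b0_def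
      by (simp add: power_add power_mult flip: power_mult)
  qed
  have aa: "a = a0 + a0 ^ R" unfolding a_def a0_def R_def by (rule trace_poly_double)
  have frobz: "z dvd p ^ R - [:poly p x0 ^ R:]" for p
  proof -
    have "p ^ R - [:poly p x0 ^ R:] = (p - [:poly p x0:]) ^ R"
      unfolding R_def by (simp add: frob_diff_poly poly_const_pow)
    then show ?thesis unfolding z_def using dvd_diff_eval[of x0 p] by (simp add: dvd_power_same)
  qed
  have t: "\<alpha> ^ R = t - \<alpha>" using x0(2) by (simp add: aa \<alpha>_def algebra_simps)
  have w: "\<beta> * \<beta> ^ R = w" using x0(3) by (simp add: bb \<beta>_def)
  then have \<beta>0: "\<beta> \<noteq> 0" using x0(4) by auto
  have c1: "z dvd [:0, 1:] ^ (k + j * Q) - [:0, 1:] ^ k * [:x0 ^ j:]"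
  proof -
    have "z dvd ([:0, 1:] ^ R) ^ R - [:poly ([:0, 1:] ^ R) x0 ^ R:]" by (rule frobz)
    moreover have "poly ([:0, 1:] ^ R) x0 ^ R = x0"
      using x0(1) by (simp add: fixed_def QR[unfolded Q_def] flip: power_mult)
    ultimately have "z dvd [:0, 1:] ^ Q - [:x0:]" by (simp add: QR flip: power_mult)
    then have "z dvd ([:0, 1:] ^ Q) ^ j - [:x0:] ^ j" by (rule dvd_diff_power)
    then have "z dvd [:0, 1:] ^ k * ([:0, 1:] ^ Q) ^ j - [:0, 1:] ^ k * [:x0:] ^ j"
      by (intro dvd_diff_mult) auto
    then show ?thesis by (simp add: power_add poly_const_pow mult.commute[of j] power_mult)
  qed
  have c2: "z dvd a ^ i - ([:t:] + a0 - [:\<alpha>:]) ^ i"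
  proof (rule dvd_diff_power)
    have "[:t - \<alpha>:] = [:t:] - [:\<alpha>:]" by simp
    then have "a - ([:t:] + a0 - [:\<alpha>:]) = a0 ^ R - [:poly a0 x0 ^ R:]"
      using t by (simp add: aa flip: \<alpha>_def)
    then show "z dvd a - ([:t:] + a0 - [:\<alpha>:])" using frobz by simp
  qed
  \<comment> \<open>b^l is congruent to b0^l w^l / \<beta>^l. The common factor \<beta>^(d - 1)
    clears these denominators for all l < d, so that only polynomial expressions in x0
    remain.\<close>
  have c3: "z dvd [:\<beta> ^ (d - 1):] * b ^ l - [:w ^ l:] * b0 ^ l * [:\<beta> ^ (d - 1 - l):]"
  proof -
    have "z dvd b0 * b0 ^ R - b0 * [:\<beta> ^ R:]" using frobz[of b0] by (intro dvd_diff_mult) (auto simp: \<beta>_def)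
    then have "z dvd b ^ l - (b0 * [:\<beta> ^ R:]) ^ l" unfolding bb by (rule dvd_diff_power)
    then have "z dvd [:\<beta> ^ (d - 1):] * b ^ l - [:\<beta> ^ (d - 1):] * (b0 * [:\<beta> ^ R:]) ^ l"
      by (intro dvd_diff_mult) auto
    moreover have "[:\<beta> ^ (d - 1):] * (b0 * [:\<beta> ^ R:]) ^ l = [:w ^ l:] * b0 ^ l * [:\<beta> ^ (d - 1 - l):]"
    proof -
      have "d - 1 = l + (d - 1 - l)" using l by simp
      then have "\<beta> ^ (d - 1) * (\<beta> ^ R) ^ l = w ^ l * \<beta> ^ (d - 1 - l)"
        unfolding w[symmetric] power_mult_distrib by (metis (no_types, lifting) mult.assoc mult.commute power_add)
      then have "[:\<beta> ^ (d - 1):] * [:(\<beta> ^ R) ^ l:] = [:w ^ l:] * [:\<beta> ^ (d - 1 - l):]" by (simp add: mult.commute)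
      then have "b0 ^ l * ([:\<beta> ^ (d - 1):] * [:(\<beta> ^ R) ^ l:]) = b0 ^ l * ([:w ^ l:] * [:\<beta> ^ (d - 1 - l):])"
        by (simp only:)
      then show ?thesis unfolding power_mult_distrib poly_const_pow by (simp only: mult_ac)
    qed
    ultimately show ?thesis by simp
  qed
  have "recenter x0 ([:[:0, 1:], 1:] ^ k * [:[:0, 1:] ^ j:] * ([:[:t:]:] + shift a0 - [:a0:]) ^ i *
        ([:[:w ^ l:]:] * shift b0 ^ l * [:b0 ^ (d - 1 - l):])) =
      [:0, 1:] ^ k * [:x0 ^ j:] * ([:t:] + a0 - [:\<alpha>:]) ^ i * ([:w ^ l:] * b0 ^ l * [:\<beta> ^ (d - 1 - l):])"
    unfolding recenter_mult recenter_power recenter_add recenter_diff recenter_const recenter_shift recenter_var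
    by (simp add: \<alpha>_def \<beta>_def)
  moreover have "[:\<beta> ^ (d - 1):] * ([:0, 1:] ^ (k + j * Q) * a ^ i * b ^ l) =
      [:0, 1:] ^ (k + j * Q) * a ^ i * ([:\<beta> ^ (d - 1):] * b ^ l)"
    by (simp only: mult_ac)
  ultimately show ?thesis
    unfolding z_def[symmetric] \<beta>_def[symmetric] by (simp only:) (intro dvd_diff_mult c1 c2 c3)
qed

text \<open>There are qa * d * J * \<delta> unknown coefficients and R * E linear conditions, so by
  \<open>count\<close> a nontrivial choice makes all coefficients of y^0, ..., y^(R-1) vanish. By
  \<open>indep\<close> the resulting polynomial \<open>Phi\<close> is nonzero, and each counted
  point is a zero of multiplicity at least R, so R times their number is at most the degree.\<close>

lemma stepanov_bound:
  fixes u G :: "'k poly" and h d qa J \<delta> m g :: nat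
  defines "R \<equiv> q ^ h" and "Q \<equiv> q ^ (2 * h)"
  defines "a \<equiv> trace_poly u (2 * h)" and "b \<equiv> G ^ ((Q - 1) div d)"
  defines "U \<equiv> {..<qa} \<times> {..<d} \<times> {..<J} \<times> {..<\<delta>}"
  assumes h: "h > 0" and d: "d dvd q - 1" "d > 0" and qa: "qa \<le> q"
    and m: "degree u \<le> m" and g: "degree G \<le> g"
    and indep: "\<And>c. (\<Sum>(i, l, j, k)\<in>U. smult (c (i, l, j, k))
        ([:0, 1:] ^ (k + j * Q) * a ^ i * b ^ l)) = 0 \<Longrightarrow> \<forall>\<iota>\<in>U. c \<iota> = 0"
    and count: "R * (\<delta> + J + (m + g) * R) < qa * d * J * \<delta>" and w: "w \<noteq> 0"
  shows "R * card {x \<in> fixed (2 * h). poly a x = t \<and> poly b x = w} \<le> \<delta> + J * Q + (m + g) * Q"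
proof -
  define a0 b0 where "a0 = trace_poly u h" and "b0 = G ^ ((R - 1) div d)"
  \<comment> \<open>Bound for the X-degree of the reduced monomials: k < \<delta> and j < J. The
    powers of a0 contribute at most m R because i < q and deg a0 is at most m q^(h-1). Those of b0,
    d - 1 in all, contribute at most g R.\<close>
  define E where "E = \<delta> + J + (m + g) * R"
  define mon where "mon = (\<lambda>(i, l, j, k). [:[:0, 1:], 1:] ^ k * [:[:0, 1:] ^ j:] *
      ([:[:t:]:] + shift a0 - [:a0:]) ^ i * ([:[:w ^ l:]:] * shift b0 ^ l * [:b0 ^ (d - 1 - l):]))"
  define V where "V = {..<R} \<times> {..<E}"
  have q1: "q ^ (h - 1) * q = R" using h by (simp add: R_def power_eq_if mult.commute)
  have q2: "q ^ (2 * h - 1) * q = Q" using h by (simp add: Q_def power_eq_if mult.commute)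
  have Rpos: "R > 0" using q_gt_1 by (simp add: R_def)
  have inner: "inner_degree_le (mon \<iota>) (E - 1)" if U: "\<iota> \<in> U" for \<iota>
  proof -
    obtain i l j k where \<iota>: "\<iota> = (i, l, j, k)" "i < qa" "l < d" "j < J" "k < \<delta>"
      using U by (auto simp: U_def)
    have da0: "degree a0 \<le> m * q ^ (h - 1)"
      unfolding a0_def using degree_trace_poly[OF h, of u] m by (meson mult_le_mono1 order_trans)
    have "i * (m * q ^ (h - 1)) \<le> q * (m * q ^ (h - 1))" using \<iota> qa by (intro mult_le_mono1) auto
    then have i1: "i * (m * q ^ (h - 1)) \<le> m * R" unfolding q1[symmetric] by (simp only: mult_ac)
    have db0: "degree b0 \<le> g * ((R - 1) div d)"
      unfolding b0_def using g by (intro order_trans[OF degree_power_le]) simp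
    have "(l + (d - 1 - l)) * (g * ((R - 1) div d)) \<le> g * (d * ((R - 1) div d))"
      using \<iota> by (simp add: mult.left_commute)
    also have "\<dots> \<le> g * (R - 1)" by (intro mult_le_mono2) simp
    also have "\<dots> \<le> g * R" by simp
    finally have i2: "l * (g * ((R - 1) div d)) + (d - 1 - l) * (g * ((R - 1) div d)) \<le> g * R"
      by (simp only: distrib_right)
    have "inner_degree_le (mon \<iota>) (k * 1 + j + i * (m * q ^ (h - 1)) +
        (0 + l * (g * ((R - 1) div d)) + (d - 1 - l) * (g * ((R - 1) div d))))"
      unfolding mon_def \<iota> case_prod_conv
    proof (intro inner_degree_le_mult inner_degree_le_power inner_degree_le_var inner_degree_le_const
        inner_degree_le_add inner_degree_le_diff)
      show "degree ([:0, 1:] ^ j :: 'k poly) \<le> j"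
        by (rule order_trans[OF degree_power_le]) simp
      show "inner_degree_le (shift a0) (m * q ^ (h - 1))"
        by (rule inner_degree_le_mono[OF inner_degree_le_shift da0])
      show "inner_degree_le (shift b0) (g * ((R - 1) div d))"
        by (rule inner_degree_le_mono[OF inner_degree_le_shift db0])
      show "degree (b0 ^ (d - 1 - l)) \<le> (d - 1 - l) * (g * ((R - 1) div d))"
        using db0 by (intro order_trans[OF degree_power_le]) (simp add: mult.commute)
    qed (use da0 in auto)
    then show ?thesis
      by (rule inner_degree_le_mono) (use i1 i2 \<iota> in \<open>unfold E_def distrib_right, linarith\<close>)
  qed
  have fU: "finite U" by (simp add: U_def)
  have "card V < card U"
    using count by (simp add: V_def U_def card_cartesian_product E_def mult.assoc)
  from underdetermined_system[of V U "\<lambda>(\<kappa>, e) \<iota>. coeff (coeff (mon \<iota>) \<kappa>) e", OF _ fU this]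
  obtain c where c: "\<exists>\<iota>\<in>U. c \<iota> \<noteq> 0"
    "\<And>\<kappa> e. \<kappa> < R \<Longrightarrow> e < E \<Longrightarrow> (\<Sum>\<iota>\<in>U. coeff (coeff (mon \<iota>) \<kappa>) e * c \<iota>) = 0"
    by (auto simp: V_def)
  define Psi where "Psi = (\<Sum>\<iota>\<in>U. [:[:c \<iota>:]:] * mon \<iota>)"
  have Psi0: "coeff Psi \<kappa> = 0" if \<kappa>: "\<kappa> < R" for \<kappa>
  proof (rule poly_eqI)
    fix e
    show "coeff (coeff Psi \<kappa>) e = coeff 0 e"
    proof (cases "e < E")
      case True
      then show ?thesis using c(2)[OF \<kappa> True] by (simp add: Psi_def coeff_sum mult.commute)
    next
      case False
      have "inner_degree_le Psi (0 + (E - 1))"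
        unfolding Psi_def by (intro inner_degree_le_sum inner_degree_le_mult inner inner_degree_le_const) auto
      then have "degree (coeff Psi \<kappa>) \<le> E - 1" by (simp add: inner_degree_le_def)
      moreover have "E > 0" using count by (cases "\<delta> = 0") (auto simp: E_def)
      ultimately show ?thesis using False by (simp add: coeff_eq_0)
    qed
  qed
  define Phi where "Phi = (\<Sum>(i, l, j, k)\<in>U. smult (c (i, l, j, k)) ([:0, 1:] ^ (k + j * Q) * a ^ i * b ^ l))"
  have Phi0: "Phi \<noteq> 0" using indep[of c] c(1) unfolding Phi_def by blast
  define Xs where "Xs = {x \<in> fixed (2 * h). poly a x = t \<and> poly b x = w}"
  have fX: "finite Xs" using card_fixed(1)[of "2 * h"] h by (simp add: Xs_def)
  have "[:-x0, 1:] ^ R dvd Phi" if x0: "x0 \<in> Xs" for x0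
  proof -
    define \<beta> where "\<beta> = poly b0 x0 ^ (d - 1)"
    have x0': "x0 \<in> fixed (2 * h)" "poly a x0 = t" "poly b x0 = w" using x0 by (auto simp: Xs_def)
    have "[:-x0, 1:] ^ R dvd (\<Sum>\<iota>\<in>U. [:c \<iota>:] * ([:\<beta>:] * (case \<iota> of (i, l, j, k) \<Rightarrow> [:0, 1:] ^ (k + j * Q) * a ^ i * b ^ l)))
        - (\<Sum>\<iota>\<in>U. [:c \<iota>:] * recenter x0 (mon \<iota>))"
    proof (rule dvd_diff_sum)
      fix \<iota> assume "\<iota> \<in> U"
      then obtain i l j k where \<iota>: "\<iota> = (i, l, j, k)" "l < d" by (auto simp: U_def)
      have "[:-x0, 1:] ^ R dvd [:\<beta>:] * ([:0, 1:] ^ (k + j * Q) * a ^ i * b ^ l) - recenter x0 (mon (i, l, j, k))"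
        unfolding \<beta>_def mon_def case_prod_conv b0_def a0_def R_def a_def b_def Q_def
        by (rule stepanov_monomial_congruence[OF d(1) \<iota>(2) x0'[unfolded a_def b_def Q_def] w])
      then show "[:-x0, 1:] ^ R dvd [:c \<iota>:] * ([:\<beta>:] * (case \<iota> of (i, l, j, k) \<Rightarrow> [:0, 1:] ^ (k + j * Q) * a ^ i * b ^ l))
          - [:c \<iota>:] * recenter x0 (mon \<iota>)"
        unfolding \<iota> case_prod_conv by (intro dvd_diff_mult) auto
    qed
    moreover have "(\<Sum>\<iota>\<in>U. [:c \<iota>:] * recenter x0 (mon \<iota>)) = recenter x0 Psi"
      unfolding Psi_def recenter_sum recenter_mult recenter_const by simp
    moreover have "[:-x0, 1:] ^ R dvd recenter x0 Psi" by (rule power_dvd_recenter[OF Psi0])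
    ultimately have "[:-x0, 1:] ^ R dvd (\<Sum>\<iota>\<in>U. [:c \<iota>:] * ([:\<beta>:] * (case \<iota> of (i, l, j, k) \<Rightarrow> [:0, 1:] ^ (k + j * Q) * a ^ i * b ^ l)))"
      by (rule dvd_of_dvd_diff)
    also have "\<dots> = [:\<beta>:] * Phi"
      unfolding Phi_def sum_distrib_left by (intro sum.cong refl) (auto simp: mult.commute)
    also have "\<dots> = smult \<beta> Phi" by simp
    finally have "[:-x0, 1:] ^ R dvd smult \<beta> Phi" .
    \<comment> \<open>The divisibility was obtained for \<beta> times \<open>Phi\<close>. The factor
      can be cancelled because w is nonzero, which keeps x0 away from the zeros of G wherever b0
      depends on G.\<close>
    moreover have "\<beta> \<noteq> 0"
    proof -
      have "poly G x0 ^ ((Q - 1) div d) \<noteq> 0" using x0'(3) w by (simp add: b_def)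
      have "poly b0 x0 \<noteq> 0"
      proof
        assume "poly b0 x0 = 0"
        then have "poly G x0 = 0" "(R - 1) div d \<noteq> 0" by (auto simp: b0_def)
        moreover have "R \<le> Q" using q_gt_1 by (simp add: R_def Q_def power_increasing)
        then have "(R - 1) div d \<le> (Q - 1) div d" by (intro div_le_mono) simp
        ultimately show False using \<open>poly G x0 ^ ((Q - 1) div d) \<noteq> 0\<close> by simp
      qed
      then show ?thesis by (simp add: \<beta>_def)
    qed
    ultimately show ?thesis by (simp add: dvd_smult_iff)
  qed
  from card_mult_le_degree[OF Phi0 fX this] have "R * card Xs \<le> degree Phi" by simp
  also have "\<dots> \<le> \<delta> + J * Q + (m + g) * Q"
    unfolding Phi_def
  proof (rule degree_sum_le[OF fU])
    fix \<iota> assume "\<iota> \<in> U"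
    then obtain i l j k where \<iota>: "\<iota> = (i, l, j, k)" "i < qa" "l < d" "j < J" "k < \<delta>"
      by (auto simp: U_def)
    have da: "degree a \<le> m * q ^ (2 * h - 1)"
      unfolding a_def using degree_trace_poly[of "2 * h" u] h m by (meson mult_le_mono1 order_trans mult_pos_pos zero_less_numeral)
    have "i * (m * q ^ (2 * h - 1)) \<le> q * (m * q ^ (2 * h - 1))" using \<iota> qa by (intro mult_le_mono1) auto
    then have i1: "i * (m * q ^ (2 * h - 1)) \<le> m * Q" unfolding q2[symmetric] by (simp only: mult_ac)
    have db: "degree b \<le> g * ((Q - 1) div d)"
      unfolding b_def using g by (intro order_trans[OF degree_power_le]) simp
    have "l * (g * ((Q - 1) div d)) \<le> g * (d * ((Q - 1) div d))"
      using \<iota> by (simp add: mult.left_commute)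
    also have "\<dots> \<le> g * (Q - 1)" by (intro mult_le_mono2) simp
    also have "\<dots> \<le> g * Q" by simp
    finally have i2: "l * (g * ((Q - 1) div d)) \<le> g * Q" .
    have "j * Q \<le> J * Q" using \<iota> by simp
    have "degree (smult (c \<iota>) ([:0, 1:] ^ (k + j * Q) * a ^ i * b ^ l)) \<le>
        degree ([:0, 1:] ^ (k + j * Q) :: 'k poly) + degree (a ^ i) + degree (b ^ l)"
      by (intro order_trans[OF degree_smult_le] order_trans[OF degree_mult_le] add_mono degree_mult_le order_refl)
    also have "\<dots> \<le> (k + j * Q) + i * (m * q ^ (2 * h - 1)) + l * (g * ((Q - 1) div d))"
      using da db by (intro add_mono order_trans[OF degree_power_le]) (auto simp: mult.commute)
    also have "\<dots> \<le> \<delta> + J * Q + (m + g) * Q"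
      using i1 i2 \<iota>(5) \<open>j * Q \<le> J * Q\<close> unfolding distrib_right by linarith
    finally show "degree (case \<iota> of (i, l, j, k) \<Rightarrow> smult (c (i, l, j, k))
        ([:0, 1:] ^ (k + j * Q) * a ^ i * b ^ l)) \<le> \<delta> + J * Q + (m + g) * Q"
      unfolding \<iota> case_prod_conv by (simp only: \<iota>)
  qed
  finally show ?thesis unfolding Xs_def .
qed

end

section \<open>From point counts to character sums\<close>

context frob
begin

text \<open>D = qa d is the number of possible pairs of character values, so Q / D is the expected
  count and the error is O(R). The slack c1 in the range of k is what the independence proofs
  require.\<close>

lemma stepanov_upper_bound:
  fixes u G :: "'k poly" and d qa m g c1 H :: nat
  defines "D \<equiv> qa * d"
  assumes d: "d dvd q - 1" "d > 0" and qa: "qa \<le> q" "qa > 0"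
    and m: "degree u \<le> m" and g: "degree G \<le> g"
    and indep: "\<And>h J c. h \<ge> H \<Longrightarrow> (\<Sum>(i, l, j, k)\<in>{..<qa} \<times> {..<d} \<times> {..<J} \<times> {..<q ^ (2 * h) div D - c1}.
        smult (c (i, l, j, k))
        ([:0, 1:] ^ (k + j * q ^ (2 * h)) * trace_poly u (2 * h) ^ i * (G ^ ((q ^ (2 * h) - 1) div d)) ^ l)) = 0 \<Longrightarrow>
        \<forall>\<iota>\<in>{..<qa} \<times> {..<d} \<times> {..<J} \<times> {..<q ^ (2 * h) div D - c1}. c \<iota> = 0"
  shows "\<exists>C H'. C \<ge> 0 \<and> (\<forall>h\<ge>H'. h > 0 \<and> (\<forall>t w. w \<noteq> 0 \<longrightarrow>
    real (card {x \<in> fixed (2 * h). poly (trace_poly u (2 * h)) x = t \<and> poly (G ^ ((q ^ (2 * h) - 1) div d)) x = w})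
      \<le> real (q ^ (2 * h)) / real D + C * real (q ^ h)))"
proof -
  have D: "D > 0" using d qa by (simp add: D_def)
  \<comment> \<open>Chosen so that the surplus of unknowns, about c2 Q, exceeds the terms R J, at
    most 2 Q, and (m + g) Q after all rounding.\<close>
  define c2 where "c2 = 2 * (m + g) + 6"
  define H' where "H' = max (Suc H) (2 * D * (1 + c1) + c2)"
  have main: "h > 0 \<and> (\<forall>t w. w \<noteq> 0 \<longrightarrow>
    real (card {x \<in> fixed (2 * h). poly (trace_poly u (2 * h)) x = t \<and> poly (G ^ ((q ^ (2 * h) - 1) div d)) x = w})
      \<le> real (q ^ (2 * h)) / real D + real (1 + c2 + m + g) * real (q ^ h))" if h: "h \<ge> H'" for h
  proof (intro conjI allI impI)
    show h0: "h > 0" using h by (simp add: H'_def)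
    fix t w :: 'k assume w: "w \<noteq> 0"
    define R Q where "R = q ^ h" and "Q = q ^ (2 * h)"
    have QR: "Q = R * R" unfolding Q_def R_def mult_2 power_add ..
    have "h \<le> 2 ^ h" by (rule less_imp_le[OF less_exp])
    also have "2 ^ h \<le> R" unfolding R_def using q_gt_1 by (intro power_mono) auto
    finally have RH: "R \<ge> 2 * D * (1 + c1) + c2" using h by (simp add: H'_def)
    \<comment> \<open>The degree of the auxiliary polynomial is about J Q, so the count is about J Q
      / R, which is Q / D + c2 R for this J. The D J \<delta> unknowns are about (R + c2 D)
      \<delta>, to be compared with R \<delta> plus O(Q) conditions, and D \<delta> is about
      Q.\<close>
    define \<delta> J where "\<delta> = Q div D - c1" and "J = R div D + c2"
    have "Q < D * (Q div D) + D" using mod_less_divisor[OF D, of Q] mult_div_mod_eq[of D Q] by linarith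
    moreover have "D * (Q div D) \<le> D * \<delta> + D * c1" unfolding distrib_left[symmetric] \<delta>_def by (intro mult_le_mono2) simp
    ultimately have "Q \<le> D * \<delta> + D * (1 + c1)" by (simp add: distrib_left)
    moreover have "2 * (D * (1 + c1)) \<le> R * R"
    proof -
      have "2 * (D * (1 + c1)) \<le> R" using RH by simp
      also have "R \<le> R * R" using RH D by (cases R) auto
      finally show ?thesis .
    qed
    ultimately have d2: "Q \<le> 2 * (D * \<delta>)" unfolding QR by linarith
    have "R < D * (R div D) + D" using mod_less_divisor[OF D, of R] mult_div_mod_eq[of D R] by linarith
    then have DJ: "R + D * (c2 - 1) \<le> D * J" by (simp add: J_def c2_def algebra_simps)
    have Rpos: "R > 0" using q_gt_1 by (simp add: R_def)
    have "2 * (R * (\<delta> + J + (m + g) * R)) < 2 * (D * J * \<delta>)"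
    proof -
      have "2 * ((R + D * (c2 - 1)) * \<delta>) \<le> 2 * (D * J * \<delta>)" using DJ by (intro mult_le_mono2 mult_le_mono1)
      moreover have "2 * ((R + D * (c2 - 1)) * \<delta>) = 2 * (R * \<delta>) + (c2 - 1) * (2 * (D * \<delta>))" by (simp add: algebra_simps)
      moreover have "(c2 - 1) * Q \<le> (c2 - 1) * (2 * (D * \<delta>))" using d2 by (rule mult_le_mono2)
      moreover have "(c2 - 1) * Q = 2 * ((m + g) * Q) + 5 * Q" by (simp add: c2_def algebra_simps)
      moreover have "R * J \<le> 2 * Q"
      proof -
        have "J \<le> R + R" unfolding J_def using RH by (intro add_mono div_le_dividend) simp
        then have "R * J \<le> R * (R + R)" by (rule mult_le_mono2)
        then show ?thesis unfolding QR distrib_left by linarith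
      qed
      moreover have "Q > 0" using Rpos by (simp add: QR)
      moreover have "2 * (R * (\<delta> + J + (m + g) * R)) = 2 * (R * \<delta>) + 2 * (R * J) + 2 * ((m + g) * Q)"
        by (simp add: QR algebra_simps)
      ultimately show ?thesis by linarith
    qed
    then have count: "R * (\<delta> + J + (m + g) * R) < qa * d * J * \<delta>" by (simp add: D_def)
    have "R * card {x \<in> fixed (2 * h). poly (trace_poly u (2 * h)) x = t \<and> poly (G ^ ((q ^ (2 * h) - 1) div d)) x = w}
      \<le> \<delta> + J * q ^ (2 * h) + (m + g) * q ^ (2 * h)"
    proof -
      have "h \<ge> H" using h by (simp add: H'_def)
      note ind = indep[OF this, where J = J, folded Q_def, folded \<delta>_def, unfolded Q_def]
      show ?thesis
        unfolding R_def by (rule stepanov_bound[OF h0 d qa(1) m g _ count[unfolded R_def] w]) (erule ind)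
    qed
    then have "R * card {x \<in> fixed (2 * h). poly (trace_poly u (2 * h)) x = t \<and> poly (G ^ ((q ^ (2 * h) - 1) div d)) x = w}
      \<le> \<delta> + J * Q + (m + g) * Q" (is "R * ?N \<le> _") by (simp add: Q_def)
    then have "real (R * ?N) \<le> real (\<delta> + J * Q + (m + g) * Q)" by (rule of_nat_mono)
    then have "real R * real ?N \<le> real \<delta> + real J * real Q + real (m + g) * real Q" by simp
    also have "real \<delta> \<le> real Q / real D"
      unfolding \<delta>_def by (rule order_trans[OF _ of_nat_div_le_of_nat]) simp
    also have "real J \<le> real R / real D + real c2"
      unfolding J_def using of_nat_div_le_of_nat[of R D, where ?'a = real] by simp
    finally have "real R * real ?N \<le> real Q / real D + (real R / real D + real c2) * real Q + real (m + g) * real Q"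
      by (simp add: mult_right_mono)
    also have "\<dots> = real R * (real R / real D + real Q / real D + real (c2 + m + g) * real R)"
      by (simp add: QR algebra_simps)
    finally have "real ?N \<le> real R / real D + real Q / real D + real (c2 + m + g) * real R"
      using Rpos by simp
    also have "real R / real D \<le> real R"
    proof -
      have "real R * 1 \<le> real R * real D" using D by (intro mult_left_mono) auto
      then show ?thesis using D by (simp add: pos_divide_le_eq)
    qed
    finally show "real ?N \<le> real (q ^ (2 * h)) / real D + real (1 + c2 + m + g) * real (q ^ h)"
      unfolding Q_def R_def by (simp add: algebra_simps)
  qed
  show ?thesis
    by (rule exI[of _ "real (1 + c2 + m + g)"], rule exI[of _ H']) (use main in auto)
qed

text \<open>With e = (q - 1) / d, the map x -> x^e sends the q - 1 units to d-th roots of unity, and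
  its fibres have at most e elements. So there are at least d roots; the polynomial X^d - 1 has no
  more.\<close>

lemma card_roots_of_unity:
  assumes d: "d dvd q - 1" "d > 0"
  shows "card {w \<in> fixed 1. w ^ d = 1} = d"
proof (rule antisym)
  have "coeff (monom 1 d - 1 :: 'k poly) d = 1" using d by simp
  then have p0: "monom 1 d - 1 \<noteq> (0 :: 'k poly)" by (metis coeff_0 zero_neq_one)
  have "card {w \<in> fixed 1. w ^ d = 1} \<le> card {w :: 'k. poly (monom 1 d - 1) w = 0}"
    using poly_roots_finite[OF p0] by (intro card_mono) (auto simp: poly_monom)
  also have "\<dots> \<le> degree (monom 1 d - 1 :: 'k poly)" by (rule card_poly_roots_bound[OF p0])
  also have "\<dots> \<le> d" by (intro degree_diff_le) (auto simp: degree_monom_le)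
  finally show "card {w \<in> fixed 1. w ^ d = 1} \<le> d" .
next
  obtain e where e: "q - 1 = d * e" using d by auto
  have e0: "e > 0" using e q_gt_1 by (cases e) auto
  define W where "W = {w \<in> fixed 1. w ^ d = 1}"
  have fin: "finite (fixed 1)" using card_fixed(1)[of 1] by simp
  have pw: "x ^ (q - 1) = 1" if "x \<in> fixed 1" "x \<noteq> 0" for x
  proof -
    have "x * x ^ (q - 1) = x * 1"
      using that(1) q_gt_1 unfolding fixed_1 by (metis Suc_diff_1 less_trans zero_less_one mult.right_neutral power_Suc)
    then show ?thesis using that(2) by simp
  qed
  have "d * e = card (fixed 1 - {0 :: 'k})"
    using card_fixed(2)[of 1] e fin by simp
  also have "fixed 1 - {0} = (\<Union>w\<in>W. {x \<in> fixed 1 - {0}. x ^ e = w})"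
  proof -
    have "x ^ e \<in> W" if "x \<in> fixed 1 - {0}" for x
    proof -
      have "(x ^ e) ^ d = 1" using pw[of x] that unfolding power_mult[symmetric] e mult.commute[of e d] by simp
      then show ?thesis using that by (auto simp: W_def intro: fixed_power)
    qed
    then show ?thesis by auto
  qed
  also have "card \<dots> \<le> (\<Sum>w\<in>W. card {x \<in> fixed 1 - {0}. x ^ e = w})"
    using fin by (intro card_UN_le) (auto simp: W_def)
  also have "\<dots> \<le> (\<Sum>w\<in>W. e)"
  proof (rule sum_mono)
    fix w :: 'k
    have "coeff (monom 1 e - [:w:]) e = 1" using e0 by (simp add: coeff_pCons split: nat.splits)
    then have p0: "monom 1 e - [:w:] \<noteq> 0" by (metis coeff_0 zero_neq_one)
    have "card {x \<in> fixed 1 - {0}. x ^ e = w} \<le> card {x. poly (monom 1 e - [:w:]) x = 0}"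
      using poly_roots_finite[OF p0] by (intro card_mono) (auto simp: poly_monom)
    also have "\<dots> \<le> degree (monom 1 e - [:w:])" by (rule card_poly_roots_bound[OF p0])
    also have "\<dots> \<le> e" by (intro degree_diff_le) (auto simp: degree_monom_le)
    finally show "card {x \<in> fixed 1 - {0}. x ^ e = w} \<le> e" .
  qed
  finally show "d \<le> card {w \<in> fixed 1. w ^ d = 1}" using e0 by (simp add: W_def)
qed

end

text \<open>As f sums to 0, each count may be replaced by its deficit Bd - N(t), which is
  nonnegative. The deficits add up to at most S. This turns one-sided bounds into
  cancellation.\<close>

lemma weighted_count_bound:
  fixes N :: "'a \<Rightarrow> nat" and f :: "'a \<Rightarrow> complex" and Bd S :: real
  assumes fin: "finite T" and f: "\<And>t. t \<in> T \<Longrightarrow> norm (f t) \<le> 1" "(\<Sum>t\<in>T. f t) = 0"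
    and up: "\<And>t. t \<in> T \<Longrightarrow> real (N t) \<le> Bd"
    and tot: "real (card T) * Bd - (\<Sum>t\<in>T. real (N t)) \<le> S"
  shows "norm (\<Sum>t\<in>T. f t * of_nat (N t)) \<le> S"
proof -
  have "(\<Sum>t\<in>T. f t * of_nat (N t)) = (\<Sum>t\<in>T. f t * of_real (real (N t) - Bd)) + of_real Bd * (\<Sum>t\<in>T. f t)"
    by (simp add: sum_distrib_left sum.distrib[symmetric] algebra_simps)
  also have "\<dots> = (\<Sum>t\<in>T. f t * of_real (real (N t) - Bd))" using f(2) by simp
  also have "norm \<dots> \<le> (\<Sum>t\<in>T. 1 * (Bd - real (N t)))"
  proof (rule sum_norm_le)
    fix t assume t: "t \<in> T"
    have "norm (f t * of_real (real (N t) - Bd)) = norm (f t) * \<bar>real (N t) - Bd\<bar>"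
      by (simp only: norm_mult norm_of_real)
    also have "\<dots> \<le> 1 * (Bd - real (N t))" using f(1)[OF t] up[OF t] by (intro mult_mono) auto
    finally show "norm (f t * of_real (real (N t) - Bd)) \<le> 1 * (Bd - real (N t))" .
  qed
  also have "\<dots> = real (card T) * Bd - (\<Sum>t\<in>T. real (N t))" by (simp add: sum_subtractf)
  finally show ?thesis using tot by simp
qed

context frob_chars
begin

definition csum :: "'k poly \<Rightarrow> 'k poly \<Rightarrow> nat \<Rightarrow> complex" where
  "csum u G s = (\<Sum>x\<in>fixed s. wt u G (cyc x s))"

lemma sum_cyc:
  assumes "fpoly u"
  shows "(\<Sum>\<theta>\<in>#cyc x s. poly u \<theta>) = poly (trace_poly u s) x"
  unfolding cyc_def trace_poly_def poly_sum poly_power fpoly_frob[OF assms]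
  by (simp add: image_mset.compositionality o_def sum_unfold_sum_mset)

lemma wt_cyc:
  assumes "fpoly u" "fpoly G" "x \<in> fixed s"
  shows "wt u G (cyc x s) = \<psi> (poly (trace_poly u s) x) * \<chi> (poly G x ^ ((q ^ s - 1) div (q - 1)))"
proof -
  have "(\<Sum>\<theta>\<in>#cyc x s. poly u \<theta>) = poly (trace_poly u s) x"
    by (rule sum_cyc[OF assms(1)])
  moreover have "(\<Prod>\<theta>\<in>#cyc x s. poly G \<theta>) = poly G x ^ (\<Sum>i<s. q ^ i)"
    using fpoly_frob[OF assms(2), of x]
    by (simp add: cyc_def image_mset.compositionality o_def power_sum prod_unfold_prod_mset)
  moreover have "(\<Sum>i<s. q ^ i) = (q ^ s - 1) div (q - 1)"
  proof -
    have "q ^ s = (q - 1) * (\<Sum>i<s. q ^ i) + 1"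
    proof (induction s)
      case (Suc s)
      obtain q' where "q = Suc q'" using q_gt_1 by (cases q) auto
      then show ?case using Suc by (simp add: algebra_simps)
    qed auto
    then show ?thesis using q_gt_1 by simp
  qed
  ultimately show ?thesis by (simp add: wt_def)
qed

text \<open>The points x are sorted by the trace of u(x) and by G(x)^((Q-1)/d), a d-th root of
  unity; for \<open>u = 0\<close> the only trace value is 0. The summand is constant on each cell,
  the cells obey a common upper bound by Stepanov's method, and \<open>zero\<close> says that the
  cell values sum to 0. The factor D in the constant depends on q, which is harmless for the growth
  rate.\<close>

lemma csum_sqrt_growth:
  fixes u G :: "'k poly" and d qa c1 H e :: nat and s :: 'k
  assumes u: "fpoly u" and G: "fpoly G" "G \<noteq> 0"
    and d: "d dvd q - 1" "d > 0" and e: "e > 0" and s: "s \<in> fixed 1"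
    and qa: "qa = q \<and> T = fixed 1 \<or> qa = 1 \<and> u = 0 \<and> T = {0}"
    and indep: "\<And>h J c. h \<ge> H \<Longrightarrow> (\<Sum>(i, l, j, k)\<in>{..<qa} \<times> {..<d} \<times> {..<J} \<times> {..<q ^ (2 * h) div (qa * d) - c1}.
        smult (c (i, l, j, k))
        ([:0, 1:] ^ (k + j * q ^ (2 * h)) * trace_poly u (2 * h) ^ i * (G ^ ((q ^ (2 * h) - 1) div d)) ^ l)) = 0 \<Longrightarrow>
        \<forall>\<iota>\<in>{..<qa} \<times> {..<d} \<times> {..<J} \<times> {..<q ^ (2 * h) div (qa * d) - c1}. c \<iota> = 0"
    and zero: "(\<Sum>t\<in>T. \<psi> (s * t)) * (\<Sum>w | w \<in> fixed 1 \<and> w ^ d = 1. \<chi> (w ^ e)) = 0"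
  shows "\<exists>C H'. \<forall>h\<ge>H'. norm (csum (smult s u) (G ^ (e * ((q - 1) div d))) (2 * h)) \<le> C * real q ^ h"
proof -
  define D where "D = qa * d"
  have qa0: "qa \<le> q" "qa > 0" using qa q_gt_1 by auto
  obtain C H' where C: "C \<ge> 0" and CH: "\<And>h. h \<ge> H' \<Longrightarrow> h > 0 \<and> (\<forall>t w. w \<noteq> 0 \<longrightarrow>
    real (card {x \<in> fixed (2 * h). poly (trace_poly u (2 * h)) x = t \<and> poly (G ^ ((q ^ (2 * h) - 1) div d)) x = w})
      \<le> real (q ^ (2 * h)) / real D + C * real (q ^ h))"
    using stepanov_upper_bound[OF d qa0 order_refl order_refl indep] unfolding D_def by blast
  define W where "W = {w \<in> fixed 1. w ^ d = 1}"
  have fin1: "finite (fixed 1)" using card_fixed(1)[of 1] by simp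
  have cT: "card T = qa" "finite T" using qa card_fixed[of 1] by auto
  have cW: "card W = d" "finite W" using card_roots_of_unity[OF d] fin1 by (auto simp: W_def)
  have TF: "T \<subseteq> fixed 1" using qa by auto
  define g where "g = degree G"
  have main: "norm (csum (smult s u) (G ^ (e * ((q - 1) div d))) (2 * h)) \<le> (real g + real D * C) * real q ^ h"
    if h: "h \<ge> H'" for h
  proof -
    have h0: "h > 0" using CH[OF h] by simp
    define Q where "Q = q ^ (2 * h)"
    define a where "a = (\<lambda>x. poly (trace_poly u (2 * h)) x)"
    define b where "b = (\<lambda>x. poly (G ^ ((Q - 1) div d)) x)"
    define Y where "Y = {x \<in> fixed (2 * h). poly G x \<noteq> 0}"
    define f where "f = (\<lambda>(t, w). \<psi> (s * t) * \<chi> (w ^ e))"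
    define N where "N = (\<lambda>(t, w). card {x \<in> fixed (2 * h). a x = t \<and> b x = w})"
    have finF: "finite (fixed (2 * h))" "card (fixed (2 * h)) = Q" using card_fixed[of "2 * h"] h0 by (auto simp: Q_def)
    have q1Q: "q - 1 dvd Q - 1" unfolding Q_def using q_gt_1 by (intro pred_dvd_power_pred) simp
    have dQ: "d dvd Q - 1" using d q1Q dvd_trans by blast
    have aT: "a x \<in> T" if "x \<in> fixed (2 * h)" for x
    proof -
      have "(\<Sum>\<theta>\<in>#cyc x (2 * h). poly u \<theta>) \<in> fixed 1" by (intro frobinv_sum_fixed frobinv_cyc that u)
      moreover have "(\<Sum>\<theta>\<in>#cyc x (2 * h). poly u \<theta>) = a x"
        unfolding a_def by (rule sum_cyc[OF u])
      ultimately have "a x \<in> fixed 1" by simp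
      moreover have "a x = 0" if "u = 0"
        unfolding a_def trace_poly_def using that q_gt_1 by (simp add: power_0_left)
      ultimately show ?thesis using qa by auto
    qed
    have Qpow: "y ^ (Q - 1) = 1" if "y \<in> fixed (2 * h)" "y \<noteq> 0" for y
    proof -
      have "Q > 0" using q_gt_1 by (simp add: Q_def)
      then have "y * y ^ (Q - 1) = y ^ Q" by (simp flip: power_Suc)
      also have "\<dots> = y * 1" using that(1) by (simp add: fixed_def Q_def)
      finally have "y * y ^ (Q - 1) = y * 1" .
      then show ?thesis using that(2) by simp
    qed
    have bW: "b x \<in> W" if "x \<in> Y" for x
    proof -
      have y: "poly G x \<in> fixed (2 * h)" "poly G x \<noteq> 0" using that fpoly_fixed[OF G(1)] by (auto simp: Y_def)
      have bd: "b x ^ d = 1"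
        using dQ Qpow[OF y] by (simp add: b_def flip: power_mult)
      moreover have "b x ^ q = b x"
      proof -
        obtain e' where "q - 1 = d * e'" using d by auto
        then have "b x ^ (q - 1) = 1" using bd by (simp add: power_mult)
        then show ?thesis using q_gt_1 by (metis Suc_diff_1 less_trans zero_less_one mult.right_neutral power_Suc)
      qed
      ultimately show ?thesis by (simp add: W_def fixed_def)
    qed
    have wt_eq: "wt (smult s u) (G ^ (e * ((q - 1) div d))) (cyc x (2 * h)) = (if x \<in> Y then f (a x, b x) else 0)"
      if x: "x \<in> fixed (2 * h)" for x
    proof -
      have tr: "poly (trace_poly (smult s u) (2 * h)) x = s * a x"
      proof -
        have "s ^ (q ^ i) = s" for i using fixed_1_imp[OF s, of i] by (simp add: fixed_def)
        then show ?thesis unfolding a_def trace_poly_def poly_sum sum_distrib_left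
          by (intro sum.cong refl) (simp add: power_mult_distrib)
      qed
      have ex: "e * ((q - 1) div d) * ((Q - 1) div (q - 1)) = (Q - 1) div d * e"
      proof -
        obtain e1 where e1: "q - 1 = d * e1" using d by auto
        obtain e2 where e2: "Q - 1 = (q - 1) * e2" using q1Q by auto
        have "(q - 1) div d = e1" using e1 d by simp
        moreover have "(Q - 1) div (q - 1) = e2" using e2 q_gt_1 by simp
        moreover have "(Q - 1) div d = e1 * e2" using e1 e2 d by (simp add: mult.assoc)
        ultimately show ?thesis by (simp add: mult_ac)
      qed
      have "poly (G ^ (e * ((q - 1) div d))) x ^ ((Q - 1) div (q - 1)) = b x ^ e"
        unfolding b_def poly_power power_mult[symmetric] ex ..
      then have "wt (smult s u) (G ^ (e * ((q - 1) div d))) (cyc x (2 * h)) = \<psi> (s * a x) * \<chi> (b x ^ e)"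
        using wt_cyc[OF fpoly_smult[OF s u] fpoly_power[OF G(1)] x, of "e * ((q - 1) div d)"]
        by (simp add: tr Q_def)
      moreover have "\<chi> (b x ^ e) = 0" if "x \<notin> Y"
      proof -
        have "poly G x = 0" using that x by (simp add: Y_def)
        moreover have "(Q - 1) div d > 0"
        proof -
          have "Q > 1" unfolding Q_def using q_gt_1 h0 by (intro one_less_power) auto
          then show ?thesis using dvd_imp_le[OF dQ] d(2) by (simp add: div_greater_zero_iff)
        qed
        ultimately show ?thesis using e chi_0 by (simp add: b_def power_0_left)
      qed
      ultimately show ?thesis by (auto simp: f_def)
    qed
    have "csum (smult s u) (G ^ (e * ((q - 1) div d))) (2 * h) = (\<Sum>x\<in>fixed (2 * h). if x \<in> Y then f (a x, b x) else 0)"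
      unfolding csum_def by (intro sum.cong refl wt_eq)
    also have "\<dots> = (\<Sum>x\<in>Y. f (a x, b x))"
      using finF by (intro sum.mono_neutral_cong_right) (auto simp: Y_def)
    also have "\<dots> = (\<Sum>p\<in>T \<times> W. \<Sum>x\<in>{x \<in> Y. (a x, b x) = p}. f (a x, b x))"
      using finF cT cW aT bW by (intro sum.group[symmetric]) (auto simp: Y_def)
    also have "\<dots> = (\<Sum>p\<in>T \<times> W. f p * of_nat (N p))"
    proof (rule sum.cong[OF refl])
      fix p assume p: "p \<in> T \<times> W"
      have w0: "snd p \<noteq> 0" using p d(2) by (auto simp: W_def power_0_left)
      have "{x \<in> Y. (a x, b x) = p} = {x \<in> fixed (2 * h). a x = fst p \<and> b x = snd p}"
      proof -
        have "poly G x \<noteq> 0" if "b x = snd p" for x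
        proof
          assume "poly G x = 0"
          moreover have "(Q - 1) div d > 0"
          proof -
            have "Q > 1" unfolding Q_def using q_gt_1 h0 by (intro one_less_power) auto
            then show ?thesis using dvd_imp_le[OF dQ] d(2) by (simp add: div_greater_zero_iff)
          qed
          ultimately show False using that w0 by (simp add: b_def power_0_left)
        qed
        then show ?thesis by (auto simp: Y_def)
      qed
      then have "card {x \<in> Y. (a x, b x) = p} = N p" by (simp add: N_def case_prod_beta)
      moreover have "(\<Sum>x\<in>{x \<in> Y. (a x, b x) = p}. f (a x, b x)) = (\<Sum>x\<in>{x \<in> Y. (a x, b x) = p}. f p)"
        by (intro sum.cong) auto
      ultimately show "(\<Sum>x\<in>{x \<in> Y. (a x, b x) = p}. f (a x, b x)) = f p * of_nat (N p)" by simp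
    qed
    finally have cs: "csum (smult s u) (G ^ (e * ((q - 1) div d))) (2 * h) = (\<Sum>p\<in>T \<times> W. f p * of_nat (N p))" .
    have "norm (\<Sum>p\<in>T \<times> W. f p * of_nat (N p)) \<le> (real g + real D * C) * real q ^ h"
    proof (rule weighted_count_bound[where Bd = "real Q / real D + C * real (q ^ h)"])
      show "finite (T \<times> W)" using cT cW by simp
      show "(\<Sum>p\<in>T \<times> W. f p) = 0"
        using zero by (simp add: f_def sum.cartesian_product[symmetric] sum_product W_def)
      fix p assume p: "p \<in> T \<times> W"
      then have w0: "snd p \<noteq> 0" using d(2) by (auto simp: W_def power_0_left)
      have "fst p \<in> fixed 1" using p TF by auto
      then have "s * fst p \<in> fixed 1" using s by (intro fixed_mult)
      moreover have "snd p ^ e \<in> fixed 1" using p by (auto simp: W_def intro: fixed_power)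
      ultimately show "norm (f p) \<le> 1" using w0
        by (simp add: f_def case_prod_beta norm_mult psi_norm chi_norm)
      show "real (N p) \<le> real Q / real D + C * real (q ^ h)"
        using CH[OF h] w0 unfolding N_def a_def b_def Q_def case_prod_beta by blast
    next
      \<comment> \<open>The cells cover all points except zeros of G, of which there are at most g.
        So the total of the deficits is bounded.\<close>
      have "(\<Sum>p\<in>T \<times> W. N p) \<ge> card Y"
      proof -
        have "Y \<subseteq> (\<Union>p\<in>T \<times> W. {x \<in> fixed (2 * h). a x = fst p \<and> b x = snd p})"
          using aT bW by (auto simp: Y_def)
        then have "card Y \<le> card (\<Union>p\<in>T \<times> W. {x \<in> fixed (2 * h). a x = fst p \<and> b x = snd p})"
          using finF cT cW by (intro card_mono) auto
        also have "\<dots> \<le> (\<Sum>p\<in>T \<times> W. card {x \<in> fixed (2 * h). a x = fst p \<and> b x = snd p})"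
          using cT cW by (intro card_UN_le) auto
        finally show ?thesis by (simp add: N_def case_prod_beta)
      qed
      moreover have "Q \<le> card Y + g"
      proof -
        have "fixed (2 * h) \<subseteq> Y \<union> {x. poly G x = 0}" by (auto simp: Y_def)
        then have "Q \<le> card (Y \<union> {x. poly G x = 0})"
          unfolding finF(2)[symmetric] using finF poly_roots_finite[OF G(2)] by (intro card_mono) (auto simp: Y_def)
        also have "\<dots> \<le> card Y + card {x. poly G x = 0}" by (rule card_Un_le)
        also have "card {x. poly G x = 0} \<le> g" unfolding g_def by (rule card_poly_roots_bound[OF G(2)])
        finally show ?thesis by simp
      qed
      ultimately have "Q \<le> (\<Sum>p\<in>T \<times> W. N p) + g" by linarith
      then have tot: "real Q \<le> (\<Sum>p\<in>T \<times> W. real (N p)) + real g"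
        by (metis of_nat_add of_nat_mono of_nat_sum)
      have D0: "real D > 0" using qa0 d by (simp add: D_def)
      have "real (card (T \<times> W)) * (real Q / real D + C * real (q ^ h)) = real Q + real D * C * real q ^ h"
      proof -
        have "card (T \<times> W) = D" using cT cW by (simp add: card_cartesian_product D_def)
        then show ?thesis using D0 by (simp add: field_simps)
      qed
      also have "real g \<le> real g * real q ^ h" using q_gt_1 by (simp add: mult_le_cancel_left1)
      ultimately show "real (card (T \<times> W)) * (real Q / real D + C * real (q ^ h)) - (\<Sum>p\<in>T \<times> W. real (N p))
          \<le> (real g + real D * C) * real q ^ h"
        using tot by (simp add: distrib_right)
    qed
    then show ?thesis using cs by simp
  qed
  then show ?thesis by blast
qed

text \<open>Here n bounds the number of roots of the L-function and is the only constant that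
  survives; C and H serve to bound the size of these roots.\<close>

lemma csum_bound:
  assumes u: "fpoly u" and G: "fpoly G"
    and van: "\<And>k. k \<ge> n \<Longrightarrow> (\<Sum>M\<in>invmsets k. wt u G M) = 0"
    and growth: "\<And>h. h \<ge> H \<Longrightarrow> norm (csum u G (2 * h)) \<le> C * real q ^ h"
  shows "norm (\<Sum>x\<in>fixed 1. \<psi> (poly u x) * \<chi> (poly G x)) \<le> real n * sqrt (real q)"
proof -
  have "norm (csum u G 1) \<le> real n * sqrt (real q)"
  proof (rule square_root_bound_of_recurrence[where c = "\<lambda>k. \<Sum>M\<in>invmsets k. wt u G M" and H = H and C = C])
    show "(\<Sum>M\<in>invmsets 0. wt u G M) = 1" by (simp add: invmsets_0 wt_def psi_0 chi_1)
    show "of_nat k * (\<Sum>M\<in>invmsets k. wt u G M) = (\<Sum>s=1..k. csum u G s * (\<Sum>M\<in>invmsets (k - s). wt u G M))" for k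
      unfolding csum_def by (rule invmset_recurrence) (rule wt_plus[OF u G])
  qed (use van growth q_gt_1 in auto)
  moreover have "csum u G 1 = (\<Sum>x\<in>fixed 1. \<psi> (poly u x) * \<chi> (poly G x))"
    unfolding csum_def using q_gt_1 by (intro sum.cong refl) (simp add: wt_cyc[OF u G] trace_poly_def)
  ultimately show ?thesis by simp
qed

end

section \<open>Independence of the auxiliary monomials\<close>

lemma distinct_degrees_independent:
  fixes \<mu> :: "'b \<Rightarrow> 'a::field poly"
  assumes fin: "finite U" and nz: "\<And>\<iota>. \<iota> \<in> U \<Longrightarrow> \<mu> \<iota> \<noteq> 0"
    and inj: "inj_on (\<lambda>\<iota>. degree (\<mu> \<iota>)) U"
    and sum: "(\<Sum>\<iota>\<in>U. smult (c \<iota>) (\<mu> \<iota>)) = 0"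
  shows "\<forall>\<iota>\<in>U. c \<iota> = 0"
proof (rule ccontr)
  assume "\<not> ?thesis"
  then have ne: "{\<iota> \<in> U. c \<iota> \<noteq> 0} \<noteq> {}" by auto
  define S where "S = {\<iota> \<in> U. c \<iota> \<noteq> 0}"
  have finS: "finite S" using fin by (simp add: S_def)
  define n where "n = Max ((\<lambda>\<iota>. degree (\<mu> \<iota>)) ` S)"
  have "n \<in> (\<lambda>\<iota>. degree (\<mu> \<iota>)) ` S"
    unfolding n_def using finS ne by (intro Max_in) (auto simp: S_def)
  then obtain \<iota>0 where i0: "\<iota>0 \<in> S" "degree (\<mu> \<iota>0) = n" by auto
  have le: "degree (\<mu> \<iota>) \<le> n" if "\<iota> \<in> S" for \<iota>
    unfolding n_def using finS that by (intro Max_ge) auto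
  have "0 = coeff (\<Sum>\<iota>\<in>U. smult (c \<iota>) (\<mu> \<iota>)) n" by (simp add: sum)
  also have "\<dots> = (\<Sum>\<iota>\<in>U. if \<iota> = \<iota>0 then c \<iota>0 * coeff (\<mu> \<iota>0) n else 0)"
    unfolding coeff_sum
  proof (rule sum.cong[OF refl])
    fix \<iota> assume \<iota>: "\<iota> \<in> U"
    show "coeff (smult (c \<iota>) (\<mu> \<iota>)) n =
        (if \<iota> = \<iota>0 then c \<iota>0 * coeff (\<mu> \<iota>0) n else 0)"
    proof (cases "\<iota> = \<iota>0 \<or> c \<iota> = 0")
      case False
      then have "\<iota> \<in> S" using \<iota> by (simp add: S_def)
      moreover have "degree (\<mu> \<iota>) \<noteq> n"
        using inj \<iota> i0 False by (auto simp: inj_on_def S_def)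
      ultimately have "coeff (\<mu> \<iota>) n = 0" using le by (intro coeff_eq_0) (simp add: le_neq_implies_less)
      then show ?thesis using False by simp
    qed (use i0 in \<open>auto simp: S_def\<close>)
  qed
  also have "\<dots> = c \<iota>0 * coeff (\<mu> \<iota>0) n" using fin i0 by (simp add: S_def)
  also have "\<dots> \<noteq> 0" using i0 nz by (auto simp: S_def)
  finally show False by simp
qed

lemma eq_if_mult_mod_eq:
  fixes a i i' n :: nat
  assumes "(i * a) mod n = (i' * a) mod n" "coprime a n" "i < n" "i' < n"
  shows "i = i'"
proof -
  have "int (i * a) mod int n = int (i' * a) mod int n" using assms(1) by (metis of_nat_mod)
  then have "int n dvd int (i * a) - int (i' * a)" by (simp only: mod_eq_dvd_iff)
  then have "int n dvd (int i - int i') * int a" by (simp add: left_diff_distrib)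
  moreover have "coprime (int n) (int a)" using assms(2) by (simp add: coprime_commute)
  ultimately have "int n dvd int i - int i'" by (simp add: coprime_dvd_mult_left_iff)
  moreover have "\<bar>int i - int i'\<bar> < int n" using assms(3,4) by linarith
  ultimately have "int i - int i' = 0" using dvd_imp_le_int[of "int i - int i'" "int n"] by linarith
  then show ?thesis by simp
qed

text \<open>Multiplying the degree by q d and using q P = Q and d E = Q - 1 turns it into Q A + B
  with A = q d j + m d i + g q l and B = q d k - g q l. Two values of B differ by less than Q, so A
  is determined. A modulo q yields i, what remains yields l modulo d, and then j and k
  follow.\<close>

lemma slots_inj:
  fixes m g d q P E :: nat
  assumes Q: "Q = q * P" and E: "d * E = Q - 1" "Q > 0" and d: "d > 0" and q: "q > 0"
    and md: "coprime (m * d) q" and gd: "coprime g d"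
    and \<delta>: "q * d * (\<delta> + g) \<le> Q"
    and 1: "i < q" "l < d" "k < \<delta>" and 2: "i' < q" "l' < d" "k' < \<delta>"
    and eq: "k + j * Q + i * (m * P) + l * (g * E) = k' + j' * Q + i' * (m * P) + l' * (g * E)"
  shows "i = i' \<and> l = l' \<and> j = j' \<and> k = k'"
proof -
  have dE: "int d * int E = int Q - 1" using E by (metis of_nat_1 of_nat_diff of_nat_mult Suc_leI One_nat_def)
  define A A' where "A = int (q * d * j + i * m * d + l * g * q)" and "A' = int (q * d * j' + i' * m * d + l' * g * q)"
  define B B' where "B = int (q * d * k) - int (l * g * q)" and "B' = int (q * d * k') - int (l' * g * q)"
  have expand: "int (q * d) * int (k + j * Q + i * (m * P) + l * (g * E)) =
      int Q * int (q * d * j + i * m * d + l * g * q) + (int (q * d * k) - int (l * g * q))" for k j i l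
  proof -
    have "int (q * d) * int (k + j * Q + i * (m * P) + l * (g * E)) =
       int q * int d * int k + int q * int d * int j * int Q + int i * int m * int d * (int q * int P) +
       int l * int g * int q * (int d * int E)" by (simp add: algebra_simps)
    also have "int q * int P = int Q" by (simp add: Q)
    finally show ?thesis unfolding dE by (simp add: algebra_simps)
  qed
  have "int Q * A + B = int Q * A' + B'"
    unfolding A_def A'_def B_def B'_def expand[symmetric] eq ..
  then have e: "int Q * (A - A') = B' - B" by (simp add: algebra_simps)
  have bnd: "\<bar>B' - B\<bar> < int Q"
  proof -
    have b: "int (q * d * k) \<le> int (q * d * \<delta>) - 1 \<and> int (l * g * q) \<le> int (q * d * g)" if "k < \<delta>" "l < d" for k l
    proof
      have "q * d * k < q * d * \<delta>" using that q d by simp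
      then show "int (q * d * k) \<le> int (q * d * \<delta>) - 1" by linarith
      have "l * g * q \<le> d * g * q" using that by (intro mult_le_mono1) simp
      also have "d * g * q = q * d * g" by simp
      finally show "int (l * g * q) \<le> int (q * d * g)" by (rule of_nat_mono)
    qed
    have "int (q * d * \<delta>) + int (q * d * g) \<le> int Q" using \<delta> by (simp only: distrib_left of_nat_add[symmetric] of_nat_le_iff)
    then show ?thesis using b[OF 1(3,2)] b[OF 2(3,2)] unfolding B_def B'_def by linarith
  qed
  have AA: "A = A'"
  proof (rule ccontr)
    assume "A \<noteq> A'"
    then have "1 \<le> \<bar>A - A'\<bar>" by linarith
    then have "int Q * 1 \<le> int Q * \<bar>A - A'\<bar>" by (intro mult_left_mono) auto
    also have "\<dots> = \<bar>B' - B\<bar>" unfolding e[symmetric] by (simp add: abs_mult)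
    finally show False using bnd by linarith
  qed
  then have BB: "B = B'" using e by simp
  have nA: "q * d * j + i * m * d + l * g * q = q * d * j' + i' * m * d + l' * g * q"
    using AA unfolding A_def A'_def by linarith
  have i: "i = i'"
  proof -
    have "(q * d * j + i * m * d + l * g * q) mod q = (i * (m * d)) mod q"
      by (metis (no_types, lifting) mult.assoc mult.commute mod_mult_self2 mod_mult_self4)
    moreover have "(q * d * j' + i' * m * d + l' * g * q) mod q = (i' * (m * d)) mod q"
      by (metis (no_types, lifting) mult.assoc mult.commute mod_mult_self2 mod_mult_self4)
    ultimately have "(i * (m * d)) mod q = (i' * (m * d)) mod q" using nA by simp
    then show ?thesis using md 1(1) 2(1) by (rule eq_if_mult_mod_eq)
  qed
  have "q * (d * j + l * g) = q * (d * j' + l' * g)" using nA i by (simp add: algebra_simps)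
  then have jl: "d * j + l * g = d * j' + l' * g" using q by simp
  have l: "l = l'"
  proof -
    have "(l * g) mod d = (l' * g) mod d" using jl by (metis mod_mult_self4)
    then show ?thesis using gd 1(2) 2(2) by (rule eq_if_mult_mod_eq)
  qed
  have "j = j'" using jl l d by simp
  moreover have "k = k'" using eq i l calculation by simp
  ultimately show ?thesis using i l by simp
qed

context frob
begin

lemma degree_trace_poly_eq:
  assumes "degree u > 0" "s > 0"
  shows "degree (trace_poly u s) = degree u * q ^ (s - 1)"
  using assms(2)
proof (induction s)
  case (Suc s)
  have u0: "u \<noteq> 0" using assms by auto
  have top: "degree (u ^ (q ^ s)) = degree u * q ^ s"
    using u0 by (simp add: degree_power_eq mult.commute)
  have eq: "trace_poly u (Suc s) = trace_poly u s + u ^ (q ^ s)" by (simp add: trace_poly_def)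
  show ?case
  proof (cases "s = 0")
    case True
    then show ?thesis by (simp add: trace_poly_def)
  next
    case False
    then have "degree (trace_poly u s) < degree (u ^ (q ^ s))"
      using Suc.IH assms q_gt_1 top by (simp add: power_strict_increasing)
    then show ?thesis unfolding eq by (simp add: degree_add_eq_right top)
  qed
qed simp

lemma coprime_q:
  assumes "0 < m" "m < CHAR('k)"
  shows "coprime m q"
proof -
  have "\<not> CHAR('k) dvd m" using assms by (auto dest: dvd_imp_le)
  then have "coprime m CHAR('k)" using char_prime by (metis coprime_commute prime_imp_coprime)
  then show ?thesis by (simp add: q_eq)
qed

lemma coprime_q_dvd_pred: "d dvd q - 1 \<Longrightarrow> coprime d q"
proof -
  assume d: "d dvd q - 1"
  have "coprime (q - 1) q" using q_gt_1 coprime_diff_one_left_nat[of q] by simp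
  then show ?thesis using d coprime_divisors[of d "q - 1" q q] by simp
qed

text \<open>All monomials have different degrees by \<open>slots_inj\<close>. That deg u is below
  the characteristic makes deg u coprime to q, and subtracting deg G in the range of k leaves the
  room that the decomposition of the degree needs.\<close>

lemma slots_independent:
  assumes u: "0 < degree u" "degree u < CHAR('k)" and G: "G \<noteq> 0"
    and d: "d dvd q - 1" "d > 0" and cop: "coprime (degree G) d" and h: "h \<ge> 1"
    and sum: "(\<Sum>(i, l, j, k)\<in>{..<q} \<times> {..<d} \<times> {..<J} \<times> {..<q ^ (2 * h) div (q * d) - degree G}.
        smult (c (i, l, j, k))
        ([:0, 1:] ^ (k + j * q ^ (2 * h)) * trace_poly u (2 * h) ^ i * (G ^ ((q ^ (2 * h) - 1) div d)) ^ l)) = 0"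
  shows "\<forall>\<iota>\<in>{..<q} \<times> {..<d} \<times> {..<J} \<times> {..<q ^ (2 * h) div (q * d) - degree G}. c \<iota> = 0"
proof -
  define m g where "m = degree u" and "g = degree G"
  define Q P E where "Q = q ^ (2 * h)" and "P = q ^ (2 * h - 1)" and "E = (Q - 1) div d"
  define \<delta> where "\<delta> = Q div (q * d) - g"
  define U where "U = {..<q} \<times> {..<d} \<times> {..<J} \<times> {..<\<delta>}"
  define \<mu> where "\<mu> = (\<lambda>(i, l, j, k). [:0, 1:] ^ (k + j * Q) * trace_poly u (2 * h) ^ i * (G ^ E) ^ l)"
  have QP: "Q = q * P" using h by (simp add: Q_def P_def power_eq_if)
  have Qpos: "Q > 0" using q_gt_1 by (simp add: Q_def)
  have dE: "d * E = Q - 1"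
  proof -
    have "q - 1 dvd Q - 1" unfolding Q_def using q_gt_1 by (intro pred_dvd_power_pred) simp
    then have "d dvd Q - 1" using d dvd_trans by blast
    then show ?thesis by (simp add: E_def)
  qed
  have da: "degree (trace_poly u (2 * h)) = m * P"
    unfolding m_def P_def using u h by (intro degree_trace_poly_eq) auto
  have a0: "trace_poly u (2 * h) \<noteq> 0"
    using da u q_gt_1 by (auto simp: m_def P_def)
  have X0: "[:0, 1:] \<noteq> (0 :: 'k poly)" by simp
  have deg: "degree (\<mu> (i, l, j, k)) = k + j * Q + i * (m * P) + l * (g * E)" for i l j k
  proof -
    have "degree (G ^ E) = g * E" using G by (simp add: degree_power_eq g_def)
    then show ?thesis using a0 G X0 by (simp add: \<mu>_def degree_mult_eq degree_power_eq da)
  qed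
  have md: "coprime (m * d) q"
    using coprime_q[of m] coprime_q_dvd_pred[OF d(1)] u by (simp add: m_def)
  have "\<forall>\<iota>\<in>U. c \<iota> = 0"
  proof (rule distinct_degrees_independent[where \<mu> = \<mu>])
    show "finite U" by (simp add: U_def)
    show "\<mu> \<iota> \<noteq> 0" for \<iota> using a0 G X0 by (cases \<iota>) (simp add: \<mu>_def)
    show "(\<Sum>\<iota>\<in>U. smult (c \<iota>) (\<mu> \<iota>)) = 0"
      using sum unfolding U_def \<mu>_def \<delta>_def g_def Q_def E_def by (simp add: case_prod_beta)
    show "inj_on (\<lambda>\<iota>. degree (\<mu> \<iota>)) U"
    proof (rule inj_onI)
      fix \<iota> \<iota>' assume U: "\<iota> \<in> U" "\<iota>' \<in> U" and eq: "degree (\<mu> \<iota>) = degree (\<mu> \<iota>')"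
      obtain i l j k where \<iota>: "\<iota> = (i, l, j, k)" "i < q" "l < d" "k < \<delta>" using U(1) by (auto simp: U_def)
      obtain i' l' j' k' where \<iota>': "\<iota>' = (i', l', j', k')" "i' < q" "l' < d" "k' < \<delta>" using U(2) by (auto simp: U_def)
      have "q * d * (\<delta> + g) \<le> Q"
      proof -
        have "\<delta> + g = Q div (q * d)" using \<iota>(4) by (simp add: \<delta>_def)
        then show ?thesis by simp
      qed
      from slots_inj[OF QP dE Qpos d(2) _ md cop[folded g_def] this \<iota>(2-4) \<iota>'(2-4), of j j']
      show "\<iota> = \<iota>'" using eq q_gt_1 unfolding \<iota>(1) \<iota>'(1) deg by simp
    qed
  qed
  then show ?thesis unfolding U_def \<delta>_def g_def Q_def .
qed

end

section \<open>Independence by Kummer theory\<close>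

lemma poly_map_poly_prod_hom:
  fixes f :: "'a::comm_ring_1 \<Rightarrow> 'b::comm_ring_1"
  assumes "f 0 = 0" "f 1 = 1" "\<And>x y. f (x + y) = f x + f y" "\<And>x y. f (x * y) = f x * f y"
  shows "poly (map_poly f (\<Prod>i\<in>A. p i)) z = (\<Prod>i\<in>A. poly (map_poly f (p i)) z)"
  using assms by (induction A rule: infinite_finite_induct) (simp_all add: map_poly_mult_hom)

text \<open>K[x] inside an algebraic closure of K(x), where d-th roots of c / G are available as
  elements.\<close>

definition ratfun :: "'k::field poly \<Rightarrow> 'k poly fract alg_closure" where
  "ratfun p = to_ac (to_fract p)"

lemma ratfun_simps [simp]:
  "ratfun 0 = 0" "ratfun 1 = 1" "ratfun (p + p') = ratfun p + ratfun p'"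
  "ratfun (p * p') = ratfun p * ratfun p'" "ratfun p = 0 \<longleftrightarrow> p = 0"
  by (simp_all add: ratfun_def)

lemma ratfun_power [simp]: "ratfun (p ^ n) = ratfun p ^ n"
  by (induction n) auto

lemma ratfun_sum: "ratfun (\<Sum>i\<in>A. f i) = (\<Sum>i\<in>A. ratfun (f i))"
  by (induction A rule: infinite_finite_induct) auto

text \<open>
  The Kummer polynomial \<open>Z^d - c / G\<close> is irreducible over \<open>K(x)\<close>: the constant coefficient of a proper
  factor of degree \<open>k\<close> is, up to a constant, a \<open>d\<close>-th root of \<open>(c / G)^k\<close>.
\<close>

lemma kummer_no_small_relation:
  fixes G :: "'k::alg_closed_field poly" and P :: "'k poly poly" and y :: "'k poly fract alg_closure"
  assumes G: "G \<noteq> 0" and c: "c \<noteq> 0" and cond: "\<And>k. (\<And>\<beta>. d dvd k * order \<beta> G) \<Longrightarrow> d dvd k"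
    and P: "P \<noteq> 0" "degree P < d"
    and y: "y ^ d * ratfun G = ratfun [:c:]" and root: "poly (map_poly ratfun P) y = 0"
  shows False
proof -
  define isroot where "isroot A \<longleftrightarrow> A \<noteq> 0 \<and> poly (map_poly to_ac A) y = 0" for A :: "'k poly fract poly"
  \<comment> \<open>The degree of the minimal polynomial of y over K(x); below, \<open>A\<close> is
    this minimal polynomial, made monic.\<close>
  define k where "k = (LEAST k. \<exists>A. isroot A \<and> degree A = k)"
  have P': "isroot (map_poly to_fract P)" "degree (map_poly to_fract P) = degree P"
  proof -
    have "map_poly to_ac (map_poly to_fract P) = map_poly ratfun P"
      by (rule poly_eqI) (simp add: coeff_map_poly ratfun_def)
    moreover have "coeff (map_poly to_fract P) (degree P) \<noteq> 0"
      using P(1) by (simp add: coeff_map_poly)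
    then have "map_poly to_fract P \<noteq> 0" by (metis coeff_0)
    ultimately show "isroot (map_poly to_fract P)" using root by (simp add: isroot_def)
    show "degree (map_poly to_fract P) = degree P" by (rule degree_map_poly) auto
  qed
  have ex: "\<exists>A. isroot A \<and> degree A = k"
    unfolding k_def by (rule LeastI[of "\<lambda>k. \<exists>A. isroot A \<and> degree A = k"], rule exI, rule conjI[OF P'])
  have kd: "k < d"
  proof -
    have "k \<le> degree P"
      unfolding k_def by (rule Least_le, rule exI, rule conjI[OF P'])
    then show ?thesis using P(2) by simp
  qed
  have min: "k \<le> degree A" if "isroot A" for A
    unfolding k_def by (rule Least_le, rule exI[of _ A]) (simp add: that)
  obtain A0 where A0: "isroot A0" "degree A0 = k" using ex by blast
  define A where "A = smult (1 / lead_coeff A0) A0"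
  have lA0: "lead_coeff A0 \<noteq> 0" using A0 by (auto simp: isroot_def)
  have A: "degree A = k" "lead_coeff A = 1" using A0 lA0 by (auto simp: A_def)
  have rA: "poly (map_poly to_ac A) y = 0"
  proof -
    have "map_poly to_ac A = smult (to_ac (1 / lead_coeff A0)) (map_poly to_ac A0)"
      by (rule poly_eqI) (simp add: A_def coeff_map_poly)
    then show ?thesis using A0 by (simp add: isroot_def)
  qed
  define cg where "cg = to_fract [:c:] / to_fract G"
  have G0: "to_fract G \<noteq> 0" using G by simp
  have yd: "y ^ d = to_ac cg"
    using y G by (simp add: cg_def ratfun_def field_simps)
  define B where "B = monom 1 d - [:cg:]"
  have tadd: "map_poly to_ac (p + p') = map_poly to_ac p + map_poly to_ac p'" for p p' :: "'k poly fract poly"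
    by (rule map_poly_add_hom) auto
  have tmult: "map_poly to_ac (p * p') = map_poly to_ac p * map_poly to_ac p'" for p p' :: "'k poly fract poly"
    by (rule map_poly_mult_hom) auto
  have mB: "map_poly to_ac B = monom 1 d - [:to_ac cg:]"
    by (rule poly_eqI) (simp add: B_def coeff_map_poly coeff_pCons split: nat.splits)
  have rB: "poly (map_poly to_ac B) y = 0" by (simp add: mB poly_monom yd)
  have "A dvd B"
  proof -
    have "B = B div A * A + B mod A" by simp
    then have "map_poly to_ac B = map_poly to_ac (B div A) * map_poly to_ac A + map_poly to_ac (B mod A)"
      by (metis tadd tmult)
    then have "poly (map_poly to_ac (B mod A)) y = 0" using rA rB by simp
    moreover have "B mod A = 0 \<or> degree (B mod A) < k"
    proof -
      have "A \<noteq> 0" using A(2) by auto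
      from degree_mod_less[OF this, of B] show ?thesis using A(1) by simp
    qed
    ultimately have "B mod A = 0" using min[of "B mod A"] unfolding isroot_def by linarith
    then show ?thesis by auto
  qed
  then obtain B' where B': "B = A * B'" by auto
  define Aac where "Aac = map_poly to_ac A"
  have Aac: "degree Aac = k" "lead_coeff Aac = 1"
  proof -
    show "degree Aac = k" unfolding Aac_def A(1)[symmetric] by (rule degree_map_poly) auto
    then show "lead_coeff Aac = 1" using A by (simp add: Aac_def coeff_map_poly)
  qed
  have rts: "\<theta> ^ d = to_ac cg" if "\<theta> \<in># proots Aac" for \<theta>
  proof -
    have "Aac \<noteq> 0" using Aac by auto
    then have "poly Aac \<theta> = 0" using that by simp
    then have "poly (map_poly to_ac B) \<theta> = 0" unfolding B' tmult Aac_def by simp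
    then show ?thesis by (simp add: mB poly_monom)
  qed
  have a0: "poly Aac 0 ^ d = ((-1) ^ d * to_ac cg) ^ k"
  proof -
    have pd: "(\<Prod>\<theta>\<in>#M. - \<theta>) ^ d = (\<Prod>\<theta>\<in>#M. (- \<theta>) ^ d)" for M :: "'k poly fract alg_closure multiset"
      by (induction M) (simp_all add: power_mult_distrib del: mult_minus_left)
    have "poly Aac 0 = (\<Prod>\<theta>\<in>#proots Aac. - \<theta>)"
      by (subst prod_mset_linear(1)[OF Aac(2), symmetric])
        (simp add: poly_prod_mset image_mset.compositionality o_def)
    also have "\<dots> ^ d = (\<Prod>\<theta>\<in>#proots Aac. (- \<theta>) ^ d)"
      by (rule pd)
    also have "\<dots> = (\<Prod>\<theta>\<in>#proots Aac. (-1) ^ d * to_ac cg)"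
    proof (intro arg_cong[of _ _ prod_mset] image_mset_cong)
      fix \<theta> assume "\<theta> \<in># proots Aac"
      then show "(- \<theta>) ^ d = (-1) ^ d * to_ac cg" using rts[of \<theta>] by (simp add: power_minus[of \<theta>])
    qed
    also have "\<dots> = ((-1) ^ d * to_ac cg) ^ k"
      using prod_mset_linear(2)[OF Aac(2)] Aac(1) by simp
    finally show ?thesis .
  qed
  have k0: "k > 0"
  proof (rule ccontr)
    assume "\<not> k > 0"
    then have "degree A = 0" using A(1) by simp
    then obtain a where a: "A = [:a:]" by (rule degree_eq_zeroE)
    then have "A = [:1:]" using A(2) by simp
    then show False using rA by (simp add: map_poly_pCons)
  qed
  have "poly Aac 0 = to_ac (poly A 0)"
    by (simp add: Aac_def poly_0_coeff_0 coeff_map_poly)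
  then have "to_ac (poly A 0 ^ d) = to_ac (((-1) ^ d * cg) ^ k)" using a0 by simp
  then have eq: "poly A 0 ^ d = ((-1) ^ d * cg) ^ k" by (simp only: to_ac_eq_iff)
  obtain a b where ab: "poly A 0 = to_fract a / to_fract b" "b \<noteq> 0"
    by (cases "poly A 0" rule: Fract_cases) (auto simp: to_fract_def)
  have "to_fract (a ^ d * G ^ k) = to_fract ([:((-1) ^ d * c) ^ k:] * b ^ d)"
  proof -
    have tp: "to_fract (p ^ n) = to_fract p ^ n" for p :: "'k poly" and n by (induction n) auto
    have b0: "to_fract b \<noteq> 0" using ab by simp
    have "to_fract a ^ d / to_fract b ^ d = ((-1) ^ d * to_fract [:c:]) ^ k / to_fract G ^ k"
      using eq unfolding ab(1) cg_def by (simp add: power_divide)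
    then have "to_fract a ^ d * to_fract G ^ k = ((-1) ^ d * to_fract [:c:]) ^ k * to_fract b ^ d"
      using b0 G0 by (simp add: field_simps)
    moreover have "((-1) ^ d * to_fract [:c:]) ^ k = to_fract [:((-1) ^ d * c) ^ k:]"
    proof -
      have "[:((-1) ^ d * c) ^ k:] = ((-1) ^ d * [:c:]) ^ k"
        by (cases "even d") (simp_all add: poly_const_pow)
      then have "to_fract [:((-1) ^ d * c) ^ k:] = (to_fract ((-1) ^ d) * to_fract [:c:]) ^ k"
        by (simp only: tp to_fract_mult)
      moreover have "to_fract ((-1) ^ d :: 'k poly) = (-1) ^ d" by (cases "even d") simp_all
      ultimately show ?thesis by (simp only:)
    qed
    ultimately show ?thesis by (simp only: tp to_fract_mult)
  qed
  then have e2: "a ^ d * G ^ k = [:((-1) ^ d * c) ^ k:] * b ^ d" by (simp only: to_fract_eq_iff)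
  have cc: "((-1) ^ d * c) ^ k \<noteq> 0" using c by simp
  then have nz: "a ^ d * G ^ k \<noteq> 0" using ab(2) unfolding e2 by simp
  \<comment> \<open>The orders at \<beta> of both sides of a^d G^k = const * b^d are compared. By
    \<open>cond\<close> this forces d to divide k, although 0 < k < d.\<close>
  have "d dvd k * order \<beta> G" for \<beta>
  proof -
    have op: "order \<beta> (p ^ n) = n * order \<beta> p" if "p \<noteq> 0" for p :: "'k poly" and n
      using that by (induction n) (simp_all add: order_mult)
    have "a \<noteq> 0" using nz k0 kd by (cases "d = 0") (auto simp: power_0_left)
    then have "order \<beta> (a ^ d * G ^ k) = d * order \<beta> a + k * order \<beta> G"
      using G by (simp add: order_mult op)
    moreover have "order \<beta> ([:((-1) ^ d * c) ^ k:] * b ^ d) = d * order \<beta> b"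
      using ab(2) cc by (simp add: order_smult op)
    ultimately have "d * order \<beta> a + k * order \<beta> G = d * order \<beta> b" by (simp only: e2)
    then show ?thesis by (metis dvd_add_right_iff dvd_triv_left)
  qed
  then have "d dvd k" by (rule cond)
  then show False using k0 kd by (auto dest: dvd_imp_le)
qed

context frob
begin

lemma infinite_UNIV_k: "infinite (UNIV :: 'k set)"
proof
  assume fin: "finite (UNIV :: 'k set)"
  define n where "n = Suc (card (UNIV :: 'k set))"
  have "n < 2 ^ n" by (rule less_exp)
  also have "2 ^ n \<le> q ^ n" using q_gt_1 by (intro power_mono) auto
  also have "q ^ n = card (fixed n)" using card_fixed(2)[of n] by (simp add: n_def)
  also have "\<dots> \<le> card (UNIV :: 'k set)" using fin by (intro card_mono) auto
  finally show False by (simp add: n_def)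
qed

text \<open>Otherwise all d of the d-th roots of unity would be zeros of Z^(i mod d) - 1, whose
  degree is too small.\<close>

lemma ex_root_of_unity_power_ne_1:
  assumes d: "d > 0" and card: "card {\<zeta> \<in> fixed 1. \<zeta> ^ d = 1} = d" and i: "\<not> d dvd i"
  shows "\<exists>z\<in>fixed 1. z ^ d = 1 \<and> z ^ i \<noteq> 1"
proof (rule ccontr)
  assume "\<not> ?thesis"
  then have A: "z ^ i = 1" if "z \<in> fixed 1" "z ^ d = 1" for z using that by blast
  define i0 where "i0 = i mod d"
  have i0: "i0 > 0" "i0 < d" using i d by (auto simp: i0_def mod_greater_zero_iff_not_dvd)
  have B: "z ^ i0 = 1" if "z \<in> fixed 1" "z ^ d = 1" for z
  proof -
    have "z ^ (d * (i div d) + i mod d) = 1" using A[OF that] by simp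
    then show ?thesis using that(2) by (simp only: power_add power_mult i0_def power_one mult_1)
  qed
  have "coeff (monom 1 i0 - 1 :: 'k poly) i0 = 1" using i0 by simp
  then have p0: "monom 1 i0 - 1 \<noteq> (0 :: 'k poly)" by (metis coeff_0 zero_neq_one)
  have "d = card {\<zeta> \<in> fixed 1. \<zeta> ^ d = 1}" using card by simp
  also have "\<dots> \<le> card {w :: 'k. poly (monom 1 i0 - 1) w = 0}"
    using poly_roots_finite[OF p0] B by (intro card_mono) (auto simp: poly_monom)
  also have "\<dots> \<le> degree (monom 1 i0 - 1 :: 'k poly)" by (rule card_poly_roots_bound[OF p0])
  also have "\<dots> \<le> i0" by (intro degree_diff_le) (auto simp: degree_monom_le)
  finally show False using i0 by simp
qed

text \<open>The norm of P for the Kummer extension: the product of P(\<zeta> Y) over all d-th roots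
  of unity \<zeta>. Replacing Y by z Y permutes the factors, so only powers of Y^d survive, and Y^d
  is what can be evaluated without a root.\<close>

lemma kummer_norm:
  fixes P :: "'k poly poly" and d :: nat
  assumes d: "d dvd q - 1" "d > 0"
  defines "N \<equiv> (\<Prod>\<zeta> | \<zeta> \<in> fixed 1 \<and> \<zeta> ^ d = 1. pcompose P [:0, [:\<zeta>:]:])"
  assumes card: "card {\<zeta> \<in> fixed 1. \<zeta> ^ d = 1} = d"
    and P: "degree P < d" "inner_degree_le P n"
  shows "P dvd N" "inner_degree_le N (d * n)" "degree N \<le> d * (d - 1)"
    "\<And>i. \<not> d dvd i \<Longrightarrow> coeff N i = 0"
proof -
  define W where "W = {\<zeta> \<in> fixed 1. \<zeta> ^ d = 1}"
  have fin: "finite W" using card_fixed(1)[of 1] by (simp add: W_def)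
  have N: "N = (\<Prod>\<zeta>\<in>W. pcompose P [:0, [:\<zeta>:]:])" by (simp add: N_def W_def)
  have one: "1 \<in> W" by (simp add: W_def)
  have "pcompose P [:0, [:1:]:] = P"
    by (metis one_pCons pcompose_idR)
  then show "P dvd N" unfolding N using dvd_prodI[OF fin one, of "\<lambda>\<zeta>. pcompose P [:0, [:\<zeta>:]:]"] by simp
  have inn: "inner_degree_le (pcompose P [:0, [:\<zeta>:]:]) n" for \<zeta>
    using P(2) unfolding inner_degree_le_def coeff_pcompose_linear
    by (auto simp: poly_const_pow intro: order_trans[OF degree_smult_le])
  have "inner_degree_le (\<Prod>\<zeta>\<in>V. pcompose P [:0, [:\<zeta>:]:]) (card V * n)" if "finite V" for V
    using that
  proof (induction V rule: finite_induct)
    case (insert \<zeta> V)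
    then show ?case using inner_degree_le_mult[OF inn insert.IH] by simp
  qed simp
  from this[OF fin] show "inner_degree_le N (d * n)" using card by (simp add: N W_def)
  have "degree N \<le> sum (degree \<circ> (\<lambda>\<zeta>. pcompose P [:0, [:\<zeta>:]:])) W"
    unfolding N by (rule degree_prod_sum_le[OF fin])
  also have "\<dots> \<le> (\<Sum>\<zeta>\<in>W. d - 1)"
  proof (rule sum_mono)
    fix \<zeta>
    have "degree (pcompose P [:0, [:\<zeta>:]:]) \<le> degree P * degree [:0, [:\<zeta>:]:]"
      by (rule degree_pcompose_le)
    also have "\<dots> \<le> degree P * 1" by (intro mult_le_mono2) simp
    finally show "(degree \<circ> (\<lambda>\<zeta>. pcompose P [:0, [:\<zeta>:]:])) \<zeta> \<le> d - 1" using P(1) by simp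
  qed
  also have "\<dots> = d * (d - 1)" using card by (simp add: W_def)
  finally show "degree N \<le> d * (d - 1)" .
  fix i assume i: "\<not> d dvd i"
  obtain z where z: "z \<in> W" "z ^ i \<noteq> 1"
    using ex_root_of_unity_power_ne_1[OF d(2) card i] by (auto simp: W_def)
  have z0: "z \<noteq> 0" using z d by (auto simp: W_def power_0_left)
  have "pcompose N [:0, [:z:]:] = (\<Prod>\<zeta>\<in>W. pcompose P [:0, [:z * \<zeta>:]:])"
  proof -
    have "pcompose (pcompose P [:0, [:\<zeta>:]:]) [:0, [:z:]:] = pcompose P [:0, [:z * \<zeta>:]:]" for \<zeta>
      by (rule poly_eqI) (simp add: coeff_pcompose_linear poly_const_pow power_mult_distrib mult.commute)
    then show ?thesis unfolding N pcompose_prod by simp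
  qed
  also have "\<dots> = N" unfolding N
    by (rule prod.reindex_bij_witness[of _ "\<lambda>\<zeta>. \<zeta> / z" "\<lambda>\<zeta>. z * \<zeta>"])
      (use z z0 in \<open>auto simp: W_def power_mult_distrib power_divide intro: fixed_mult fixed_divide\<close>)
  finally have "coeff (pcompose N [:0, [:z:]:]) i = coeff N i" by simp
  then have "smult (z ^ i) (coeff N i) = coeff N i"
    by (simp add: coeff_pcompose_linear poly_const_pow)
  then have "smult (z ^ i - 1) (coeff N i) = 0" by (simp add: smult_diff_left)
  then show "coeff N i = 0" using z(2) by simp
qed

end

lemma poly_eq_sum_multiples:
  fixes p :: "'a::comm_ring_1 poly"
  assumes "degree p \<le> d * (d - 1)" "\<And>i. \<not> d dvd i \<Longrightarrow> coeff p i = 0" "d > 0"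
  shows "poly p x = (\<Sum>k<d. coeff p (d * k) * x ^ (d * k))"
proof -
  have "poly p x = (\<Sum>i\<le>degree p. coeff p i * x ^ i)" by (rule poly_altdef)
  also have "\<dots> = (\<Sum>i\<in>times d ` {..<d}. coeff p i * x ^ i)"
  proof (rule sum.mono_neutral_cong)
    fix i assume i: "i \<in> {..degree p} - times d ` {..<d}"
    have "\<not> d dvd i"
    proof
      assume "d dvd i"
      then obtain k where k: "i = d * k" by auto
      have "i \<le> degree p" using i by simp
      then have "d * k \<le> d * (d - 1)" using assms(1) unfolding k by (rule order_trans)
      then have "k \<le> d - 1" using assms(3) by (simp only: nat_mult_le_cancel1)
      then have "k < d" using assms(3) by linarith
      then show False using i k by auto
    qed
    then show "coeff p i * x ^ i = 0" by (simp add: assms(2))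
  qed (auto simp: coeff_eq_0)
  also have "\<dots> = (\<Sum>k<d. coeff p (d * k) * x ^ (d * k))"
    using assms(3) by (subst sum.reindex) (auto simp: inj_on_def)
  finally show ?thesis .
qed

lemma poly_eq_sum_atMost:
  fixes p :: "'a::comm_ring_1 poly"
  assumes "degree p \<le> n"
  shows "poly p x = (\<Sum>i\<le>n. coeff p i * x ^ i)"
  unfolding poly_altdef using assms by (intro sum.mono_neutral_left) (auto simp: coeff_eq_0)

text \<open>Modulo (x - x0)^Q the power x^Q becomes a constant, so a relation becomes P(b) = 0 with
  P of degree below d and coefficients of degree below \<delta>. The norm of P involves only b^d,
  and G b^d = G^Q is constant modulo (x - x0)^Q as well. Clearing denominators leaves a polynomial
  \<nu> of degree below Q divisible by (x - x0)^Q, so \<nu> = 0 identically. Read in the closure of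
  K(x), this says that P vanishes at a d-th root of c / G, contrary to
  \<open>kummer_no_small_relation\<close>.\<close>

lemma (in frob) kummer_independent:
  fixes G :: "'k poly" and c :: "nat \<times> nat \<times> nat \<times> nat \<Rightarrow> 'k"
  assumes G: "G \<noteq> 0" and d: "d dvd q - 1" "d > 0"
    and card: "card {\<zeta> \<in> fixed 1. \<zeta> ^ d = 1} = d"
    and cond: "\<And>k. (\<And>\<beta>. d dvd k * order \<beta> G) \<Longrightarrow> d dvd k"
    and sum: "(\<Sum>(i, l, j, k)\<in>{..<1} \<times> {..<d} \<times> {..<J} \<times> {..<q ^ (2 * h) div (1 * d) - degree G}.
        smult (c (i, l, j, k))
        ([:0, 1:] ^ (k + j * q ^ (2 * h)) * trace_poly 0 (2 * h) ^ i * (G ^ ((q ^ (2 * h) - 1) div d)) ^ l)) = 0"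
  shows "\<forall>\<iota>\<in>{..<1} \<times> {..<d} \<times> {..<J} \<times> {..<q ^ (2 * h) div (1 * d) - degree G}. c \<iota> = 0"
proof (rule ccontr)
  define Q where "Q = q ^ (2 * h)"
  define g where "g = degree G"
  define \<delta> where "\<delta> = Q div (1 * d) - g"
  assume "\<not> ?thesis"
  then obtain l0 j0 k0 where c0: "l0 < d" "j0 < J" "k0 < \<delta>" "c (0, l0, j0, k0) \<noteq> 0"
    unfolding \<delta>_def g_def Q_def by auto
  have dg: "d * \<delta> + d * g \<le> Q"
  proof -
    have "\<delta> + g = Q div d" using c0(3) by (simp add: \<delta>_def)
    then have "d * (\<delta> + g) \<le> Q" by simp
    then show ?thesis by (simp only: distrib_left)
  qed
  have Qpos: "Q > 0" using q_gt_1 by (simp add: Q_def)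
  define pX where "pX = (\<Sum>j<J. monom (c (0, l0, j, k0)) j)"
  have "coeff pX j0 = c (0, l0, j0, k0)"
    using c0 by (simp add: pX_def coeff_sum)
  then have pX0: "pX \<noteq> 0" using c0 by auto
  have injQ: "inj (\<lambda>x :: 'k. x ^ Q)" using frob_inj unfolding Q_def by (auto simp: inj_def)
  \<comment> \<open>The point x0 must keep P nonzero after x^Q is replaced by its value, and must
    avoid the zeros of G so that the constant \<open>cG\<close> is nonzero.\<close>
  have "finite ((\<lambda>x :: 'k. x ^ Q) -` {y. poly pX y = 0} \<union> {x. poly G x = 0})"
    using finite_vimageI[OF poly_roots_finite[OF pX0] injQ] poly_roots_finite[OF G] by simp
  from ex_new_if_finite[OF infinite_UNIV_k this] obtain x0 where x0: "poly pX (x0 ^ Q) \<noteq> 0" "poly G x0 \<noteq> 0" by auto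
  define X0 where "X0 = x0 ^ Q"
  define s where "s l = (\<Sum>j<J. \<Sum>k<\<delta>. monom (c (0, l, j, k) * X0 ^ j) k)" for l
  define P where "P = (\<Sum>l<d. monom (s l) l)"
  have cP: "coeff P l = (if l < d then s l else 0)" for l
    by (simp add: P_def coeff_sum)
  have cs: "coeff (s l) k = (if k < \<delta> then \<Sum>j<J. c (0, l, j, k) * X0 ^ j else 0)" for l k
    by (simp add: s_def coeff_sum)
  have dP: "degree P < d"
    using d(2) by (intro le_less_trans[OF degree_le[of "d - 1"]]) (auto simp: cP)
  have "coeff (coeff P l0) k0 = poly pX X0"
    using c0 by (simp add: cP cs pX_def poly_sum poly_monom)
  then have P0: "P \<noteq> 0" using x0(1) by (auto simp: X0_def)
  have ds: "degree (s l) \<le> \<delta> - 1" for l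
    by (rule degree_le) (auto simp: cs)
  have inP: "inner_degree_le P (\<delta> - 1)"
    using ds by (auto simp: inner_degree_le_def cP)
  define b where "b = G ^ ((Q - 1) div d)"
  define z where "z = [:-x0, 1:] ^ Q"
  have zQ: "z dvd p ^ Q - [:poly p x0 ^ Q:]" for p
  proof -
    have "p ^ Q - [:poly p x0 ^ Q:] = (p - [:poly p x0:]) ^ Q"
      unfolding Q_def by (simp add: frob_diff_poly poly_const_pow)
    then show ?thesis unfolding z_def using dvd_diff_eval[of x0 p] by (simp add: dvd_power_same)
  qed
  have zPb: "z dvd poly P b"
  proof -
    have zx: "z dvd [:0, 1:] ^ Q - [:X0:]" using zQ[of "[:0, 1:]"] by (simp add: X0_def)
    have "poly P b = (\<Sum>l<d. \<Sum>j<J. \<Sum>k<\<delta>. monom (c (0, l, j, k) * X0 ^ j) k * b ^ l)"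
      by (simp add: P_def poly_sum poly_monom s_def sum_distrib_right)
    moreover have "(\<Sum>l<d. \<Sum>j<J. \<Sum>k<\<delta>. smult (c (0, l, j, k)) ([:0, 1:] ^ (k + j * Q) * b ^ l)) = 0"
      using sum unfolding Q_def[symmetric] g_def[symmetric] \<delta>_def[symmetric] b_def[symmetric]
      by (simp add: sum.cartesian_product[symmetric] lessThan_Suc)
    moreover have "z dvd (\<Sum>l<d. \<Sum>j<J. \<Sum>k<\<delta>. monom (c (0, l, j, k) * X0 ^ j) k * b ^ l) -
        (\<Sum>l<d. \<Sum>j<J. \<Sum>k<\<delta>. smult (c (0, l, j, k)) ([:0, 1:] ^ (k + j * Q) * b ^ l))"
    proof (intro dvd_diff_sum)
      fix l j k
      have "z dvd ([:0, 1:] ^ Q) ^ j - [:X0:] ^ j" by (rule dvd_diff_power[OF zx])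
      then have "z dvd [:c (0, l, j, k):] * [:0, 1:] ^ k * b ^ l * (([:0, 1:] ^ Q) ^ j - [:X0:] ^ j)" by (rule dvd_mult)
      then have "z dvd - ([:c (0, l, j, k):] * [:0, 1:] ^ k * b ^ l * (([:0, 1:] ^ Q) ^ j - [:X0:] ^ j))" by simp
      also have "- ([:c (0, l, j, k):] * [:0, 1:] ^ k * b ^ l * (([:0, 1:] ^ Q) ^ j - [:X0:] ^ j)) =
         [:c (0, l, j, k):] * [:X0:] ^ j * [:0, 1:] ^ k * b ^ l - [:c (0, l, j, k):] * ([:0, 1:] ^ k * ([:0, 1:] ^ Q) ^ j * b ^ l)"
        unfolding right_diff_distrib minus_diff_eq by (simp only: mult_ac)
      also have "[:c (0, l, j, k):] * [:X0:] ^ j * [:0, 1:] ^ k = monom (c (0, l, j, k) * X0 ^ j) k"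
        by (simp add: monom_altdef poly_const_pow mult.commute)
      also have "[:c (0, l, j, k):] * ([:0, 1:] ^ k * ([:0, 1:] ^ Q) ^ j * b ^ l) =
          smult (c (0, l, j, k)) ([:0, 1:] ^ (k + j * Q) * b ^ l)"
        by (simp add: power_add mult.commute[of j] power_mult)
      finally show "z dvd monom (c (0, l, j, k) * X0 ^ j) k * b ^ l -
          smult (c (0, l, j, k)) ([:0, 1:] ^ (k + j * Q) * b ^ l)" .
    qed
    ultimately show ?thesis by simp
  qed
  define N where "N = (\<Prod>\<zeta> | \<zeta> \<in> fixed 1 \<and> \<zeta> ^ d = 1. pcompose P [:0, [:\<zeta>:]:])"
  note Nprops = kummer_norm[OF d card dP inP, folded N_def]
  have zN: "z dvd poly N b"
  proof -
    obtain M where "N = P * M" using Nprops(1) by auto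
    then show ?thesis using zPb by simp
  qed
  define cG where "cG = poly G x0 ^ Q"
  have cG0: "cG \<noteq> 0" using x0 by (simp add: cG_def)
  have Gbd: "G * b ^ d = G ^ Q"
  proof -
    have "q - 1 dvd Q - 1" unfolding Q_def using q_gt_1 by (intro pred_dvd_power_pred) simp
    then have "d dvd Q - 1" using d dvd_trans by blast
    then have "(Q - 1) div d * d = Q - 1" by simp
    then have "G * b ^ d = G ^ Suc (Q - 1)" by (simp add: b_def flip: power_mult)
    then show ?thesis using Qpos by simp
  qed
  \<comment> \<open>G^(d - 1) times the norm at b, with G b^d replaced by its constant value; k < d
    ensures that the power of G suffices for every term.\<close>
  define \<nu> where "\<nu> = (\<Sum>k<d. coeff N (d * k) * G ^ (d - 1 - k) * [:cG:] ^ k)"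
  have "z dvd G ^ (d - 1) * poly N b - \<nu>"
  proof -
    have pN: "poly N b = (\<Sum>k<d. coeff N (d * k) * b ^ (d * k))"
      by (rule poly_eq_sum_multiples[OF Nprops(3) _ d(2)]) (rule Nprops(4))
    have "G ^ (d - 1) * poly N b = (\<Sum>k<d. coeff N (d * k) * G ^ (d - 1 - k) * (G * b ^ d) ^ k)"
      unfolding pN sum_distrib_left
    proof (rule sum.cong[OF refl])
      fix k assume "k \<in> {..<d}"
      then have "d - 1 = (d - 1 - k) + k" by simp
      then have "G ^ (d - 1) = G ^ (d - 1 - k) * G ^ k" by (metis power_add)
      then show "G ^ (d - 1) * (coeff N (d * k) * b ^ (d * k)) =
          coeff N (d * k) * G ^ (d - 1 - k) * (G * b ^ d) ^ k"
        by (simp add: power_mult power_mult_distrib mult_ac)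
    qed
    moreover have "z dvd (\<Sum>k<d. coeff N (d * k) * G ^ (d - 1 - k) * (G * b ^ d) ^ k) - \<nu>"
      unfolding \<nu>_def
    proof (rule dvd_diff_sum)
      fix k
      have "z dvd G * b ^ d - [:cG:]" unfolding Gbd cG_def by (rule zQ)
      then show "z dvd coeff N (d * k) * G ^ (d - 1 - k) * (G * b ^ d) ^ k -
          coeff N (d * k) * G ^ (d - 1 - k) * [:cG:] ^ k"
        by (intro dvd_diff_mult[OF _ dvd_diff_power]) auto
    qed
    ultimately show ?thesis by simp
  qed
  moreover have "z dvd G ^ (d - 1) * poly N b" using zN by (rule dvd_mult)
  ultimately have z\<nu>: "z dvd \<nu>" by (metis dvd_diff_right_iff dvd_diff diff_diff_eq2 add_diff_cancel_left')
  have "\<nu> = 0"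
  proof (rule ccontr)
    assume \<nu>: "\<nu> \<noteq> 0"
    have "Q = degree z" unfolding z_def by (simp add: degree_power_eq)
    also have "\<dots> \<le> degree \<nu>" using z\<nu> \<nu> by (rule dvd_imp_degree_le)
    also have "\<dots> \<le> d * (\<delta> - 1) + (d - 1) * g"
      unfolding \<nu>_def
    proof (rule degree_sum_le)
      fix k assume "k \<in> {..<d}"
      have "degree (coeff N (d * k) * G ^ (d - 1 - k) * [:cG:] ^ k) \<le>
          degree (coeff N (d * k)) + degree (G ^ (d - 1 - k)) + degree ([:cG:] ^ k)"
        by (intro order_trans[OF degree_mult_le] add_mono degree_mult_le order_refl)
      also have "\<dots> \<le> d * (\<delta> - 1) + (d - 1 - k) * g + 0"
        using Nprops(2) by (intro add_mono) (auto simp: inner_degree_le_def poly_const_pow degree_power_eq[OF G] g_def)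
      also have "\<dots> \<le> d * (\<delta> - 1) + (d - 1) * g"
        using mult_le_mono1[of "d - 1 - k" "d - 1" g] by linarith
      finally show "degree (coeff N (d * k) * G ^ (d - 1 - k) * [:cG:] ^ k) \<le>
          d * (\<delta> - 1) + (d - 1) * g" .
    qed simp
    also have "\<dots> < d * \<delta> + d * g"
      using c0(3) d(2) by (intro add_less_le_mono) auto
    finally show False using dg by simp
  qed
  \<comment> \<open>From here on b is replaced by a true solution of G z0^d = cG. The identity \<nu>
    = 0 has no modulus and so transfers.\<close>
  obtain z0 :: "'k poly fract alg_closure" where z0: "z0 ^ d = ratfun [:cG:] / ratfun G"
    using nth_root_exists[of d "ratfun [:cG:] / ratfun G"] d(2) by blast
  have rG: "ratfun G \<noteq> 0" using G by simp
  have dm: "degree (map_poly ratfun p) = degree p" for p :: "'k poly poly"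
    by (rule degree_map_poly) auto
  have "poly (map_poly ratfun N) z0 = (\<Sum>k<d. coeff (map_poly ratfun N) (d * k) * z0 ^ (d * k))"
    by (rule poly_eq_sum_multiples) (use Nprops(3,4) d(2) in \<open>auto simp: coeff_map_poly dm\<close>)
  also have "ratfun G ^ (d - 1) * \<dots> = ratfun \<nu>"
    unfolding \<nu>_def ratfun_sum sum_distrib_left
  proof (rule sum.cong[OF refl])
    fix k assume "k \<in> {..<d}"
    then have "d - 1 = (d - 1 - k) + k" by simp
    then have e: "ratfun G ^ (d - 1) = ratfun G ^ (d - 1 - k) * ratfun G ^ k" by (metis power_add)
    have "ratfun G ^ k * z0 ^ (d * k) = ratfun [:cG:] ^ k"
      using rG by (simp add: power_mult z0 power_divide)
    then show "ratfun G ^ (d - 1) * (coeff (map_poly ratfun N) (d * k) * z0 ^ (d * k)) =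
        ratfun (coeff N (d * k) * G ^ (d - 1 - k) * [:cG:] ^ k)"
      unfolding e by (simp add: coeff_map_poly mult_ac)
  qed
  finally have "poly (map_poly ratfun N) z0 = 0" using \<open>\<nu> = 0\<close> rG by simp
  then have "(\<Prod>\<zeta> | \<zeta> \<in> fixed 1 \<and> \<zeta> ^ d = 1. poly (map_poly ratfun (pcompose P [:0, [:\<zeta>:]:])) z0) = 0"
    unfolding N_def by (subst (asm) poly_map_poly_prod_hom) auto
  then obtain \<zeta> where \<zeta>: "\<zeta> ^ d = 1" "poly (map_poly ratfun (pcompose P [:0, [:\<zeta>:]:])) z0 = 0"
    by (auto simp: prod_zero_iff card_fixed)
  define y where "y = ratfun [:\<zeta>:] * z0"
  have "poly (map_poly ratfun P) y = poly (map_poly ratfun (pcompose P [:0, [:\<zeta>:]:])) z0"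
  proof -
    have dp: "degree (pcompose P [:0, [:\<zeta>:]:]) \<le> d"
    proof -
      have "degree (pcompose P [:0, [:\<zeta>:]:]) \<le> degree P * degree [:0, [:\<zeta>:]:]"
        by (rule degree_pcompose_le)
      also have "\<dots> \<le> degree P * 1" by (intro mult_le_mono2) simp
      finally show ?thesis using dP by simp
    qed
    have e1: "poly (map_poly ratfun P) y = (\<Sum>i\<le>d. coeff (map_poly ratfun P) i * y ^ i)"
      using dP by (intro poly_eq_sum_atMost) (simp add: dm)
    have e2: "poly (map_poly ratfun (pcompose P [:0, [:\<zeta>:]:])) z0 =
        (\<Sum>i\<le>d. coeff (map_poly ratfun (pcompose P [:0, [:\<zeta>:]:])) i * z0 ^ i)"
      using dp by (intro poly_eq_sum_atMost) (simp add: dm)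
    show ?thesis unfolding e1 e2
      by (intro sum.cong refl) (simp add: coeff_map_poly coeff_pcompose_linear y_def power_mult_distrib mult_ac del: mult_pCons_left)
  qed
  then have "poly (map_poly ratfun P) y = 0" using \<zeta> by simp
  moreover have "y ^ d * ratfun G = ratfun [:cG:]"
  proof -
    have "ratfun [:\<zeta>:] ^ d = ratfun ([:\<zeta>:] ^ d)" by simp
    also have "[:\<zeta>:] ^ d = 1" by (simp only: poly_const_pow \<zeta> one_pCons)
    finally have "ratfun [:\<zeta>:] ^ d = 1" by simp
    then show ?thesis using rG by (simp add: y_def power_mult_distrib z0)
  qed
  ultimately show False using kummer_no_small_relation[OF G cG0 cond P0 dP, of y] by blast
qed

section \<open>Square-root cancellation\<close>

lemma sum_order_eq_degree:
  fixes G :: "'a::alg_closed_field poly"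
  assumes "G \<noteq> 0"
  shows "(\<Sum>\<beta>\<in>{x. poly G x = 0}. order \<beta> G) = degree G"
proof -
  define l where "l = lead_coeff G"
  have l: "l \<noteq> 0" using assms by (simp add: l_def)
  have "lead_coeff (smult (1 / l) G) = 1" using l by (simp add: l_def)
  from prod_mset_linear(2)[OF this] have "size (proots G) = degree G" using l by simp
  then show ?thesis using assms by (simp add: size_multiset_overloaded_eq)
qed

context frob_chars
begin

lemma chi_unity_sum:
  assumes d: "d dvd q - 1" "d > 0" and e: "\<not> d dvd e"
  shows "(\<Sum>w | w \<in> fixed 1 \<and> w ^ d = 1. \<chi> (w ^ e)) = 0"
proof -
  obtain z where z: "z \<in> fixed 1" "z ^ d = 1" "z ^ e \<noteq> 1"
    using ex_root_of_unity_power_ne_1[OF d(2) card_roots_of_unity[OF d] e] by blast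
  have z0: "z \<noteq> 0" using z(2) d(2) by (auto simp: power_0_left)
  have "\<chi> (z ^ e) \<noteq> 1" using chi_faithful[OF fixed_power[OF z(1)], of e] z z0 by auto
  moreover have "(\<Sum>w | w \<in> fixed 1 \<and> w ^ d = 1. \<chi> (w ^ e)) = \<chi> (z ^ e) * (\<Sum>w | w \<in> fixed 1 \<and> w ^ d = 1. \<chi> (w ^ e))"
  proof -
  have "(\<Sum>w | w \<in> fixed 1 \<and> w ^ d = 1. \<chi> (w ^ e)) = (\<Sum>w | w \<in> fixed 1 \<and> w ^ d = 1. \<chi> ((z * w) ^ e))"
    by (rule sum.reindex_bij_witness[of _ "\<lambda>w. z * w" "\<lambda>w. w / z"])
      (use z z0 in \<open>auto simp: power_mult_distrib power_divide intro: fixed_mult fixed_divide\<close>)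
  also have "\<dots> = \<chi> (z ^ e) * (\<Sum>w | w \<in> fixed 1 \<and> w ^ d = 1. \<chi> (w ^ e))"
    unfolding sum_distrib_left using z
    by (intro sum.cong refl) (simp add: power_mult_distrib chi_mult[OF fixed_power fixed_power])
  finally show ?thesis .
  qed
  ultimately show ?thesis by (simp only: mult_cancel_right1) simp
qed

text \<open>The points are sorted by the trace of u even when s = 0, so that one independence
  statement, by degrees, serves all s. Vanishing of the L-coefficients comes from the additive shift
  if s is nonzero and from the multiplicative one otherwise. Taking \<rho> = G bounds the number of
  roots independently of e.\<close>

theorem weil_mixed:
  assumes u: "fpoly u" "0 < degree u" "degree u < CHAR('k)"
    and G: "fpoly G" "G \<noteq> 0" and d: "d dvd q - 1" "d > 0" and cop: "coprime (degree G) d"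
    and e: "e > 0" and s: "s \<in> fixed 1" and nontriv: "s \<noteq> 0 \<or> \<not> d dvd e"
  shows "norm (\<Sum>x\<in>fixed 1. \<psi> (s * poly u x) * \<chi> (poly G x ^ (e * ((q - 1) div d))))
    \<le> real (degree u + degree G) * sqrt (real q)"
proof -
  define e' where "e' = e * ((q - 1) div d)"
  have e'0: "e' > 0" using e d dvd_imp_le[OF d(1)] q_gt_1 by (auto simp: e'_def div_greater_zero_iff)
  have "(\<Sum>t\<in>fixed 1. \<psi> (s * t)) * (\<Sum>w | w \<in> fixed 1 \<and> w ^ d = 1. \<chi> (w ^ e)) = 0"
    using nontriv psi_sum[OF s] chi_unity_sum[OF d] by auto
  from csum_sqrt_growth[OF u(1) G d e s disjI1[OF conjI[OF refl refl]] _ this, of 1 "degree G"]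
    slots_independent[OF u(2,3) G(2) d cop]
  obtain C H where growth: "\<And>h. h \<ge> H \<Longrightarrow> norm (csum (smult s u) (G ^ e') (2 * h)) \<le> C * real q ^ h"
    unfolding e'_def by blast
  have van: "(\<Sum>M\<in>invmsets k. wt (smult s u) (G ^ e') M) = 0"
    if k: "k \<ge> degree u + degree G" for k
  proof (cases "s = 0")
    case False
    show ?thesis
      by (rule additive_coefficient_vanishes[where \<rho> = G and m = "degree u"])
        (use False u G s k in \<open>auto intro: fpoly_smult fpoly_power\<close>)
  next
    case True
    then have de: "\<not> d dvd e" using nontriv by simp
    \<comment> \<open>The orders of G add up to deg G, which is coprime to d. If d divided e times
      each of them, it would divide e.\<close>
    obtain \<beta> where \<beta>: "\<not> d dvd e * order \<beta> G"
    proof (rule ccontr)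
      assume "\<not> thesis"
      then have "d dvd e * order \<beta> G" for \<beta> using \<open>\<And>\<beta>. \<not> d dvd e * order \<beta> G \<Longrightarrow> thesis\<close> by blast
      then have "d dvd (\<Sum>\<beta>\<in>{x. poly G x = 0}. e * order \<beta> G)" by (intro dvd_sum)
      then have "d dvd e * degree G"
        using sum_order_eq_degree[OF G(2)] by (simp flip: sum_distrib_left)
      then show False using de cop by (simp add: coprime_dvd_mult_left_iff coprime_commute)
    qed
    have "\<not> (q - 1) dvd order \<beta> (G ^ e')"
    proof
      assume A: "(q - 1) dvd order \<beta> (G ^ e')"
      obtain e1 where e1: "q - 1 = d * e1" using d by auto
      have "e1 > 0" using e1 q_gt_1 by (cases e1) auto
      have "order \<beta> (G ^ n) = n * order \<beta> G" for n
        using G(2) by (induction n) (simp_all add: order_mult)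
      then have "order \<beta> (G ^ e') = e * order \<beta> G * e1"
        using e1 d(2) by (simp add: e'_def mult_ac)
      then have "d * e1 dvd (e * order \<beta> G) * e1" using A e1 by simp
      then show False using \<beta> \<open>e1 > 0\<close> by simp
    qed
    then have "(\<Sum>M\<in>invmsets k. wt 0 (G ^ e') M) = 0"
      by (intro multiplicative_coefficient_vanishes[where \<rho> = G and \<beta> = \<beta>])
        (use G k in \<open>auto intro: fpoly_power\<close>)
    then show ?thesis using True by simp
  qed
  have "norm (\<Sum>x\<in>fixed 1. \<psi> (poly (smult s u) x) * \<chi> (poly (G ^ e') x))
      \<le> real (degree u + degree G) * sqrt (real q)"
    using fpoly_smult[OF s u(1)] fpoly_power[OF G(1)] van growth by (rule csum_bound)
  then show ?thesis by (simp add: e'_def)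
qed

text \<open>G will be a product f^a g^b with exponents of the size of q, whereas \<rho> = f g has
  bounded degree; deg G enters only the growth constant. The condition \<open>cond\<close> says that
  no G^k with d not dividing k has all its orders divisible by d, which is what Kummer theory
  requires.\<close>

theorem weil_multiplicative:
  assumes G: "fpoly G" "G \<noteq> 0" and \<rho>: "fpoly \<rho>" "\<rho> \<noteq> 0" "\<And>x. poly G x = 0 \<Longrightarrow> poly \<rho> x = 0"
    and d: "d dvd q - 1" "d > 1"
    and cond: "\<And>k. (\<And>\<beta>. d dvd k * order \<beta> G) \<Longrightarrow> d dvd k"
  shows "norm (\<Sum>x\<in>fixed 1. \<chi> (poly G x ^ ((q - 1) div d))) \<le> real (degree \<rho>) * sqrt (real q)"
proof -
  define e' where "e' = (q - 1) div d"
  have d0: "d > 0" using d by simp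
  have e'0: "e' > 0" using d dvd_imp_le[OF d(1)] q_gt_1 by (auto simp: e'_def div_greater_zero_iff)
  have nd1: "\<not> d dvd 1" using d by auto
  have zero: "(\<Sum>t\<in>{0}. \<psi> (0 * t)) * (\<Sum>w | w \<in> fixed 1 \<and> w ^ d = 1. \<chi> (w ^ 1)) = 0"
    using chi_unity_sum[OF d(1) d0 nd1] by simp
  obtain C H where growth: "\<And>h. h \<ge> H \<Longrightarrow> norm (csum 0 (G ^ e') (2 * h)) \<le> C * real q ^ h"
    using csum_sqrt_growth[OF fpoly_0 G d(1) d0 zero_less_one fixed_0 disjI2[OF conjI[OF refl conjI[OF refl refl]]] _ zero, of 0 "degree G"]
      kummer_independent[OF G(2) d(1) d0 card_roots_of_unity[OF d(1) d0] cond]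
    unfolding e'_def smult_0_right mult_1 by blast
  obtain \<beta> where \<beta>: "\<not> d dvd order \<beta> G" using cond[of 1] nd1 by auto
  have "\<not> (q - 1) dvd order \<beta> (G ^ e')"
  proof
    assume A: "(q - 1) dvd order \<beta> (G ^ e')"
    have "order \<beta> (G ^ n) = n * order \<beta> G" for n
      using G(2) by (induction n) (simp_all add: order_mult)
    moreover have "q - 1 = e' * d" using d by (simp add: e'_def)
    ultimately have "e' * d dvd e' * order \<beta> G" using A by simp
    then show False using \<beta> e'0 by simp
  qed
  then have van: "(\<Sum>M\<in>invmsets k. wt 0 (G ^ e') M) = 0" if "k \<ge> degree \<rho>" for k
    by (intro multiplicative_coefficient_vanishes[where \<rho> = \<rho> and \<beta> = \<beta>])
      (use G \<rho> that e'0 in \<open>auto intro: fpoly_power\<close>)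
  have "norm (\<Sum>x\<in>fixed 1. \<psi> (poly 0 x) * \<chi> (poly (G ^ e') x)) \<le> real (degree \<rho>) * sqrt (real q)"
    using fpoly_0 fpoly_power[OF G(1)] van growth by (rule csum_bound)
  then show ?thesis by (simp add: e'_def psi_0)
qed

end

section \<open>Incidence bounds\<close>

lemma cauchy_schwarz_sum:
  fixes a b :: "'a \<Rightarrow> real"
  shows "(\<Sum>i\<in>A. a i * b i)\<^sup>2 \<le> (\<Sum>i\<in>A. (a i)\<^sup>2) * (\<Sum>i\<in>A. (b i)\<^sup>2)"
proof (cases "finite A")
  case fin: True
  define x y z where "x = (\<Sum>i\<in>A. (a i)\<^sup>2)" and "y = (\<Sum>i\<in>A. (b i)\<^sup>2)" and "z = (\<Sum>i\<in>A. a i * b i)"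
  have x0: "x \<ge> 0" by (simp add: x_def sum_nonneg)
  show ?thesis
  proof (cases "x = 0")
    case True
    then have "\<forall>i\<in>A. a i = 0" using fin by (simp add: x_def sum_nonneg_eq_0_iff)
    then show ?thesis by (simp add: sum_nonneg)
  next
    case False
    define t where "t = z / x"
    have "0 \<le> (\<Sum>i\<in>A. (t * a i - b i)\<^sup>2)" by (simp add: sum_nonneg)
    also have "\<dots> = (\<Sum>i\<in>A. t\<^sup>2 * (a i)\<^sup>2 - 2 * t * (a i * b i) + (b i)\<^sup>2)"
      by (intro sum.cong refl) (simp add: power2_eq_square algebra_simps)
    also have "\<dots> = t\<^sup>2 * x - 2 * t * z + y"
      by (simp only: sum.distrib sum_subtractf sum_distrib_left x_def y_def z_def)
    also have "\<dots> = y - z\<^sup>2 / x" using False by (simp add: t_def field_simps power2_eq_square)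
    finally have "z\<^sup>2 / x \<le> y" by simp
    then have "z\<^sup>2 \<le> x * y" using False x0 by (simp add: pos_divide_le_eq mult.commute)
    then show ?thesis by (simp add: x_def y_def z_def)
  qed
qed simp

text \<open>A finite group H with operation \<open>opn\<close>, its characters e(s, -) for s in
  \<Gamma>, and the trivial one at s0; the last clause is column orthogonality. This form treats the
  additive and the multiplicative group uniformly, although their characters are indexed
  differently.\<close>

definition dual_family :: "'s set \<Rightarrow> 'h set \<Rightarrow> ('s \<Rightarrow> 'h \<Rightarrow> complex) \<Rightarrow> ('h \<Rightarrow> 'h \<Rightarrow> 'h) \<Rightarrow> 's \<Rightarrow> bool" where
  "dual_family \<Gamma> H e opn s0 \<longleftrightarrow> finite \<Gamma> \<and> finite H \<and> H \<noteq> {} \<and> s0 \<in> \<Gamma> \<and> (\<forall>y\<in>H. e s0 y = 1) \<and>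
     (\<forall>y\<in>H. \<forall>b\<in>H. opn y b \<in> H \<and> (\<forall>s\<in>\<Gamma>. e s (opn y b) = e s y * e s b)) \<and>
     (\<forall>y\<in>H. \<forall>z\<in>H. (\<Sum>s\<in>\<Gamma>. e s y * cnj (e s z)) = (if y = z then of_nat (card H) else 0))"

lemma dual_family_parseval:
  assumes df: "dual_family \<Gamma> H e opn s0" and E: "E \<subseteq> H"
  shows "(\<Sum>s\<in>\<Gamma>. (norm (\<Sum>z\<in>E. e s z))\<^sup>2) = real (card H) * real (card E)"
proof -
  have finE: "finite E" using df E by (auto simp: dual_family_def intro: finite_subset)
  have orth: "(\<Sum>s\<in>\<Gamma>. e s y * cnj (e s z)) = (if y = z then of_nat (card H) else 0)" if "y \<in> H" "z \<in> H" for y z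
    using df that unfolding dual_family_def by blast
  have "complex_of_real (\<Sum>s\<in>\<Gamma>. (norm (\<Sum>z\<in>E. e s z))\<^sup>2) = (\<Sum>s\<in>\<Gamma>. (\<Sum>z\<in>E. e s z) * cnj (\<Sum>z\<in>E. e s z))"
    unfolding of_real_sum by (intro sum.cong refl) (rule complex_norm_square)
  also have "\<dots> = (\<Sum>s\<in>\<Gamma>. \<Sum>z\<in>E. \<Sum>z'\<in>E. e s z * cnj (e s z'))"
    by (simp only: sum_product cnj_sum)
  also have "\<dots> = (\<Sum>z\<in>E. \<Sum>s\<in>\<Gamma>. \<Sum>z'\<in>E. e s z * cnj (e s z'))" by (rule sum.swap)
  also have "\<dots> = (\<Sum>z\<in>E. \<Sum>z'\<in>E. \<Sum>s\<in>\<Gamma>. e s z * cnj (e s z'))" by (intro sum.cong refl sum.swap)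
  also have "\<dots> = (\<Sum>z\<in>E. \<Sum>z'\<in>E. if z = z' then of_nat (card H) else 0)"
    by (intro sum.cong refl orth) (use E in auto)
  also have "\<dots> = complex_of_real (real (card H) * real (card E))" using finE by simp
  finally show ?thesis by (simp only: of_real_eq_iff)
qed

lemma dual_family_count:
  assumes df: "dual_family \<Gamma> H e opn s0" and E: "E \<subseteq> H" and B: "B \<subseteq> H" and y: "y \<in> H"
  shows "of_nat (card {b \<in> B. opn y b \<in> E}) * of_nat (card H) =
    (\<Sum>s\<in>\<Gamma>. cnj (\<Sum>z\<in>E. e s z) * (\<Sum>b\<in>B. e s b) * e s y)"
proof -
  have orth: "(\<Sum>s\<in>\<Gamma>. e s y * cnj (e s z)) = (if y = z then of_nat (card H) else 0)" if "y \<in> H" "z \<in> H" for y z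
    using df that unfolding dual_family_def by blast
  have opH: "opn y b \<in> H" if "b \<in> B" for b
    using df y B that unfolding dual_family_def by blast
  have finH: "finite H" using df by (simp add: dual_family_def)
  have finE: "finite E" "finite B" using finite_subset[OF E finH] finite_subset[OF B finH] by simp_all
  have "(\<Sum>s\<in>\<Gamma>. cnj (\<Sum>z\<in>E. e s z) * (\<Sum>b\<in>B. e s b) * e s y) =
      (\<Sum>s\<in>\<Gamma>. \<Sum>z\<in>E. \<Sum>b\<in>B. e s (opn y b) * cnj (e s z))"
  proof (intro sum.cong refl)
    fix s assume s: "s \<in> \<Gamma>"
    have "cnj (\<Sum>z\<in>E. e s z) * (\<Sum>b\<in>B. e s b) * e s y = (\<Sum>z\<in>E. \<Sum>b\<in>B. cnj (e s z) * e s b * e s y)"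
      unfolding cnj_sum sum_product by (simp only: sum_distrib_right)
    also have "\<dots> = (\<Sum>z\<in>E. \<Sum>b\<in>B. e s (opn y b) * cnj (e s z))"
      using df y B s by (intro sum.cong refl) (auto simp: dual_family_def subset_iff)
    finally show "cnj (\<Sum>z\<in>E. e s z) * (\<Sum>b\<in>B. e s b) * e s y = (\<Sum>z\<in>E. \<Sum>b\<in>B. e s (opn y b) * cnj (e s z))" .
  qed
  also have "\<dots> = (\<Sum>z\<in>E. \<Sum>s\<in>\<Gamma>. \<Sum>b\<in>B. e s (opn y b) * cnj (e s z))" by (rule sum.swap)
  also have "\<dots> = (\<Sum>z\<in>E. \<Sum>b\<in>B. \<Sum>s\<in>\<Gamma>. e s (opn y b) * cnj (e s z))" by (intro sum.cong refl sum.swap)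
  also have "\<dots> = (\<Sum>z\<in>E. \<Sum>b\<in>B. if opn y b = z then of_nat (card H) else 0)"
    by (intro sum.cong refl orth opH) (use E in auto)
  also have "\<dots> = (\<Sum>b\<in>B. \<Sum>z\<in>E. if opn y b = z then of_nat (card H) else 0)" by (rule sum.swap)
  also have "\<dots> = (\<Sum>b\<in>B. if opn y b \<in> E then of_nat (card H) else 0)"
    using finE by (intro sum.cong refl) simp
  also have "\<dots> = of_nat (card {b \<in> B. opn y b \<in> E}) * of_nat (card H)"
    using finE by (simp add: sum.If_cases Int_def)
  finally show ?thesis by simp
qed

text \<open>Cauchy-Schwarz followed by Parseval for both sets. This is the source of the square
  roots of the cardinalities in the error term.\<close>

lemma dual_family_l1:
  assumes df: "dual_family \<Gamma> H e opn s0" and E: "E \<subseteq> H" and B: "B \<subseteq> H"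
  shows "(\<Sum>s\<in>\<Gamma>. norm (\<Sum>z\<in>E. e s z) * norm (\<Sum>b\<in>B. e s b)) \<le> real (card H) * sqrt (real (card E) * real (card B))"
proof (rule power2_le_imp_le)
  have "(\<Sum>s\<in>\<Gamma>. norm (\<Sum>z\<in>E. e s z) * norm (\<Sum>b\<in>B. e s b))\<^sup>2 \<le>
      (\<Sum>s\<in>\<Gamma>. (norm (\<Sum>z\<in>E. e s z))\<^sup>2) * (\<Sum>s\<in>\<Gamma>. (norm (\<Sum>b\<in>B. e s b))\<^sup>2)"
    by (rule cauchy_schwarz_sum)
  also have "\<dots> = (real (card H) * sqrt (real (card E) * real (card B)))\<^sup>2"
    unfolding dual_family_parseval[OF df E] dual_family_parseval[OF df B]
    by (simp add: power_mult_distrib power2_eq_square)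
  finally show "(\<Sum>s\<in>\<Gamma>. norm (\<Sum>z\<in>E. e s z) * norm (\<Sum>b\<in>B. e s b))\<^sup>2
      \<le> (real (card H) * sqrt (real (card E) * real (card B)))\<^sup>2" .
qed simp

text \<open>\<open>I\<close> counts the (x, b, c) whose two images lie in E and G, and every (a, b,
  c) with a in A is such a triple. Expanding both membership conditions in characters, the trivial
  pair gives the expected number. Any other pair contributes a character sum of size at most
  \<open>lm\<close>, weighted by the Fourier coefficients of E, B, G and C.\<close>

lemma incidence_bound:
  assumes df1: "dual_family \<Gamma>1 H1 e1 op1 s0" and df2: "dual_family \<Gamma>2 H2 e2 op2 t0"
    and finX: "finite Dm" and \<phi>: "\<And>x. x \<in> Dm \<Longrightarrow> \<phi>1 x \<in> H1" "\<And>x. x \<in> Dm \<Longrightarrow> \<phi>2 x \<in> H2"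
    and A: "A \<subseteq> Dm" and B: "B \<subseteq> H1" and C: "C \<subseteq> H2" and E: "E \<subseteq> H1" and G: "G \<subseteq> H2"
    and AB: "\<And>a b. a \<in> A \<Longrightarrow> b \<in> B \<Longrightarrow> op1 (\<phi>1 a) b \<in> E"
    and AC: "\<And>a c. a \<in> A \<Longrightarrow> c \<in> C \<Longrightarrow> op2 (\<phi>2 a) c \<in> G"
    and lam: "\<And>s t. s \<in> \<Gamma>1 \<Longrightarrow> t \<in> \<Gamma>2 \<Longrightarrow> (s, t) \<noteq> (s0, t0) \<Longrightarrow> norm (\<Sum>x\<in>Dm. e1 s (\<phi>1 x) * e2 t (\<phi>2 x)) \<le> lm"
    and lam0: "lm \<ge> 0"
  shows "real (card A) * real (card B) * real (card C) \<le>
     real (card Dm) * (real (card E) * real (card G) * real (card B) * real (card C)) / (real (card H1) * real (card H2))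
     + lm * sqrt (real (card E) * real (card G) * real (card B) * real (card C))"
proof -
  define h1 h2 where "h1 = real (card H1)" and "h2 = real (card H2)"
  have h: "h1 > 0" "h2 > 0" using df1 df2 by (auto simp: h1_def h2_def dual_family_def card_gt_0_iff)
  define I where "I = (\<Sum>x\<in>Dm. card {b \<in> B. op1 (\<phi>1 x) b \<in> E} * card {c \<in> C. op2 (\<phi>2 x) c \<in> G})"
  have lower: "card A * card B * card C \<le> I"
  proof -
    have "card A * card B * card C = (\<Sum>x\<in>A. card B * card C)" by simp
    also have "\<dots> = (\<Sum>x\<in>A. card {b \<in> B. op1 (\<phi>1 x) b \<in> E} * card {c \<in> C. op2 (\<phi>2 x) c \<in> G})"
    proof (intro sum.cong refl)
      fix x assume "x \<in> A"
      then have "{b \<in> B. op1 (\<phi>1 x) b \<in> E} = B" "{c \<in> C. op2 (\<phi>2 x) c \<in> G} = C" using AB AC by auto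
      then show "card B * card C = card {b \<in> B. op1 (\<phi>1 x) b \<in> E} * card {c \<in> C. op2 (\<phi>2 x) c \<in> G}" by simp
    qed
    also have "\<dots> \<le> I" unfolding I_def using finX A by (intro sum_mono2) auto
    finally show ?thesis .
  qed
  define a where "a s = cnj (\<Sum>z\<in>E. e1 s z) * (\<Sum>b\<in>B. e1 s b)" for s
  define g where "g t = cnj (\<Sum>z\<in>G. e2 t z) * (\<Sum>b\<in>C. e2 t b)" for t
  define S where "S s t = (\<Sum>x\<in>Dm. e1 s (\<phi>1 x) * e2 t (\<phi>2 x))" for s t
  have "of_nat I * (of_nat (card H1) * of_nat (card H2)) =
     (\<Sum>x\<in>Dm. (of_nat (card {b \<in> B. op1 (\<phi>1 x) b \<in> E}) * of_nat (card H1)) * (of_nat (card {c \<in> C. op2 (\<phi>2 x) c \<in> G}) * complex_of_nat (card H2)))"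
    unfolding I_def of_nat_sum of_nat_mult sum_distrib_right by (intro sum.cong refl) (simp only: mult_ac)
  also have "\<dots> = (\<Sum>x\<in>Dm. (\<Sum>s\<in>\<Gamma>1. a s * e1 s (\<phi>1 x)) * (\<Sum>t\<in>\<Gamma>2. g t * e2 t (\<phi>2 x)))"
    unfolding a_def g_def using dual_family_count[OF df1 E B \<phi>(1)] dual_family_count[OF df2 G C \<phi>(2)]
    by (intro sum.cong refl arg_cong2[of _ _ _ _ times])
  also have "\<dots> = (\<Sum>x\<in>Dm. \<Sum>s\<in>\<Gamma>1. \<Sum>t\<in>\<Gamma>2. a s * g t * (e1 s (\<phi>1 x) * e2 t (\<phi>2 x)))"
    unfolding sum_product by (intro sum.cong refl) (simp only: mult_ac)
  also have "\<dots> = (\<Sum>s\<in>\<Gamma>1. \<Sum>x\<in>Dm. \<Sum>t\<in>\<Gamma>2. a s * g t * (e1 s (\<phi>1 x) * e2 t (\<phi>2 x)))" by (rule sum.swap)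
  also have "\<dots> = (\<Sum>s\<in>\<Gamma>1. \<Sum>t\<in>\<Gamma>2. \<Sum>x\<in>Dm. a s * g t * (e1 s (\<phi>1 x) * e2 t (\<phi>2 x)))" by (intro sum.cong refl sum.swap)
  also have "\<dots> = (\<Sum>p\<in>\<Gamma>1 \<times> \<Gamma>2. a (fst p) * g (snd p) * S (fst p) (snd p))"
    unfolding S_def sum_distrib_left[symmetric] by (simp add: sum.cartesian_product case_prod_beta)
  also have "\<dots> = a s0 * g t0 * S s0 t0 + (\<Sum>p\<in>\<Gamma>1 \<times> \<Gamma>2 - {(s0, t0)}. a (fst p) * g (snd p) * S (fst p) (snd p))"
    using df1 df2 by (subst sum.remove[of _ "(s0, t0)"]) (auto simp: dual_family_def)
  finally have eq: "of_nat I * (of_nat (card H1) * of_nat (card H2)) =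
     a s0 * g t0 * S s0 t0 + (\<Sum>p\<in>\<Gamma>1 \<times> \<Gamma>2 - {(s0, t0)}. a (fst p) * g (snd p) * S (fst p) (snd p))" .
  have a0: "a s0 = of_nat (card E) * of_nat (card B)"
  proof -
    have "(\<Sum>z\<in>E. e1 s0 z) = of_nat (card E)" "(\<Sum>z\<in>B. e1 s0 z) = of_nat (card B)"
      using df1 E B by (auto simp: dual_family_def subset_iff)
    then show ?thesis by (simp add: a_def)
  qed
  have g0: "g t0 = of_nat (card G) * of_nat (card C)"
  proof -
    have "(\<Sum>z\<in>G. e2 t0 z) = of_nat (card G)" "(\<Sum>z\<in>C. e2 t0 z) = of_nat (card C)"
      using df2 G C by (auto simp: dual_family_def subset_iff)
    then show ?thesis by (simp add: g_def)
  qed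
  have S0: "S s0 t0 = of_nat (card Dm)"
    using df1 df2 \<phi> by (simp add: S_def dual_family_def)
  have "norm (\<Sum>p\<in>\<Gamma>1 \<times> \<Gamma>2 - {(s0, t0)}. a (fst p) * g (snd p) * S (fst p) (snd p)) \<le>
      (\<Sum>p\<in>\<Gamma>1 \<times> \<Gamma>2 - {(s0, t0)}. norm (a (fst p)) * norm (g (snd p)) * lm)"
  proof (rule sum_norm_le)
    fix p assume p: "p \<in> \<Gamma>1 \<times> \<Gamma>2 - {(s0, t0)}"
    have "norm (S (fst p) (snd p)) \<le> lm"
      unfolding S_def by (rule lam) (use p in auto)
    then show "norm (a (fst p) * g (snd p) * S (fst p) (snd p)) \<le> norm (a (fst p)) * norm (g (snd p)) * lm"
      by (simp add: norm_mult mult_left_mono)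
  qed
  also have "\<dots> \<le> (\<Sum>p\<in>\<Gamma>1 \<times> \<Gamma>2. norm (a (fst p)) * norm (g (snd p)) * lm)"
    using df1 df2 lam0 by (intro sum_mono2) (auto simp: dual_family_def)
  also have "\<dots> = (\<Sum>s\<in>\<Gamma>1. norm (a s)) * (\<Sum>t\<in>\<Gamma>2. norm (g t)) * lm"
    by (subst sum_product) (simp add: sum_distrib_right sum.cartesian_product case_prod_beta)
  also have "\<dots> \<le> (h1 * sqrt (real (card E) * real (card B))) * (h2 * sqrt (real (card G) * real (card C))) * lm"
  proof -
    have na: "norm (a s) = norm (\<Sum>z\<in>E. e1 s z) * norm (\<Sum>b\<in>B. e1 s b)" for s
      by (simp only: a_def norm_mult complex_mod_cnj)
    have ng: "norm (g t) = norm (\<Sum>z\<in>G. e2 t z) * norm (\<Sum>b\<in>C. e2 t b)" for t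
      by (simp only: g_def norm_mult complex_mod_cnj)
    show ?thesis unfolding na ng h1_def h2_def
      using dual_family_l1[OF df1 E B] dual_family_l1[OF df2 G C] lam0
      by (intro mult_right_mono mult_mono) (simp_all add: sum_nonneg)
  qed
  finally have err: "norm (\<Sum>p\<in>\<Gamma>1 \<times> \<Gamma>2 - {(s0, t0)}. a (fst p) * g (snd p) * S (fst p) (snd p)) \<le>
      h1 * h2 * (lm * sqrt (real (card E) * real (card G) * real (card B) * real (card C)))"
    by (simp add: real_sqrt_mult mult_ac)
  have "real I * (h1 * h2) = norm (of_nat I * (of_nat (card H1) * complex_of_nat (card H2)))"
    by (simp add: norm_mult h1_def h2_def)
  also have "\<dots> \<le> norm (a s0 * g t0 * S s0 t0) + h1 * h2 * (lm * sqrt (real (card E) * real (card G) * real (card B) * real (card C)))"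
    unfolding eq by (rule order_trans[OF norm_triangle_ineq add_left_mono[OF err]])
  also have "norm (a s0 * g t0 * S s0 t0) = real (card Dm) * (real (card E) * real (card G) * real (card B) * real (card C))"
    by (simp add: a0 g0 S0 norm_mult mult_ac)
  finally have "real I * (h1 * h2) \<le> real (card Dm) * (real (card E) * real (card G) * real (card B) * real (card C))
      + h1 * h2 * (lm * sqrt (real (card E) * real (card G) * real (card B) * real (card C)))" .
  then have "real I \<le> (real (card Dm) * (real (card E) * real (card G) * real (card B) * real (card C))
      + h1 * h2 * (lm * sqrt (real (card E) * real (card G) * real (card B) * real (card C)))) / (h1 * h2)"
    by (rule mult_imp_le_div_pos[rotated]) (use h in simp)
  also have "\<dots> = real (card Dm) * (real (card E) * real (card G) * real (card B) * real (card C)) / (h1 * h2)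
     + lm * sqrt (real (card E) * real (card G) * real (card B) * real (card C))"
    using h by (simp add: add_divide_distrib)
  finally have "real I \<le> real (card Dm) * (real (card E) * real (card G) * real (card B) * real (card C)) / (h1 * h2)
     + lm * sqrt (real (card E) * real (card G) * real (card B) * real (card C))" .
  moreover have "real (card A) * real (card B) * real (card C) \<le> real I"
    using lower by (metis of_nat_mono of_nat_mult)
  ultimately show ?thesis unfolding h1_def h2_def by linarith
qed

text \<open>N stands for |A|, \<beta> for |B||C|, and P for the product of the two image sizes.
  Either the expected number is at least N \<beta> / 2, which yields N q <= 8 P, or the error term
  is, which after squaring yields N^2 \<beta> / q <= 4 l^2 P. The group orders are only assumed to
  be at least q / 2 because the unit group has q - 1 elements.\<close>

lemma sum_product_arith:
  fixes N \<beta> P q l Dm h1 h2 :: real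
  assumes pos: "N \<ge> 0" "\<beta> \<ge> 0" "P \<ge> 0" "q > 0" "l \<ge> 1" and Dm: "0 \<le> Dm" "Dm \<le> q" and h: "h1 \<ge> q / 2" "h2 \<ge> q / 2"
    and main: "N * \<beta> \<le> Dm * (P * \<beta>) / (h1 * h2) + l * sqrt q * sqrt (P * \<beta>)"
  shows "P \<ge> 1 / (8 * l\<^sup>2) * min (N * q) (N\<^sup>2 * \<beta> / q)"
proof (cases "\<beta> = 0 \<or> N = 0")
  case True
  then have "min (N * q) (N\<^sup>2 * \<beta> / q) \<le> 0" by (auto simp: min_le_iff_disj)
  then have "1 / (8 * l\<^sup>2) * min (N * q) (N\<^sup>2 * \<beta> / q) \<le> 0" by (intro mult_nonneg_nonpos) auto
  then show ?thesis using pos by linarith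
next
  case False
  then have b: "\<beta> > 0" "N > 0" using pos by auto
  have l2: "1 \<le> l\<^sup>2" using pos(5) by simp
  have l8: "1 / (8 * l\<^sup>2) * M \<le> P" if "M \<le> 8 * l\<^sup>2 * P" for M
  proof -
    have "0 < 8 * l\<^sup>2" using l2 by linarith
    then have "M / (8 * l\<^sup>2) \<le> P" by (rule mult_imp_div_pos_le) (use that in \<open>simp only: mult.commute\<close>)
    then show ?thesis by simp
  qed
  have "h1 * h2 \<ge> q / 2 * (q / 2)" using h pos by (intro mult_mono) auto
  then have hh: "h1 * h2 \<ge> q\<^sup>2 / 4" by (simp add: power2_eq_square)
  have hh0: "h1 * h2 > 0" using hh pos(4) by (smt (verit) divide_pos_pos zero_less_power)
  have "Dm * (P * \<beta>) / (h1 * h2) \<le> q * (P * \<beta>) / (q\<^sup>2 / 4)"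
    using Dm hh pos b by (intro frac_le mult_right_mono) auto
  also have "\<dots> = 4 * P * \<beta> / q" using pos(4) by (simp add: power2_eq_square field_simps)
  finally have m: "N * \<beta> \<le> 4 * P * \<beta> / q + l * sqrt q * sqrt (P * \<beta>)" using main by linarith
  show ?thesis
  proof (cases "4 * P * \<beta> / q \<ge> N * \<beta> / 2")
    case True
    then have "\<beta> * (N * q) \<le> \<beta> * (8 * P)" using pos(4) by (simp add: field_simps)
    then have "N * q \<le> 8 * P" using b by simp
    moreover have "8 * P \<le> 8 * l\<^sup>2 * P" using l2 pos(3) by (simp add: mult_le_cancel_right1)
    ultimately have "N * q \<le> 8 * l\<^sup>2 * P" by linarith
    then have "min (N * q) (N\<^sup>2 * \<beta> / q) \<le> 8 * l\<^sup>2 * P" by linarith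
    then show ?thesis by (rule l8)
  next
    case False
    then have "N * \<beta> / 2 \<le> l * sqrt q * sqrt (P * \<beta>)" using m by linarith
    then have "(N * \<beta> / 2)\<^sup>2 \<le> (l * sqrt q * sqrt (P * \<beta>))\<^sup>2" using b by (intro power_mono) auto
    also have "\<dots> = l\<^sup>2 * q * (P * \<beta>)" using pos by (simp add: power_mult_distrib)
    finally have "\<beta> * (N\<^sup>2 * \<beta>) \<le> \<beta> * (4 * l\<^sup>2 * q * P)" by (simp add: power2_eq_square field_simps)
    then have "N\<^sup>2 * \<beta> \<le> 4 * l\<^sup>2 * q * P" using b by simp
    then have "N\<^sup>2 * \<beta> / q \<le> 4 * l\<^sup>2 * P" using pos(4) by (simp add: field_simps)
    moreover have "4 * l\<^sup>2 * P \<le> 8 * l\<^sup>2 * P" using pos(3) by (intro mult_right_mono) auto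
    ultimately have "N\<^sup>2 * \<beta> / q \<le> 8 * l\<^sup>2 * P" by (rule order_trans)
    then have "min (N * q) (N\<^sup>2 * \<beta> / q) \<le> 8 * l\<^sup>2 * P" by (rule min.coboundedI2)
    then show ?thesis by (rule l8)
  qed
qed

section \<open>The additive and the multiplicative character families\<close>

context frob_chars
begin

lemma card_fixed_1: "card (fixed 1) = q" "finite (fixed 1)"
  using card_fixed[of 1] by auto

lemma additive_dual_family: "dual_family (fixed 1) (fixed 1) (\<lambda>s y. \<psi> (s * y)) (+) 0"
proof -
  have "(\<Sum>s\<in>fixed 1. \<psi> (s * y) * cnj (\<psi> (s * z))) = (if y = z then of_nat (card (fixed 1)) else 0)"
    if y: "y \<in> fixed 1" and z: "z \<in> fixed 1" for y z
  proof -
    have "\<psi> (s * y) * cnj (\<psi> (s * z)) = \<psi> ((y - z) * s)" if s: "s \<in> fixed 1" for s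
    proof -
      have f: "s * z \<in> fixed 1" "(y - z) * s \<in> fixed 1" using s y z by (auto intro: fixed_mult fixed_diff)
      have "\<psi> ((y - z) * s + s * z) = \<psi> ((y - z) * s) * \<psi> (s * z)" using f by (simp add: psi_add)
      moreover have "(y - z) * s + s * z = s * y" by (simp add: algebra_simps)
      moreover have "\<psi> (s * z) * cnj (\<psi> (s * z)) = 1"
        using psi_norm[OF f(1)] by (simp add: complex_norm_square[symmetric])
      ultimately show ?thesis by (simp add: mult.assoc)
    qed
    then have "(\<Sum>s\<in>fixed 1. \<psi> (s * y) * cnj (\<psi> (s * z))) = (\<Sum>s\<in>fixed 1. \<psi> ((y - z) * s))" by simp
    also have "\<dots> = (if y = z then of_nat (card (fixed 1)) else 0)"
      using psi_sum[of "y - z"] y z by (auto simp: psi_0 intro: fixed_diff)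
    finally show ?thesis .
  qed
  moreover have "fixed 1 \<noteq> ({} :: 'k set)" using fixed_0 by blast
  moreover have "\<psi> (s * (y + b)) = \<psi> (s * y) * \<psi> (s * b)"
    if "s \<in> fixed 1" "y \<in> fixed 1" "b \<in> fixed 1" for s y b
    unfolding distrib_left using that by (intro psi_add fixed_mult)
  moreover have "y + b \<in> fixed 1" if "y \<in> fixed 1" "b \<in> fixed 1" for y b
    using that by (rule fixed_add)
  ultimately show ?thesis
    unfolding dual_family_def using card_fixed_1(2) fixed_0[of 1] psi_0
    by (intro conjI ballI) (simp_all del: One_nat_def)
qed

text \<open>The exponents run from 1 to q - 1, with q - 1 in the place of 0 as the trivial one.
  Positive exponents keep \<chi>(G(x)^a) = 0 at the zeros of G, where exponent 0 would give
  \<chi>(1) = 1.\<close>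

lemma multiplicative_dual_family:
  "dual_family {1..q - 1} (fixed 1 - {0}) (\<lambda>a y. \<chi> (y ^ a)) times (q - 1)"
proof -
  have pw: "y ^ (q - 1) = 1" if "y \<in> fixed 1" "y \<noteq> 0" for y
  proof -
    have "y * y ^ (q - 1) = y ^ q" using q_gt_1 by (simp flip: power_Suc)
    also have "\<dots> = y * 1" using that(1) unfolding fixed_1 by simp
    finally have "y * y ^ (q - 1) = y * 1" .
    then show ?thesis using that(2) by simp
  qed
  have chip: "\<chi> (y ^ a) = \<chi> y ^ a" if "y \<in> fixed 1" for y a
    by (induction a) (use that in \<open>simp_all add: chi_1 chi_mult fixed_power\<close>)
  have cH: "card (fixed 1 - {0 :: 'k}) = q - 1" using card_fixed_1 by simp
  have "(\<Sum>a\<in>{1..q - 1}. \<chi> (y ^ a) * cnj (\<chi> (z ^ a))) = (if y = z then of_nat (q - 1) else 0)"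
    if y: "y \<in> fixed 1" "y \<noteq> 0" and z: "z \<in> fixed 1" "z \<noteq> 0" for y z
  proof -
    define w where "w = \<chi> (y / z)"
    have yz: "y / z \<in> fixed 1" "y / z \<noteq> 0" using y z by (auto intro: fixed_divide)
    have "\<chi> y = w * \<chi> z" unfolding w_def using chi_mult[OF yz(1) z(1)] z(2) by simp
    moreover have "\<chi> z * cnj (\<chi> z) = 1" using chi_norm[OF z] by (simp add: complex_norm_square[symmetric])
    ultimately have wyz: "\<chi> y * cnj (\<chi> z) = w" by (simp add: mult.assoc)
    have "(\<Sum>a\<in>{1..q - 1}. \<chi> (y ^ a) * cnj (\<chi> (z ^ a))) = (\<Sum>a\<in>{1..q - 1}. w ^ a)"
      using y z by (intro sum.cong refl) (simp add: chip wyz[symmetric] power_mult_distrib)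
    also have "\<dots> = (if y = z then of_nat (q - 1) else 0)"
    proof (cases "y = z")
      case True
      then have "w = 1" using z by (simp add: w_def chi_1)
      then show ?thesis using True by simp
    next
      case False
      then have "w \<noteq> 1" using chi_faithful[OF yz] z by (auto simp: w_def)
      moreover have "w ^ (q - 1) = 1" unfolding w_def chip[OF yz(1), symmetric] pw[OF yz] by (rule chi_1)
      moreover have "(\<Sum>a\<in>{1..q - 1}. w ^ a) = w * (\<Sum>a<q - 1. w ^ a)"
        unfolding sum_distrib_left by (rule sum.reindex_bij_witness[of _ Suc "\<lambda>a. a - 1"]) (auto simp flip: power_Suc)
      ultimately show ?thesis using False by (simp add: geometric_sum)
    qed
    finally show ?thesis .
  qed
  moreover have "fixed 1 - {0} \<noteq> ({} :: 'k set)" using fixed_one by (metis Diff_iff empty_iff singletonD zero_neq_one)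
  moreover have "\<chi> ((y * b) ^ a) = \<chi> (y ^ a) * \<chi> (b ^ a)"
    if "y \<in> fixed 1 - {0}" "b \<in> fixed 1 - {0}" for y b a
    unfolding power_mult_distrib using that by (intro chi_mult fixed_power) auto
  moreover have "y * b \<in> fixed 1 - {0}" if "y \<in> fixed 1 - {0}" "b \<in> fixed 1 - {0}" for y b
    using that by (auto intro: fixed_mult)
  moreover have "\<chi> (y ^ (q - 1)) = 1" if "y \<in> fixed 1 - {0}" for y
    using pw[of y] that chi_1 by auto
  moreover have "q - 1 \<in> {1..q - 1}" using q_gt_1 by auto
  moreover have "finite (fixed 1 - {0 :: 'k})" using card_fixed_1(2) by blast
  ultimately show ?thesis
    unfolding dual_family_def cH by (intro conjI ballI) (simp_all del: One_nat_def)
qed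

end

lemma product_of_images_bound:
  fixes q l :: real
  assumes df1: "dual_family \<Gamma>1 H1 e1 op1 s0" and df2: "dual_family \<Gamma>2 H2 e2 op2 t0"
    and fin: "finite Dm" and \<phi>: "\<And>x. x \<in> Dm \<Longrightarrow> \<phi>1 x \<in> H1" "\<And>x. x \<in> Dm \<Longrightarrow> \<phi>2 x \<in> H2"
    and A: "A \<subseteq> Dm" and B: "B \<subseteq> H1" and C: "C \<subseteq> H2"
    and lam: "\<And>s t. s \<in> \<Gamma>1 \<Longrightarrow> t \<in> \<Gamma>2 \<Longrightarrow> (s, t) \<noteq> (s0, t0) \<Longrightarrow>
        norm (\<Sum>x\<in>Dm. e1 s (\<phi>1 x) * e2 t (\<phi>2 x)) \<le> l * sqrt q"
    and q: "q > 0" and l: "l \<ge> 1" and cD: "real (card Dm) \<le> q"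
    and cH: "real (card H1) \<ge> q / 2" "real (card H2) \<ge> q / 2"
  shows "1 / (8 * l\<^sup>2) * min (real (card A) * q) ((real (card A))\<^sup>2 * real (card B) * real (card C) / q)
    \<le> real (card ((\<lambda>(a, b). op1 (\<phi>1 a) b) ` (A \<times> B))) * real (card ((\<lambda>(a, c). op2 (\<phi>2 a) c) ` (A \<times> C)))"
proof -
  define E G where "E = (\<lambda>(a, b). op1 (\<phi>1 a) b) ` (A \<times> B)" and "G = (\<lambda>(a, c). op2 (\<phi>2 a) c) ` (A \<times> C)"
  have o1: "op1 y b \<in> H1" if "y \<in> H1" "b \<in> H1" for y b using df1 that unfolding dual_family_def by blast
  have o2: "op2 y b \<in> H2" if "y \<in> H2" "b \<in> H2" for y b using df2 that unfolding dual_family_def by blast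
  have E: "E \<subseteq> H1" unfolding E_def using o1 \<phi>(1) A B by (auto simp: subset_iff)
  have G: "G \<subseteq> H2" unfolding G_def using o2 \<phi>(2) A C by (auto simp: subset_iff)
  have AB: "op1 (\<phi>1 a) b \<in> E" if "a \<in> A" "b \<in> B" for a b using that by (auto simp: E_def)
  have AC: "op2 (\<phi>2 a) c \<in> G" if "a \<in> A" "c \<in> C" for a c using that by (auto simp: G_def)
  have lm0: "l * sqrt q \<ge> 0" using l q by simp
  have "real (card A) * real (card B) * real (card C) \<le>
     real (card Dm) * (real (card E) * real (card G) * real (card B) * real (card C)) / (real (card H1) * real (card H2))
     + l * sqrt q * sqrt (real (card E) * real (card G) * real (card B) * real (card C))"
    using df1 df2 fin \<phi> A B C E G AB AC lam lm0 by (rule incidence_bound)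
  then have main: "real (card A) * (real (card B) * real (card C)) \<le>
     real (card Dm) * ((real (card E) * real (card G)) * (real (card B) * real (card C))) / (real (card H1) * real (card H2))
     + l * sqrt q * sqrt ((real (card E) * real (card G)) * (real (card B) * real (card C)))"
    by (simp only: mult.assoc)
  have "1 / (8 * l\<^sup>2) * min (real (card A) * q) ((real (card A))\<^sup>2 * (real (card B) * real (card C)) / q)
    \<le> real (card E) * real (card G)"
    by (rule sum_product_arith[OF _ _ _ q l _ cD cH main]) auto
  then show ?thesis by (simp only: E_def G_def mult.assoc)
qed

lemma card_le_degree_mult_card_image:
  fixes f :: "'a::idom poly"
  assumes "finite A" "degree f > 0"
  shows "card A \<le> degree f * card (poly f ` A)"
proof -
  have nz: "f - [:y:] \<noteq> 0" "degree (f - [:y:]) \<le> degree f" for y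
    using assms(2) by (auto intro: degree_diff_le)
  have "A \<subseteq> (\<Union>y\<in>poly f ` A. {x. poly (f - [:y:]) x = 0})" by auto
  then have "card A \<le> card (\<Union>y\<in>poly f ` A. {x. poly (f - [:y:]) x = 0})"
    using assms(1) poly_roots_finite[OF nz(1)] by (intro card_mono) auto
  also have "\<dots> \<le> (\<Sum>y\<in>poly f ` A. card {x. poly (f - [:y:]) x = 0})"
    using assms(1) by (intro card_UN_le) auto
  also have "\<dots> \<le> (\<Sum>y\<in>poly f ` A. degree f)"
    by (intro sum_mono order_trans[OF card_poly_roots_bound[OF nz(1)] nz(2)])
  finally show ?thesis by (simp add: mult.commute)
qed

text \<open>The price for passing to subsets of A, B and C of at least half the size: 16 = 2^2 * 2 *
  2.\<close>

lemma min_shrink: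
  fixes N N' b b' c c' q :: real
  assumes "0 \<le> N" "0 \<le> b" "0 \<le> c" "q > 0" "N \<le> 2 * N'" "b \<le> 2 * b'" "c \<le> 2 * c'"
  shows "min (N * q) (N\<^sup>2 * b * c / q) \<le> 16 * min (N' * q) (N'\<^sup>2 * b' * c' / q)"
proof -
  have N': "N' \<ge> 0" "b' \<ge> 0" "c' \<ge> 0" using assms by linarith+
  have "N * q \<le> 2 * N' * q" using assms by (intro mult_right_mono) auto
  also have "\<dots> \<le> 16 * (N' * q)" using N' assms(4) by simp
  finally have 1: "N * q \<le> 16 * (N' * q)" .
  have "N\<^sup>2 * b * c \<le> (2 * N')\<^sup>2 * (2 * b') * (2 * c')"
    using assms N' by (intro mult_mono power_mono) auto
  also have "\<dots> = 16 * (N'\<^sup>2 * b' * c')" by (simp add: power_mult_distrib)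
  finally have "N\<^sup>2 * b * c / q \<le> 16 * (N'\<^sup>2 * b' * c') / q" using assms(4) by (intro divide_right_mono) auto
  then have 2: "N\<^sup>2 * b * c / q \<le> 16 * (N'\<^sup>2 * b' * c' / q)" by simp
  show ?thesis using 1 2 by linarith
qed

lemma sqrt_bound_of_square_bound:
  fixes N q E K :: real
  assumes "N \<ge> 0" "q > 0" "E \<ge> 0" "K > 0" and main: "min (N * q) (N ^ 4 / q) \<le> K\<^sup>2 * E\<^sup>2"
  shows "min (sqrt N * sqrt q) (N\<^sup>2 / sqrt q) \<le> K * E"
proof (rule power2_le_imp_le)
  have "(min (sqrt N * sqrt q) (N\<^sup>2 / sqrt q))\<^sup>2 \<le> min (N * q) (N ^ 4 / q)"
  proof -
    have "(min (sqrt N * sqrt q) (N\<^sup>2 / sqrt q))\<^sup>2 \<le> (sqrt N * sqrt q)\<^sup>2"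
      using assms by (intro power_mono) auto
    moreover have "(min (sqrt N * sqrt q) (N\<^sup>2 / sqrt q))\<^sup>2 \<le> (N\<^sup>2 / sqrt q)\<^sup>2"
      using assms by (intro power_mono) auto
    moreover have "(sqrt N * sqrt q)\<^sup>2 = N * q" using assms by (simp add: power_mult_distrib)
    moreover have "(N\<^sup>2 / sqrt q)\<^sup>2 = N ^ 4 / q" using assms by (simp add: power_divide flip: power_mult)
    ultimately show ?thesis by simp
  qed
  also note main
  finally show "(min (sqrt N * sqrt q) (N\<^sup>2 / sqrt q))\<^sup>2 \<le> (K * E)\<^sup>2" by (simp add: power_mult_distrib)
qed (use assms in auto)

text \<open>The exponent condition expressed by roots in the algebraic closure, one prime at a time.
  As every l divides 0, the point \<beta> is necessarily a root of f.\<close>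

definition coprime_root_orders :: "'a::idom poly \<Rightarrow> 'a poly \<Rightarrow> bool" where
  "coprime_root_orders f g \<longleftrightarrow> (\<forall>l. prime l \<longrightarrow>
     (\<exists>\<beta>. poly g \<beta> \<noteq> 0 \<and> \<not> l dvd order \<beta> f))"

lemma order_power: "p \<noteq> 0 \<Longrightarrow> order \<beta> (p ^ n) = n * order \<beta> p" for p :: "'a::idom poly"
  by (induction n) (simp_all add: order_mult)

section \<open>The three estimates away from zeros\<close>

context frob_chars
begin

text \<open>A pair (s, t) other than (0, 0) gives the phase s f + t g, which is nonconstant of
  degree at most deg g because the degrees differ. The multiplicative factor is switched off by G =
  1 and d = 1.\<close>

lemma additive_additive:
  assumes f: "fpoly f" "0 < degree f" and g: "fpoly g" "degree f < degree g" "degree g < CHAR('k)"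
    and A: "A \<subseteq> fixed 1" and B: "B \<subseteq> fixed 1" and C: "C \<subseteq> fixed 1"
  shows "1 / (8 * (real (degree g))\<^sup>2) * min (real (card A) * real q) ((real (card A))\<^sup>2 * real (card B) * real (card C) / real q)
    \<le> real (card ((\<lambda>(a, b). poly f a + b) ` (A \<times> B))) * real (card ((\<lambda>(a, c). poly g a + c) ` (A \<times> C)))"
proof (rule product_of_images_bound[OF additive_dual_family additive_dual_family, where Dm = "fixed 1"])
  fix s t assume st: "s \<in> fixed 1" "t \<in> fixed 1" "(s, t) \<noteq> (0, 0)"
  define u where "u = smult s f + smult t g"
  have u: "fpoly u" unfolding u_def using f g st by (intro fpoly_add fpoly_smult)
  have "0 < degree u \<and> degree u \<le> degree g"
  proof (cases "t = 0")
    case True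
    then show ?thesis using st f g by (simp add: u_def)
  next
    case False
    then have "degree u = degree g"
      unfolding u_def using g by (subst degree_add_eq_right) (auto intro: le_less_trans[OF degree_smult_le])
    then show ?thesis using g by simp
  qed
  then have du: "0 < degree u" "degree u \<le> degree g" "degree u < CHAR('k)" using g by auto
  have "norm (\<Sum>x\<in>fixed 1. \<psi> (1 * poly u x) * \<chi> (poly 1 x ^ (1 * ((q - 1) div 1)))) \<le>
      real (degree u + degree (1 :: 'k poly)) * sqrt (real q)"
    by (rule weil_mixed[OF u du(1,3)]) auto
  also have "\<dots> \<le> real (degree g) * sqrt (real q)" using du by (intro mult_right_mono) auto
  also have "(\<Sum>x\<in>fixed 1. \<psi> (1 * poly u x) * \<chi> (poly 1 x ^ (1 * ((q - 1) div 1)))) =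
      (\<Sum>x\<in>fixed 1. \<psi> (s * poly f x) * \<psi> (t * poly g x))"
  proof (intro sum.cong refl)
    fix x :: 'k assume "x \<in> fixed 1"
    then have "s * poly f x \<in> fixed 1" "t * poly g x \<in> fixed 1" using st f g by (auto intro: fixed_mult fpoly_fixed)
    then show "\<psi> (1 * poly u x) * \<chi> (poly 1 x ^ (1 * ((q - 1) div 1))) = \<psi> (s * poly f x) * \<psi> (t * poly g x)"
      by (simp add: u_def psi_add chi_1)
  qed
  finally show "norm (\<Sum>x\<in>fixed 1. \<psi> (s * poly f x) * \<psi> (t * poly g x)) \<le> real (degree g) * sqrt (real q)" .
next
  show "real q / 2 \<le> real (card (fixed 1 :: 'k set))" "real q / 2 \<le> real (card (fixed 1 :: 'k set))"
    "real (card (fixed 1 :: 'k set)) \<le> real q" unfolding card_fixed_1(1) by simp_all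
  show "1 \<le> real (degree g)" "0 < real q" using g(2) q_gt_1 by linarith+
  show "finite (fixed 1 :: 'k set)" by (rule card_fixed_1(2))
  show "poly f x \<in> fixed 1" "poly g x \<in> fixed 1" if "x \<in> fixed 1" for x
    using fpoly_fixed[OF f(1) that] fpoly_fixed[OF g(1) that] by simp_all
  show "A \<subseteq> fixed 1" "B \<subseteq> fixed 1" "C \<subseteq> fixed 1" by (rule A, rule B, rule C)
qed

text \<open>With d = q - 1 every multiplicative character occurs as an exponent a, and the
  coprimality hypothesis of \<open>weil_mixed\<close> becomes that of deg g and q - 1.\<close>

lemma additive_multiplicative:
  assumes f: "fpoly f" "0 < degree f" "degree f < CHAR('k)" and g: "fpoly g" "g \<noteq> 0" "coprime (degree g) (q - 1)"
    and A: "A \<subseteq> {x \<in> fixed 1. poly g x \<noteq> 0}" and B: "B \<subseteq> fixed 1" and C: "C \<subseteq> fixed 1 - {0}"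
  shows "1 / (8 * (real (degree f + degree g))\<^sup>2) * min (real (card A) * real q) ((real (card A))\<^sup>2 * real (card B) * real (card C) / real q)
    \<le> real (card ((\<lambda>(a, b). poly f a + b) ` (A \<times> B))) * real (card ((\<lambda>(a, c). poly g a * c) ` (A \<times> C)))"
proof (rule product_of_images_bound[OF additive_dual_family multiplicative_dual_family, where Dm = "{x \<in> fixed 1. poly g x \<noteq> 0}"])
  fix s :: 'k and a assume sa: "s \<in> fixed 1" "a \<in> {1..q - 1}" "(s, a) \<noteq> (0, q - 1)"
  have q1: "q - 1 > 0" using q_gt_1 by simp
  have "s \<noteq> 0 \<or> \<not> (q - 1) dvd a" using sa by (auto dest: dvd_imp_le)
  then have "norm (\<Sum>x\<in>fixed 1. \<psi> (s * poly f x) * \<chi> (poly g x ^ (a * ((q - 1) div (q - 1))))) \<le>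
      real (degree f + degree g) * sqrt (real q)"
    using sa q1 by (intro weil_mixed f g) auto
  also have "(\<Sum>x\<in>fixed 1. \<psi> (s * poly f x) * \<chi> (poly g x ^ (a * ((q - 1) div (q - 1))))) =
      (\<Sum>x\<in>{x \<in> fixed 1. poly g x \<noteq> 0}. \<psi> (s * poly f x) * \<chi> (poly g x ^ a))"
    using q1 sa card_fixed_1 by (intro sum.mono_neutral_cong_right) (auto simp: chi_0 power_0_left simp del: One_nat_def)
  finally show "norm (\<Sum>x\<in>{x \<in> fixed 1. poly g x \<noteq> 0}. \<psi> (s * poly f x) * \<chi> (poly g x ^ a)) \<le>
      real (degree f + degree g) * sqrt (real q)" .
next
  have "card {x \<in> fixed 1. poly g x \<noteq> 0} \<le> card (fixed 1 :: 'k set)"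
    using card_fixed_1(2) by (intro card_mono) auto
  then have "card {x \<in> fixed 1. poly g x \<noteq> 0} \<le> q" by (simp only: card_fixed_1(1))
  then show "real (card {x \<in> fixed 1. poly g x \<noteq> 0}) \<le> real q" by simp
  have "card (fixed 1 - {0 :: 'k}) = q - 1" using card_fixed_1 by simp
  then show "real q / 2 \<le> real (card (fixed 1 - {0 :: 'k}))" using q_gt_1 by simp
  show "real q / 2 \<le> real (card (fixed 1 :: 'k set))" unfolding card_fixed_1(1) by simp
  show "finite {x \<in> fixed 1. poly g x \<noteq> 0}" using card_fixed_1(2) by simp
  show "1 \<le> real (degree f + degree g)" "0 < real q" using f(2) q_gt_1 by linarith+
  fix x assume "x \<in> {x \<in> fixed 1. poly g x \<noteq> 0}"
  then show "poly f x \<in> fixed 1" "poly g x \<in> fixed 1 - {0}"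
    using fpoly_fixed[OF f(1), of x 1] fpoly_fixed[OF g(1), of x 1] by auto
next
  show "A \<subseteq> {x \<in> fixed 1. poly g x \<noteq> 0}" "B \<subseteq> fixed 1" "C \<subseteq> fixed 1 - {0}" by (rule A, rule B, rule C)
qed

text \<open>If d does not divide k, some prime l divides d / gcd(d, k) and hence a ord(f) + b ord(g)
  at every point. A zero of f that is not one of g and whose order is prime to l shows that l
  divides a; symmetrically l divides b. As l also divides d, this contradicts the coprimality of a,
  b, d.\<close>

lemma coprime_root_orders_cond:
  assumes f: "f \<noteq> 0" "g \<noteq> 0" and fg: "coprime_root_orders f g" "coprime_root_orders g f"
    and ab: "gcd a (gcd b d) = 1" and d: "d > 0"
    and k: "\<And>\<beta>. d dvd k * order \<beta> (f ^ a * g ^ b)"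
  shows "d dvd k"
proof (rule ccontr)
  assume ndk: "\<not> d dvd k"
  define h where "h = gcd d k"
  have h0: "h > 0" using d by (simp add: h_def)
  obtain d' k' where d': "d = d' * h" "k = k' * h" "coprime d' k'"
    using gcd_coprime_exists[of d k] d unfolding h_def by (metis gcd_eq_0_iff less_not_refl)
  have "d' \<noteq> 1" using ndk d' by auto
  moreover have "d' \<noteq> 0" using d d' by auto
  ultimately obtain l where l: "prime l" "l dvd d'" using prime_factor_nat by blast
  have ord: "l dvd a * order \<beta> f + b * order \<beta> g" for \<beta>
  proof -
    have o: "order \<beta> (f ^ a * g ^ b) = a * order \<beta> f + b * order \<beta> g"
      using f by (simp add: order_mult order_power)
    have "d' * h dvd (k' * (a * order \<beta> f + b * order \<beta> g)) * h"
      using k[of \<beta>] unfolding o d'(1,2) by (simp only: mult_ac)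
    then have "d' dvd k' * (a * order \<beta> f + b * order \<beta> g)" using h0 by simp
    then have "d' dvd a * order \<beta> f + b * order \<beta> g"
      using d'(3) by (simp add: coprime_dvd_mult_right_iff)
    then show ?thesis using l(2) dvd_trans by blast
  qed
  have "l dvd d" using l(2) d'(1) by auto
  have "\<not> (l dvd a \<and> l dvd b)"
  proof
    assume "l dvd a \<and> l dvd b"
    then have "l dvd gcd a (gcd b d)" using \<open>l dvd d\<close> by (intro gcd_greatest) auto
    then have "l = 1" unfolding ab by simp
    then show False using l(1) by simp
  qed
  then consider "\<not> l dvd a" | "\<not> l dvd b" by blast
  then show False
  proof cases
    case 1
    obtain \<beta> where \<beta>: "poly g \<beta> \<noteq> 0" "\<not> l dvd order \<beta> f" using fg(1) l(1) by (auto simp: coprime_root_orders_def)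
    have "l dvd a * order \<beta> f" using ord[of \<beta>] order_0I[OF \<beta>(1)] by simp
    then show False using 1 \<beta>(2) l(1) by (simp add: prime_dvd_mult_iff)
  next
    case 2
    obtain \<beta> where \<beta>: "poly f \<beta> \<noteq> 0" "\<not> l dvd order \<beta> g" using fg(2) l(1) by (auto simp: coprime_root_orders_def)
    have "l dvd b * order \<beta> g" using ord[of \<beta>] order_0I[OF \<beta>(1)] by simp
    then show False using 2 \<beta>(2) l(1) by (simp add: prime_dvd_mult_iff)
  qed
qed

text \<open>The product of the two characters is \<chi> of f^a g^b. Extracting \<gamma> = gcd(a, b,
  q - 1) writes this as (f^a' g^b')^\<gamma> with a', b' and d = (q - 1) / \<gamma> jointly coprime.
  Since (a, b) is not the trivial pair, d > 1, and the multiplicative Weil bound applies with \<rho>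
  = f g.\<close>

lemma multiplicative_multiplicative:
  assumes f: "fpoly f" "f \<noteq> 0" and g: "fpoly g" "g \<noteq> 0" and deg: "0 < degree f + degree g"
    and fg: "coprime_root_orders f g" "coprime_root_orders g f"
    and A: "A \<subseteq> {x \<in> fixed 1. poly f x \<noteq> 0 \<and> poly g x \<noteq> 0}" and B: "B \<subseteq> fixed 1 - {0}" and C: "C \<subseteq> fixed 1 - {0}"
  shows "1 / (8 * (real (degree f + degree g))\<^sup>2) * min (real (card A) * real q) ((real (card A))\<^sup>2 * real (card B) * real (card C) / real q)
    \<le> real (card ((\<lambda>(a, b). poly f a * b) ` (A \<times> B))) * real (card ((\<lambda>(a, c). poly g a * c) ` (A \<times> C)))"
proof (rule product_of_images_bound[OF multiplicative_dual_family multiplicative_dual_family, where Dm = "{x \<in> fixed 1. poly f x \<noteq> 0 \<and> poly g x \<noteq> 0}"])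
  fix a b assume ab: "a \<in> {1..q - 1}" "b \<in> {1..q - 1}" "(a, b) \<noteq> (q - 1, q - 1)"
  have q1: "q - 1 > 0" using q_gt_1 by simp
  define \<gamma> where "\<gamma> = gcd a (gcd b (q - 1))"
  have \<gamma>d: "\<gamma> dvd a" "\<gamma> dvd b" "\<gamma> dvd q - 1"
    unfolding \<gamma>_def by (rule gcd_dvd1, rule dvd_trans[OF gcd_dvd2 gcd_dvd1], rule dvd_trans[OF gcd_dvd2 gcd_dvd2])
  have \<gamma>0: "\<gamma> > 0" using \<gamma>d(3) q1 by (metis dvd_0_left_iff gr0I less_numeral_extra(3))
  obtain a' b' d where abd: "a = \<gamma> * a'" "b = \<gamma> * b'" "q - 1 = \<gamma> * d" using \<gamma>d by (auto elim!: dvdE)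
  have d0: "d > 0" using abd(3) q1 by (cases d) auto
  have G1: "gcd a' (gcd b' d) = 1"
  proof -
    have "\<gamma> * gcd a' (gcd b' d) = gcd (\<gamma> * a') (gcd (\<gamma> * b') (\<gamma> * d))" by (simp only: gcd_mult_distrib_nat)
    also have "\<dots> = \<gamma>" unfolding abd[symmetric] by (rule \<gamma>_def[symmetric])
    finally show ?thesis using \<gamma>0 by simp
  qed
  have d1: "d > 1"
  proof (rule ccontr)
    assume "\<not> d > 1"
    then have "d = 1" using d0 by simp
    then have "q - 1 dvd a" "q - 1 dvd b" using abd by auto
    then show False using ab by (auto dest!: dvd_imp_le)
  qed
  define G where "G = f ^ a' * g ^ b'"
  have "norm (\<Sum>x\<in>fixed 1. \<chi> (poly G x ^ ((q - 1) div d))) \<le> real (degree (f * g)) * sqrt (real q)"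
  proof (rule weil_multiplicative)
    show "fpoly G" "fpoly (f * g)" unfolding G_def using f g by (auto intro: fpoly_mult fpoly_power)
    show "G \<noteq> 0" "f * g \<noteq> 0" unfolding G_def using f g by auto
    show "poly (f * g) x = 0" if "poly G x = 0" for x using that by (auto simp: G_def)
    show "d dvd q - 1" "d > 1" using abd d1 by auto
    show "d dvd k" if "\<And>\<beta>. d dvd k * order \<beta> G" for k
      by (rule coprime_root_orders_cond[OF f(2) g(2) fg G1 d0 that[unfolded G_def]])
  qed
  also have "degree (f * g) = degree f + degree g" using f g by (simp add: degree_mult_eq)
  also have "(\<Sum>x\<in>fixed 1. \<chi> (poly G x ^ ((q - 1) div d))) =
      (\<Sum>x\<in>{x \<in> fixed 1. poly f x \<noteq> 0 \<and> poly g x \<noteq> 0}. \<chi> (poly f x ^ a) * \<chi> (poly g x ^ b))"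
  proof (rule sum.mono_neutral_cong_right)
    have dv: "(q - 1) div d = \<gamma>" using abd(3) d0 by simp
    have val: "poly G x ^ ((q - 1) div d) = poly f x ^ a * poly g x ^ b" for x
      unfolding dv G_def abd(1,2) by (simp add: power_mult_distrib mult.commute[of \<gamma>] power_mult)
    show "\<forall>x\<in>fixed 1 - {x \<in> fixed 1. poly f x \<noteq> 0 \<and> poly g x \<noteq> 0}. \<chi> (poly G x ^ ((q - 1) div d)) = 0"
      unfolding val using ab by (auto simp: power_0_left chi_0)
    show "\<chi> (poly G x ^ ((q - 1) div d)) = \<chi> (poly f x ^ a) * \<chi> (poly g x ^ b)"
      if "x \<in> {x \<in> fixed 1. poly f x \<noteq> 0 \<and> poly g x \<noteq> 0}" for x
      unfolding val using that f g by (intro chi_mult fixed_power fpoly_fixed) auto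
    show "finite (fixed 1 :: 'k set)" by (rule card_fixed_1(2))
  qed auto
  finally show "norm (\<Sum>x\<in>{x \<in> fixed 1. poly f x \<noteq> 0 \<and> poly g x \<noteq> 0}. \<chi> (poly f x ^ a) * \<chi> (poly g x ^ b)) \<le>
      real (degree f + degree g) * sqrt (real q)" .
next
  have "card {x \<in> fixed 1. poly f x \<noteq> 0 \<and> poly g x \<noteq> 0} \<le> card (fixed 1 :: 'k set)"
    using card_fixed_1(2) by (intro card_mono) auto
  then have "card {x \<in> fixed 1. poly f x \<noteq> 0 \<and> poly g x \<noteq> 0} \<le> q" by (simp only: card_fixed_1(1))
  then show "real (card {x \<in> fixed 1. poly f x \<noteq> 0 \<and> poly g x \<noteq> 0}) \<le> real q" by simp
  have "card (fixed 1 - {0 :: 'k}) = q - 1" using card_fixed_1 by simp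
  then show "real q / 2 \<le> real (card (fixed 1 - {0 :: 'k}))" "real q / 2 \<le> real (card (fixed 1 - {0 :: 'k}))" using q_gt_1 by simp_all
  show "finite {x \<in> fixed 1. poly f x \<noteq> 0 \<and> poly g x \<noteq> 0}" using card_fixed_1(2) by simp
  show "1 \<le> real (degree f + degree g)" "0 < real q" using deg q_gt_1 by linarith+
  fix x assume "x \<in> {x \<in> fixed 1. poly f x \<noteq> 0 \<and> poly g x \<noteq> 0}"
  then show "poly f x \<in> fixed 1 - {0}" "poly g x \<in> fixed 1 - {0}"
    using fpoly_fixed[OF f(1), of x 1] fpoly_fixed[OF g(1), of x 1] by auto
next
  show "A \<subseteq> {x \<in> fixed 1. poly f x \<noteq> 0 \<and> poly g x \<noteq> 0}" "B \<subseteq> fixed 1 - {0}" "C \<subseteq> fixed 1 - {0}" by (rule A, rule B, rule C)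
qed

end

section \<open>Sum-product estimates\<close>

definition sp_bound :: "real \<Rightarrow> real \<Rightarrow> real \<Rightarrow> real \<Rightarrow> real" where
  "sp_bound N b c q = min (N * q) (N\<^sup>2 * b * c / q)"

definition self_bound :: "real \<Rightarrow> real \<Rightarrow> real" where
  "self_bound N q = min (sqrt N * sqrt q) (N\<^sup>2 / sqrt q)"

text \<open>128 = 8 * 16: the constant 8 l^2 of \<open>sum_product_arith\<close> with l at most m +
  n + 1, times the loss of 16 in \<open>min_shrink\<close>.\<close>

definition sp_const :: "nat \<Rightarrow> nat \<Rightarrow> real" where
  "sp_const m n = 1 / (128 * (real m + real n + 1)\<^sup>2)"

lemma sp_bound_nonneg: "0 \<le> N \<Longrightarrow> 0 \<le> b \<Longrightarrow> 0 \<le> c \<Longrightarrow> 0 < q \<Longrightarrow> 0 \<le> sp_bound N b c q"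
  by (simp add: sp_bound_def)

lemma sp_const_pos: "sp_const m n > 0"
proof -
  have "(0 :: real) < real m + real n + 1" by linarith
  then show ?thesis by (simp add: sp_const_def)
qed

lemma sp_const_mult_le:
  assumes "M \<le> 128 * (real m + real n + 1)\<^sup>2 * P"
  shows "sp_const m n * M \<le> P"
proof -
  have p: "(0 :: real) < 128 * (real m + real n + 1)\<^sup>2"
  proof -
    have "(0 :: real) < real m + real n + 1" by linarith
    then show ?thesis by simp
  qed
  have "M / (128 * (real m + real n + 1)\<^sup>2) \<le> P"
    by (rule mult_imp_div_pos_le[OF p]) (use assms in \<open>simp only: mult.commute\<close>)
  then show ?thesis by (simp add: sp_const_def)
qed

lemma sp_bound_rescale:
  assumes main: "1 / (8 * l\<^sup>2) * sp_bound N' b' c' q \<le> P" and l: "1 \<le> l" "l \<le> real m + real n + 1"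
    and sh: "sp_bound N b c q \<le> 16 * sp_bound N' b' c' q" and P: "P \<ge> 0"
  shows "sp_const m n * sp_bound N b c q \<le> P"
proof (rule sp_const_mult_le)
  have l0: "0 < 8 * l\<^sup>2" using l(1) by simp
  have "sp_bound N' b' c' q / (8 * l\<^sup>2) \<le> P" using main by simp
  then have "sp_bound N' b' c' q \<le> P * (8 * l\<^sup>2)" by (simp only: pos_divide_le_eq[OF l0])
  then have "sp_bound N b c q \<le> 16 * (P * (8 * l\<^sup>2))" using sh by linarith
  also have "\<dots> = 128 * l\<^sup>2 * P" by simp
  also have "\<dots> \<le> 128 * (real m + real n + 1)\<^sup>2 * P"
    using l P by (intro mult_right_mono mult_left_mono power_mono) auto
  finally show "sp_bound N b c q \<le> 128 * (real m + real n + 1)\<^sup>2 * P" .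
qed

text \<open>For the single set f(A) + g(A) or f(A) g(A) one takes B = g(A) and C = f(A). Both
  factors of the product are then the same set, of size E, and b and c are at least |A| divided by
  the degrees. Square roots are taken at the end.\<close>

lemma self_bound_rescale:
  fixes N N' b c q E l L :: real
  assumes N: "0 \<le> N" "N \<le> 2 * N'" and b: "N' \<le> m * b" "N' \<le> n * c" and q: "q > 0"
    and l: "1 \<le> l" "l \<le> L" and mn: "0 \<le> m" "m \<le> L" "0 \<le> n" "n \<le> L" and bc: "0 \<le> b" "0 \<le> c"
    and E: "E \<ge> 0" and main: "1 / (8 * l\<^sup>2) * sp_bound N' b c q \<le> E\<^sup>2"
  shows "self_bound N q \<le> 128 * L\<^sup>2 * E"
  unfolding self_bound_def
proof (rule sqrt_bound_of_square_bound)
  have L: "1 \<le> L" using l by linarith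
  have L2: "1 \<le> L\<^sup>2" using L by simp
  have N': "N' \<ge> 0" using N by linarith
  have l0: "0 < 8 * l\<^sup>2" using l(1) by simp
  have "sp_bound N' b c q / (8 * l\<^sup>2) \<le> E\<^sup>2" using main by simp
  then have 1: "sp_bound N' b c q \<le> E\<^sup>2 * (8 * l\<^sup>2)" by (simp only: pos_divide_le_eq[OF l0])
  also have "\<dots> \<le> E\<^sup>2 * (8 * L\<^sup>2)" using l by (intro mult_left_mono power_mono) auto
  finally have s: "sp_bound N' b c q \<le> 8 * L\<^sup>2 * E\<^sup>2" by (simp add: mult_ac)
  have A: "N * q \<le> 16 * L\<^sup>2 * (N' * q)"
  proof -
    have "N * q \<le> 2 * N' * q" using N q by (intro mult_right_mono) auto
    also have "\<dots> \<le> 16 * L\<^sup>2 * N' * q" using L2 N' q by (intro mult_right_mono) auto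
    finally show ?thesis by (simp add: mult_ac)
  qed
  have B: "N ^ 4 / q \<le> 16 * L\<^sup>2 * (N'\<^sup>2 * b * c / q)"
  proof -
    have "N ^ 4 \<le> (2 * N') ^ 4" using N by (intro power_mono) auto
    also have "\<dots> = 16 * (N'\<^sup>2 * (N' * N'))" by (simp add: power4_eq_xxxx power2_eq_square)
    also have "\<dots> \<le> 16 * (N'\<^sup>2 * ((L * b) * (L * c)))"
    proof -
      have "N' \<le> L * b" "N' \<le> L * c" using b mn bc by (meson mult_right_mono order_trans)+
      then show ?thesis using N' by (intro mult_left_mono mult_mono) auto
    qed
    also have "\<dots> = 16 * L\<^sup>2 * (N'\<^sup>2 * b * c)" by (simp add: power2_eq_square)
    finally have "N ^ 4 / q \<le> 16 * L\<^sup>2 * (N'\<^sup>2 * b * c) / q" using q by (intro divide_right_mono) auto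
    then show ?thesis by simp
  qed
  have "min (N * q) (N ^ 4 / q) \<le> min (16 * L\<^sup>2 * (N' * q)) (16 * L\<^sup>2 * (N'\<^sup>2 * b * c / q))"
    using A B by (rule min.mono)
  also have "\<dots> = 16 * L\<^sup>2 * sp_bound N' b c q"
  proof -
    have "0 \<le> 16 * L\<^sup>2" by simp
    then show ?thesis unfolding sp_bound_def by (simp only: min_mult_distrib_left if_True)
  qed
  also have "\<dots> \<le> 16 * L\<^sup>2 * (8 * L\<^sup>2 * E\<^sup>2)" using s by (intro mult_left_mono) auto
  also have "\<dots> = 128 * (L\<^sup>2)\<^sup>2 * E\<^sup>2" by (simp add: power2_eq_square)
  also have "\<dots> \<le> 128\<^sup>2 * (L\<^sup>2)\<^sup>2 * E\<^sup>2" by (intro mult_right_mono) auto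
  also have "\<dots> = (128 * L\<^sup>2)\<^sup>2 * E\<^sup>2" by (simp add: power_mult_distrib)
  finally show "min (N * q) (N ^ 4 / q) \<le> (128 * L\<^sup>2)\<^sup>2 * E\<^sup>2" .
  show "0 < 128 * L\<^sup>2" using L2 by linarith
qed (use assms in auto)

lemma image_pairs: "(\<lambda>(a, b). h (p a) b) ` (A \<times> B) = (\<lambda>(y, b). h y b) ` (p ` A \<times> B)"
  by force

text \<open>Removing one element fails to keep half of the set only if nothing is left. This is
  where the set {0} has to be excluded for a multiplicative factor.\<close>

lemma card_half_of_remove:
  assumes "C \<noteq> {z}" "finite C"
  shows "real (card C) \<le> 2 * real (card (C - {z}))"
proof (cases "z \<in> C")
  case True
  then have "card C \<noteq> 1" using assms(1) by (metis card_1_singletonE singletonD)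
  moreover have "card C > 0" using True assms(2) by (auto simp: card_gt_0_iff)
  moreover have "card (C - {z}) = card C - 1" using True by simp
  ultimately show ?thesis by linarith
qed simp

context frob_chars
begin

lemma finite_sub: "A \<subseteq> fixed 1 \<Longrightarrow> finite A" and card_sub_le: "A \<subseteq> fixed 1 \<Longrightarrow> card A \<le> q"
proof -
  show "A \<subseteq> fixed 1 \<Longrightarrow> finite A" using card_fixed_1(2) finite_subset by blast
  assume "A \<subseteq> fixed 1"
  then have "card A \<le> card (fixed 1 :: 'k set)" using card_fixed_1(2) by (rule card_mono[rotated])
  then show "card A \<le> q" by (simp only: card_fixed_1(1))
qed

lemma estimate_add_add:
  fixes f g :: "'k poly"
  defines "m \<equiv> degree f" and "n \<equiv> degree g"
  assumes f: "fpoly f" "0 < m" and g: "fpoly g" "m < n" "n < CHAR('k)"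
    and A: "A \<subseteq> fixed 1" and B: "B \<subseteq> fixed 1" and C: "C \<subseteq> fixed 1"
  shows "sp_const m n * sp_bound (real (card A)) (real (card B)) (real (card C)) (real q) \<le>
      real (card ((\<lambda>(y, b). y + b) ` (poly f ` A \<times> B))) * real (card ((\<lambda>(y, c). y + c) ` (poly g ` A \<times> C)))"
    and "sp_const m n * self_bound (real (card A)) (real q) \<le> real (card ((\<lambda>(y, z). y + z) ` (poly f ` A \<times> poly g ` A)))"
proof -
  have q0: "real q > 0" using q_gt_1 by simp
  note fin = finite_sub[OF A]
  have main: "1 / (8 * (real n)\<^sup>2) * sp_bound (real (card A)) (real (card B)) (real (card C)) (real q) \<le>
      real (card ((\<lambda>(y, b). y + b) ` (poly f ` A \<times> B))) * real (card ((\<lambda>(y, c). y + c) ` (poly g ` A \<times> C)))"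
    if "B \<subseteq> fixed 1" "C \<subseteq> fixed 1" for B C
    using additive_additive[OF f[unfolded m_def] g[unfolded m_def n_def] A that]
    unfolding sp_bound_def n_def image_pairs[of "(+)" "poly f"] image_pairs[of "(+)" "poly g"] .
  show "sp_const m n * sp_bound (real (card A)) (real (card B)) (real (card C)) (real q) \<le>
      real (card ((\<lambda>(y, b). y + b) ` (poly f ` A \<times> B))) * real (card ((\<lambda>(y, c). y + c) ` (poly g ` A \<times> C)))"
  proof (rule sp_bound_rescale[OF main[OF B C]])
    show "sp_bound (real (card A)) (real (card B)) (real (card C)) (real q) \<le>
        16 * sp_bound (real (card A)) (real (card B)) (real (card C)) (real q)"
      using sp_bound_nonneg[of "real (card A)" "real (card B)" "real (card C)" "real q"] q0 by simp
  qed (use g in auto)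
  define E where "E = (\<lambda>(y, z). y + z) ` (poly f ` A \<times> poly g ` A)"
  have sub: "poly f ` A \<subseteq> fixed 1" "poly g ` A \<subseteq> fixed 1"
    using A fpoly_fixed[OF f(1), of _ 1] fpoly_fixed[OF g(1), of _ 1] by auto
  have E2: "(\<lambda>(y, z). y + z) ` (poly g ` A \<times> poly f ` A) = E"
    unfolding E_def by (auto simp: image_iff) (metis add.commute)+
  have sq: "1 / (8 * (real n)\<^sup>2) * sp_bound (real (card A)) (real (card (poly g ` A))) (real (card (poly f ` A))) (real q) \<le> (real (card E))\<^sup>2"
    using main[OF sub(2,1)] unfolding E2 E_def[symmetric] power2_eq_square .
  have "self_bound (real (card A)) (real q) \<le> 128 * (real m + real n + 1)\<^sup>2 * real (card E)"
  proof (rule self_bound_rescale[OF _ _ _ _ q0 _ _ _ _ _ _ _ _ _ sq, where m = "real n" and n = "real m"])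
    show "real (card A) \<le> real n * real (card (poly g ` A))" "real (card A) \<le> real m * real (card (poly f ` A))"
      using card_le_degree_mult_card_image[OF fin, of g] card_le_degree_mult_card_image[OF fin, of f] f g
      unfolding m_def n_def by (metis of_nat_mono of_nat_mult gr0I less_zeroE)+
  qed (use g in auto)
  then show "sp_const m n * self_bound (real (card A)) (real q) \<le> real (card ((\<lambda>(y, z). y + z) ` (poly f ` A \<times> poly g ` A)))"
    unfolding E_def by (rule sp_const_mult_le)
qed

lemma card_inj_image_le:
  assumes "finite V" "inj_on h U" "h ` U \<subseteq> V"
  shows "card U \<le> card V"
  using assms card_inj_on_le by blast

lemma card_nonroots:
  fixes p :: "'k poly"
  assumes "p \<noteq> 0" "finite A" "2 * degree p \<le> card A"
  shows "real (card A) \<le> 2 * real (card {x \<in> A. poly p x \<noteq> 0})"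
proof -
  have "card A \<le> card ({x \<in> A. poly p x \<noteq> 0} \<union> {x. poly p x = 0})"
    using assms poly_roots_finite[OF assms(1)] by (intro card_mono) auto
  also have "\<dots> \<le> card {x \<in> A. poly p x \<noteq> 0} + card {x. poly p x = 0}" by (rule card_Un_le)
  also have "card {x. poly p x = 0} \<le> degree p" by (rule card_poly_roots_bound[OF assms(1)])
  finally show ?thesis using assms(3) by linarith
qed

text \<open>For A of bounded size the right-hand side is at most a constant times |B|, so the
  trivial bound that some image is at least as large as B suffices.\<close>

lemma sp_bound_small:
  assumes K: "real N \<le> 2 * (real m + real n + 1)" and c: "c \<le> q" and b: "real b \<le> P"
  shows "sp_const m n * sp_bound (real N) (real b) (real c) (real q) \<le> P"
proof (rule sp_const_mult_le)
  have q0: "real q > 0" using q_gt_1 by simp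
  have "sp_bound (real N) (real b) (real c) (real q) \<le> (real N)\<^sup>2 * real b * real c / real q"
    by (simp add: sp_bound_def)
  also have "\<dots> \<le> (real N)\<^sup>2 * real b * real q / real q"
    using c q0 by (intro divide_right_mono mult_left_mono) auto
  also have "\<dots> = (real N)\<^sup>2 * real b" using q0 by simp
  also have "\<dots> \<le> (2 * (real m + real n + 1))\<^sup>2 * P" using K b by (intro mult_mono power_mono) auto
  also have "\<dots> = 4 * (real m + real n + 1)\<^sup>2 * P" by (simp only: power_mult_distrib) simp
  also have "\<dots> \<le> 128 * (real m + real n + 1)\<^sup>2 * P" using b by (intro mult_right_mono) (auto intro: order_trans[OF of_nat_0_le_iff])
  finally show "sp_bound (real N) (real b) (real c) (real q) \<le> 128 * (real m + real n + 1)\<^sup>2 * P" .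
qed

lemma sp_bound_swap: "sp_bound N b c q' = sp_bound N c b q'"
  by (simp add: sp_bound_def mult_ac)

lemma sp_bound_empty: "b = 0 \<or> c = 0 \<or> N = 0 \<Longrightarrow> P \<ge> 0 \<Longrightarrow> sp_const m n * sp_bound N b c q' \<le> P"
proof -
  assume a: "b = 0 \<or> c = 0 \<or> N = 0" "P \<ge> 0"
  then have "sp_bound N b c q' \<le> 0" by (auto simp: sp_bound_def)
  then have "sp_const m n * sp_bound N b c q' \<le> 0" using sp_const_pos[of m n] by (simp add: mult_nonneg_nonpos)
  then show ?thesis using a(2) by linarith
qed

text \<open>For small A the translate f(a0) + B is enough. For large A at most half of it is lost
  with the zeros of g, and at most half of C with the element 0.\<close>

lemma estimate_add_mult:
  fixes f g :: "'k poly"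
  defines "m \<equiv> degree f" and "n \<equiv> degree g"
  assumes f: "fpoly f" "0 < m" and g: "fpoly g" "gcd n (q - 1) = 1" and deg: "m + n < CHAR('k)"
    and A: "A \<subseteq> fixed 1" and B: "B \<subseteq> fixed 1" and C: "C \<subseteq> fixed 1" "C \<noteq> {0}"
  shows "sp_const m n * sp_bound (real (card A)) (real (card B)) (real (card C)) (real q) \<le>
      real (card ((\<lambda>(y, b). y + b) ` (poly f ` A \<times> B))) * real (card ((\<lambda>(y, c). y * c) ` (poly g ` A \<times> C)))"
proof (cases "A = {} \<or> B = {} \<or> C = {}")
  case True
  then show ?thesis by (intro sp_bound_empty) auto
next
  case ne: False
  have q0: "real q > 0" using q_gt_1 by simp
  note fins = finite_sub[OF A] finite_sub[OF B] finite_sub[OF C(1)]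
  define E G where "E = (\<lambda>(y, b). y + b) ` (poly f ` A \<times> B)" and "G = (\<lambda>(y, c). y * c) ` (poly g ` A \<times> C)"
  have fE: "finite E" "finite G" using fins by (auto simp: E_def G_def)
  obtain a0 where a0: "a0 \<in> A" using ne by auto
  have "card B \<le> card E"
    by (rule card_inj_image_le[OF fE(1), of "\<lambda>b. poly f a0 + b"]) (use a0 in \<open>auto simp: E_def inj_on_def image_iff\<close>)
  moreover have "card G \<ge> 1" using ne fE(2) by (auto simp: Suc_le_eq card_gt_0_iff G_def)
  ultimately have BG: "real (card B) \<le> real (card E) * real (card G)"
    by (metis (no_types, lifting) mult_le_mono mult.right_neutral of_nat_mono of_nat_mult)
  show ?thesis
  proof (cases "card A \<le> 2 * (m + n + 1)")
    case True
    then have "real (card A) \<le> real (2 * (m + n + 1))" by (rule of_nat_mono)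
    then have K: "real (card A) \<le> 2 * (real m + real n + 1)" by simp
    show ?thesis unfolding E_def[symmetric] G_def[symmetric]
      using K card_sub_le[OF C(1)] BG by (rule sp_bound_small)
  next
    case big: False
    have "2 * (m + n + 1) < q" using big card_sub_le[OF A] by simp
    then have "q > 2" by simp
    \<comment> \<open>For a constant g the gcd is q - 1, so the hypothesis could hold only for q =
      2, which the size of A excludes.\<close>
    then have n0: "n > 0" using g(2) by (intro gr0I) auto
    then have g0: "g \<noteq> 0" by (auto simp: n_def)
    define A' C' where "A' = {x \<in> A. poly g x \<noteq> 0}" and "C' = C - {0}"
    define E' G' where "E' = (\<lambda>(y, b). y + b) ` (poly f ` A' \<times> B)" and "G' = (\<lambda>(y, c). y * c) ` (poly g ` A' \<times> C')"
    have "1 / (8 * (real (m + n))\<^sup>2) * sp_bound (real (card A')) (real (card B)) (real (card C')) (real q) \<le>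
        real (card E') * real (card G')"
      unfolding sp_bound_def E'_def G'_def m_def n_def
      unfolding image_pairs[of "(+)", symmetric] image_pairs[of times, symmetric]
      by (rule additive_multiplicative) (use f g g0 deg A B C in \<open>auto simp: A'_def C'_def m_def n_def coprime_iff_gcd_eq_1\<close>)
    also have "\<dots> \<le> real (card E) * real (card G)"
      using fE by (intro mult_mono of_nat_mono card_mono) (auto simp: E_def E'_def G_def G'_def A'_def C'_def)
    finally have main: "1 / (8 * (real (m + n))\<^sup>2) * sp_bound (real (card A')) (real (card B)) (real (card C')) (real q) \<le>
        real (card E) * real (card G)" .
    show ?thesis unfolding E_def[symmetric] G_def[symmetric]
    proof (rule sp_bound_rescale[OF main])
      show "sp_bound (real (card A)) (real (card B)) (real (card C)) (real q) \<le>
          16 * sp_bound (real (card A')) (real (card B)) (real (card C')) (real q)"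
        unfolding sp_bound_def
      proof (rule min_shrink)
        show "real (card A) \<le> 2 * real (card A')"
          unfolding A'_def using big by (intro card_nonroots g0 fins) (simp add: n_def)
        show "real (card C) \<le> 2 * real (card C')"
          unfolding C'_def by (rule card_half_of_remove[OF C(2) fins(3)])
      qed (use q0 in auto)
    qed (use f in auto)
  qed
qed

text \<open>For small A the first estimate needs a point of A that is not a common zero, so that
  multiplication by f(a0) or g(a0) is injective. The second needs no such point: there the
  right-hand side is bounded for small A, while the product set is nonempty.\<close>

lemma estimate_mult_mult:
  fixes f g :: "'k poly"
  defines "m \<equiv> degree f" and "n \<equiv> degree g"
  assumes f: "fpoly f" "0 < m" and g: "fpoly g" "0 < n"
    and fg: "coprime_root_orders f g" "coprime_root_orders g f"
    and A: "A \<subseteq> fixed 1"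
  shows "B \<subseteq> fixed 1 \<Longrightarrow> B \<noteq> {0} \<Longrightarrow> C \<subseteq> fixed 1 \<Longrightarrow> C \<noteq> {0} \<Longrightarrow>
      A = {} \<or> (\<exists>a\<in>A. poly f a \<noteq> 0 \<or> poly g a \<noteq> 0) \<Longrightarrow>
      sp_const m n * sp_bound (real (card A)) (real (card B)) (real (card C)) (real q) \<le>
      real (card ((\<lambda>(y, b). y * b) ` (poly f ` A \<times> B))) * real (card ((\<lambda>(y, c). y * c) ` (poly g ` A \<times> C)))"
    and "sp_const m n * self_bound (real (card A)) (real q) \<le> real (card ((\<lambda>(y, z). y * z) ` (poly f ` A \<times> poly g ` A)))"
proof -
  have q0: "real q > 0" using q_gt_1 by simp
  note fin = finite_sub[OF A]
  have f0: "f \<noteq> 0" "g \<noteq> 0" using f(2) g(2) by (auto simp: m_def n_def)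
  have deg_fg: "degree (f * g) = m + n" using f0 by (simp add: degree_mult_eq m_def n_def)
  define A' where "A' = {x \<in> A. poly (f * g) x \<noteq> 0}"
  have A': "A' \<subseteq> {x \<in> fixed 1. poly f x \<noteq> 0 \<and> poly g x \<noteq> 0}" using A by (auto simp: A'_def)
  have main: "1 / (8 * (real (m + n))\<^sup>2) * sp_bound (real (card A')) (real (card B)) (real (card C)) (real q) \<le>
      real (card ((\<lambda>(y, b). y * b) ` (poly f ` A' \<times> B))) * real (card ((\<lambda>(y, c). y * c) ` (poly g ` A' \<times> C)))"
    if "B \<subseteq> fixed 1 - {0}" "C \<subseteq> fixed 1 - {0}" for B C
    unfolding sp_bound_def m_def n_def
    unfolding image_pairs[of times, symmetric]
    by (rule multiplicative_multiplicative[OF f(1) f0(1) g(1) f0(2) _ fg A' that]) (use f in \<open>simp add: m_def\<close>)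
  have half: "real (card A) \<le> 2 * real (card A')" if "\<not> card A \<le> 2 * (m + n + 1)"
    unfolding A'_def using that f0 by (intro card_nonroots fin) (auto simp: deg_fg)
  show "sp_const m n * sp_bound (real (card A)) (real (card B)) (real (card C)) (real q) \<le>
      real (card ((\<lambda>(y, b). y * b) ` (poly f ` A \<times> B))) * real (card ((\<lambda>(y, c). y * c) ` (poly g ` A \<times> C)))"
    if B: "B \<subseteq> fixed 1" "B \<noteq> {0}" and C: "C \<subseteq> fixed 1" "C \<noteq> {0}"
      and ex: "A = {} \<or> (\<exists>a\<in>A. poly f a \<noteq> 0 \<or> poly g a \<noteq> 0)"
  proof (cases "A = {} \<or> B = {} \<or> C = {}")
    case True
    then show ?thesis by (intro sp_bound_empty) auto
  next
    case ne: False
    note fins = finite_sub[OF B(1)] finite_sub[OF C(1)]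
    define E G where "E = (\<lambda>(y, b). y * b) ` (poly f ` A \<times> B)" and "G = (\<lambda>(y, c). y * c) ` (poly g ` A \<times> C)"
    have fE: "finite E" "finite G" using fin fins by (auto simp: E_def G_def)
    have E1: "card E \<ge> 1" "card G \<ge> 1" using ne fE by (auto simp: Suc_le_eq card_gt_0_iff E_def G_def)
    show ?thesis
    proof (cases "card A \<le> 2 * (m + n + 1)")
      case True
      then have "real (card A) \<le> real (2 * (m + n + 1))" by (rule of_nat_mono)
    then have K: "real (card A) \<le> 2 * (real m + real n + 1)" by simp
      obtain a0 where a0: "a0 \<in> A" "poly f a0 \<noteq> 0 \<or> poly g a0 \<noteq> 0" using ex ne by auto
      from a0(2) show ?thesis
      proof
        assume nz: "poly f a0 \<noteq> 0"
        have "card B \<le> card E"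
          by (rule card_inj_image_le[OF fE(1), of "\<lambda>b. poly f a0 * b"]) (use a0 nz in \<open>auto simp: E_def inj_on_def image_iff\<close>)
        then have "real (card B) \<le> real (card E) * real (card G)"
          using E1(2) by (metis (no_types, lifting) mult_le_mono mult.right_neutral of_nat_mono of_nat_mult)
        with K card_sub_le[OF C(1)] show ?thesis unfolding E_def[symmetric] G_def[symmetric] by (rule sp_bound_small)
      next
        assume nz: "poly g a0 \<noteq> 0"
        have "card C \<le> card G"
          by (rule card_inj_image_le[OF fE(2), of "\<lambda>b. poly g a0 * b"]) (use a0 nz in \<open>auto simp: G_def inj_on_def image_iff\<close>)
        then have "real (card C) \<le> real (card E) * real (card G)"
          using E1(1) by (metis (no_types, lifting) mult_le_mono mult_1 of_nat_mono of_nat_mult)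
        with K card_sub_le[OF B(1)] show ?thesis
          unfolding E_def[symmetric] G_def[symmetric] sp_bound_swap[of _ "real (card B)"] by (rule sp_bound_small)
      qed
    next
      case big: False
      define B' C' where "B' = B - {0}" and "C' = C - {0}"
      have "1 / (8 * (real (m + n))\<^sup>2) * sp_bound (real (card A')) (real (card B')) (real (card C')) (real q) \<le>
          real (card ((\<lambda>(y, b). y * b) ` (poly f ` A' \<times> B'))) * real (card ((\<lambda>(y, c). y * c) ` (poly g ` A' \<times> C')))"
        by (rule main) (use B C in \<open>auto simp: B'_def C'_def\<close>)
      also have "\<dots> \<le> real (card E) * real (card G)"
        using fE by (intro mult_mono of_nat_mono card_mono) (auto simp: E_def G_def A'_def B'_def C'_def)
      finally have m1: "1 / (8 * (real (m + n))\<^sup>2) * sp_bound (real (card A')) (real (card B')) (real (card C')) (real q) \<le>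
          real (card E) * real (card G)" .
      show ?thesis unfolding E_def[symmetric] G_def[symmetric]
      proof (rule sp_bound_rescale[OF m1])
        show "sp_bound (real (card A)) (real (card B)) (real (card C)) (real q) \<le>
            16 * sp_bound (real (card A')) (real (card B')) (real (card C')) (real q)"
          unfolding sp_bound_def
        proof (rule min_shrink)
          show "real (card A) \<le> 2 * real (card A')" by (rule half[OF big])
          show "real (card B) \<le> 2 * real (card B')" "real (card C) \<le> 2 * real (card C')"
            unfolding B'_def C'_def by (rule card_half_of_remove[OF B(2) fins(1)], rule card_half_of_remove[OF C(2) fins(2)])
        qed (use q0 in auto)
      qed (use f in auto)
    qed
  qed
  define E where "E = (\<lambda>(y, z). y * z) ` (poly f ` A \<times> poly g ` A)"
  have fE: "finite E" using fin by (auto simp: E_def)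
  have "self_bound (real (card A)) (real q) \<le> 128 * (real m + real n + 1)\<^sup>2 * real (card E)"
  proof (cases "card A \<le> 2 * (m + n + 1)")
    case True
    show ?thesis
    proof (cases "A = {}")
      case True
      then show ?thesis by (simp add: self_bound_def)
    next
      case False
      then have "card E \<ge> 1" using fE by (auto simp: Suc_le_eq card_gt_0_iff E_def)
      have "real (card A) \<le> real (2 * (m + n + 1))" using True by (rule of_nat_mono)
      then have K: "real (card A) \<le> 2 * (real m + real n + 1)" by simp
      have "self_bound (real (card A)) (real q) \<le> (real (card A))\<^sup>2 / sqrt (real q)" by (simp add: self_bound_def)
      also have "\<dots> \<le> (real (card A))\<^sup>2 / 1"
        using q_gt_1 by (intro divide_left_mono) auto
      also have "\<dots> \<le> (2 * (real m + real n + 1))\<^sup>2" using K by simp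
      also have "\<dots> = 4 * (real m + real n + 1)\<^sup>2 * 1" by (simp only: power_mult_distrib) simp
      also have "\<dots> \<le> 128 * (real m + real n + 1)\<^sup>2 * real (card E)"
        using \<open>card E \<ge> 1\<close> by (intro mult_mono) auto
      finally show ?thesis .
    qed
  next
    case big: False
    define E' where "E' = (\<lambda>(y, z). y * z) ` (poly f ` A' \<times> poly g ` A')"
    have finA': "finite A'" using fin by (simp add: A'_def)
    have sub: "poly f ` A' \<subseteq> fixed 1 - {0}" "poly g ` A' \<subseteq> fixed 1 - {0}"
      using A' fpoly_fixed[OF f(1), of _ 1] fpoly_fixed[OF g(1), of _ 1] by auto
    have E2: "(\<lambda>(y, z). y * z) ` (poly g ` A' \<times> poly f ` A') = E'"
      unfolding E'_def by (auto simp: image_iff) (metis mult.commute)+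
    have sq: "1 / (8 * (real (m + n))\<^sup>2) * sp_bound (real (card A')) (real (card (poly g ` A'))) (real (card (poly f ` A'))) (real q) \<le> (real (card E'))\<^sup>2"
      using main[OF sub(2,1)] unfolding E2 E'_def[symmetric] power2_eq_square .
    have "self_bound (real (card A)) (real q) \<le> 128 * (real m + real n + 1)\<^sup>2 * real (card E')"
    proof (rule self_bound_rescale[OF _ half[OF big] _ _ q0 _ _ _ _ _ _ _ _ _ sq, where m = "real n" and n = "real m"])
      show "real (card A') \<le> real n * real (card (poly g ` A'))" "real (card A') \<le> real m * real (card (poly f ` A'))"
        using card_le_degree_mult_card_image[OF finA', of g] card_le_degree_mult_card_image[OF finA', of f] f(2) g(2)
        unfolding m_def n_def by (metis of_nat_mono of_nat_mult)+
    qed (use f in auto)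
    also have "real (card E') \<le> real (card E)"
      using fE by (intro of_nat_mono card_mono) (auto simp: E_def E'_def A'_def)
    finally show ?thesis by (simp add: mult_left_mono)
  qed
  then show "sp_const m n * self_bound (real (card A)) (real q) \<le> real (card ((\<lambda>(y, z). y * z) ` (poly f ` A \<times> poly g ` A)))"
    unfolding E_def by (rule sp_const_mult_le)
qed

end

section \<open>Existence of characters\<close>

definition nth_unit :: "nat \<Rightarrow> nat \<Rightarrow> complex" where
  "nth_unit n k = cis (2 * pi * real k / real n)"

lemma nth_unit_add: "nth_unit n (j + k) = nth_unit n j * nth_unit n k"
  by (simp add: nth_unit_def cis_mult distrib_left add_divide_distrib)

lemma norm_nth_unit: "norm (nth_unit n k) = 1"
  by (simp add: nth_unit_def)

lemma nth_unit_mult_self: "n > 0 \<Longrightarrow> nth_unit n (n * k) = 1"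
proof -
  assume "n > 0"
  then have "2 * pi * real (n * k) / real n = 2 * pi * real k" by simp
  then show ?thesis unfolding nth_unit_def by (simp only: cis_multiple_2pi Ints_of_nat)
qed

lemma nth_unit_mod:
  assumes "n > 0"
  shows "nth_unit n (k mod n) = nth_unit n k"
proof -
  have "nth_unit n k = nth_unit n (n * (k div n) + k mod n)" by simp
  then show ?thesis unfolding nth_unit_add nth_unit_mult_self[OF assms] by simp
qed

lemma nth_unit_cong: "n > 0 \<Longrightarrow> j mod n = k mod n \<Longrightarrow> nth_unit n j = nth_unit n k"
  by (metis nth_unit_mod)

lemma nth_unit_eq_1D:
  assumes "n > 0" "nth_unit n k = 1"
  shows "n dvd k"
proof -
  have "nth_unit n (k mod n) = nth_unit n 0" unfolding nth_unit_mod[OF assms(1)] assms(2) by (simp add: nth_unit_def)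
  then have "k mod n = 0"
    using bij_betw_imp_inj_on[OF bij_betw_roots_unity[OF assms(1)]] assms(1)
    by (intro inj_onD[of "\<lambda>k. cis (2 * pi * real k / real n)" "{..<n}"]) (auto simp: nth_unit_def)
  then show ?thesis by auto
qed

lemma of_nat_eq_imp_mod_CHAR_eq:
  assumes "of_nat a = (of_nat b :: 'a::ring_1)"
  shows "a mod CHAR('a) = b mod CHAR('a)"
proof -
  have le: "a mod CHAR('a) = b mod CHAR('a)" if "of_nat a = (of_nat b :: 'a)" "a \<le> b" for a b
  proof -
    have "of_nat (b - a) = (0 :: 'a)" using that by (simp add: of_nat_diff)
    then have "CHAR('a) dvd b - a" by (simp only: of_nat_eq_0_iff_char_dvd)
    then show ?thesis using that(2) mod_eq_dvd_iff_nat by metis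
  qed
  show ?thesis using le[of a b] le[of b a] assms nat_le_linear by metis
qed

context frob
begin

text \<open>The locale applied with q = p and r = 1: there are exactly p solutions of x^p = x, and
  the images of 0, ..., p - 1 are that many.\<close>

lemma prime_subfield_eq: "x ^ CHAR('k) = x \<Longrightarrow> \<exists>k. of_nat k = (x :: 'k)"
proof -
  interpret P: frob "CHAR('k)" 1 type_dummy by unfold_locales (use char_prime in auto)
  have "(of_nat :: nat \<Rightarrow> 'k) ` {..<CHAR('k)} = P.fixed 1"
  proof (rule card_subset_eq)
    show "finite (P.fixed 1)" using P.card_fixed[of 1] by simp
    show "(of_nat :: nat \<Rightarrow> 'k) ` {..<CHAR('k)} \<subseteq> P.fixed 1" using P.fixed_of_nat by auto
    have "inj_on (of_nat :: nat \<Rightarrow> 'k) {..<CHAR('k)}"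
      by (auto simp: inj_on_def dest!: of_nat_eq_imp_mod_CHAR_eq)
    then show "card ((of_nat :: nat \<Rightarrow> 'k) ` {..<CHAR('k)}) = card (P.fixed 1)"
      using P.card_fixed[of 1] by (simp add: card_image)
  qed
  moreover assume "x ^ CHAR('k) = x"
  ultimately show ?thesis using P.fixed_1[of x] by (metis imageE)
qed

text \<open>The absolute trace of \<open>fixed 1\<close> down to the prime field, in contrast to
  \<open>trace_poly\<close>, which goes down to \<open>fixed 1\<close> only.\<close>

definition trace :: "'k \<Rightarrow> 'k" where "trace x = (\<Sum>i<r. x ^ (CHAR('k) ^ i))"

lemma trace_add: "trace (x + y) = trace x + trace y"
  unfolding trace_def sum.distrib[symmetric]
  by (intro sum.cong refl freshmans_dream') (use char_prime in auto)

lemma ex_of_nat_eq_trace: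
  assumes "x \<in> fixed 1"
  shows "\<exists>k. of_nat k = trace x"
proof (rule prime_subfield_eq)
  have "trace x ^ CHAR('k) = (\<Sum>i<r. x ^ (CHAR('k) ^ Suc i))"
    unfolding trace_def using char_prime by (subst freshmans_dream_sum) (auto simp: mult.commute simp flip: power_mult)
  moreover have "(\<Sum>i<r. x ^ (CHAR('k) ^ Suc i)) + x ^ (CHAR('k) ^ 0) = (\<Sum>i<r. x ^ (CHAR('k) ^ i)) + x ^ (CHAR('k) ^ r)"
    using sum.lessThan_Suc_shift[of "\<lambda>i. x ^ (CHAR('k) ^ i)" r, unfolded sum.lessThan_Suc]
    by (subst add.commute) (rule sym)
  moreover have "x ^ (CHAR('k) ^ r) = x" using assms[unfolded fixed_1] unfolding q_eq .
  ultimately show "trace x ^ CHAR('k) = trace x" by (simp add: trace_def)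
qed

text \<open>As a polynomial the trace is nonzero, having coefficient 1 at x, and its degree p^(r-1)
  is too small for q zeros.\<close>

lemma trace_nontrivial: "\<exists>x\<in>fixed 1. trace x \<noteq> 0"
proof (rule ccontr)
  assume "\<not> ?thesis"
  then have z: "trace x = 0" if "x \<in> fixed 1" for x using that by auto
  define h :: "'k poly" where "h = (\<Sum>i<r. monom 1 (CHAR('k) ^ i))"
  have p1: "CHAR('k) > 1" using char_prime prime_gt_1_nat by blast
  have "coeff h 1 = (\<Sum>i<r. if i = 0 then 1 else 0)"
    unfolding h_def coeff_sum coeff_monom using p1 by (intro sum.cong refl) (auto simp: power_eq_if)
  also have "\<dots> = 1" using r_pos by (subst sum.delta) auto
  finally have h0: "h \<noteq> 0" by auto
  have "degree h \<le> CHAR('k) ^ (r - 1)"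
    unfolding h_def using p1 r_pos
    by (intro degree_sum_le) (auto intro!: order_trans[OF degree_monom_le] power_increasing)
  also have "\<dots> < q" unfolding q_eq using p1 r_pos by (intro power_strict_increasing) auto
  also have "q = card (fixed 1 :: 'k set)" using card_fixed[of 1] by simp
  also have "\<dots> \<le> card {x. poly h x = 0}"
  proof (rule card_mono[OF poly_roots_finite[OF h0]])
    show "fixed 1 \<subseteq> {x. poly h x = 0}" using z by (auto simp: h_def poly_sum poly_monom trace_def)
  qed
  also have "\<dots> \<le> degree h" by (rule card_poly_roots_bound[OF h0])
  finally show False by simp
qed

text \<open>\<psi>(x) = exp(2 pi i Tr(x) / p), and \<chi>(x) = exp(2 pi i ind(x) / (q - 1)) with the
  discrete logarithm \<open>ind\<close> to the base g. The representatives \<open>k\<close> and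
  \<open>ind\<close> are arbitrary natural numbers; only their residues matter.\<close>

lemma ex_characters:
  assumes gen: "\<And>x. x \<in> fixed 1 \<Longrightarrow> x \<noteq> 0 \<Longrightarrow> \<exists>i::nat. g ^ i = x" and g0: "g \<in> fixed 1" "g \<noteq> 0"
  shows "\<exists>\<psi> \<chi>. frob_chars q r \<psi> (\<chi> :: 'k \<Rightarrow> complex)"
proof -
  let ?p = "CHAR('k)"
  have p0: "?p > 0" using char_prime prime_gt_0_nat by blast
  have q1: "q - 1 > 0" using q_gt_1 by simp
  have cf: "card (fixed 1 - {0 :: 'k}) = q - 1" "finite (fixed 1 :: 'k set)" using card_fixed[of 1] by auto
  define k where "k x = (SOME k. of_nat k = trace x)" for x
  have k: "of_nat (k x) = trace x" if "x \<in> fixed 1" for x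
    unfolding k_def using someI_ex[OF ex_of_nat_eq_trace[OF that]] .
  define ind where "ind x = (SOME i. g ^ i = x)" for x
  have ind: "g ^ ind x = x" if "x \<in> fixed 1" "x \<noteq> 0" for x
    unfolding ind_def using someI_ex[OF gen[OF that]] .
  have gq: "g ^ (q - 1) = 1"
  proof -
    have "g * g ^ (q - 1) = g ^ q" using q_gt_1 by (simp flip: power_Suc)
    also have "\<dots> = g * 1" using g0(1) unfolding fixed_1 by simp
    finally show ?thesis using g0(2) by (simp only: mult_left_cancel not_False_eq_True simp_thms)
  qed
  have ord: "(q - 1) dvd i" if i: "g ^ i = 1" for i
  proof (rule ccontr)
    assume "\<not> (q - 1) dvd i"
    then have d: "i mod (q - 1) > 0" "i mod (q - 1) < q - 1" using q1 by (auto simp: dvd_eq_mod_eq_0)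
    define d where "d = i mod (q - 1)"
    have "g ^ (((q - 1)) * (i div (q - 1)) + i mod (q - 1)) = 1" using i by simp
    then have gd: "g ^ d = 1" unfolding power_add power_mult gq d_def by simp
    have "fixed 1 - {0} \<subseteq> (\<lambda>i. g ^ i) ` {..<d}"
    proof
      fix x :: 'k assume x: "x \<in> fixed 1 - {0}"
      have "x = g ^ (d * (ind x div d) + ind x mod d)" using ind[of x] x by simp
      also have "\<dots> = g ^ (ind x mod d)" unfolding power_add power_mult gd by simp
      finally show "x \<in> (\<lambda>i. g ^ i) ` {..<d}" using d d_def by auto
    qed
    then have "card (fixed 1 - {0 :: 'k}) \<le> card ((\<lambda>i. g ^ i) ` {..<d})" by (intro card_mono) auto
    also have "\<dots> \<le> card {..<d}" by (rule card_image_le) simp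
    finally show False using d unfolding cf d_def by simp
  qed
  have le: "i mod (q - 1) = j mod (q - 1)" if "g ^ i = g ^ j" "i \<le> j" for i j
  proof -
    have "g ^ i * g ^ (j - i) = g ^ i * 1" unfolding power_add[symmetric] using that by simp
    then have "g ^ (j - i) = 1" using g0(2) by (subst (asm) mult_left_cancel) auto
    then show ?thesis using ord that(2) by (metis mod_eq_dvd_iff_nat)
  qed
  have eq: "i mod (q - 1) = j mod (q - 1)" if "g ^ i = g ^ j" for i j
    using le[of i j] le[of j i] that by (metis nat_le_linear)
  define \<psi> where "\<psi> x = nth_unit ?p (k x)" for x
  define \<chi> where "\<chi> x = (if x = 0 then 0 else nth_unit (q - 1) (ind x))" for x
  have "frob_chars q r \<psi> \<chi>"
  proof
    fix x y :: 'k assume xy: "x \<in> fixed 1" "y \<in> fixed 1"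
    have "(of_nat (k (x + y)) :: 'k) = of_nat (k x + k y)"
      using k[OF xy(1)] k[OF xy(2)] k[OF fixed_add[OF xy]] by (simp add: trace_add)
    then have "k (x + y) mod ?p = (k x + k y) mod ?p" by (rule of_nat_eq_imp_mod_CHAR_eq)
    then show "\<psi> (x + y) = \<psi> x * \<psi> y"
      unfolding \<psi>_def nth_unit_add[symmetric] by (rule nth_unit_cong[OF p0])
    show "\<chi> (x * y) = \<chi> x * \<chi> y"
    proof (cases "x = 0 \<or> y = 0")
      case False
      have "g ^ ind (x * y) = g ^ (ind x + ind y)"
        using ind[OF xy(1)] ind[OF xy(2)] ind[OF fixed_mult[OF xy]] False by (simp add: power_add)
      then have "nth_unit (q - 1) (ind (x * y)) = nth_unit (q - 1) (ind x + ind y)"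
        by (intro nth_unit_cong[OF q1] eq)
      then show ?thesis using False by (simp add: \<chi>_def nth_unit_add)
    qed (auto simp: \<chi>_def)
  next
    obtain x where x: "x \<in> fixed 1" "trace x \<noteq> 0" using trace_nontrivial by blast
    have "\<psi> x \<noteq> 1"
    proof
      assume "\<psi> x = 1"
      then have "?p dvd k x" unfolding \<psi>_def by (rule nth_unit_eq_1D[OF p0])
      then have "of_nat (k x) = (0 :: 'k)" by (simp add: of_nat_eq_0_iff_char_dvd)
      then show False using k[OF x(1)] x(2) by simp
    qed
    then show "\<exists>x\<in>fixed 1. \<psi> x \<noteq> 1" using x(1) by blast
  next
    fix x :: 'k assume x: "x \<in> fixed 1" "x \<noteq> 0" "\<chi> x = 1"
    then have "(q - 1) dvd ind x" by (intro nth_unit_eq_1D[OF q1]) (simp add: \<chi>_def)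
    then obtain j where "ind x = (q - 1) * j" by blast
    then have "g ^ ind x = 1" by (simp only: power_mult gq power_one)
    then show "x = 1" using ind[OF x(1,2)] by simp
  qed (auto simp: \<psi>_def \<chi>_def norm_nth_unit)
  then show ?thesis by blast
qed

end

section \<open>Embedding a field record into an algebraically closed type\<close>

primrec list_poly :: "('a \<Rightarrow> 'k::comm_semiring_1) \<Rightarrow> 'a list \<Rightarrow> 'k poly" where
  "list_poly h [] = 0"
| "list_poly h (a # p) = monom (h a) (length p) + list_poly h p"

lemma list_poly_conv_Poly: "list_poly h p = Poly (rev (map h p))"
  by (induction p) (auto simp: Poly_append mult_monom add.commute simp flip: monom_0)

locale field_embedding = F: field F for F :: "('a, 'b) ring_scheme" +
  fixes \<phi> :: "'a \<Rightarrow> 'k::alg_closed_field"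
  assumes finite_carrier: "finite (carrier F)"
    and \<phi>_add: "x \<in> carrier F \<Longrightarrow> y \<in> carrier F \<Longrightarrow> \<phi> (x \<oplus>\<^bsub>F\<^esub> y) = \<phi> x + \<phi> y"
    and \<phi>_mult: "x \<in> carrier F \<Longrightarrow> y \<in> carrier F \<Longrightarrow> \<phi> (x \<otimes>\<^bsub>F\<^esub> y) = \<phi> x * \<phi> y"
    and \<phi>_one: "\<phi> \<one>\<^bsub>F\<^esub> = 1"
    and inj_\<phi>: "inj_on \<phi> (carrier F)"
begin

lemma \<phi>_zero: "\<phi> \<zero>\<^bsub>F\<^esub> = 0"
proof -
  have "\<phi> \<zero>\<^bsub>F\<^esub> = \<phi> \<zero>\<^bsub>F\<^esub> + \<phi> \<zero>\<^bsub>F\<^esub>" using \<phi>_add[OF F.zero_closed F.zero_closed] by (simp only: F.l_zero F.zero_closed)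
  then show ?thesis by (simp only: add_cancel_right_right)
qed

lemma \<phi>_eq_0_iff: "x \<in> carrier F \<Longrightarrow> \<phi> x = 0 \<longleftrightarrow> x = \<zero>\<^bsub>F\<^esub>"
  using inj_onD[OF inj_\<phi>, of x "\<zero>\<^bsub>F\<^esub>"] \<phi>_zero by auto

lemma \<phi>_pow: "x \<in> carrier F \<Longrightarrow> \<phi> (x [^]\<^bsub>F\<^esub> (n::nat)) = \<phi> x ^ n"
  by (induction n) (auto simp: \<phi>_one \<phi>_mult)

lemma \<phi>_add_pow: "x \<in> carrier F \<Longrightarrow> \<phi> (add_pow F (n::nat) x) = of_nat n * \<phi> x"
  by (induction n) (auto simp: \<phi>_zero \<phi>_add algebra_simps)

lemma \<phi>_finsum:
  assumes "finite I" "\<And>i. i \<in> I \<Longrightarrow> h i \<in> carrier F"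
  shows "\<phi> (finsum F h I) = (\<Sum>i\<in>I. \<phi> (h i))"
  using assms
proof (induction I)
  case (insert i I)
  then have "finsum F h (insert i I) = h i \<oplus>\<^bsub>F\<^esub> finsum F h I" by (intro F.finsum_insert) auto
  then show ?case using insert by (simp add: \<phi>_add F.finsum_closed Pi_def)
qed (simp add: \<phi>_zero)

lemma CHAR_eq: "CHAR('k) = ring_char F"
proof (rule CHAR_eqI)
  have iff: "of_nat n = (0 :: 'k) \<longleftrightarrow> ring_char F dvd n" for n
  proof -
    have "of_nat n = (0 :: 'k) \<longleftrightarrow> add_pow F n \<one>\<^bsub>F\<^esub> = \<zero>\<^bsub>F\<^esub>"
      using \<phi>_eq_0_iff[of "add_pow F n \<one>\<^bsub>F\<^esub>"] \<phi>_add_pow[of "\<one>\<^bsub>F\<^esub>" n] \<phi>_one by simp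
    also have "\<dots> \<longleftrightarrow> ring_char F dvd n"
      unfolding ring_char_def using group.pow_eq_id[OF F.a_group, of "\<one>\<^bsub>F\<^esub>" n] by (simp add: add_pow_def)
    finally show ?thesis .
  qed
  show "of_nat (ring_char F) = (0 :: 'k)" unfolding iff by simp
  show "ring_char F dvd n" if "of_nat n = (0 :: 'k)" for n using that unfolding iff .
qed

lemma order_dvd_CHAR_nat: "of_nat (Coset.order F) = (0 :: 'k)"
proof -
  have "add_pow F (Coset.order F) \<one>\<^bsub>F\<^esub> = \<zero>\<^bsub>F\<^esub>"
    using group.pow_order_eq_1[OF F.a_group, of "\<one>\<^bsub>F\<^esub>"] by (simp add: add_pow_def Coset.order_def)
  then show ?thesis using \<phi>_add_pow[of "\<one>\<^bsub>F\<^esub>" "Coset.order F"] \<phi>_one \<phi>_zero by simp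
qed

lemma order_gt_1: "Coset.order F > 1"
proof -
  have "card {\<zero>\<^bsub>F\<^esub>, \<one>\<^bsub>F\<^esub>} \<le> card (carrier F)" by (rule card_mono[OF finite_carrier]) auto
  then show ?thesis by (simp add: Coset.order_def)
qed

lemma prime_CHAR: "prime CHAR('k)"
proof -
  have "CHAR('k) dvd Coset.order F" using order_dvd_CHAR_nat by (simp only: of_nat_eq_0_iff_char_dvd)
  then have "CHAR('k) > 0" using order_gt_1 by (intro gr0I) auto
  then show ?thesis by (rule prime_CHAR_semidom)
qed

text \<open>Cauchy's theorem for the additive group, read off from Sylow: a subgroup of order l
  contains some x nonzero with l x = 0, so l = 0 in the field. Hence p is the only prime divisor of
  the order, which must be a power of p.\<close>

lemma prime_dvd_order:
  assumes l: "prime l" "l dvd Coset.order F"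
  shows "l = CHAR('k)"
proof -
  obtain m where m: "Coset.order F = l ^ 1 * m" using l(2) by auto
  obtain H where H: "subgroup H (add_monoid F)" "card H = l ^ 1"
    using sylow_thm[of l "add_monoid F" 1 m] l(1) F.a_group m finite_carrier
    by (auto simp: Coset.order_def prime_nat_iff)
  interpret H: subgroup H "add_monoid F" by (rule H)
  have HF: "H \<subseteq> carrier F" using H.subset by simp
  have "finite H" using HF finite_carrier finite_subset by blast
  have "\<exists>x\<in>H. x \<noteq> \<zero>\<^bsub>F\<^esub>"
  proof (rule ccontr)
    assume "\<not> ?thesis"
    then have "card H \<le> card {\<zero>\<^bsub>F\<^esub>}" by (intro card_mono) auto
    then show False using H(2) prime_gt_1_nat[OF l(1)] by simp
  qed
  then obtain x where x: "x \<in> H" "x \<noteq> \<zero>\<^bsub>F\<^esub>" by blast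
  let ?H = "(add_monoid F) \<lparr> carrier := H \<rparr>"
  have "group ?H" by (rule subgroup.subgroup_is_group[OF H(1) F.a_group])
  then have "x [^]\<^bsub>?H\<^esub> Coset.order ?H = \<one>\<^bsub>?H\<^esub>" using x(1) by (intro group.pow_order_eq_1) auto
  then have "add_pow F l x = \<zero>\<^bsub>F\<^esub>"
    using H(2) monoid.nat_pow_consistent[OF group.is_monoid[OF F.a_group], of x l H] by (simp add: Coset.order_def add_pow_def)
  then have "of_nat l * \<phi> x = 0" using \<phi>_add_pow[of x l] x HF \<phi>_zero by auto
  then have "of_nat l = (0 :: 'k)" using \<phi>_eq_0_iff[of x] x HF by auto
  then have "CHAR('k) dvd l" by (simp add: of_nat_eq_0_iff_char_dvd)
  then show ?thesis using l(1) prime_CHAR primes_dvd_imp_eq by blast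
qed

lemma ex_order_eq: "\<exists>r. r > 0 \<and> Coset.order F = CHAR('k) ^ r"
proof -
  have n0: "Coset.order F \<noteq> 0" "\<not> is_unit CHAR('k)" using order_gt_1 prime_CHAR by auto
  obtain m where m: "Coset.order F = CHAR('k) ^ multiplicity CHAR('k) (Coset.order F) * m" "\<not> CHAR('k) dvd m"
    by (rule multiplicity_decompose'[OF n0])
  have "m = 1"
  proof (rule ccontr)
    assume "m \<noteq> 1"
    then obtain l where l: "prime l" "l dvd m" using prime_factor_nat by blast
    then have "l = CHAR('k)" using m(1) by (intro prime_dvd_order) (metis dvd_mult)+
    then show False using l m(2) by simp
  qed
  then have "Coset.order F = CHAR('k) ^ multiplicity CHAR('k) (Coset.order F)" using m(1) by simp
  moreover from this have "multiplicity CHAR('k) (Coset.order F) > 0" using order_gt_1 by (intro gr0I) auto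
  ultimately show ?thesis by blast
qed

definition field_degree :: nat where "field_degree = (SOME r. r > 0 \<and> Coset.order F = CHAR('k) ^ r)"

sublocale frob "Coset.order F" field_degree "TYPE('k)"
  using someI_ex[OF ex_order_eq] prime_CHAR by unfold_locales (auto simp: field_degree_def)

text \<open>Lagrange's theorem in the unit group places the image inside \<open>fixed 1\<close>, and
  both sets have as many elements as the field.\<close>

lemma \<phi>_image: "\<phi> ` carrier F = fixed 1"
proof (rule card_subset_eq)
  show "finite (fixed 1 :: 'k set)" using card_fixed[of 1] by simp
  show "card (\<phi> ` carrier F) = card (fixed 1 :: 'k set)"
    using card_fixed[of 1] by (simp add: card_image[OF inj_\<phi>] Coset.order_def)
  show "\<phi> ` carrier F \<subseteq> fixed 1"
  proof
    fix y assume "y \<in> \<phi> ` carrier F"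
    then obtain x where x: "x \<in> carrier F" "y = \<phi> x" by blast
    show "y \<in> fixed 1"
    proof (cases "x = \<zero>\<^bsub>F\<^esub>")
      case True
      then show ?thesis by (simp add: x \<phi>_zero)
    next
      case False
      interpret M: group "Multiplicative_Group.mult_of F" by (rule F.field_mult_group)
      have "x [^]\<^bsub>F\<^esub> (Coset.order F - 1) = \<one>\<^bsub>F\<^esub>"
        using M.pow_order_eq_1[of x] False x finite_carrier
        by (simp add: F.order_mult_of Multiplicative_Group.nat_pow_mult_of)
      then have "\<phi> x ^ (Coset.order F - 1) = 1" using \<phi>_pow[OF x(1)] \<phi>_one by metis
      then have "\<phi> x ^ (Coset.order F - 1) * \<phi> x = \<phi> x" by simp
      then show ?thesis unfolding fixed_1 x(2) power_Suc2[symmetric] using order_gt_1 by simp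
    qed
  qed
qed

lemma \<phi>_fixed: "x \<in> carrier F \<Longrightarrow> \<phi> x \<in> fixed 1"
  unfolding \<phi>_image[symmetric] by (rule imageI)

lemma ex_field_characters: "\<exists>\<psi> \<chi>. frob_chars (Coset.order F) field_degree \<psi> (\<chi> :: 'k \<Rightarrow> complex)"
proof -
  obtain a where a: "a \<in> carrier (Multiplicative_Group.mult_of F)" "carrier (Multiplicative_Group.mult_of F) = {a [^]\<^bsub>F\<^esub> i | i::nat. i \<in> UNIV}"
    using F.finite_field_mult_group_has_gen[OF finite_carrier] by blast
  show ?thesis
  proof (rule ex_characters)
    show "\<phi> a \<in> fixed 1" "\<phi> a \<noteq> 0" using a(1) by (auto simp: \<phi>_fixed \<phi>_eq_0_iff simp del: One_nat_def)
    fix y assume y: "y \<in> fixed 1" "y \<noteq> (0 :: 'k)"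
    then obtain x where x: "x \<in> carrier F" "y = \<phi> x" unfolding \<phi>_image[symmetric] by blast
    then have "x \<in> carrier (Multiplicative_Group.mult_of F)" using y(2) \<phi>_zero by auto
    then obtain i :: nat where "x = a [^]\<^bsub>F\<^esub> i" unfolding a(2) by blast
    then have "\<phi> a ^ i = y" using a(1) x by (simp add: \<phi>_pow)
    then show "\<exists>i::nat. \<phi> a ^ i = y" ..
  qed
qed

abbreviation PK :: "'a list \<Rightarrow> 'k poly" where "PK \<equiv> list_poly \<phi>"

lemma poly_carrierD: "f \<in> carrier (poly_ring F) \<Longrightarrow> set f \<subseteq> carrier F"
  by (auto simp: polynomial_def simp flip: univ_poly_carrier)

lemma coeff_PK: "set f \<subseteq> carrier F \<Longrightarrow> coeff (PK f) i = \<phi> (F.coeff f i)"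
  by (induction f) (auto simp: \<phi>_zero F.coeff_length)

lemma poly_PK: "set f \<subseteq> carrier F \<Longrightarrow> x \<in> carrier F \<Longrightarrow> poly (PK f) (\<phi> x) = \<phi> (F.eval f x)"
  by (induction f) (auto simp: \<phi>_zero \<phi>_add \<phi>_mult \<phi>_pow poly_monom F.eval_in_carrier)

lemma fpoly_PK: "set f \<subseteq> carrier F \<Longrightarrow> fpoly (PK f)"
  by (auto simp: fpoly_def coeff_PK F.coeff_in_carrier \<phi>_fixed simp del: One_nat_def)

lemma PK_mult:
  assumes f: "set f \<subseteq> carrier F" and g: "set g \<subseteq> carrier F"
  shows "PK (f \<otimes>\<^bsub>poly_ring F\<^esub> g) = PK f * PK g"
proof -
  have s: "set (F.poly_mult f g) \<subseteq> carrier F" using F.poly_mult_in_carrier[OF f g] .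
  have "coeff (PK (F.poly_mult f g)) i = coeff (PK f * PK g) i" for i
    unfolding coeff_PK[OF s] F.poly_mult_coeff[OF f g] coeff_mult
    using F.coeff_in_carrier[OF f] F.coeff_in_carrier[OF g]
    by (subst \<phi>_finsum) (auto simp: coeff_PK f g \<phi>_mult)
  then show ?thesis by (simp add: univ_poly_mult poly_eq_iff)
qed

lemma PK_one: "PK \<one>\<^bsub>poly_ring F\<^esub> = 1"
  by (simp add: univ_poly_one \<phi>_one)

lemma inj_PK: "f \<in> carrier (poly_ring F) \<Longrightarrow> g \<in> carrier (poly_ring F) \<Longrightarrow> PK f = PK g \<Longrightarrow> f = g"
proof -
  assume f: "f \<in> carrier (poly_ring F)" and g: "g \<in> carrier (poly_ring F)" and eq: "PK f = PK g"
  have "F.coeff f i = F.coeff g i" for i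
    using eq coeff_PK[OF poly_carrierD[OF f], of i] coeff_PK[OF poly_carrierD[OF g], of i]
      F.coeff_in_carrier[OF poly_carrierD[OF f]] F.coeff_in_carrier[OF poly_carrierD[OF g]]
    by (intro inj_onD[OF inj_\<phi>]) auto
  then show "f = g"
    using F.coeff_iff_polynomial_cond[of "carrier F" f g] f g by (auto simp: univ_poly_carrier)
qed

lemma ex_PK:
  assumes "fpoly h"
  obtains f where "f \<in> carrier (poly_ring F)" "PK f = h"
proof (cases "h = 0")
  case True
  then show ?thesis by (intro that[of "[]"]) (auto simp: univ_poly_zero_closed)
next
  case False
  define f where "f = rev (map (inv_into (carrier F) \<phi>) (coeffs h))"
  have c: "set (coeffs h) \<subseteq> \<phi> ` carrier F"
    unfolding \<phi>_image using assms range_coeff[of h] unfolding fpoly_def by (metis image_subset_iff insert_subset)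
  have inv: "inv_into (carrier F) \<phi> y \<in> carrier F" "\<phi> (inv_into (carrier F) \<phi> y) = y" if "y \<in> set (coeffs h)" for y
    using c that by (auto simp: inv_into_into f_inv_into_f)
  have "map (\<phi> \<circ> inv_into (carrier F) \<phi>) (coeffs h) = coeffs h" using inv by (intro map_idI) auto
  then have "PK f = h" by (simp add: list_poly_conv_Poly f_def rev_map)
  moreover have "f \<in> carrier (poly_ring F)"
  proof -
    have ne: "coeffs h \<noteq> []" using False by simp
    have "hd f = inv_into (carrier F) \<phi> (last (coeffs h))" using ne by (simp add: f_def hd_rev last_map)
    then have "\<phi> (hd f) = lead_coeff h" using inv(2)[OF last_in_set[OF ne]] False by (simp add: last_coeffs_eq_coeff_degree)
    then have "hd f \<noteq> \<zero>\<^bsub>F\<^esub>" using False \<phi>_zero by auto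
    moreover have "set f \<subseteq> carrier F" using inv by (auto simp: f_def)
    ultimately show ?thesis by (simp add: polynomial_def flip: univ_poly_carrier)
  qed
  ultimately show ?thesis using that by blast
qed

lemma degree_PK:
  assumes f: "f \<in> carrier (poly_ring F)"
  shows "degree (PK f) = length f - 1"
    and "f \<noteq> [] \<Longrightarrow> lead_coeff (PK f) = \<phi> (hd f)"
proof -
  note s = poly_carrierD[OF f]
  have le: "degree (PK f) \<le> length f - 1"
    by (rule degree_le) (auto simp: coeff_PK[OF s] F.coeff_length \<phi>_zero)
  have c: "coeff (PK f) (length f - 1) = \<phi> (hd f)" if "f \<noteq> []"
    unfolding coeff_PK[OF s] F.lead_coeff_simp[OF that] ..
  have nz: "\<phi> (hd f) \<noteq> 0" if "f \<noteq> []"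
  proof -
    have "hd f \<noteq> \<zero>\<^bsub>F\<^esub>" using f that by (auto simp: polynomial_def simp flip: univ_poly_carrier)
    moreover have "hd f \<in> carrier F" using s that by (auto dest: hd_in_set)
    ultimately show ?thesis by (simp add: \<phi>_eq_0_iff)
  qed
  show d: "degree (PK f) = length f - 1"
    using le le_degree[of "PK f" "length f - 1"] c nz by (cases "f = []") auto
  show "f \<noteq> [] \<Longrightarrow> lead_coeff (PK f) = \<phi> (hd f)" unfolding d by (rule c)
qed

lemma card_set_add:
  assumes "S \<subseteq> carrier F" "T \<subseteq> carrier F"
  shows "card (S <+>\<^bsub>F\<^esub> T) = card ((\<lambda>(y, z). y + z) ` (\<phi> ` S \<times> \<phi> ` T))"
proof -
  have "\<phi> ` (S <+>\<^bsub>F\<^esub> T) = (\<lambda>(y, z). y + z) ` (\<phi> ` S \<times> \<phi> ` T)"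
    using assms by (force simp: set_add_def' \<phi>_add subset_iff image_iff)
  moreover have "inj_on \<phi> (S <+>\<^bsub>F\<^esub> T)"
    using assms by (intro inj_on_subset[OF inj_\<phi>]) (auto simp: set_add_def')
  ultimately show ?thesis by (metis card_image)
qed

lemma card_set_mult:
  assumes "S \<subseteq> carrier F" "T \<subseteq> carrier F"
  shows "card (S <#>\<^bsub>F\<^esub> T) = card ((\<lambda>(y, z). y * z) ` (\<phi> ` S \<times> \<phi> ` T))"
proof -
  have "\<phi> ` (S <#>\<^bsub>F\<^esub> T) = (\<lambda>(y, z). y * z) ` (\<phi> ` S \<times> \<phi> ` T)"
    using assms by (force simp: set_mult_def \<phi>_mult subset_iff image_iff)
  moreover have "inj_on \<phi> (S <#>\<^bsub>F\<^esub> T)"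
    using assms by (intro inj_on_subset[OF inj_\<phi>]) (auto simp: set_mult_def)
  ultimately show ?thesis by (metis card_image)
qed

lemma image_eval_PK:
  assumes "f \<in> carrier (poly_ring F)" "A \<subseteq> carrier F"
  shows "\<phi> ` F.eval f ` A = poly (PK f) ` \<phi> ` A" "F.eval f ` A \<subseteq> carrier F"
  using assms poly_PK[OF poly_carrierD[OF assms(1)]] F.eval_in_carrier[OF poly_carrierD[OF assms(1)]]
  by (auto simp: image_image subset_iff intro!: image_cong)

end

section \<open>Minimal polynomials and irreducible factors\<close>

context frob
begin

lemma fpoly_cancel:
  assumes "fpoly (f * g)" "fpoly f" "f \<noteq> 0"
  shows "fpoly g"
proof -
  have "f * map_poly (\<lambda>c. c ^ q) g = f * g" using assms(1,2) by (simp add: fpoly_iff map_poly_frob_mult)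
  then show ?thesis using assms(3) by (simp add: fpoly_iff)
qed

definition minpoly :: "'k \<Rightarrow> 'k poly" where "minpoly \<beta> = (\<Prod>x\<in>#cyc \<beta> (period \<beta>). [:- x, 1:])"

lemma minpoly:
  assumes "\<beta> \<in> fixed s" "s > 0"
  shows "fpoly (minpoly \<beta>)" "lead_coeff (minpoly \<beta>) = 1" "degree (minpoly \<beta>) > 0"
    and "order \<beta> (minpoly \<beta>) = 1"
proof -
  have m: "minpoly \<beta> \<in> mpolys (period \<beta>)" unfolding minpoly_def
    by (intro invmsets_prod) (simp add: invmsets_def frobinv_cyc period(2)[OF assms])
  then show "fpoly (minpoly \<beta>)" "lead_coeff (minpoly \<beta>) = 1" "degree (minpoly \<beta>) > 0"
    using period(1)[OF assms] by (auto simp: mpolys_def)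
  then have "minpoly \<beta> \<noteq> 0" by auto
  then have "order \<beta> (minpoly \<beta>) = count (proots (minpoly \<beta>)) \<beta>" by simp
  also have "proots (minpoly \<beta>) = cyc \<beta> (period \<beta>)" unfolding minpoly_def by (rule proots_prod_linear)
  also have "count \<dots> \<beta> = 1"
    unfolding cyc_period[OF assms] using period(1)[OF assms] by (subst count_mset_set(1)) (auto intro!: image_eqI[of _ _ 0])
  finally show "order \<beta> (minpoly \<beta>) = 1" .
qed

text \<open>A polynomial over the base field vanishes on the whole Frobenius orbit of any of its
  zeros. The cofactor again has coefficients in the base field because Frobenius fixes h and the
  minimal polynomial.\<close>

lemma minpoly_dvd:
  assumes b: "\<beta> \<in> fixed s" "s > 0" and h: "fpoly h" "poly h \<beta> = 0"
  obtains k where "h = minpoly \<beta> * k" "fpoly k"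
proof (cases "h = 0")
  case True
  then show ?thesis by (intro that[of 0]) auto
next
  case False
  have "cyc \<beta> (period \<beta>) \<subseteq># proots h"
  proof (rule mset_subset_eqI)
    fix x
    have "poly h x = 0" if "x \<in> (\<lambda>i. \<beta> ^ (q ^ i)) ` {..<period \<beta>}"
      using that fpoly_frob[OF h(1), of \<beta>, symmetric] h(2) q_gt_1 by auto
    then show "count (cyc \<beta> (period \<beta>)) x \<le> count (proots h) x"
      unfolding cyc_period[OF b] using False by (auto simp: count_mset_set' Suc_le_eq order_gt_0_iff)
  qed
  then obtain N where N: "proots h = cyc \<beta> (period \<beta>) + N" using subset_mset.le_iff_add by blast
  define l where "l = lead_coeff h"
  have l: "l \<noteq> 0" using False by (simp add: l_def)
  have "lead_coeff (smult (1 / l) h) = 1" using l by (simp add: l_def)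
  from prod_mset_linear(1)[OF this] have "(\<Prod>x\<in>#proots h. [:-x, 1:]) = smult (1 / l) h"
    using l by simp
  then have "h = smult l (\<Prod>x\<in>#proots h. [:-x, 1:])" using l by simp
  then have eq: "h = minpoly \<beta> * smult l (\<Prod>x\<in>#N. [:-x, 1:])" unfolding N by (simp add: minpoly_def)
  moreover have "fpoly (smult l (\<Prod>x\<in>#N. [:-x, 1:]))"
    by (rule fpoly_cancel[of "minpoly \<beta>"]) (use h(1) eq minpoly[OF b] in auto)
  ultimately show ?thesis by (rule that)
qed

end

context field_embedding
begin

abbreviation Fpoly ("P\<^sub>F") where "P\<^sub>F \<equiv> poly_ring F"

lemma cring_poly_ring: "cring P\<^sub>F"
  using F.univ_poly_is_cring[OF F.carrier_is_subring] .

definition irred :: "'a list \<Rightarrow> bool" where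
  "irred P \<longleftrightarrow> P \<in> carrier P\<^sub>F \<and> pirreducible\<^bsub>F\<^esub> (carrier F) P \<and> hd P = \<one>\<^bsub>F\<^esub>"

lemma irred_monic:
  assumes "irred P"
  shows "P \<noteq> []" "degree (PK P) > 0" "lead_coeff (PK P) = 1" "fpoly (PK P)"
proof -
  have P: "P \<in> carrier P\<^sub>F" "pirreducible\<^bsub>F\<^esub> (carrier F) P" "hd P = \<one>\<^bsub>F\<^esub>" using assms by (auto simp: irred_def)
  show ne: "P \<noteq> []" by (rule F.pirreducibleE(1)[OF F.carrier_is_subring P(1,2)])
  have "length P - 1 \<ge> 1" by (rule F.pirreducible_degree[OF F.carrier_is_subfield P(1,2)])
  then show "degree (PK P) > 0" by (simp only: degree_PK(1)[OF P(1)])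
  show "lead_coeff (PK P) = 1" using degree_PK(2)[OF P(1) ne] P(3) \<phi>_one by simp
  show "fpoly (PK P)" by (rule fpoly_PK[OF poly_carrierD[OF P(1)]])
qed

lemma irred_root_fixed:
  assumes "irred P" "poly (PK P) \<beta> = 0"
  obtains s where "s > 0" "\<beta> \<in> fixed s"
proof -
  have "PK P \<in> mpolys (degree (PK P))" using irred_monic[OF assms(1)] by (simp add: mpolys_def)
  then have "frobinv (proots (PK P))" using mpolys_proots by (auto simp: invmsets_def)
  moreover have "\<beta> \<in># proots (PK P)" using assms(2) irred_monic(3)[OF assms(1)] by (subst set_count_proots) auto
  ultimately show ?thesis using frobinv_fixed that by blast
qed

text \<open>The minimal polynomial of a root and its cofactor come from polynomials of the record,
  so irreducibility makes one of them a unit; the minimal polynomial is not constant. Consequently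
  irreducible polynomials have simple roots, and distinct monic ones share none.\<close>

lemma irred_eq_minpoly:
  assumes P: "irred P" and b: "poly (PK P) \<beta> = 0"
  shows "PK P = minpoly \<beta>"
proof -
  have Pc: "P \<in> carrier P\<^sub>F" "pirreducible\<^bsub>F\<^esub> (carrier F) P" using P by (auto simp: irred_def)
  obtain s where s: "s > 0" "\<beta> \<in> fixed s" by (rule irred_root_fixed[OF assms])
  note mp = minpoly[OF s(2,1)]
  obtain k where k: "PK P = minpoly \<beta> * k" "fpoly k"
    by (rule minpoly_dvd[OF s(2,1) irred_monic(4)[OF P] b])
  obtain U where U: "U \<in> carrier P\<^sub>F" "PK U = minpoly \<beta>" by (rule ex_PK[OF mp(1)])
  obtain V where V: "V \<in> carrier P\<^sub>F" "PK V = k" by (rule ex_PK[OF k(2)])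
  interpret PR: cring "P\<^sub>F" by (rule cring_poly_ring)
  have "P = U \<otimes>\<^bsub>P\<^sub>F\<^esub> V"
    by (rule inj_PK[OF Pc(1)])
      (use U V k(1) PK_mult[OF poly_carrierD[OF U(1)] poly_carrierD[OF V(1)]] in auto)
  then have "U \<in> Units P\<^sub>F \<or> V \<in> Units P\<^sub>F"
    by (rule F.pirreducibleE(3)[OF F.carrier_is_subring Pc U(1) V(1)])
  moreover have "U \<notin> Units P\<^sub>F"
    using mp(3) degree_PK(1)[OF U(1)] U(2) F.univ_poly_units'[OF F.carrier_is_subfield, of U] by auto
  ultimately have "degree k = 0"
    using degree_PK(1)[OF V(1)] V(2) F.univ_poly_units'[OF F.carrier_is_subfield, of V] by auto
  then obtain c where c: "k = [:c:]" by (rule degree_eq_zeroE)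
  have "lead_coeff (PK P) = lead_coeff (minpoly \<beta>) * lead_coeff k"
    unfolding k(1) by (rule lead_coeff_mult)
  then have "c = 1" using irred_monic(3)[OF P] mp(2) c by simp
  then show ?thesis using k(1) c by (simp add: one_pCons[symmetric])
qed

lemma irred_common_root: "irred P \<Longrightarrow> irred Q \<Longrightarrow> poly (PK P) \<beta> = 0 \<Longrightarrow> poly (PK Q) \<beta> = 0 \<Longrightarrow> P = Q"
  by (metis inj_PK irred_def irred_eq_minpoly)

lemma irred_root_pdivides:
  assumes P: "irred P" and b: "poly (PK P) \<beta> = 0" and g: "g \<in> carrier P\<^sub>F" "poly (PK g) \<beta> = 0"
  shows "P pdivides\<^bsub>F\<^esub> g"
proof -
  have Pc: "P \<in> carrier P\<^sub>F" using P by (auto simp: irred_def)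
  obtain s where s: "s > 0" "\<beta> \<in> fixed s" by (rule irred_root_fixed[OF P b])
  obtain k where k: "PK g = minpoly \<beta> * k" "fpoly k"
    by (rule minpoly_dvd[OF s(2,1) fpoly_PK[OF poly_carrierD[OF g(1)]] g(2)])
  obtain V where V: "V \<in> carrier P\<^sub>F" "PK V = k" by (rule ex_PK[OF k(2)])
  interpret PR: cring "P\<^sub>F" by (rule cring_poly_ring)
  have "g = P \<otimes>\<^bsub>P\<^sub>F\<^esub> V"
    by (rule inj_PK[OF g(1)])
      (use Pc V k(1) PK_mult[OF poly_carrierD[OF Pc] poly_carrierD[OF V(1)]] irred_eq_minpoly[OF P b] in auto)
  then show ?thesis using V(1) by (auto simp: pdivides_def factor_def)
qed

lemma PK_pow:
  assumes "f \<in> carrier P\<^sub>F"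
  shows "PK (f [^]\<^bsub>P\<^sub>F\<^esub> (n::nat)) = PK f ^ n"
proof -
  interpret PR: cring "P\<^sub>F" by (rule cring_poly_ring)
  show ?thesis
  proof (induction n)
    case (Suc n)
    have "f [^]\<^bsub>P\<^sub>F\<^esub> n \<in> carrier P\<^sub>F" using assms by simp
    then show ?case using Suc PK_mult[OF poly_carrierD poly_carrierD[OF assms]] by (simp add: mult.commute)
  qed (simp add: PK_one)
qed

lemma PK_finprod:
  assumes "finite S" "\<And>P. P \<in> S \<Longrightarrow> h P \<in> carrier P\<^sub>F"
  shows "PK (finprod P\<^sub>F h S) = (\<Prod>P\<in>S. PK (h P))"
proof -
  interpret PR: cring "P\<^sub>F" by (rule cring_poly_ring)
  show ?thesis using assms
  proof (induction S)
    case (insert P S)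
    have "finprod P\<^sub>F h (insert P S) = h P \<otimes>\<^bsub>P\<^sub>F\<^esub> finprod P\<^sub>F h S"
      using insert by (intro PR.finprod_insert) auto
    moreover have "finprod P\<^sub>F h S \<in> carrier P\<^sub>F" using insert by (intro PR.finprod_closed) auto
    ultimately show ?case using insert PK_mult[OF poly_carrierD poly_carrierD] by simp
  qed (simp add: PK_one)
qed

text \<open>At a root of an irreducible factor P of f the order of f is exactly the exponent of P,
  because P has simple roots and shares none with the other factors. If P does not divide g, that
  root is not a zero of g. For each prime l some exponent in T is not divisible by l.\<close>

lemma coprime_exponents_outside_imp:
  assumes g: "g \<in> carrier P\<^sub>F" and co: "coprime_exponents_outside F f g"
  shows "coprime_root_orders (PK f) (PK g)" "degree (PK f) > 0"
proof -
  interpret PR: cring "P\<^sub>F" by (rule cring_poly_ring)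
  obtain u S e T where cf: "canonical_factorization F f u S e" and T: "T \<subseteq> S" "\<And>P. P \<in> T \<Longrightarrow> \<not> P pdivides\<^bsub>F\<^esub> g"
    "Gcd (e ` T) = 1"
    using co unfolding coprime_exponents_outside_def by blast
  have u: "u \<in> carrier F" "u \<noteq> \<zero>\<^bsub>F\<^esub>" and S: "finite S" "\<And>P. P \<in> S \<Longrightarrow> irred P" and e: "\<And>P. P \<in> S \<Longrightarrow> e P \<ge> 1"
    and f: "f = F.poly_of_const u \<otimes>\<^bsub>P\<^sub>F\<^esub> (finprod P\<^sub>F (\<lambda>P. P [^]\<^bsub>P\<^sub>F\<^esub> e P) S)"
    using cf by (auto simp: canonical_factorization_def irred_def)
  have Sc: "P \<in> carrier P\<^sub>F" if "P \<in> S" for P using S(2)[OF that] by (simp add: irred_def)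
  have "F.poly_of_const u = [u]" using u by (simp add: F.poly_of_const_def F.normalize.simps)
  then have "PK f = PK [u] * PK (finprod P\<^sub>F (\<lambda>P. P [^]\<^bsub>P\<^sub>F\<^esub> e P) S)"
    unfolding f using u Sc by (simp only:) (rule PK_mult, simp, intro poly_carrierD PR.finprod_closed, auto)
  also have "PK (finprod P\<^sub>F (\<lambda>P. P [^]\<^bsub>P\<^sub>F\<^esub> e P) S) = (\<Prod>P\<in>S. PK P ^ e P)"
    using S(1) Sc by (subst PK_finprod) (auto simp: PK_pow intro!: prod.cong)
  finally have PKf: "PK f = [:\<phi> u:] * (\<Prod>P\<in>S. PK P ^ e P)" by (simp add: monom_0)
  have u0: "\<phi> u \<noteq> 0" using u by (simp add: \<phi>_eq_0_iff)
  have Pn0: "PK P \<noteq> 0" if "P \<in> S" for P using irred_monic(2)[OF S(2)[OF that]] by auto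
  have f0: "PK f \<noteq> 0" unfolding PKf using u0 Pn0 S(1) by auto
  have key: "poly (PK g) \<beta> \<noteq> 0 \<and> order \<beta> (PK f) = e P" if P: "P \<in> T" and b: "poly (PK P) \<beta> = 0" for P \<beta>
  proof
    have PS: "P \<in> S" using P T(1) by blast
    show "poly (PK g) \<beta> \<noteq> 0" using irred_root_pdivides[OF S(2)[OF PS] b g] T(2)[OF P] by blast
    define R where "R = [:\<phi> u:] * (\<Prod>Q\<in>S - {P}. PK Q ^ e Q)"
    have fR: "PK f = PK P ^ e P * R" unfolding PKf R_def using S(1) PS by (simp add: prod.remove)
    have "poly R \<beta> \<noteq> 0"
      using u0 irred_common_root[OF S(2)[OF PS] S(2) b] S(1) by (auto simp: R_def poly_prod)
    then have "order \<beta> R = 0" by (rule order_0I)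
    moreover have "order \<beta> (PK P) = 1"
    proof -
      obtain s where s: "s > 0" "\<beta> \<in> fixed s" by (rule irred_root_fixed[OF S(2)[OF PS] b])
      show ?thesis unfolding irred_eq_minpoly[OF S(2)[OF PS] b] by (rule minpoly(4)[OF s(2,1)])
    qed
    ultimately show "order \<beta> (PK f) = e P"
      using f0 Pn0[OF PS] by (simp add: fR order_mult order_power)
  qed
  have root: "\<exists>\<beta>. poly (PK P) \<beta> = 0" if "P \<in> S" for P
    using irred_monic(2)[OF S(2)[OF that]] alg_closed_imp_poly_has_root by blast
  show "coprime_root_orders (PK f) (PK g)"
    unfolding coprime_root_orders_def
  proof (intro allI impI)
    fix l :: nat assume l: "prime l"
    have "\<exists>P\<in>T. \<not> l dvd e P"
    proof (rule ccontr)
      assume "\<not> ?thesis"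
      then have "l dvd Gcd (e ` T)" by (intro Gcd_greatest) auto
      then show False using T(3) l by simp
    qed
    then obtain P where P: "P \<in> T" "\<not> l dvd e P" by blast
    then obtain \<beta> where "poly (PK P) \<beta> = 0" using root T(1) by blast
    then show "\<exists>\<beta>. poly (PK g) \<beta> \<noteq> 0 \<and> \<not> l dvd order \<beta> (PK f)"
      using key[OF P(1)] P(2) by metis
  qed
  have "T \<noteq> {}" using T(3) by auto
  then obtain P \<beta> where P: "P \<in> T" "poly (PK P) \<beta> = 0" using root T(1) by blast
  then have "order \<beta> (PK f) > 0" using key[OF P] e[of P] T(1) by auto
  then have "poly (PK f) \<beta> = 0" using f0 by (simp add: order_root)
  then show "degree (PK f) > 0" using f0 by (metis degree_eq_zeroE gr0I poly_const_conv pCons_0_0)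
qed

end

section \<open>From types to field records\<close>

text \<open>Named as a predicate of a single field so that \<open>test_field\<close> can be chosen
  to violate it. The constant is explicit in the degrees, which makes it common to all
  fields.\<close>

definition sum_product_estimates :: "('a, 'b) ring_scheme \<Rightarrow> bool" where
  "sum_product_estimates F \<longleftrightarrow>
    (\<forall>f g A B C. f \<in> carrier (poly_ring F) \<and> g \<in> carrier (poly_ring F) \<and>
       A \<subseteq> carrier F \<and> B \<subseteq> carrier F \<and> C \<subseteq> carrier F \<longrightarrow>
       (let q = real (Coset.order F); p = ring_char F; c = sp_const (Polynomials.degree f) (Polynomials.degree g);
            fA = ring.eval F f ` A; gA = ring.eval F g ` A;
            bound = sp_bound (real (card A)) (real (card B)) (real (card C)) q;
            bound' = self_bound (real (card A)) q
        in
          (1 \<le> Polynomials.degree f \<and> Polynomials.degree f < Polynomials.degree g \<and> Polynomials.degree g < p \<longrightarrow>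
             real (card (fA <+>\<^bsub>F\<^esub> B)) * real (card (gA <+>\<^bsub>F\<^esub> C)) \<ge> c * bound \<and>
             real (card (fA <+>\<^bsub>F\<^esub> gA)) \<ge> c * bound')
        \<and> (gcd (Polynomials.degree g) (Coset.order F - 1) = 1 \<and> 1 \<le> Polynomials.degree f \<and>
             Polynomials.degree f + Polynomials.degree g < p \<and> C \<noteq> {\<zero>\<^bsub>F\<^esub>} \<longrightarrow>
             real (card (fA <+>\<^bsub>F\<^esub> B)) * real (card (gA <#>\<^bsub>F\<^esub> C)) \<ge> c * bound)
        \<and> (coprime_exponents_outside F f g \<and> coprime_exponents_outside F g f \<longrightarrow>
             (B \<noteq> {\<zero>\<^bsub>F\<^esub>} \<and> C \<noteq> {\<zero>\<^bsub>F\<^esub>} \<and>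
              (A = {} \<or> (\<exists>a\<in>A. ring.eval F f a \<noteq> \<zero>\<^bsub>F\<^esub> \<or> ring.eval F g a \<noteq> \<zero>\<^bsub>F\<^esub>)) \<longrightarrow>
                real (card (fA <#>\<^bsub>F\<^esub> B)) * real (card (gA <#>\<^bsub>F\<^esub> C)) \<ge> c * bound) \<and>
             real (card (fA <#>\<^bsub>F\<^esub> gA)) \<ge> c * bound')))"

context field_embedding
begin

lemma sum_product_estimates: "sum_product_estimates F"
  unfolding sum_product_estimates_def Let_def
proof (intro allI impI, elim conjE)
  fix f g A B C
  assume f: "f \<in> carrier (poly_ring F)" and g: "g \<in> carrier (poly_ring F)"
    and A: "A \<subseteq> carrier F" and B: "B \<subseteq> carrier F" and C: "C \<subseteq> carrier F"
  obtain \<psi> and \<chi> :: "'k \<Rightarrow> complex" where "frob_chars (Coset.order F) field_degree \<psi> \<chi>"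
    using ex_field_characters by blast
  then interpret frob_chars "Coset.order F" field_degree "TYPE('k)" \<psi> \<chi> .
  have fK: "fpoly (PK f)" "fpoly (PK g)" using f g by (auto intro!: fpoly_PK poly_carrierD)
  have sub: "\<phi> ` S \<subseteq> fixed 1" if "S \<subseteq> carrier F" for S using that \<phi>_fixed by blast
  have card: "card (\<phi> ` S) = card S" if "S \<subseteq> carrier F" for S by (rule card_image[OF inj_on_subset[OF inj_\<phi> that]])
  have img: "\<phi> ` S = {0} \<longleftrightarrow> S = {\<zero>\<^bsub>F\<^esub>}" if "S \<subseteq> carrier F" for S
  proof
    assume "\<phi> ` S = {0}"
    then have "\<phi> ` S = \<phi> ` {\<zero>\<^bsub>F\<^esub>}" by (simp add: \<phi>_zero)
    then show "S = {\<zero>\<^bsub>F\<^esub>}" using inj_on_image_eq_iff[OF inj_\<phi> that, of "{\<zero>\<^bsub>F\<^esub>}"] by simp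
  qed (simp add: \<phi>_zero)
  note ev = image_eval_PK[OF f A] image_eval_PK[OF g A]
  note tr = card_set_add[OF ev(2)] card_set_add[OF ev(4)] card_set_mult[OF ev(2)] card_set_mult[OF ev(4)]
  note dg = degree_PK(1)[OF f] degree_PK(1)[OF g]
  have root: "poly (PK h) (\<phi> a) \<noteq> 0 \<longleftrightarrow> F.eval h a \<noteq> \<zero>\<^bsub>F\<^esub>" if "h \<in> carrier (poly_ring F)" "a \<in> A" for h a
    using that A poly_PK[OF poly_carrierD[OF that(1)], of a] \<phi>_eq_0_iff[of "F.eval h a"]
      F.eval_in_carrier[OF poly_carrierD[OF that(1)], of a] by auto
  note est = estimate_add_add[OF fK(1) _ fK(2) _ _ sub[OF A] sub[OF B] sub[OF C], unfolded dg card[OF A] card[OF B] card[OF C]]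
    estimate_add_mult[OF fK(1) _ fK(2) _ _ sub[OF A] sub[OF B] sub[OF C], unfolded dg card[OF A] card[OF B] card[OF C] img[OF C]]
    estimate_mult_mult[OF fK(1) _ fK(2) _ _ _ sub[OF A], unfolded dg card[OF A]]
  let ?fA = "F.eval f ` A" and ?gA = "F.eval g ` A"
  let ?c = "sp_const (length f - 1) (length g - 1)" and ?q = "real (Coset.order F)"
  let ?b = "sp_bound (real (card A)) (real (card B)) (real (card C)) ?q" and ?b' = "self_bound (real (card A)) ?q"
  have 1: "?c * ?b \<le> real (card (?fA <+>\<^bsub>F\<^esub> B)) * real (card (?gA <+>\<^bsub>F\<^esub> C))"
    "?c * ?b' \<le> real (card (?fA <+>\<^bsub>F\<^esub> ?gA))"
    if "1 \<le> length f - 1" "length f - 1 < length g - 1" "length g - 1 < ring_char F"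
    unfolding tr(1)[OF B] tr(2)[OF C] tr(1)[OF ev(4)] ev(1,3)
    using est(1,2) that by (simp_all only: CHAR_eq One_nat_def Suc_le_eq simp_thms)
  have 2: "?c * ?b \<le> real (card (?fA <+>\<^bsub>F\<^esub> B)) * real (card (?gA <#>\<^bsub>F\<^esub> C))"
    if "gcd (length g - 1) (Coset.order F - 1) = 1" "1 \<le> length f - 1" "length f - 1 + (length g - 1) < ring_char F"
      "C \<noteq> {\<zero>\<^bsub>F\<^esub>}"
    unfolding tr(1)[OF B] tr(4)[OF C] ev(1,3)
    using est(3) that by (simp only: CHAR_eq One_nat_def Suc_le_eq simp_thms)
  have 3: "?c * ?b' \<le> real (card (?fA <#>\<^bsub>F\<^esub> ?gA))"
    "B \<noteq> {\<zero>\<^bsub>F\<^esub>} \<Longrightarrow> C \<noteq> {\<zero>\<^bsub>F\<^esub>} \<Longrightarrow> A = {} \<or> (\<exists>a\<in>A. F.eval f a \<noteq> \<zero>\<^bsub>F\<^esub> \<or> F.eval g a \<noteq> \<zero>\<^bsub>F\<^esub>) \<Longrightarrow>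
      ?c * ?b \<le> real (card (?fA <#>\<^bsub>F\<^esub> B)) * real (card (?gA <#>\<^bsub>F\<^esub> C))"
    if co: "coprime_exponents_outside F f g" "coprime_exponents_outside F g f"
  proof -
    note cf = coprime_exponents_outside_imp[OF g co(1)] and cg = coprime_exponents_outside_imp[OF f co(2)]
    note e = est(4,5)[OF cf(2)[unfolded dg] cg(2)[unfolded dg] cf(1) cg(1)]
    show "?c * ?b' \<le> real (card (?fA <#>\<^bsub>F\<^esub> ?gA))" unfolding tr(3)[OF ev(4)] ev(1,3) by (rule e(2))
    assume "B \<noteq> {\<zero>\<^bsub>F\<^esub>}" "C \<noteq> {\<zero>\<^bsub>F\<^esub>}" and nr: "A = {} \<or> (\<exists>a\<in>A. F.eval f a \<noteq> \<zero>\<^bsub>F\<^esub> \<or> F.eval g a \<noteq> \<zero>\<^bsub>F\<^esub>)"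
    then have BC: "\<phi> ` B \<noteq> {0}" "\<phi> ` C \<noteq> {0}" using img[OF B] img[OF C] by simp_all
    have "\<phi> ` A = {} \<or> (\<exists>a\<in>\<phi> ` A. poly (PK f) a \<noteq> 0 \<or> poly (PK g) a \<noteq> 0)"
      using nr root[OF f] root[OF g] by auto
    from e(1)[OF sub[OF B] BC(1) sub[OF C] BC(2) this]
    show "?c * ?b \<le> real (card (?fA <#>\<^bsub>F\<^esub> B)) * real (card (?gA <#>\<^bsub>F\<^esub> C))"
      unfolding tr(3)[OF B] tr(4)[OF C] ev(1,3) card[OF B] card[OF C] .
  qed
  show "(1 \<le> length f - 1 \<and> length f - 1 < length g - 1 \<and> length g - 1 < ring_char F \<longrightarrow>
        ?c * ?b \<le> real (card (?fA <+>\<^bsub>F\<^esub> B)) * real (card (?gA <+>\<^bsub>F\<^esub> C)) \<and> ?c * ?b' \<le> real (card (?fA <+>\<^bsub>F\<^esub> ?gA))) \<and>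
      (gcd (length g - 1) (Coset.order F - 1) = 1 \<and> 1 \<le> length f - 1 \<and> length f - 1 + (length g - 1) < ring_char F \<and>
        C \<noteq> {\<zero>\<^bsub>F\<^esub>} \<longrightarrow> ?c * ?b \<le> real (card (?fA <+>\<^bsub>F\<^esub> B)) * real (card (?gA <#>\<^bsub>F\<^esub> C))) \<and>
      (coprime_exponents_outside F f g \<and> coprime_exponents_outside F g f \<longrightarrow>
        (B \<noteq> {\<zero>\<^bsub>F\<^esub>} \<and> C \<noteq> {\<zero>\<^bsub>F\<^esub>} \<and> (A = {} \<or> (\<exists>a\<in>A. F.eval f a \<noteq> \<zero>\<^bsub>F\<^esub> \<or> F.eval g a \<noteq> \<zero>\<^bsub>F\<^esub>)) \<longrightarrow>
          ?c * ?b \<le> real (card (?fA <#>\<^bsub>F\<^esub> B)) * real (card (?gA <#>\<^bsub>F\<^esub> C))) \<and>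
        ?c * ?b' \<le> real (card (?fA <#>\<^bsub>F\<^esub> ?gA)))"
    by (intro conjI impI; (elim conjE)?; intro 1 2 3; assumption)
qed

end

text \<open>
  The estimates are proved for fields that are types. A single type is enough: it is carved out of a
  field record that is chosen to violate the estimates if any finite field does.
\<close>

definition test_field :: "nat ring" where
  "test_field = (SOME F. field F \<and> finite (carrier F) \<and>
     ((\<exists>F' :: nat ring. field F' \<and> finite (carrier F') \<and> \<not> sum_product_estimates F') \<longrightarrow> \<not> sum_product_estimates F))"

lemma test_field:
  "field test_field" "finite (carrier test_field)"
  "sum_product_estimates test_field \<Longrightarrow> field F \<Longrightarrow> finite (carrier F) \<Longrightarrow> sum_product_estimates (F :: nat ring)"
proof -
  \<comment> \<open>Some finite field has to exist for the choice to be meaningful; the type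
    \<open>gf2\<close> provides one.\<close>
  have "finite (UNIV :: gf2 set)"
    using type_definition.Abs_image[OF type_definition_gf2] by (metis finite.emptyI finite.insertI finite_imageI)
  then have "\<exists>F :: nat ring. field F \<and> finite (carrier F)"
    using finite_field_iso_nat_field[OF field_from_type_algebra[where ?'a = gf2]]
    by (auto simp: ring_of_type_algebra_def)
  then have "\<exists>F :: nat ring. field F \<and> finite (carrier F) \<and>
     ((\<exists>F' :: nat ring. field F' \<and> finite (carrier F') \<and> \<not> sum_product_estimates F') \<longrightarrow> \<not> sum_product_estimates F)"
    by blast
  from someI_ex[OF this, folded test_field_def]
  show "field test_field" "finite (carrier test_field)"
    "sum_product_estimates test_field \<Longrightarrow> field F \<Longrightarrow> finite (carrier F) \<Longrightarrow> sum_product_estimates F"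
    by blast+
qed

interpretation TF: cring test_field
  using test_field(1) by (simp add: field_def domain_def)

lemma test_field_inverse:
  "x \<in> carrier test_field \<Longrightarrow> x \<noteq> \<zero>\<^bsub>test_field\<^esub> \<Longrightarrow> x \<in> Units test_field"
  "\<zero>\<^bsub>test_field\<^esub> \<noteq> \<one>\<^bsub>test_field\<^esub>"
  using field.field_Units[OF test_field(1)] domain.zero_not_one[OF field.axioms(1)[OF test_field(1)]] by auto

typedef tf = "carrier test_field" by (rule exI[of _ "\<zero>\<^bsub>test_field\<^esub>"]) simp

setup_lifting type_definition_tf

instantiation tf :: field
begin

lift_definition zero_tf :: tf is "\<zero>\<^bsub>test_field\<^esub>" by simp
lift_definition one_tf :: tf is "\<one>\<^bsub>test_field\<^esub>" by simp
lift_definition plus_tf :: "tf \<Rightarrow> tf \<Rightarrow> tf" is "\<lambda>x y. x \<oplus>\<^bsub>test_field\<^esub> y" by simp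
lift_definition uminus_tf :: "tf \<Rightarrow> tf" is "\<lambda>x. \<ominus>\<^bsub>test_field\<^esub> x" by simp
lift_definition minus_tf :: "tf \<Rightarrow> tf \<Rightarrow> tf" is "\<lambda>x y. x \<ominus>\<^bsub>test_field\<^esub> y" by simp
lift_definition times_tf :: "tf \<Rightarrow> tf \<Rightarrow> tf" is "\<lambda>x y. x \<otimes>\<^bsub>test_field\<^esub> y" by simp
lift_definition inverse_tf :: "tf \<Rightarrow> tf" is
  "\<lambda>x. if x = \<zero>\<^bsub>test_field\<^esub> then \<zero>\<^bsub>test_field\<^esub> else inv\<^bsub>test_field\<^esub> x"
  by (simp add: test_field_inverse)
definition divide_tf :: "tf \<Rightarrow> tf \<Rightarrow> tf" where "divide_tf x y = x * inverse y"

instance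
proof
  fix a b c :: tf
  show "a * b * c = a * (b * c)" by transfer (rule TF.m_assoc)
  show "a * b = b * a" by transfer (rule TF.m_comm)
  show "1 * a = a" by transfer simp
  show "a + b + c = a + (b + c)" by transfer (rule TF.a_assoc)
  show "a + b = b + a" by transfer (rule TF.a_comm)
  show "0 + a = a" by transfer simp
  show "- a + a = 0" by transfer (rule TF.l_neg)
  show "a - b = a + - b" by transfer (simp add: a_minus_def)
  show "(a + b) * c = a * c + b * c" by transfer (rule TF.l_distr)
  show "(0 :: tf) \<noteq> 1" by transfer (rule test_field_inverse(2))
  show "a \<noteq> 0 \<Longrightarrow> inverse a * a = 1" by transfer (simp add: test_field_inverse)
  show "a div b = a * inverse b" by (rule divide_tf_def)
  show "inverse (0 :: tf) = 0" by transfer simp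
qed

end

text \<open>By the choice of \<open>test_field\<close> it is enough to treat that record. It is
  embedded in the algebraic closure of the type \<open>tf\<close>, to which everything proved for
  algebraically closed types applies.\<close>

lemma sum_product_estimates_finite_field:
  assumes "field F" "finite (carrier F)"
  shows "sum_product_estimates (F :: nat ring)"
proof (rule test_field(3)[OF _ assms])
  interpret field_embedding test_field "\<lambda>x. to_ac (Abs_tf x)"
  proof (intro field_embedding.intro test_field(1) field_embedding_axioms.intro)
    show "finite (carrier test_field)" by (rule test_field(2))
    show "inj_on (\<lambda>x. to_ac (Abs_tf x)) (carrier test_field)" by (auto simp: inj_on_def Abs_tf_inject)
  qed (auto simp: zero_tf.abs_eq one_tf_def plus_tf.abs_eq times_tf.abs_eq eq_onp_def simp flip: to_ac_add to_ac_mult)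
  show "sum_product_estimates test_field" by (rule sum_product_estimates)
qed

text \<open>The products fail to be large in degenerate cases, which are excluded. If C = {0} and A
  = B = F, the second factor is 1 and the first at most q, against a bound q^2. If A consists of one
  common zero of f and g and B = C = F, both product sets are {0}, against a bound q.\<close>

theorem theorem2p5:
  fixes m n :: nat
  shows "\<exists>c::real. c > 0 \<and>
    (\<forall>(F :: nat ring) f g A B C.
       field F \<and> finite (carrier F) \<and>
       f \<in> carrier (poly_ring F) \<and> g \<in> carrier (poly_ring F) \<and>
       Polynomials.degree f = m \<and> Polynomials.degree g = n \<and>
       A \<subseteq> carrier F \<and> B \<subseteq> carrier F \<and> C \<subseteq> carrier F \<longrightarrow>
       (let q = real (Coset.order F); p = ring_char F;
            fA = ring.eval F f ` A; gA = ring.eval F g ` A;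
            bound = min (real (card A) * q) ((real (card A))\<^sup>2 * real (card B) * real (card C) / q);
            bound' = min (sqrt (real (card A)) * sqrt q) ((real (card A))\<^sup>2 / sqrt q)
        in
          (1 \<le> Polynomials.degree f \<and> Polynomials.degree f < Polynomials.degree g \<and> Polynomials.degree g < p \<longrightarrow>
             real (card (fA <+>\<^bsub>F\<^esub> B)) * real (card (gA <+>\<^bsub>F\<^esub> C)) \<ge> c * bound \<and>
             real (card (fA <+>\<^bsub>F\<^esub> gA)) \<ge> c * bound')
        \<and> (gcd (Polynomials.degree g) (Coset.order F - 1) = 1 \<and> 1 \<le> Polynomials.degree f \<and> Polynomials.degree f + Polynomials.degree g < p \<and>
             C \<noteq> {\<zero>\<^bsub>F\<^esub>} \<longrightarrow>
             real (card (fA <+>\<^bsub>F\<^esub> B)) * real (card (gA <#>\<^bsub>F\<^esub> C)) \<ge> c * bound)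
        \<and> (coprime_exponents_outside F f g \<and> coprime_exponents_outside F g f \<and>
             Polynomials.degree f + Polynomials.degree g < p \<longrightarrow>
             (B \<noteq> {\<zero>\<^bsub>F\<^esub>} \<and> C \<noteq> {\<zero>\<^bsub>F\<^esub>} \<and>
              (A = {} \<or> (\<exists>a\<in>A. ring.eval F f a \<noteq> \<zero>\<^bsub>F\<^esub> \<or> ring.eval F g a \<noteq> \<zero>\<^bsub>F\<^esub>)) \<longrightarrow>
                real (card (fA <#>\<^bsub>F\<^esub> B)) * real (card (gA <#>\<^bsub>F\<^esub> C)) \<ge> c * bound) \<and>
             real (card (fA <#>\<^bsub>F\<^esub> gA)) \<ge> c * bound')))"
proof (intro exI[of _ "sp_const m n"] conjI allI impI sp_const_pos, elim conjE, goal_cases)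
  case (1 F f g A B C)
  have "sum_product_estimates F" using 1 by (intro sum_product_estimates_finite_field)
  then show ?case
    unfolding sum_product_estimates_def sp_bound_def self_bound_def Let_def
    using 1 by (elim allE[of _ f] allE[of _ g] allE[of _ A] allE[of _ B] allE[of _ C]) simp
qed

end
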